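(* Let $F$ be Thompson's group, and for $x\in F$ let $C_F(x)$ denote the centralizer of $x$ in $F$. Then: (i) For every $x\in F$, $C_F(x)\cong F^m\times\mathbb{Z}^n$ for some integers $m,n$ with $0\le m\le n+1$. (ii) Every $x\in F$ has a finite number of roots in $F$, and these can be effectively computed. (iii) The centralizer in $F$ of any finitely generated subgroup $A\subset F$ decomposes as a direct product of groups $C_i$, where each $C_i$ is either trivial, infinite cyclic, or isomorphic to $F$. (iv) The intersection of any number $k\ge 2$ of centralizers of elements of $F$ is equal to the intersection of $2$ centralizers of elements of $F$.
   Context: Thompson's group $F$ is the group (under composition) of all orientation-preserving piecewise linear (i.e. piecewise affine) homeomorphisms of $[0,1]$ onto itself with finitely many breakpoints, all in $\mathbb{Z}[\frac12]$, and with all slopes integral powers of $2$. A root of $x\in F$ is an element $h\in F$ with $h^n=x$ for some positive integer $n$. *)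

theory Defs
  imports
    "HOL-Analysis.Analysis"
    "HOL-Algebra.Algebra"
    "HOL-Library.Nat_Bijection"
begin

section \<open>Thompson's group\<close>

text \<open>
  Elements are maps of the unit interval, made total extensionally as in
  \<^const>\<open>BijGroup\<close>. The set \<open>B\<close> contains the breakpoints: on every
  subinterval without a point of \<open>B\<close> in its interior, the map is affine with slope a power
  of two. The library constant \<^const>\<open>dyadics\<close> consists of the non-negative
  dyadic rationals, so its points in the unit interval are those of \<open>Z[1/2]\<close>.
\<close>

definition thompson_maps :: "(real \<Rightarrow> real) set" where
  "thompson_maps =
     {f \<in> extensional {0..1}.
        (\<exists>g. homeomorphism {0..1} {0..1} f g) \<and>
        strict_mono_on {0..1} f \<and>
        (\<exists>B. finite B \<and> B \<subseteq> {0..1} \<inter> dyadics \<and>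
             (\<forall>a b. 0 \<le> a \<and> a < b \<and> b \<le> 1 \<and> {a<..<b} \<inter> B = {} \<longrightarrow>
                (\<exists>(k::int) c. \<forall>t\<in>{a..b}. f t = 2 powi k * t + c)))}"

definition thompson_F :: "(real \<Rightarrow> real) monoid" where
  "thompson_F = BijGroup {0..1} \<lparr>carrier := thompson_maps\<rparr>"


section \<open>Group-theoretic notions\<close>

definition centralizer :: "('a, 'b) monoid_scheme \<Rightarrow> 'a set \<Rightarrow> 'a set" where
  "centralizer G A = {y \<in> carrier G. \<forall>a\<in>A. y \<otimes>\<^bsub>G\<^esub> a = a \<otimes>\<^bsub>G\<^esub> y}"

definition roots :: "('a, 'b) monoid_scheme \<Rightarrow> 'a \<Rightarrow> 'a set" where
  "roots G x = {h \<in> carrier G. \<exists>n::nat. n > 0 \<and> h [^]\<^bsub>G\<^esub> n = x}"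

definition finitely_generated_subgroup :: "('a, 'b) monoid_scheme \<Rightarrow> 'a set \<Rightarrow> bool" where
  "finitely_generated_subgroup G A \<longleftrightarrow>
     (\<exists>S. finite S \<and> S \<subseteq> carrier G \<and> A = generate G S)"


section \<open>Computable functions\<close>

text \<open>
  Kleene's general recursive functions: the closure of the basic functions under composition,
  primitive recursion and minimization of regular functions. In
  \<open>general_recursive n f\<close> only the values of \<open>f\<close> on lists of length \<open>n\<close> matter.
\<close>

inductive general_recursive :: "nat \<Rightarrow> (nat list \<Rightarrow> nat) \<Rightarrow> bool" where
  zero: "general_recursive n (\<lambda>xs. 0)"
| succ: "general_recursive 1 (\<lambda>xs. Suc (xs ! 0))"
| proj: "i < n \<Longrightarrow> general_recursive n (\<lambda>xs. xs ! i)"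
| comp: "general_recursive m g \<Longrightarrow> (\<And>i. i < m \<Longrightarrow> general_recursive n (f i)) \<Longrightarrow>
           general_recursive n (\<lambda>xs. g (map (\<lambda>i. f i xs) [0..<m]))"
| prim: "general_recursive n f \<Longrightarrow> general_recursive (Suc (Suc n)) g \<Longrightarrow>
           general_recursive (Suc n)
             (\<lambda>xs. rec_nat (f (tl xs)) (\<lambda>y r. g (y # r # tl xs)) (hd xs))"
| mini: "general_recursive (Suc n) f \<Longrightarrow>
           (\<And>xs. length xs = n \<Longrightarrow> \<exists>y. f (y # xs) = 0) \<Longrightarrow>
           general_recursive n (\<lambda>xs. LEAST y. f (y # xs) = 0)"

definition computable :: "(nat \<Rightarrow> nat) \<Rightarrow> bool" where
  "computable r \<longleftrightarrow> (\<exists>f. general_recursive 1 f \<and> (\<forall>x. r x = f [x]))"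

text \<open>
  A code for an element of Thompson's group lists, from left to right, the vertices of its
  graph: finitely many points of the graph with dyadic coordinates, joined by straight
  segments. Every element has a code, since its
  breakpoints are dyadic and it maps dyadic rationals to dyadic rationals; codes are not unique
  (superfluous vertices, unreduced fractions).
\<close>

definition decode_dyadic :: "nat \<Rightarrow> real" where
  "decode_dyadic p = (case prod_decode p of (k, m) \<Rightarrow> real k / 2 ^ m)"

definition decode_vertices :: "nat \<Rightarrow> (real \<times> real) list" where
  "decode_vertices c =
     map (\<lambda>p. map_prod decode_dyadic decode_dyadic (prod_decode p)) (list_decode c)"

definition codes_element :: "nat \<Rightarrow> (real \<Rightarrow> real) \<Rightarrow> bool" where
  "codes_element c f \<longleftrightarrow>
     f \<in> carrier thompson_F \<and>
     (let vs = decode_vertices c in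
        sorted_wrt (\<lambda>p q. fst p < fst q) vs \<and>
        (\<lambda>t. (t, f t)) ` {0..1} = (\<Union>i<length vs - 1. closed_segment (vs ! i) (vs ! Suc i)))"

text \<open>A code for a list of elements is the code of the list of their codes.\<close>

definition codes_element_list :: "nat \<Rightarrow> (real \<Rightarrow> real) list \<Rightarrow> bool" where
  "codes_element_list d hs \<longleftrightarrow> list_all2 codes_element (list_decode d) hs"

end

theory Submission
  imports Defs
begin

text \<open>
  Everything rests on the fixed points of an element \<open>x\<close>. A dyadic piecewise affine map has only
  finitely many boundary points of its fixed set (\<open>finite_boundary_fixpoints\<close>); an element \<open>y\<close>
  commuting with \<open>x\<close> permutes them monotonically and hence fixes each of them
  (\<open>centralizer_fixes_boundary\<close>). Cut the unit interval at the dyadic ones among them. On a piece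
  \<open>[a, b]\<close> of this subdivision, \<open>x\<close> is either the identity or moves every dyadic point strictly
  between \<open>a\<close> and \<open>b\<close>; in the latter case \<open>x\<close> is called atomic there (\<open>identity_or_atomic\<close>).

  Over an identity piece the centralizer is unrestricted, and the elements supported in a dyadic
  interval form a copy of the whole group (\<open>F_on_iso_thompson\<close>). Over an atomic piece an element of
  the centralizer is determined by its slope at \<open>a\<close>: if that slope is 1, the element is the identity
  near \<open>a\<close>, commutation with \<open>x\<close> spreads the identity to the right as long as \<open>x\<close> moves the points
  reached, and at a fixed point of \<open>x\<close>, which is not dyadic and hence no breakpoint, it spreads
  because slopes do not change there (\<open>atomic_germ_determines\<close>). So this factor embeds
  into the integers and is infinite cyclic (\<open>F_comm_iso_integer_group\<close>). Two adjacent pieces cannot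
  both be identity pieces, since their common endpoint is a boundary point of the fixed set; this
  gives the inequality between the two ranks (\<open>centralizer_element_structure\<close>).

  For several elements, call a subgroup standard if it splits along a finite dyadic subdivision into
  factors that are full, trivial, or the centralizer of an atomic element, and if no cut point has full
  factors on both sides. Centralizers of elements
  are standard, and standard subgroups are closed under intersection (\<open>standard_Int\<close>), for two
  reasons: a nontrivial element of an atomic factor has no dyadic fixed point inside its piece, so a
  proper refinement of such a piece leaves only the identity; and two cyclic factors that meet
  nontrivially are equal (\<open>F_comm_eq_if_meet\<close>). Conversely a standard subgroup is the intersection
  of just two centralizers, because on each piece two elements suffice to cut out the required factor
  (\<open>standard_two_centralizers\<close>). The centralizer of a finitely generated subgroup is the intersection
  of the centralizers of its generators.

  For roots, measure elements by dyadic cells: \<open>x\<close> is \<open>e\<close>-fine if it maps every dyadic cell of length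
  \<open>2\<^sup>-\<^sup>E\<close> with \<open>E \<ge> e\<close> affinely onto a dyadic cell whose exponent differs from \<open>E\<close> by at most \<open>e\<close>.
  If a cell of length \<open>2\<^sup>-\<^sup>e\<close> contains no fixed point, \<open>x\<close> moves all its points by at least
  \<open>4\<^sup>-\<^sup>e\<close>, so every orbit reaches a cell with a fixed point within \<open>4\<^sup>e\<close> steps
  (\<open>orbit_meets_fixed_cell\<close>). On such a cell \<open>x\<close> is affine about its fixed point, and so is any root,
  whose slope is the corresponding root of the slope of \<open>x\<close> (\<open>root_on_fixed_cell\<close>). Transporting
  this along orbits, on which a root commutes with \<open>x\<close>, bounds the fineness of all roots
  (\<open>root_cell_fine\<close>) and their exponents (\<open>root_order_bound\<close>). There are finitely many elements of
  given fineness, with codes below an explicit bound (\<open>small_code_exists\<close>). Hence the roots are found by a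
  bounded search: test every small code for being a code at all and for having \<open>x\<close> as one of its
  powers, where equality is checked on a finite grid. All this is arithmetic with primitive recursion
  (\<open>computable_root_list\<close>, \<open>root_list_correct\<close>).
\<close>

section \<open>Dyadic numbers\<close>

text \<open>
  Integer numerators make the dyadic rationals a ring; \<^const>\<open>dyadics\<close> contains only the
  non-negative ones.
\<close>

definition dyadic :: "real \<Rightarrow> bool" where
  "dyadic x \<longleftrightarrow> (\<exists>(z::int) (n::nat). x = real_of_int z / 2 ^ n)"

lemma dyadic_of_int [simp]: "dyadic (real_of_int z)"
  unfolding dyadic_def by (rule exI[of _ z], rule exI[of _ 0]) simp

lemma dyadic_numeral [simp]: "dyadic 0" "dyadic 1" "dyadic (numeral m)" "dyadic (real n)"
  using dyadic_of_int[of 0] dyadic_of_int[of 1] dyadic_of_int[of "numeral m"] dyadic_of_int[of "int n"]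
  by simp_all

lemma dyadic_common:
  assumes "dyadic x" "dyadic y"
  obtains z w :: int and n :: nat where "x = z / 2 ^ n" "y = w / 2 ^ n"
proof -
  obtain z n w m where "x = real_of_int z / 2 ^ n" "y = real_of_int w / 2 ^ m"
    using assms unfolding dyadic_def by blast
  then have "x = real_of_int (z * 2 ^ m) / 2 ^ (n + m)" "y = real_of_int (w * 2 ^ n) / 2 ^ (n + m)"
    by (simp_all add: power_add field_simps)
  then show thesis using that by blast
qed

lemma dyadic_add [simp, intro]: "dyadic x \<Longrightarrow> dyadic y \<Longrightarrow> dyadic (x + y)"
proof -
  assume "dyadic x" "dyadic y"
  then obtain z w :: int and n :: nat where "x = z / 2 ^ n" "y = w / 2 ^ n" by (rule dyadic_common)
  then have "x + y = real_of_int (z + w) / 2 ^ n" by (simp add: add_divide_distrib)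
  then show ?thesis unfolding dyadic_def by blast
qed

lemma dyadic_mult [simp, intro]:
  assumes "dyadic x" "dyadic y" shows "dyadic (x * y)"
proof -
  obtain z n w m where "x = real_of_int z / 2 ^ n" "y = real_of_int w / 2 ^ m"
    using assms unfolding dyadic_def by blast
  then have "x * y = real_of_int (z * w) / 2 ^ (n + m)" by (simp add: power_add)
  then show ?thesis unfolding dyadic_def by blast
qed

lemma dyadic_minus [simp, intro]: "dyadic x \<Longrightarrow> dyadic (- x)"
  using dyadic_mult[OF dyadic_of_int[of "-1"], of x] by simp

lemma dyadic_diff [simp, intro]: "dyadic x \<Longrightarrow> dyadic y \<Longrightarrow> dyadic (x - y)"
  using dyadic_add[of x "- y"] by simp

lemma dyadic_powi [simp]: "dyadic (2 powi k)"
proof (cases "k \<ge> 0")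
  case True
  then have "2 powi k = real_of_int (2 ^ nat k)" by (simp add: power_int_def)
  then show ?thesis by (metis dyadic_of_int)
next
  case False
  then have "2 powi k = real_of_int 1 / 2 ^ nat (- k)" by (simp add: power_int_def field_simps)
  then show ?thesis unfolding dyadic_def by blast
qed

lemma dyadic_div_power2 [simp, intro]: "dyadic x \<Longrightarrow> dyadic (x / 2 ^ n)"
proof -
  assume "dyadic x"
  then obtain z m where "x = real_of_int z / 2 ^ m" unfolding dyadic_def by blast
  then have "x / 2 ^ n = real_of_int z / 2 ^ (m + n)" by (simp add: power_add)
  then show ?thesis unfolding dyadic_def by blast
qed

lemma dyadic_div2 [simp, intro]: "dyadic x \<Longrightarrow> dyadic (x / 2)" "dyadic x \<Longrightarrow> dyadic (x / 4)"
  using dyadic_div_power2[of x 1] dyadic_div_power2[of x 2] by simp_all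

lemma mem_dyadics_iff: "x \<in> dyadics \<longleftrightarrow> 0 \<le> x \<and> dyadic x" for x :: real
proof
  assume "x \<in> dyadics"
  then obtain k m where x: "x = real m / 2 ^ k" unfolding dyadics_def by auto
  have "x = real_of_int (int m) / 2 ^ k" using x by simp
  then have "dyadic x" unfolding dyadic_def by blast
  then show "0 \<le> x \<and> dyadic x" using x by simp
next
  assume "0 \<le> x \<and> dyadic x"
  then obtain z n where x: "x = real_of_int z / 2 ^ n" "0 \<le> x" unfolding dyadic_def by blast
  have "(0::real) < 2 ^ n" by simp
  then have "z \<ge> 0" using x by (metis divide_neg_pos not_le of_int_less_0_iff)
  then have "x = of_nat (nat z) / 2 ^ n" using x by simp
  then show "x \<in> dyadics" unfolding dyadics_def by blast
qed

section \<open>Dyadic piecewise affine maps\<close>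

text \<open>
  Piecewise affine maps on an interval with dyadic endpoints, built by concatenation. Requiring the
  additive constants to be dyadic encodes that dyadic points go to dyadic points, which an element of
  Thompson's group satisfies because it fixes 0. The inductive form replaces induction over a set of
  breakpoints.
\<close>

inductive pl2 :: "(real \<Rightarrow> real) \<Rightarrow> real \<Rightarrow> real \<Rightarrow> bool" for f where
  affine: "dyadic a \<Longrightarrow> dyadic b \<Longrightarrow> a < b \<Longrightarrow> dyadic c \<Longrightarrow>
            (\<And>t. a \<le> t \<Longrightarrow> t \<le> b \<Longrightarrow> f t = 2 powi k * t + c) \<Longrightarrow> pl2 f a b"
| join: "pl2 f a b \<Longrightarrow> pl2 f b c \<Longrightarrow> pl2 f a c"

lemma pl2_cong:
  assumes "pl2 f a b" "\<And>t. a \<le> t \<Longrightarrow> t \<le> b \<Longrightarrow> f t = g t"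
  shows "pl2 g a b"
proof -
  have "pl2 f a b \<Longrightarrow> a < b \<and> ((\<forall>t. a \<le> t \<longrightarrow> t \<le> b \<longrightarrow> f t = g t) \<longrightarrow> pl2 g a b)"
  proof (induction rule: pl2.induct)
    case (affine a b c k)
    then show ?case by (auto intro: pl2.affine[where k = k and c = c])
  next
    case (join a b c)
    then show ?case by (auto intro: pl2.join[where b = b])
  qed
  then show ?thesis using assms by blast
qed

lemma pl2_dom: "pl2 f a b \<Longrightarrow> a < b \<and> dyadic a \<and> dyadic b"
  by (induction rule: pl2.induct) auto

lemma pl2_less: "pl2 f a b \<Longrightarrow> a \<le> s \<Longrightarrow> s < t \<Longrightarrow> t \<le> b \<Longrightarrow> f s < f t"
proof (induction arbitrary: s t rule: pl2.induct)
  case (affine a b c k)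
  then show ?case by simp
next
  case (join a b c)
  consider "t \<le> b" | "b \<le> s" | "s < b" "b < t" by linarith
  then show ?case
  proof cases
    case 3
    then have "f s < f b" "f b < f t"
      using join.IH(1)[of s b] join.IH(2)[of b t] join.prems by simp_all
    then show ?thesis by simp
  next case 1 then show ?thesis using join.IH(1) join.prems by simp
  next case 2 then show ?thesis using join.IH(2) join.prems by simp
  qed
qed

lemma pl2_le: "pl2 f a b \<Longrightarrow> a \<le> s \<Longrightarrow> s \<le> t \<Longrightarrow> t \<le> b \<Longrightarrow> f s \<le> f t"
  using pl2_less[of f a b s t] by (cases "s = t") auto

lemma pl2_eq_iff: "pl2 f a b \<Longrightarrow> a \<le> s \<Longrightarrow> s \<le> b \<Longrightarrow> a \<le> t \<Longrightarrow> t \<le> b \<Longrightarrow> f s = f t \<longleftrightarrow> s = t"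
  using pl2_less[of f a b s t] pl2_less[of f a b t s] by (cases s t rule: linorder_cases) auto

lemma dyadic_affine_iff: "dyadic c \<Longrightarrow> dyadic (2 powi k * t + c) \<longleftrightarrow> dyadic t"
proof
  assume c: "dyadic c" and "dyadic (2 powi k * t + c)"
  then have "dyadic (2 powi (- k) * ((2 powi k * t + c) - c))" by (intro dyadic_mult dyadic_diff) auto
  then show "dyadic t" by (simp add: power_int_minus flip: mult.assoc)
qed auto

lemma pl2_dyadic_iff: "pl2 f a b \<Longrightarrow> a \<le> t \<Longrightarrow> t \<le> b \<Longrightarrow> dyadic (f t) \<longleftrightarrow> dyadic t"
proof (induction rule: pl2.induct)
  case (affine a b c k)
  have "f t = 2 powi k * t + c" using affine by blast
  then show ?case using dyadic_affine_iff[OF affine(4)] by metis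
next
  case (join a b c)
  then show ?case by (cases "t \<le> b") simp_all
qed

lemma pl2_continuous: "pl2 f a b \<Longrightarrow> continuous_on {a..b} f"
proof (induction rule: pl2.induct)
  case (affine a b c k)
  have "continuous_on {a..b} (\<lambda>t. 2 powi k * t + c)" by (intro continuous_intros)
  then show ?case by (rule continuous_on_eq) (use affine in auto)
next
  case (join a b c)
  have "{a..c} = {a..b} \<union> {b..c}" using join pl2_dom by fastforce
  then show ?case using join continuous_on_closed_Un by (metis closed_atLeastAtMost)
qed

lemma pl2_onto:
  assumes "pl2 f a b" "f a \<le> s" "s \<le> f b"
  obtains t where "a \<le> t" "t \<le> b" "f t = s"
  using IVT'[of f a s b] assms pl2_continuous pl2_dom by (metis less_imp_le)

lemma pl2_restrict:
  "pl2 f a b \<Longrightarrow> a \<le> c \<Longrightarrow> c < d \<Longrightarrow> d \<le> b \<Longrightarrow> dyadic c \<Longrightarrow> dyadic d \<Longrightarrow> pl2 f c d"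
proof (induction arbitrary: c d rule: pl2.induct)
  case (affine a b c' k)
  show ?case by (rule pl2.affine[where k = k and c = c']) (use affine.hyps(4,5) affine.prems in auto)
next
  case (join a b c')
  consider "d \<le> b" | "b \<le> c" | "c < b" "b < d" by linarith
  then show ?case
  proof cases
    case 3
    then have "pl2 f c b" "pl2 f b d" using join.IH(1)[of c b] join.IH(2)[of b d] join.prems pl2_dom[OF join(1)] by simp_all
    then show ?thesis by (rule pl2.join)
  next case 1 then show ?thesis using join.IH(1) join.prems by blast
  next case 2 then show ?thesis using join.IH(2) join.prems by blast
  qed
qed

text \<open>
  The breakpoints of the composition are the preimages, under the affine map, of the breakpoints
  of the outer map, and these are dyadic.
\<close>

lemma pl2_affine_comp:
  assumes "pl2 g u v" "dyadic a" "dyadic b" "a < b" "dyadic c"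
    "\<And>t. a \<le> t \<Longrightarrow> t \<le> b \<Longrightarrow> f t = 2 powi k * t + c" "f a = u" "f b = v"
  shows "pl2 (\<lambda>t. g (f t)) a b"
  using assms
proof (induction arbitrary: a b rule: pl2.induct)
  case (affine u v d l)
  show ?case
  proof (rule pl2.affine[where k = "l + k" and c = "2 powi l * c + d"])
  fix t assume t: "a \<le> t" "t \<le> b"
    have "2 powi k * a \<le> 2 powi k * t" "2 powi k * t \<le> 2 powi k * b" using t by simp_all
    moreover have "f t = 2 powi k * t + c" "u = 2 powi k * a + c" "v = 2 powi k * b + c"
      using affine.prems(3,5,6,7) t by force+
    ultimately have "u \<le> f t" "f t \<le> v" by linarith+
    then have "g (f t) = 2 powi l * f t + d" by (rule affine(5))
    moreover have "f t = 2 powi k * t + c" by fact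
    ultimately show "g (f t) = 2 powi (l + k) * t + (2 powi l * c + d)"
      by (simp add: power_int_add distrib_left mult.assoc)
  next
    show "dyadic (2 powi l * c + d)" by (intro dyadic_add dyadic_mult dyadic_powi affine)
  qed (rule affine)+
next
  case (join u w v)
  define m where "m = 2 powi (- k) * (w - c)"
  have w: "u < w" "w < v" "dyadic w" using pl2_dom[OF join.hyps(1)] pl2_dom[OF join.hyps(2)] by simp_all
  have m: "2 powi k * m + c = w" by (simp add: m_def power_int_minus flip: mult.assoc)
  have "dyadic m" unfolding m_def by (intro dyadic_mult dyadic_powi dyadic_diff w join.prems(4))
  have ua: "u = 2 powi k * a + c" "v = 2 powi k * b + c" using join.prems(3,5,6,7) by force+
  then have "2 powi k * a < 2 powi k * m" "2 powi k * m < 2 powi k * b" using m w by linarith+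
  then have ab: "a < m" "m < b" by simp_all
  then have "f m = w" using join.prems(5)[of m] m by simp
  have "pl2 (\<lambda>t. g (f t)) a m" "pl2 (\<lambda>t. g (f t)) m b"
    using join.IH(1)[of a m] join.IH(2)[of m b] join.prems ab \<open>dyadic m\<close> \<open>f m = w\<close> by simp_all
  then show ?case by (rule pl2.join)
qed

lemma pl2_comp:
  assumes "pl2 f a b" "pl2 g (f a) (f b)"
  shows "pl2 (\<lambda>t. g (f t)) a b"
  using assms
proof (induction rule: pl2.induct)
  case (affine a b c k)
  show ?case by (rule pl2_affine_comp[OF affine(6,1-5)]) auto
next
  case (join a b c)
  have ab: "a < b" "b < c" "dyadic a" "dyadic b" "dyadic c" using pl2_dom[OF join.hyps(1)] pl2_dom[OF join.hyps(2)] by simp_all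
  have "f a < f b" "f b < f c"
    using pl2_less[OF join(1), of a b] pl2_less[OF join(2), of b c] ab by auto
  moreover have "dyadic (f a)" "dyadic (f b)" "dyadic (f c)"
    using pl2_dyadic_iff[OF join(1), of a] pl2_dyadic_iff[OF join(2)] ab by auto
  ultimately have "pl2 g (f a) (f b)" "pl2 g (f b) (f c)"
    using pl2_restrict[OF join(5)] by auto
  then show ?case using join pl2.join by blast
qed

lemma pl2_inverse:
  "pl2 f a b \<Longrightarrow> (\<And>t. a \<le> t \<Longrightarrow> t \<le> b \<Longrightarrow> g (f t) = t) \<Longrightarrow> pl2 g (f a) (f b)"
proof (induction rule: pl2.induct)
  case (affine a b c k)
  show ?case
  proof (rule pl2.affine[where k = "- k" and c = "- (2 powi (- k) * c)"])
    fix s assume s: "f a \<le> s" "s \<le> f b"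
    define t where "t = 2 powi (- k) * (s - c)"
    have ts: "2 powi k * t + c = s" by (simp add: t_def power_int_minus flip: mult.assoc)
    then have "2 powi k * a \<le> 2 powi k * t" "2 powi k * t \<le> 2 powi k * b" using s affine by auto
    then have t: "a \<le> t" "t \<le> b" by simp_all
    then have "g s = t" using affine ts by metis
    then show "g s = 2 powi (- k) * s + - (2 powi (- k) * c)" by (simp add: t_def algebra_simps)
  qed (use affine in auto)
next
  case (join a b c)
  have "a < b" "b < c" using pl2_dom[OF join.hyps(1)] pl2_dom[OF join.hyps(2)] by simp_all
  show ?case
  proof (rule pl2.join)
    show "pl2 g (f a) (f b)"
      by (rule join.IH(1), rule join.prems) (use \<open>b < c\<close> in linarith)+
    show "pl2 g (f b) (f c)"
      by (rule join.IH(2), rule join.prems) (use \<open>a < b\<close> in linarith)+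
  qed
qed

lemma pl2_ident: "dyadic a \<Longrightarrow> dyadic b \<Longrightarrow> a < b \<Longrightarrow> (\<And>t. a \<le> t \<Longrightarrow> t \<le> b \<Longrightarrow> f t = t) \<Longrightarrow> pl2 f a b"
  by (rule pl2.affine[where k = 0 and c = 0]) auto

section \<open>Local behaviour\<close>

lemma pl2_germ_right:
  "pl2 f a b \<Longrightarrow> a \<le> t \<Longrightarrow> t < b \<Longrightarrow>
   \<exists>e>0. \<exists>k. t + e \<le> b \<and> (\<forall>s. t \<le> s \<longrightarrow> s \<le> t + e \<longrightarrow> f s = f t + 2 powi k * (s - t))"
proof (induction rule: pl2.induct)
  case (affine a b c k)
  then show ?case by (intro exI[of _ "b - t"] conjI exI[of _ k]) (auto simp: algebra_simps)
next
  case (join a b c)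
  show ?case
  proof (cases "t < b")
    case True
    then obtain e k where "e > 0" "t + e \<le> b" "\<forall>s. t \<le> s \<longrightarrow> s \<le> t + e \<longrightarrow> f s = f t + 2 powi k * (s - t)"
      using join.IH(1) join.prems by blast
    then show ?thesis using pl2_dom[OF join(2)] by (intro exI[of _ e] conjI exI[of _ k]) (linarith | blast)+
  next
    case False then show ?thesis using join.IH(2) join.prems by simp
  qed
qed

lemma pl2_germ_left:
  "pl2 f a b \<Longrightarrow> a < t \<Longrightarrow> t \<le> b \<Longrightarrow>
   \<exists>e>0. \<exists>k. a \<le> t - e \<and> (\<forall>s. t - e \<le> s \<longrightarrow> s \<le> t \<longrightarrow> f s = f t + 2 powi k * (s - t))"
proof (induction rule: pl2.induct)
  case (affine a b c k)
  then show ?case by (intro exI[of _ "t - a"] conjI exI[of _ k]) (auto simp: algebra_simps)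
next
  case (join a b c)
  show ?case
  proof (cases "b < t")
    case True
    then obtain e k where "e > 0" "b \<le> t - e" "\<forall>s. t - e \<le> s \<longrightarrow> s \<le> t \<longrightarrow> f s = f t + 2 powi k * (s - t)"
      using join.IH(2) join.prems by blast
    then show ?thesis using pl2_dom[OF join(1)] by (intro exI[of _ e] conjI exI[of _ k]) (linarith | blast)+
  next
    case False then show ?thesis using join.IH(1) join.prems by simp
  qed
qed

text \<open>
  All breakpoints are dyadic, so at a point that is not dyadic the slopes on both sides agree.
\<close>

lemma pl2_germ_nondyadic:
  "pl2 f a b \<Longrightarrow> a \<le> t \<Longrightarrow> t \<le> b \<Longrightarrow> \<not> dyadic t \<Longrightarrow>
   \<exists>e>0. \<exists>k. a \<le> t - e \<and> t + e \<le> b \<and> (\<forall>s. t - e \<le> s \<longrightarrow> s \<le> t + e \<longrightarrow> f s = f t + 2 powi k * (s - t))"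
proof (induction rule: pl2.induct)
  case (affine a b c k)
  then have "a < t" "t < b" by (metis less_eq_real_def)+
  then show ?case using affine by (intro exI[of _ "min (t - a) (b - t)"] conjI exI[of _ k]) (auto simp: algebra_simps)
next
  case (join a b c)
  have d: "a < b" "b < c" using pl2_dom[OF join.hyps(1)] pl2_dom[OF join.hyps(2)] by simp_all
  consider "t \<le> b" | "b \<le> t" by linarith
  then show ?case
  proof cases
    case 1
    then obtain e k where "e > 0" "a \<le> t - e" "t + e \<le> b" "\<forall>s. t - e \<le> s \<longrightarrow> s \<le> t + e \<longrightarrow> f s = f t + 2 powi k * (s - t)"
      using join.IH(1) join.prems by blast
    then show ?thesis using d by (intro exI[of _ e] conjI exI[of _ k]) (linarith | blast)+
  next
    case 2
    then obtain e k where "e > 0" "b \<le> t - e" "t + e \<le> c" "\<forall>s. t - e \<le> s \<longrightarrow> s \<le> t + e \<longrightarrow> f s = f t + 2 powi k * (s - t)"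
      using join.IH(2) join.prems by blast
    then show ?thesis using d by (intro exI[of _ e] conjI exI[of _ k]) (linarith | blast)+
  qed
qed

text \<open>
  The boundary of the fixed set, relative to the interval: fixed points with moved points arbitrarily
  near.
\<close>

definition boundary_fixpoints :: "(real \<Rightarrow> real) \<Rightarrow> real \<Rightarrow> real \<Rightarrow> real set" where
  "boundary_fixpoints f a b =
     {t \<in> {a..b}. f t = t \<and> (\<forall>e>0. \<exists>s\<in>{a..b}. \<bar>s - t\<bar> < e \<and> f s \<noteq> s)}"

lemma boundary_fixpoints_left_part:
  assumes "t \<in> boundary_fixpoints f a c" "a \<le> b" "b \<le> c" "t < b"
  shows "t \<in> boundary_fixpoints f a b"
proof -
  have "\<exists>s\<in>{a..b}. \<bar>s - t\<bar> < e \<and> f s \<noteq> s" if "e > 0" for e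
  proof -
    have "min e (b - t) > 0" using that assms by simp
    then obtain s where "s \<in> {a..c}" "\<bar>s - t\<bar> < min e (b - t)" "f s \<noteq> s"
      using assms unfolding boundary_fixpoints_def by blast
    then show ?thesis by (intro bexI[of _ s]) auto
  qed
  then show ?thesis using assms unfolding boundary_fixpoints_def by auto
qed

lemma boundary_fixpoints_right_part:
  assumes "t \<in> boundary_fixpoints f a c" "a \<le> b" "b \<le> c" "b < t"
  shows "t \<in> boundary_fixpoints f b c"
proof -
  have "\<exists>s\<in>{b..c}. \<bar>s - t\<bar> < e \<and> f s \<noteq> s" if "e > 0" for e
  proof -
    have "min e (t - b) > 0" using that assms by simp
    then obtain s where "s \<in> {a..c}" "\<bar>s - t\<bar> < min e (t - b)" "f s \<noteq> s"
      using assms unfolding boundary_fixpoints_def by blast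
    then show ?thesis by (intro bexI[of _ s]) auto
  qed
  then show ?thesis using assms unfolding boundary_fixpoints_def by auto
qed

text \<open>
  An affine piece other than the identity has at most one fixed point, an identity piece contributes
  none, and concatenation adds at most the common endpoint.
\<close>

lemma finite_boundary_fixpoints: "pl2 f a b \<Longrightarrow> finite (boundary_fixpoints f a b)"
proof (induction rule: pl2.induct)
  case (affine a b c k)
  show ?case
  proof (cases "\<forall>s\<in>{a..b}. f s = s")
    case True
    then have "boundary_fixpoints f a b = {}" unfolding boundary_fixpoints_def using zero_less_one by blast
    then show ?thesis by simp
  next
    case False
    \<comment> \<open>two fixed points of an affine map force slope 1 and constant 0\<close>
    have "p = q" if pq: "p \<in> boundary_fixpoints f a b" "q \<in> boundary_fixpoints f a b" for p q
    proof (rule ccontr)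
      assume "p \<noteq> q"
      have "p \<in> {a..b}" "q \<in> {a..b}" "f p = p" "f q = q"
        using pq unfolding boundary_fixpoints_def by auto
      then have e: "p = 2 powi k * p + c" "q = 2 powi k * q + c" using affine by force+
      then have "(2 powi k - 1) * (p - q) = 0" by (simp add: algebra_simps)
      then have "2 powi k = (1::real)" using \<open>p \<noteq> q\<close> by simp
      moreover from this have "c = 0" using e by simp
      ultimately show False using False affine by auto
    qed
    then have "boundary_fixpoints f a b \<subseteq> {SOME p. p \<in> boundary_fixpoints f a b}" by (metis someI_ex singletonI subsetI)
    then show ?thesis by (rule finite_subset) simp
  qed
next
  case (join a b c)
  have d: "a < b" "b < c" using pl2_dom[OF join.hyps(1)] pl2_dom[OF join.hyps(2)] by simp_all
  have "boundary_fixpoints f a c \<subseteq> boundary_fixpoints f a b \<union> boundary_fixpoints f b c \<union> {b}"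
  proof
    fix t assume t: "t \<in> boundary_fixpoints f a c"
    show "t \<in> boundary_fixpoints f a b \<union> boundary_fixpoints f b c \<union> {b}"
      using boundary_fixpoints_left_part[OF t, of b] boundary_fixpoints_right_part[OF t, of b] d
      by (cases t b rule: linorder_cases) auto
  qed
  then show ?case using join by (auto intro: finite_subset)
qed

section \<open>Any two dyadic intervals are related by a dyadic piecewise affine map\<close>

definition pl2_equiv :: "real \<Rightarrow> real \<Rightarrow> real \<Rightarrow> real \<Rightarrow> bool" where
  "pl2_equiv a b c d \<longleftrightarrow> (\<exists>f. pl2 f a b \<and> f a = c \<and> f b = d)"

lemma pl2_equiv_trans: "pl2_equiv a b c d \<Longrightarrow> pl2_equiv c d u v \<Longrightarrow> pl2_equiv a b u v"
  unfolding pl2_equiv_def using pl2_comp by blast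

lemma pl2_left_inverse:
  assumes "pl2 f a b"
  shows "\<exists>g. pl2 g (f a) (f b) \<and> (\<forall>t\<in>{a..b}. g (f t) = t) \<and> (\<forall>s\<in>{f a..f b}. f (g s) = s \<and> g s \<in> {a..b})"
proof -
  define g where "g = (\<lambda>s. THE t. a \<le> t \<and> t \<le> b \<and> f t = s)"
  have g: "g (f t) = t" if "a \<le> t" "t \<le> b" for t
    unfolding g_def using that pl2_eq_iff[OF assms] by blast
  have "f (g s) = s \<and> a \<le> g s \<and> g s \<le> b" if s: "f a \<le> s" "s \<le> f b" for s
  proof -
    obtain t where "a \<le> t" "t \<le> b" "f t = s" by (rule pl2_onto[OF assms s])
    then show ?thesis using g[of t] by simp
  qed
  moreover have "pl2 g (f a) (f b)" by (rule pl2_inverse[OF assms g])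
  ultimately show ?thesis using g by (intro exI[of _ g]) simp
qed

lemma pl2_equiv_sym: "pl2_equiv a b c d \<Longrightarrow> pl2_equiv c d a b"
proof -
  assume "pl2_equiv a b c d"
  then obtain f where f: "pl2 f a b" "f a = c" "f b = d" unfolding pl2_equiv_def by blast
  obtain g where g: "pl2 g (f a) (f b)" "\<forall>t\<in>{a..b}. g (f t) = t"
    using pl2_left_inverse[OF f(1)] by blast
  have "a \<le> b" using pl2_dom[OF f(1)] by simp
  then have "g c = a" "g d = b" using bspec[OF g(2), of a] bspec[OF g(2), of b] f by simp_all
  then show ?thesis unfolding pl2_equiv_def using f g(1) by (intro exI[of _ g]) simp
qed

lemma pl2_glue:
  assumes "pl2 f a b" "pl2 g b c" "f b = g b"
  shows "pl2 (\<lambda>t. if t \<le> b then f t else g t) a c"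
proof (rule pl2.join[of _ a b])
  show "pl2 (\<lambda>t. if t \<le> b then f t else g t) a b" by (rule pl2_cong[OF assms(1)]) auto
  show "pl2 (\<lambda>t. if t \<le> b then f t else g t) b c" by (rule pl2_cong[OF assms(2)]) (use assms(3) in auto)
qed

lemma pl2_equiv_join:
  assumes "pl2_equiv a b u v" "pl2_equiv b c v w" shows "pl2_equiv a c u w"
proof -
  obtain f g where f: "pl2 f a b" "f a = u" "f b = v" and g: "pl2 g b c" "g b = v" "g c = w"
    using assms unfolding pl2_equiv_def by blast
  have ab: "a < b" "b < c" using pl2_dom f(1) g(1) by blast+
  have "pl2 (\<lambda>t. if t \<le> b then f t else g t) a c"
    by (rule pl2_glue) (use f g in simp_all)
  moreover have "(if a \<le> b then f a else g a) = u" "(if c \<le> b then f c else g c) = w"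
    using f g ab by simp_all
  ultimately show ?thesis unfolding pl2_equiv_def by blast
qed

lemma pl2_equiv_affine:
  assumes "dyadic a" "dyadic b" "dyadic c" "dyadic d" "a < b" "d - c = 2 powi k * (b - a)"
  shows "pl2_equiv a b c d"
  unfolding pl2_equiv_def
proof (intro exI conjI)
  show "pl2 (\<lambda>t. 2 powi k * t + (c - 2 powi k * a)) a b"
    by (rule pl2.affine[where k = k and c = "c - 2 powi k * a"]) (use assms in auto)
qed (use assms in \<open>auto simp: algebra_simps\<close>)

text \<open>
  Induction on the length: the first unit interval is compressed to \<open>[0, 1/2]\<close>, and the
  remaining part, already comparable to a unit interval, to \<open>[1/2, 1]\<close>. The slopes stay powers of
  two although the length of the interval need not be one.
\<close>

lemma pl2_equiv_integer_interval: "0 < m \<Longrightarrow> pl2_equiv 0 (real m) 0 1"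
proof (induction m)
  case (Suc m)
  show ?case
  proof (cases "m = 0")
    case True then show ?thesis by (auto intro!: pl2_equiv_affine[where k = 0])
  next
    case False
    then have "pl2_equiv 0 (real m) 0 1" using Suc by simp
    moreover have "pl2_equiv 1 (real (Suc m)) 0 (real m)"
      using False by (intro pl2_equiv_affine[where k = 0]) auto
    moreover have "pl2_equiv 0 1 (1/2) 1"
      by (intro pl2_equiv_affine[where k = "-1"]) (auto simp: power_int_minus)
    ultimately have "pl2_equiv 1 (real (Suc m)) (1/2) 1" using pl2_equiv_trans by blast
    moreover have "pl2_equiv 0 1 0 (1/2)"
      by (intro pl2_equiv_affine[where k = "-1"]) (auto simp: power_int_minus)
    ultimately show ?thesis using pl2_equiv_join by blast
  qed
qed simp

lemma pl2_equiv_unit_interval: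
  assumes "dyadic a" "dyadic b" "a < b" shows "pl2_equiv 0 1 a b"
proof -
  have "dyadic (b - a)" using assms by auto
  then obtain z n where z: "b - a = real_of_int z / 2 ^ n" unfolding dyadic_def by blast
  moreover have "0 < b - a" "(0::real) < 2 ^ n" using assms by simp_all
  ultimately have "z > 0" by (auto simp: zero_less_divide_iff)
  define m where "m = nat z"
  have m: "b - a = real m / 2 ^ n" "0 < m" using z \<open>z > 0\<close> by (simp_all add: m_def)
  have "pl2_equiv 0 (real m) a b"
    by (rule pl2_equiv_affine[where k = "- int n"]) (use assms m in \<open>auto simp: power_int_minus field_simps\<close>)
  then show ?thesis using pl2_equiv_integer_interval[OF m(2)] pl2_equiv_sym pl2_equiv_trans by blast
qed

section \<open>Thompson's group in terms of dyadic piecewise affine maps\<close>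

text \<open>
  The condition on breakpoints in the definition of \<^const>\<open>thompson_maps\<close>, for an arbitrary
  interval.
\<close>

definition affine_off :: "(real \<Rightarrow> real) \<Rightarrow> real \<Rightarrow> real \<Rightarrow> real set \<Rightarrow> bool" where
  "affine_off f a b B \<longleftrightarrow> (\<forall>u v. a \<le> u \<and> u < v \<and> v \<le> b \<and> {u<..<v} \<inter> B = {} \<longrightarrow>
        (\<exists>(k::int) c. \<forall>t\<in>{u..v}. f t = 2 powi k * t + c))"

lemma affine_offD:
  "affine_off f a b B \<Longrightarrow> a \<le> u \<Longrightarrow> u < v \<Longrightarrow> v \<le> b \<Longrightarrow> {u<..<v} \<inter> B = {} \<Longrightarrow>
    \<exists>(k::int) c. \<forall>t\<in>{u..v}. f t = 2 powi k * t + c"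
  unfolding affine_off_def by (drule spec[of _ u], drule spec[of _ v]) simp

lemma affine_offI:
  "(\<And>u v. a \<le> u \<Longrightarrow> u < v \<Longrightarrow> v \<le> b \<Longrightarrow> {u<..<v} \<inter> B = {} \<Longrightarrow>
    \<exists>(k::int) c. \<forall>t\<in>{u..v}. f t = 2 powi k * t + c) \<Longrightarrow> affine_off f a b B"
  unfolding affine_off_def by simp

lemma thompson_maps_affine_off:
  "f \<in> thompson_maps \<longleftrightarrow> f \<in> extensional {0..1} \<and> (\<exists>g. homeomorphism {0..1} {0..1} f g) \<and>
     strict_mono_on {0..1} f \<and> (\<exists>B. finite B \<and> B \<subseteq> {0..1} \<inter> dyadics \<and> affine_off f 0 1 B)"
  unfolding thompson_maps_def affine_off_def by (rule mem_Collect_eq[THEN trans]) (rule refl)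

lemma pl2_breakpoints:
  "pl2 f a b \<Longrightarrow> \<exists>B. finite B \<and> B \<subseteq> {a..b} \<and> (\<forall>x\<in>B. dyadic x) \<and> affine_off f a b B"
proof (induction rule: pl2.induct)
  case (affine a b c k)
  have "affine_off f a b {}"
  proof (rule affine_offI)
    fix u v assume uv: "a \<le> u" "u < v" "v \<le> b"
    have "\<forall>t\<in>{u..v}. f t = 2 powi k * t + c"
    proof
      fix t assume "t \<in> {u..v}"
      then show "f t = 2 powi k * t + c" by (intro affine(5)) (use uv in auto)
    qed
    then show "\<exists>k c. \<forall>t\<in>{u..v}. f t = 2 powi k * t + c" by (intro exI)
  qed
  then show ?case by (intro exI[of _ "{}"]) auto
next
  case (join a b c)
  have d: "a < b" "b < c" "dyadic b" using pl2_dom[OF join.hyps(1)] pl2_dom[OF join.hyps(2)] by simp_all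
  obtain B1 where B1: "finite B1" "B1 \<subseteq> {a..b}" "\<forall>x\<in>B1. dyadic x" "affine_off f a b B1"
    using join.IH(1) by blast
  obtain B2 where B2: "finite B2" "B2 \<subseteq> {b..c}" "\<forall>x\<in>B2. dyadic x" "affine_off f b c B2"
    using join.IH(2) by blast
  have "affine_off f a c (B1 \<union> B2 \<union> {b})"
  proof (rule affine_offI)
    fix u v assume uv: "a \<le> u" "u < v" "v \<le> c" "{u<..<v} \<inter> (B1 \<union> B2 \<union> {b}) = {}"
    then have "b \<notin> {u<..<v}" and e: "{u<..<v} \<inter> B1 = {}" "{u<..<v} \<inter> B2 = {}" by blast+
    then consider "v \<le> b" | "b \<le> u" by fastforce
    then show "\<exists>k c. \<forall>t\<in>{u..v}. f t = 2 powi k * t + c"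
    proof cases
      case 1 then show ?thesis by (intro affine_offD[OF B1(4)] uv e)
    next
      case 2 then show ?thesis by (intro affine_offD[OF B2(4)] uv e)
    qed
  qed
  moreover have "B1 \<union> B2 \<union> {b} \<subseteq> {a..c}" using B1 B2 d by auto
  ultimately show ?case using B1 B2 d by (intro exI[of _ "B1 \<union> B2 \<union> {b}"]) auto
qed

text \<open>
  From left to right, induction on the number of breakpoints inside an interval splits it at a
  breakpoint. The value at the left endpoint is carried along as dyadic, starting from \<open>f 0 = 0\<close>;
  it makes the additive constant of each affine piece dyadic.
\<close>

lemma thompson_maps_iff:
  "f \<in> thompson_maps \<longleftrightarrow> f \<in> extensional {0..1} \<and> f 0 = 0 \<and> f 1 = 1 \<and> pl2 f 0 1"
proof
  assume f: "f \<in> thompson_maps"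
  then have ext: "f \<in> extensional {0..1}" and mono: "strict_mono_on {0..1} f"
    and im: "f ` {0..1} = {0..1}"
    unfolding thompson_maps_def homeomorphism_def by auto
  obtain B where B: "finite B" "B \<subseteq> {0..1} \<inter> dyadics"
    and aff: "affine_off f 0 1 B"
    using f unfolding thompson_maps_affine_off by blast
  have le: "f s \<le> f t" if "0 \<le> s" "s \<le> t" "t \<le> 1" for s t
    using strict_mono_onD[OF mono, of s t] that by (cases "s = t") auto
  obtain s where s: "s \<in> {0..1}" "f s = 0" using im by (metis atLeastAtMost_iff imageE order_refl zero_le_one)
  obtain t where t: "t \<in> {0..1}" "f t = 1" using im by (metis atLeastAtMost_iff imageE order_refl zero_le_one)
  have "f 0 \<in> {0..1}" "f 1 \<in> {0..1}" using im by auto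
  then have f01: "f 0 = 0" "f 1 = 1" using le[of 0 s] le[of t 1] s t by auto
  \<comment> \<open>induction on the number of breakpoints in the open interval\<close>
  have "pl2 f a b" if "card (B \<inter> {a<..<b}) = n" "0 \<le> a" "a < b" "b \<le> 1" "dyadic a" "dyadic b" "dyadic (f a)" for a b n
    using that
  proof (induction n arbitrary: a b rule: less_induct)
    case (less n)
    show ?case
    proof (cases "B \<inter> {a<..<b} = {}")
      case True
      then have "{a<..<b} \<inter> B = {}" by blast
      then obtain k :: int and c where kc: "\<forall>t\<in>{a..b}. f t = 2 powi k * t + c" using affine_offD[OF aff less.prems(2-4)] by blast
      then have "f a = 2 powi k * a + c" using less.prems by simp
      then have "c = f a - 2 powi k * a" by simp
      then have "dyadic c" using less.prems dyadic_diff dyadic_mult dyadic_powi by metis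
      then show ?thesis using kc less.prems by (intro pl2.affine[where k = k and c = c]) simp_all
    next
      case False
      then obtain p where p: "p \<in> B" "a < p" "p < b" by auto
      then have dp: "dyadic p" using B mem_dyadics_iff by blast
      have "B \<inter> {a<..<p} \<subset> B \<inter> {a<..<b}" "B \<inter> {p<..<b} \<subset> B \<inter> {a<..<b}" using p by auto
      then have cards: "card (B \<inter> {a<..<p}) < n" "card (B \<inter> {p<..<b}) < n"
        using B less.prems(1) psubset_card_mono[of "B \<inter> {a<..<b}"] by auto
      have 1: "pl2 f a p" using less.IH[OF cards(1) refl] less.prems p dp by simp
      then have "dyadic (f p)" using pl2_dyadic_iff[OF 1, of p] p dp by simp
      then have "pl2 f p b" using less.IH[OF cards(2) refl] less.prems p dp by simp
      then show ?thesis using 1 pl2.join by blast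
    qed
  qed
  then show "f \<in> extensional {0..1} \<and> f 0 = 0 \<and> f 1 = 1 \<and> pl2 f 0 1"
    using ext f01 by simp
next
  assume f: "f \<in> extensional {0..1} \<and> f 0 = 0 \<and> f 1 = 1 \<and> pl2 f 0 1"
  then have pl: "pl2 f 0 1" by blast
  have mono: "strict_mono_on {0..1} f"
    by (rule strict_mono_onI) (use pl2_less[OF pl] in auto)
  have im: "f ` {0..1} = {0..1}"
  proof
    show "f ` {0..1} \<subseteq> {0..1}" using pl2_le[OF pl, of 0] pl2_le[OF pl, of _ 1] f by auto
    show "{0..1} \<subseteq> f ` {0..1}"
    proof
      fix s :: real assume "s \<in> {0..1}"
      then have "f 0 \<le> s" "s \<le> f 1" using f by auto
      then obtain t where "0 \<le> t" "t \<le> 1" "f t = s" by (rule pl2_onto[OF pl])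
      then show "s \<in> f ` {0..1}" by force
    qed
  qed
  have "\<exists>g. homeomorphism {0..1} {0..1} f g"
    by (rule homeomorphism_compact[OF compact_Icc pl2_continuous[OF pl] im])
       (rule strict_mono_on_imp_inj_on[OF mono])
  moreover obtain B where "finite B" "B \<subseteq> {0..1}" "\<forall>x\<in>B. dyadic x" "affine_off f 0 1 B"
    using pl2_breakpoints[OF pl] by blast
  moreover from this have "B \<subseteq> {0..1} \<inter> dyadics" using mem_dyadics_iff by auto
  ultimately show "f \<in> thompson_maps" unfolding thompson_maps_affine_off using f mono by blast
qed

lemma thompson_pl2: "f \<in> thompson_maps \<Longrightarrow> pl2 f 0 1"
  and thompson_0: "f \<in> thompson_maps \<Longrightarrow> f 0 = 0"
  and thompson_1: "f \<in> thompson_maps \<Longrightarrow> f 1 = 1"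
  by (simp_all add: thompson_maps_iff)

lemma thompson_mapsI: "pl2 f 0 1 \<Longrightarrow> f 0 = 0 \<Longrightarrow> f 1 = 1 \<Longrightarrow> restrict f {0..1} \<in> thompson_maps"
  unfolding thompson_maps_iff by (auto intro: pl2_cong)

lemma thompson_eqI:
  "f \<in> thompson_maps \<Longrightarrow> g \<in> thompson_maps \<Longrightarrow> (\<And>t. 0 \<le> t \<Longrightarrow> t \<le> 1 \<Longrightarrow> f t = g t) \<Longrightarrow> f = g"
  unfolding thompson_maps_iff by (auto intro: extensionalityI)

lemma thompson_less: "f \<in> thompson_maps \<Longrightarrow> 0 \<le> s \<Longrightarrow> s < t \<Longrightarrow> t \<le> 1 \<Longrightarrow> f s < f t"
  using thompson_pl2 pl2_less by blast

lemma thompson_le: "f \<in> thompson_maps \<Longrightarrow> 0 \<le> s \<Longrightarrow> s \<le> t \<Longrightarrow> t \<le> 1 \<Longrightarrow> f s \<le> f t"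
  using thompson_pl2 pl2_le by blast

lemma thompson_inj: "f \<in> thompson_maps \<Longrightarrow> 0 \<le> s \<Longrightarrow> s \<le> 1 \<Longrightarrow> 0 \<le> t \<Longrightarrow> t \<le> 1 \<Longrightarrow> f s = f t \<longleftrightarrow> s = t"
  using thompson_pl2 pl2_eq_iff by blast

lemma thompson_range: "f \<in> thompson_maps \<Longrightarrow> 0 \<le> t \<Longrightarrow> t \<le> 1 \<Longrightarrow> 0 \<le> f t \<and> f t \<le> 1"
  using thompson_le[of f 0 t] thompson_le[of f t 1] thompson_0 thompson_1 by force

lemma thompson_dyadic_iff: "f \<in> thompson_maps \<Longrightarrow> 0 \<le> t \<Longrightarrow> t \<le> 1 \<Longrightarrow> dyadic (f t) \<longleftrightarrow> dyadic t"
  using thompson_pl2 pl2_dyadic_iff by blast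

lemma thompson_bij: "f \<in> thompson_maps \<Longrightarrow> f \<in> Bij {0..1}"
  unfolding thompson_maps_def Bij_def homeomorphism_def bij_betw_def
  using strict_mono_on_imp_inj_on by auto

lemma carrier_thompson [simp]: "carrier thompson_F = thompson_maps"
  by (simp add: thompson_F_def)

lemma mult_thompson:
  "f \<in> thompson_maps \<Longrightarrow> g \<in> thompson_maps \<Longrightarrow> f \<otimes>\<^bsub>thompson_F\<^esub> g = compose {0..1} f g"
  by (simp add: thompson_F_def BijGroup_def thompson_bij)

lemma mult_thompson_apply [simp]:
  "f \<in> thompson_maps \<Longrightarrow> g \<in> thompson_maps \<Longrightarrow> 0 \<le> t \<Longrightarrow> t \<le> 1 \<Longrightarrow> (f \<otimes>\<^bsub>thompson_F\<^esub> g) t = f (g t)"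
  by (simp add: mult_thompson compose_def)

lemma one_thompson: "\<one>\<^bsub>thompson_F\<^esub> = (\<lambda>t\<in>{0..1}. t)"
  by (simp add: thompson_F_def BijGroup_def)

lemma one_thompson_apply [simp]: "0 \<le> t \<Longrightarrow> t \<le> 1 \<Longrightarrow> \<one>\<^bsub>thompson_F\<^esub> t = t"
  by (simp add: one_thompson)

lemma subgroup_thompson_maps: "subgroup thompson_maps (BijGroup {0..1})"
proof (rule group.subgroupI[OF group_BijGroup])
  show "thompson_maps \<subseteq> carrier (BijGroup {0..1})" using thompson_bij by (auto simp: BijGroup_def)
  have "restrict (\<lambda>t. t) {0..1} \<in> thompson_maps"
    by (rule thompson_mapsI) (auto intro: pl2_ident)
  then show "thompson_maps \<noteq> {}" by blast
next
  fix f assume f: "f \<in> thompson_maps"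
  have inj: "inj_on f {0..1}" using thompson_inj[OF f] by (auto simp: inj_on_def)
  let ?g = "inv_into {0..1} f"
  have "?g (f t) = t" if "0 \<le> t" "t \<le> 1" for t using inv_into_f_f[OF inj, of t] that by simp
  then have "pl2 ?g 0 1" "?g 0 = 0" "?g 1 = 1"
    using pl2_inverse[OF thompson_pl2[OF f], of ?g] thompson_0[OF f] thompson_1[OF f]
    by (auto, metis order_refl zero_le_one, metis order_refl zero_le_one)
  then show "inv\<^bsub>BijGroup {0..1}\<^esub> f \<in> thompson_maps"
    using thompson_mapsI f thompson_bij by (simp add: inv_BijGroup)
next
  fix f g assume fg: "f \<in> thompson_maps" "g \<in> thompson_maps"
  have "pl2 (\<lambda>t. f (g t)) 0 1"
    by (rule pl2_comp[where f = g and g = f])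
       (use fg thompson_pl2 thompson_0[OF fg(2)] thompson_1[OF fg(2)] in auto)
  then have "restrict (\<lambda>t. f (g t)) {0..1} \<in> thompson_maps"
    by (rule thompson_mapsI) (use thompson_0[OF fg(1)] thompson_1[OF fg(1)] thompson_0[OF fg(2)] thompson_1[OF fg(2)] in simp_all)
  then show "f \<otimes>\<^bsub>BijGroup {0..1}\<^esub> g \<in> thompson_maps"
    using fg thompson_bij by (simp add: BijGroup_def compose_def)
qed

interpretation F: group thompson_F
  unfolding thompson_F_def by (rule subgroup.subgroup_is_group[OF subgroup_thompson_maps group_BijGroup])

lemma thompson_mult_closed [simp]:
  "f \<in> thompson_maps \<Longrightarrow> g \<in> thompson_maps \<Longrightarrow> f \<otimes>\<^bsub>thompson_F\<^esub> g \<in> thompson_maps"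
  using F.m_closed[of f g] by simp

lemma thompson_one_closed [simp]: "\<one>\<^bsub>thompson_F\<^esub> \<in> thompson_maps"
  using F.one_closed by simp

lemma thompson_inv_closed [simp]: "f \<in> thompson_maps \<Longrightarrow> inv\<^bsub>thompson_F\<^esub> f \<in> thompson_maps"
  using F.inv_closed[of f] by simp

lemma thompson_inv_apply [simp]:
  assumes "f \<in> thompson_maps" "0 \<le> t" "t \<le> 1"
  shows "f ((inv\<^bsub>thompson_F\<^esub> f) t) = t" "(inv\<^bsub>thompson_F\<^esub> f) (f t) = t"
proof -
  have "f \<otimes>\<^bsub>thompson_F\<^esub> inv\<^bsub>thompson_F\<^esub> f = \<one>\<^bsub>thompson_F\<^esub>"
    "inv\<^bsub>thompson_F\<^esub> f \<otimes>\<^bsub>thompson_F\<^esub> f = \<one>\<^bsub>thompson_F\<^esub>" using assms F.r_inv[of f] F.l_inv[of f] by auto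
  then show "f ((inv\<^bsub>thompson_F\<^esub> f) t) = t" "(inv\<^bsub>thompson_F\<^esub> f) (f t) = t"
    using assms mult_thompson_apply[of f "inv\<^bsub>thompson_F\<^esub> f" t] mult_thompson_apply[of "inv\<^bsub>thompson_F\<^esub> f" f t]
      one_thompson_apply[of t] thompson_inv_closed[of f] by metis+
qed

lemma thompson_pow_closed [simp]: "f \<in> thompson_maps \<Longrightarrow> f [^]\<^bsub>thompson_F\<^esub> (n::nat) \<in> thompson_maps"
  using F.nat_pow_closed[of f n] by simp

lemma thompson_pow_apply:
  "f \<in> thompson_maps \<Longrightarrow> 0 \<le> t \<Longrightarrow> t \<le> 1 \<Longrightarrow> (f [^]\<^bsub>thompson_F\<^esub> (n::nat)) t = (f ^^ n) t \<and> 0 \<le> (f ^^ n) t \<and> (f ^^ n) t \<le> 1"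
proof (induction n arbitrary: t)
  case (Suc n)
  have r: "0 \<le> f t" "f t \<le> 1" using thompson_range Suc.prems by auto
  then show ?case using Suc.IH[OF Suc.prems(1) r] Suc.prems by (simp add: funpow_swap1)
qed simp

definition commutes :: "(real \<Rightarrow> real) \<Rightarrow> (real \<Rightarrow> real) \<Rightarrow> bool" where
  "commutes x y \<longleftrightarrow> x \<otimes>\<^bsub>thompson_F\<^esub> y = y \<otimes>\<^bsub>thompson_F\<^esub> x"

lemma commutes_iff:
  "x \<in> thompson_maps \<Longrightarrow> y \<in> thompson_maps \<Longrightarrow>
   commutes x y \<longleftrightarrow> (\<forall>t. 0 \<le> t \<longrightarrow> t \<le> 1 \<longrightarrow> x (y t) = y (x t))"
  unfolding commutes_def
  by (metis mult_thompson_apply thompson_eqI thompson_mult_closed)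

lemma commutes_apply:
  "commutes x y \<Longrightarrow> x \<in> thompson_maps \<Longrightarrow> y \<in> thompson_maps \<Longrightarrow> 0 \<le> t \<Longrightarrow> t \<le> 1 \<Longrightarrow> x (y t) = y (x t)"
  using commutes_iff by blast

lemma commutes_sym: "commutes x y \<Longrightarrow> commutes y x"
  unfolding commutes_def by simp

lemma centralizer_singleton: "centralizer thompson_F {x} = {y \<in> thompson_maps. commutes y x}"
  unfolding centralizer_def commutes_def by simp

section \<open>Elements supported in an interval\<close>

definition support_extend :: "real \<Rightarrow> real \<Rightarrow> (real \<Rightarrow> real) \<Rightarrow> real \<Rightarrow> real" where
  "support_extend u v f = (\<lambda>t\<in>{0..1}. if u \<le> t \<and> t \<le> v then f t else t)"

text \<open>
  The elements supported in \<open>[u, v]\<close>. Fixing the endpoints is stated separately so that the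
  condition on the outside concerns only points strictly outside the interval.
\<close>

definition F_on :: "real \<Rightarrow> real \<Rightarrow> (real \<Rightarrow> real) set" where
  "F_on u v = {y \<in> thompson_maps. y u = u \<and> y v = v \<and> (\<forall>t. 0 \<le> t \<and> t < u \<or> v < t \<and> t \<le> 1 \<longrightarrow> y t = t)}"

definition dyadic_interval :: "real \<Rightarrow> real \<Rightarrow> bool" where
  "dyadic_interval u v \<longleftrightarrow> dyadic u \<and> dyadic v \<and> 0 \<le> u \<and> u < v \<and> v \<le> 1"

lemma support_extend_apply [simp]:
  "0 \<le> t \<Longrightarrow> t \<le> 1 \<Longrightarrow> support_extend u v f t = (if u \<le> t \<and> t \<le> v then f t else t)"
  by (simp add: support_extend_def)

lemma support_extend_F_on:
  assumes "dyadic_interval u v" "pl2 f u v" "f u = u" "f v = v"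
  shows "support_extend u v f \<in> F_on u v"
proof -
  let ?g = "\<lambda>t. if u \<le> t \<and> t \<le> v then f t else t"
  have uv: "dyadic u" "dyadic v" "0 \<le> u" "u < v" "v \<le> 1" using assms(1) by (auto simp: dyadic_interval_def)
  have "pl2 ?g u v" by (rule pl2_cong[OF assms(2)]) auto
  moreover have "pl2 ?g 0 v" if "0 < u"
    by (rule pl2.join[of _ 0 u]) (use that uv assms calculation in \<open>auto intro: pl2_ident\<close>)
  ultimately have 0: "pl2 ?g 0 v" using uv by (cases "u = 0") auto
  have "pl2 ?g 0 1"
  proof (cases "v = 1")
    case False
    then have "pl2 ?g v 1" by (intro pl2_ident) (use uv assms in auto)
    then show ?thesis using 0 pl2.join by blast
  qed (use 0 in simp)
  then have "support_extend u v f \<in> thompson_maps"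
    unfolding support_extend_def by (rule thompson_mapsI) (use uv assms in auto)
  then show ?thesis unfolding F_on_def using uv assms by auto
qed

lemma F_onI:
  "y \<in> thompson_maps \<Longrightarrow> y u = u \<Longrightarrow> y v = v \<Longrightarrow> (\<And>t. 0 \<le> t \<Longrightarrow> t < u \<Longrightarrow> y t = t) \<Longrightarrow>
   (\<And>t. t \<le> 1 \<Longrightarrow> v < t \<Longrightarrow> y t = t) \<Longrightarrow> y \<in> F_on u v"
  unfolding F_on_def by simp

lemma F_on_thompson: "y \<in> F_on u v \<Longrightarrow> y \<in> thompson_maps"
  and F_on_fixes: "y \<in> F_on u v \<Longrightarrow> y u = u" "y \<in> F_on u v \<Longrightarrow> y v = v"
  and F_on_outside: "y \<in> F_on u v \<Longrightarrow> 0 \<le> t \<Longrightarrow> t < u \<Longrightarrow> y t = t"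
    "y \<in> F_on u v \<Longrightarrow> t \<le> 1 \<Longrightarrow> v < t \<Longrightarrow> y t = t"
  by (auto simp: F_on_def)

lemma support_extend_self:
  assumes "y \<in> thompson_maps" "y u = u" "y v = v" "dyadic_interval u v"
  shows "support_extend u v y \<in> F_on u v"
proof -
  have "pl2 y u v" using assms pl2_restrict[OF thompson_pl2[OF assms(1)]] by (auto simp: dyadic_interval_def)
  then show ?thesis using assms support_extend_F_on by blast
qed

lemma F_on_range:
  assumes "y \<in> F_on u v" "dyadic_interval u v" "u \<le> t" "t \<le> v" shows "u \<le> y t" "y t \<le> v"
  using thompson_le[OF F_on_thompson[OF assms(1)], of u t] thompson_le[OF F_on_thompson[OF assms(1)], of t v]
    F_on_fixes[OF assms(1)] assms by (auto simp: dyadic_interval_def)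

lemma thompson_preserves_interval:
  assumes "y \<in> thompson_maps" "y u = u" "y v = v" "0 \<le> u" "v \<le> 1" "u \<le> t" "t \<le> v"
  shows "u \<le> y t \<and> y t \<le> v"
  using thompson_le[OF assms(1), of u t] thompson_le[OF assms(1), of t v] assms by auto

lemma F_on_eqI:
  assumes "x \<in> F_on u v" "y \<in> F_on u v" "\<And>t. u \<le> t \<Longrightarrow> t \<le> v \<Longrightarrow> x t = y t"
  shows "x = y"
proof (rule thompson_eqI)
  fix t :: real assume t: "0 \<le> t" "t \<le> 1"
  show "x t = y t"
    using assms(3)[of t] F_on_outside[OF assms(1), of t] F_on_outside[OF assms(2), of t] t
    by (cases "t < u"; cases "v < t") auto
qed (use assms F_on_thompson in auto)

lemma thompson_inv_fixes: "y \<in> thompson_maps \<Longrightarrow> 0 \<le> t \<Longrightarrow> t \<le> 1 \<Longrightarrow> y t = t \<Longrightarrow> (inv\<^bsub>thompson_F\<^esub> y) t = t"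
  by (metis thompson_inv_apply(2))

lemma subgroup_F_on:
  assumes uv: "dyadic_interval u v" shows "subgroup (F_on u v) thompson_F"
proof (rule F.subgroupI)
  have uv': "0 \<le> u" "u \<le> 1" "u < v" "v \<le> 1" "0 \<le> v" using uv by (auto simp: dyadic_interval_def)
  show "F_on u v \<subseteq> carrier thompson_F" using F_on_thompson by auto
  have "\<one>\<^bsub>thompson_F\<^esub> \<in> F_on u v" by (rule F_onI) (use uv' in simp_all)
  then show "F_on u v \<noteq> {}" by blast
  fix y assume y: "y \<in> F_on u v"
  note yT = F_on_thompson[OF y]
  show "inv\<^bsub>thompson_F\<^esub> y \<in> F_on u v"
    by (rule F_onI; (rule thompson_inv_fixes[OF yT])?; (rule F_on_fixes[OF y] F_on_outside[OF y])?)
       (use uv' yT in simp_all)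
  fix x assume x: "x \<in> F_on u v"
  note xT = F_on_thompson[OF x]
  show "x \<otimes>\<^bsub>thompson_F\<^esub> y \<in> F_on u v"
    by (rule F_onI) (use uv' xT yT F_on_fixes[OF x] F_on_fixes[OF y] F_on_outside[OF x] F_on_outside[OF y] in simp_all)
qed

text \<open>
  Conjugation by a dyadic piecewise affine map from the unit interval onto \<open>[u, v]\<close>; it exists for
  every dyadic interval, even if the length is not a power of two.
\<close>

theorem F_on_iso_thompson:
  assumes uv: "dyadic_interval u v"
  shows "thompson_F\<lparr>carrier := F_on u v\<rparr> \<cong> thompson_F"
proof -
  have uv': "dyadic u" "dyadic v" "0 \<le> u" "u < v" "v \<le> 1" using uv by (auto simp: dyadic_interval_def)
  obtain p where p: "pl2 p 0 1" "p 0 = u" "p 1 = v"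
    using pl2_equiv_unit_interval[of u v] uv' unfolding pl2_equiv_def by blast
  obtain q where q: "pl2 q u v" "\<forall>t\<in>{0..1}. q (p t) = t" "\<forall>s\<in>{u..v}. p (q s) = s \<and> q s \<in> {0..1}"
    using pl2_left_inverse[OF p(1)] p by auto
  have p_range: "u \<le> p t" "p t \<le> v" if "0 \<le> t" "t \<le> 1" for t
    using pl2_le[OF p(1), of 0 t] pl2_le[OF p(1), of t 1] p that by auto
  have q_range: "0 \<le> q t" "q t \<le> 1" if "u \<le> t" "t \<le> v" for t using q(3) that by auto
  have quv: "q u = 0" "q v = 1" using bspec[OF q(2), of 0] bspec[OF q(2), of 1] p by auto
  \<comment> \<open>conjugation by \<open>p\<close>, extended by the identity, and its inverse\<close>
  define \<Phi> where "\<Phi> = (\<lambda>f. support_extend u v (\<lambda>t. p (f (q t))))"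
  define \<Psi> where "\<Psi> = (\<lambda>y. restrict (\<lambda>t. q (y (p t))) {0..1})"
  have \<Phi>: "\<Phi> f \<in> F_on u v" if f: "f \<in> thompson_maps" for f
    unfolding \<Phi>_def
  proof (rule support_extend_F_on[OF uv])
    have "pl2 (\<lambda>t. f (q t)) u v" by (rule pl2_comp) (use q(1) quv thompson_pl2[OF f] in auto)
    then show "pl2 (\<lambda>t. p (f (q t))) u v"
      by (rule pl2_comp) (use quv p(1) thompson_0[OF f] thompson_1[OF f] in auto)
  qed (use quv p thompson_0[OF f] thompson_1[OF f] in auto)
  have \<Psi>: "\<Psi> y \<in> thompson_maps" if y: "y \<in> F_on u v" for y
    unfolding \<Psi>_def
  proof (rule thompson_mapsI)
    have "pl2 y (p 0) (p 1)" using pl2_restrict[OF thompson_pl2[OF F_on_thompson[OF y]]] uv' p by simp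
    then have "pl2 (\<lambda>t. y (p t)) 0 1" by (rule pl2_comp[rotated]) (use p in simp_all)
    then show "pl2 (\<lambda>t. q (y (p t))) 0 1"
      by (rule pl2_comp) (use q(1) p F_on_fixes[OF y] in auto)
  qed (use quv p F_on_fixes[OF y] in auto)
  have "\<Psi> (\<Phi> f) = f" if f: "f \<in> thompson_maps" for f
  proof (rule thompson_eqI)
    fix t :: real assume t: "0 \<le> t" "t \<le> 1"
    have "0 \<le> p t" "p t \<le> 1" using p_range[OF t] uv' by auto
    then show "\<Psi> (\<Phi> f) t = f t"
      unfolding \<Psi>_def \<Phi>_def using p_range[OF t] q(2) t thompson_range[OF f t] by simp
  qed (use \<Psi> \<Phi> f in auto)
  moreover have "\<Phi> (\<Psi> y) = y" if y: "y \<in> F_on u v" for y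
  proof (rule F_on_eqI)
    fix t assume t: "u \<le> t" "t \<le> v"
    have "0 \<le> t" "t \<le> 1" using t uv' by auto
    then show "\<Phi> (\<Psi> y) t = y t"
      unfolding \<Psi>_def \<Phi>_def using q_range[OF t] q(3) t F_on_range[OF y uv t] by simp
  qed (use \<Psi> \<Phi> y in auto)
  ultimately have bij: "bij_betw \<Phi> thompson_maps (F_on u v)"
    using \<Phi> \<Psi> by (intro bij_betwI[where g = \<Psi>]) auto
  have "\<Phi> (f \<otimes>\<^bsub>thompson_F\<^esub> g) = \<Phi> f \<otimes>\<^bsub>thompson_F\<^esub> \<Phi> g"
    if fg: "f \<in> thompson_maps" "g \<in> thompson_maps" for f g
  proof (rule F_on_eqI)
    show "\<Phi> f \<otimes>\<^bsub>thompson_F\<^esub> \<Phi> g \<in> F_on u v"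
      using subgroup.m_closed[OF subgroup_F_on[OF uv]] \<Phi> fg by blast
    fix t assume t: "u \<le> t" "t \<le> v"
    have t1: "0 \<le> t" "t \<le> 1" using t uv' by auto
    have gq: "0 \<le> g (q t)" "g (q t) \<le> 1" using thompson_range[OF fg(2) q_range[OF t]] by auto
    have "\<Phi> g t = p (g (q t))" unfolding \<Phi>_def using t t1 by simp
    moreover have "\<Phi> f (p (g (q t))) = p (f (g (q t)))"
      unfolding \<Phi>_def using p_range[OF gq] uv' q(2) gq by simp
    moreover have "\<Phi> (f \<otimes>\<^bsub>thompson_F\<^esub> g) t = p (f (g (q t)))"
      unfolding \<Phi>_def using t t1 fg q_range[OF t] by simp
    ultimately show "\<Phi> (f \<otimes>\<^bsub>thompson_F\<^esub> g) t = (\<Phi> f \<otimes>\<^bsub>thompson_F\<^esub> \<Phi> g) t"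
      using mult_thompson_apply[OF F_on_thompson[OF \<Phi>[OF fg(1)]] F_on_thompson[OF \<Phi>[OF fg(2)]] t1] by simp
  qed (use \<Phi> fg in auto)
  then have "\<Phi> \<in> iso thompson_F (thompson_F\<lparr>carrier := F_on u v\<rparr>)"
    using bij \<Phi> by (intro isoI homI) auto
  then have "thompson_F \<cong> thompson_F\<lparr>carrier := F_on u v\<rparr>" unfolding is_iso_def by blast
  then show ?thesis by (rule F.iso_sym)
qed

section \<open>Gluing\<close>

definition subdivision :: "(nat \<Rightarrow> real) \<Rightarrow> nat \<Rightarrow> bool" where
  "subdivision p r \<longleftrightarrow> p 0 = 0 \<and> p r = 1 \<and> (\<forall>i<r. p i < p (Suc i)) \<and> (\<forall>i\<le>r. dyadic (p i))"

lemma subdivision_less: "subdivision p r \<Longrightarrow> i < j \<Longrightarrow> j \<le> r \<Longrightarrow> p i < p j"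
proof (induction j)
  case (Suc j)
  have "p j < p (Suc j)" using Suc.prems by (auto simp: subdivision_def)
  moreover have "p i \<le> p j" using Suc by (cases "i = j") auto
  ultimately show ?case by simp
qed simp

lemma subdivision_le: "subdivision p r \<Longrightarrow> i \<le> j \<Longrightarrow> j \<le> r \<Longrightarrow> p i \<le> p j"
  using subdivision_less[of p r i j] by (cases "i = j") auto

lemma subdivision_interval: "subdivision p r \<Longrightarrow> i < r \<Longrightarrow> dyadic_interval (p i) (p (Suc i))"
  using subdivision_le[of p r 0 i] subdivision_le[of p r "Suc i" r]
  by (auto simp: subdivision_def dyadic_interval_def)

lemma subdivision_locate:
  assumes "subdivision p r" "0 \<le> t" "t \<le> 1"
  obtains i where "i < r" "p i \<le> t" "t \<le> p (Suc i)"
proof -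
  have "\<exists>i<n. p i \<le> t \<and> t \<le> p (Suc i)" if "n \<le> r" "0 < n" "t \<le> p n" for n
    using that
  proof (induction n)
    case (Suc n)
    show ?case
    proof (cases "p n \<le> t")
      case False
      then have "n \<noteq> 0" using assms by (auto simp: subdivision_def intro: gr0I)
      then show ?thesis using Suc False by (auto simp: less_Suc_eq)
    qed (use Suc in auto)
  qed simp
  moreover have "r \<noteq> 0" using assms(1) by (auto simp: subdivision_def intro: gr0I)
  moreover have "t \<le> p r" using assms by (simp add: subdivision_def)
  ultimately show thesis using that[of "_"] by blast
qed

lemma glue_pl2:
  assumes p: "subdivision p r"
    and f: "\<And>i. i < r \<Longrightarrow> pl2 (f i) (p i) (p (Suc i))"
    and match: "\<And>i. Suc i < r \<Longrightarrow> f i (p (Suc i)) = f (Suc i) (p (Suc i))"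
  shows "\<exists>g. pl2 g 0 1 \<and> (\<forall>i<r. \<forall>t. p i \<le> t \<and> t \<le> p (Suc i) \<longrightarrow> g t = f i t)"
proof -
  have "\<exists>g. pl2 g 0 (p n) \<and> (\<forall>i<n. \<forall>t. p i \<le> t \<and> t \<le> p (Suc i) \<longrightarrow> g t = f i t)" if "0 < n" "n \<le> r" for n
    using that
  proof (induction n)
    case (Suc n)
    show ?case
    proof (cases "n = 0")
      case True
      then show ?thesis using Suc f[of 0] p by (intro exI[of _ "f 0"]) (auto simp: subdivision_def)
    next
      case False
      then obtain g where g: "pl2 g 0 (p n)" "\<And>i t. i < n \<Longrightarrow> p i \<le> t \<and> t \<le> p (Suc i) \<Longrightarrow> g t = f i t"
        using Suc by auto
      obtain m where m: "n = Suc m" using False not0_implies_Suc by blast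
      have "p m < p n" using m Suc.prems subdivision_less[OF p, of m n] by simp
      then have "g (p n) = f m (p n)" using g(2)[of m "p n"] m by simp
      then have gn: "g (p n) = f n (p n)" using match[of m] m Suc.prems by simp
      let ?h = "\<lambda>t. if t \<le> p n then g t else f n t"
      have "pl2 ?h 0 (p (Suc n))" by (rule pl2_glue) (use g f[of n] Suc.prems gn in auto)
      moreover have "?h t = f i t" if i: "i < Suc n" and t: "p i \<le> t \<and> t \<le> p (Suc i)" for i t
      proof (cases "i = n")
        case True
        then show ?thesis using t gn by (cases "t = p n") auto
      next
        case False
        then have "p (Suc i) \<le> p n" using i Suc.prems subdivision_le[OF p, of "Suc i" n] by simp
        then show ?thesis using False i t g(2)[of i t] by simp
      qed
      ultimately show ?thesis by blast
    qed
  qed simp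
  moreover have "r \<noteq> 0" using p by (auto simp: subdivision_def intro: gr0I)
  ultimately show ?thesis using p unfolding subdivision_def by (metis gr0I order_refl)
qed

text \<open>
  Only the behaviour of each element on its own piece matters, and there it maps the piece onto itself.
\<close>

lemma glue_pieces:
  assumes p: "subdivision p r"
    and f: "\<And>i. i < r \<Longrightarrow> f i \<in> thompson_maps \<and> f i (p i) = p i \<and> f i (p (Suc i)) = p (Suc i)"
  obtains g where "g \<in> thompson_maps" "\<And>i t. i < r \<Longrightarrow> p i \<le> t \<Longrightarrow> t \<le> p (Suc i) \<Longrightarrow> g t = f i t"
proof -
  have piece: "pl2 (f i) (p i) (p (Suc i))" if "i < r" for i
    using pl2_restrict[OF thompson_pl2] f[OF that] subdivision_interval[OF p that] by (auto simp: dyadic_interval_def)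
  have r: "r \<noteq> 0" using p by (auto simp: subdivision_def intro: gr0I)
  have "\<exists>g. pl2 g 0 1 \<and> (\<forall>i<r. \<forall>t. p i \<le> t \<and> t \<le> p (Suc i) \<longrightarrow> g t = f i t)"
    by (rule glue_pl2[OF p piece]) (use f in simp_all)
  then obtain g where g: "pl2 g 0 1" "\<And>i t. i < r \<Longrightarrow> p i \<le> t \<Longrightarrow> t \<le> p (Suc i) \<Longrightarrow> g t = f i t"
    by blast
  have "g (p 0) = p 0" using g(2)[of 0 "p 0"] f[of 0] subdivision_less[OF p, of 0 1] r by simp
  moreover have "g (p r) = p r"
    using g(2)[of "r - 1" "p r"] f[of "r - 1"] subdivision_less[OF p, of "r - 1" r] r by simp
  ultimately have g01: "g 0 = 0" "g 1 = 1" using p by (auto simp: subdivision_def)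
  show thesis
  proof (rule that[of "restrict g {0..1}"])
    show "restrict g {0..1} \<in> thompson_maps" by (rule thompson_mapsI[OF g(1) g01])
    fix i t assume it: "i < r" "p i \<le> t" "t \<le> p (Suc i)"
    then have "0 \<le> t" "t \<le> 1" using subdivision_interval[OF p it(1)] by (auto simp: dyadic_interval_def)
    then show "restrict g {0..1} t = f i t" using g(2)[OF it] by simp
  qed
qed

section \<open>Fixed points and slopes\<close>

lemma dyadic_dense:
  fixes a b :: real assumes "a < b" obtains d where "dyadic d" "a < d" "d < b"
proof -
  obtain n where n: "(1/2) ^ n < b - a" using real_arch_pow_inv[of "b - a" "1/2"] assms by auto
  define z where "z = \<lfloor>a * 2 ^ n\<rfloor> + 1"
  have "a * 2 ^ n < of_int z" "of_int z \<le> a * 2 ^ n + 1" unfolding z_def by linarith+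
  then have "a < of_int z / 2 ^ n" "of_int z / 2 ^ n \<le> a + 1 / 2 ^ n"
    by (simp_all add: field_simps)
  moreover have "a + 1 / 2 ^ n < b" using n by (simp add: power_divide)
  moreover have "dyadic (of_int z / 2 ^ n)" by simp
  ultimately show thesis using that by (meson le_less_trans)
qed

definition affine_about :: "(real \<Rightarrow> real) \<Rightarrow> real \<Rightarrow> int \<Rightarrow> real \<Rightarrow> real \<Rightarrow> bool" where
  "affine_about y w k a b \<longleftrightarrow> (\<forall>s. a \<le> s \<longrightarrow> s \<le> b \<longrightarrow> y s = y w + 2 powi k * (s - w))"

lemma affine_aboutD: "affine_about y w k a b \<Longrightarrow> a \<le> s \<Longrightarrow> s \<le> b \<Longrightarrow> y s = y w + 2 powi k * (s - w)"
  unfolding affine_about_def by blast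

lemma thompson_germ_right:
  "y \<in> thompson_maps \<Longrightarrow> 0 \<le> t \<Longrightarrow> t < 1 \<Longrightarrow> \<exists>e>0. \<exists>k. t + e \<le> 1 \<and> affine_about y t k t (t + e)"
  unfolding affine_about_def by (rule pl2_germ_right[OF thompson_pl2])

lemma thompson_germ_left:
  "y \<in> thompson_maps \<Longrightarrow> 0 < t \<Longrightarrow> t \<le> 1 \<Longrightarrow> \<exists>e>0. \<exists>k. 0 \<le> t - e \<and> affine_about y t k (t - e) t"
  unfolding affine_about_def by (rule pl2_germ_left[OF thompson_pl2])

lemma thompson_germ_nondyadic:
  "y \<in> thompson_maps \<Longrightarrow> 0 \<le> t \<Longrightarrow> t \<le> 1 \<Longrightarrow> \<not> dyadic t \<Longrightarrow>
   \<exists>e>0. \<exists>k. 0 \<le> t - e \<and> t + e \<le> 1 \<and> affine_about y t k (t - e) (t + e)"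
  unfolding affine_about_def by (rule pl2_germ_nondyadic[OF thompson_pl2])

lemma affine_two_fixpoints:
  fixes c w d s1 s2 :: real
  assumes "s1 = d + c * (s1 - w)" "s2 = d + c * (s2 - w)" "s1 \<noteq> s2"
  shows "c = 1 \<and> d = w"
proof -
  have "(c - 1) * (s1 - s2) = 0" using assms(1,2) by (simp add: algebra_simps)
  then have "c = 1" using assms(3) by simp
  then show ?thesis using assms(1) by simp
qed

lemma fix_left_limit:
  assumes y: "y \<in> thompson_maps" and "0 \<le> a" "a < w" "w \<le> 1" "\<And>t. a \<le> t \<Longrightarrow> t < w \<Longrightarrow> y t = t"
  shows "y w = w"
proof -
  have "0 < w" using assms(2,3) by simp
  then obtain e k where e0: "e > 0" "affine_about y w k (w - e) w"
    using thompson_germ_left[OF y _ assms(4)] by blast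
  note e = e0(1) affine_aboutD[OF e0(2)]
  define s1 where "s1 = max a (w - e)"
  define s2 where "s2 = (s1 + w) / 2"
  have s: "a \<le> s1" "s1 < s2" "s2 < w" "w - e \<le> s1" using assms e(1) by (auto simp: s1_def s2_def)
  have "s1 = y w + 2 powi k * (s1 - w)" "s2 = y w + 2 powi k * (s2 - w)"
    using e(2)[of s1] e(2)[of s2] assms(5)[of s1] assms(5)[of s2] s by auto
  then show ?thesis using affine_two_fixpoints s(2) by (metis less_irrefl)
qed

lemma fix_right_limit:
  assumes y: "y \<in> thompson_maps" and "0 \<le> w" "w < b" "b \<le> 1" "\<And>t. w < t \<Longrightarrow> t \<le> b \<Longrightarrow> y t = t"
  shows "y w = w"
proof -
  have "w < 1" using assms(3,4) by simp
  then obtain e k where e0: "e > 0" "affine_about y w k w (w + e)"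
    using thompson_germ_right[OF y assms(2)] by blast
  note e = e0(1) affine_aboutD[OF e0(2)]
  define s1 where "s1 = min b (w + e)"
  define s2 where "s2 = (s1 + w) / 2"
  have s: "s1 \<le> b" "s2 < s1" "w < s2" "s1 \<le> w + e" using assms e(1) by (auto simp: s1_def s2_def)
  have "s1 = y w + 2 powi k * (s1 - w)" "s2 = y w + 2 powi k * (s2 - w)"
    using e(2)[of s1] e(2)[of s2] assms(5)[of s1] assms(5)[of s2] s by auto
  then show ?thesis using affine_two_fixpoints s(2) by (metis less_irrefl)
qed

definition identity_on :: "(real \<Rightarrow> real) \<Rightarrow> real \<Rightarrow> real \<Rightarrow> bool" where
  "identity_on y a b \<longleftrightarrow> (\<forall>t. a \<le> t \<longrightarrow> t \<le> b \<longrightarrow> y t = t)"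

lemma identity_onD: "identity_on y a b \<Longrightarrow> a \<le> t \<Longrightarrow> t \<le> b \<Longrightarrow> y t = t"
  unfolding identity_on_def by blast

lemma identity_onI: "(\<And>t. a \<le> t \<Longrightarrow> t \<le> b \<Longrightarrow> y t = t) \<Longrightarrow> identity_on y a b"
  unfolding identity_on_def by blast

lemma identity_on_join: "identity_on y a b \<Longrightarrow> identity_on y b c \<Longrightarrow> identity_on y a c"
  unfolding identity_on_def by (meson linear)

lemma identity_on_subset: "identity_on y a b \<Longrightarrow> a \<le> c \<Longrightarrow> d \<le> b \<Longrightarrow> identity_on y c d"
  unfolding identity_on_def by (meson order_trans)

text \<open>
  A point that is not dyadic is no breakpoint, so \<open>y\<close> is affine around it, and being the
  identity on one side makes it the identity on the other.
\<close>

lemma identity_extends_right: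
  assumes y: "y \<in> thompson_maps" and w: "\<not> dyadic w" "0 \<le> a" "a < w" "w < b" "b \<le> 1"
    and id': "identity_on y a w"
  shows "\<exists>w'>w. w' \<le> b \<and> identity_on y w w'"
proof -
  note id = identity_onD[OF id']
  have "0 \<le> w" "w \<le> 1" using w by simp_all
  then obtain e k where e0: "e > 0" "affine_about y w k (w - e) (w + e)"
    using thompson_germ_nondyadic[OF y _ _ w(1)] by blast
  note e = e0(1) affine_aboutD[OF e0(2)]
  define s where "s = max a (w - e)"
  have s: "a \<le> s" "s < w" "w - e \<le> s" using w e(1) by (auto simp: s_def)
  have "s = y w + 2 powi k * (s - w)" "w = y w + 2 powi k * (w - w)"
    using e(2)[of s] id[of s] id[of w] s e(1) by auto
  then have "2 powi k = (1::real)" "y w = w" using affine_two_fixpoints s(2) by (metis less_irrefl)+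
  then have "y t = t" if "w \<le> t" "t \<le> w + e" for t using e(2)[of t] that e(1) by simp
  then have "identity_on y w (min b (w + e))" by (intro identity_onI) simp
  then show ?thesis using w e(1) by (intro exI[of _ "min b (w + e)"]) auto
qed

lemma identity_extends_left:
  assumes y: "y \<in> thompson_maps" and w: "\<not> dyadic w" "0 \<le> a" "a < w" "w < b" "b \<le> 1"
    and id': "identity_on y w b"
  shows "\<exists>w'<w. a \<le> w' \<and> identity_on y w' w"
proof -
  note id = identity_onD[OF id']
  have "0 \<le> w" "w \<le> 1" using w by simp_all
  then obtain e k where e0: "e > 0" "affine_about y w k (w - e) (w + e)"
    using thompson_germ_nondyadic[OF y _ _ w(1)] by blast
  note e = e0(1) affine_aboutD[OF e0(2)]
  define s where "s = min b (w + e)"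
  have s: "s \<le> b" "w < s" "s \<le> w + e" using w e(1) by (auto simp: s_def)
  have "s = y w + 2 powi k * (s - w)" "w = y w + 2 powi k * (w - w)"
    using e(2)[of s] id[of s] id[of w] s e(1) by auto
  then have "2 powi k = (1::real)" "y w = w" using affine_two_fixpoints s(2) by (metis less_irrefl)+
  then have "y t = t" if "w - e \<le> t" "t \<le> w" for t using e(2)[of t] that e(1) by simp
  then have "identity_on y (max a (w - e)) w" by (intro identity_onI) simp
  then show ?thesis using w e(1) by (intro exI[of _ "max a (w - e)"]) auto
qed

text \<open>
  A supremum argument: if the identity can always be continued a little beyond the point reached, then
  it reaches the right endpoint, because the fixed set is closed.
\<close>

lemma identity_propagates_right:
  assumes y: "y \<in> thompson_maps" and ab: "0 \<le> a" "a < b" "b \<le> 1"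
    and e: "0 < e" "a + e \<le> b" "identity_on y a (a + e)"
    and step: "\<And>w. a < w \<Longrightarrow> w < b \<Longrightarrow> identity_on y a w \<Longrightarrow> \<exists>w'>w. w' \<le> b \<and> identity_on y w w'"
  shows "identity_on y a b"
proof -
  define A where "A = {w. a + e \<le> w \<and> w \<le> b \<and> identity_on y a w}"
  define w where "w = Sup A"
  have A: "a + e \<in> A" "bdd_above A" unfolding A_def using e by (auto intro!: bdd_aboveI[of _ b])
  have "x \<le> b" if "x \<in> A" for x using that by (simp add: A_def)
  then have w: "a + e \<le> w" "w \<le> b"
    using cSup_upper[OF A] cSup_least[of A b] A(1) unfolding w_def by blast+
  have lt: "y t = t" if t: "a \<le> t" "t < w" for t
  proof -
    obtain w' where "w' \<in> A" "t < w'" using less_cSup_iff[of A t] A t unfolding w_def by blast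
    then show ?thesis using identity_onD[of y a w' t] t by (simp add: A_def)
  qed
  have "y w = w" by (rule fix_left_limit[OF y ab(1), of w], use w ab e in linarith, use w ab e in linarith, rule lt)
  then have le: "identity_on y a w"
    by (intro identity_onI) (metis lt order_le_less)
  have "w = b"
  proof (rule ccontr)
    assume "w \<noteq> b"
    then have "a < w" "w < b" using w e(1) by linarith+
    then obtain w' where w': "w' > w" "w' \<le> b" "identity_on y w w'" using step le by blast
    have "identity_on y a w'" using identity_on_join[OF le w'(3)] .
    then have "w' \<in> A" unfolding A_def using w w' by simp
    then show False using cSup_upper[OF _ A(2), of w'] w'(1) unfolding w_def by simp
  qed
  then show ?thesis using le by simp
qed

lemma identity_propagates_left:
  assumes y: "y \<in> thompson_maps" and ab: "0 \<le> a" "a < b" "b \<le> 1"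
    and e: "0 < e" "a \<le> b - e" "identity_on y (b - e) b"
    and step: "\<And>w. a < w \<Longrightarrow> w < b \<Longrightarrow> identity_on y w b \<Longrightarrow> \<exists>w'<w. a \<le> w' \<and> identity_on y w' w"
  shows "identity_on y a b"
proof -
  define A where "A = {w. w \<le> b - e \<and> a \<le> w \<and> identity_on y w b}"
  define w where "w = Inf A"
  have A: "b - e \<in> A" "bdd_below A" unfolding A_def using e by (auto intro!: bdd_belowI[of _ a])
  have "a \<le> x" if "x \<in> A" for x using that by (simp add: A_def)
  then have w: "w \<le> b - e" "a \<le> w"
    using cInf_lower[OF A] cInf_greatest[of A a] A(1) unfolding w_def by blast+
  have lt: "y t = t" if t: "w < t" "t \<le> b" for t
  proof -
    obtain w' where "w' \<in> A" "w' < t" using cInf_less_iff[of A t] A t unfolding w_def by blast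
    then show ?thesis using identity_onD[of y w' b t] t by (simp add: A_def)
  qed
  have "y w = w" by (rule fix_right_limit[OF y _ _ ab(3), of w], use w ab e in linarith, use w ab e in linarith, rule lt)
  then have le: "identity_on y w b"
    by (intro identity_onI) (metis lt order_le_less)
  have "w = a"
  proof (rule ccontr)
    assume "w \<noteq> a"
    then have "a < w" "w < b" using w e(1) by linarith+
    then obtain w' where w': "w' < w" "a \<le> w'" "identity_on y w' w" using step le by blast
    have "identity_on y w' b" using identity_on_join[OF w'(3) le] .
    then have "w' \<in> A" unfolding A_def using w w' by simp
    then show False using cInf_lower[OF _ A(2), of w'] w'(1) unfolding w_def by simp
  qed
  then show ?thesis using le by simp
qed

section \<open>Slopes at a fixed point\<close>

definition right_slope :: "(real \<Rightarrow> real) \<Rightarrow> real \<Rightarrow> int \<Rightarrow> bool" where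
  "right_slope y u k \<longleftrightarrow> (\<exists>e>0. affine_about y u k u (u + e))"

lemma right_slope_exists: "y \<in> thompson_maps \<Longrightarrow> 0 \<le> u \<Longrightarrow> u < 1 \<Longrightarrow> \<exists>k. right_slope y u k"
  using thompson_germ_right[of y u] unfolding right_slope_def by blast

lemma right_slope_unique:
  assumes "right_slope y u k" "right_slope y u l" shows "k = l"
proof -
  obtain e d where e0: "e > 0" "affine_about y u k u (u + e)" and d0: "d > 0" "affine_about y u l u (u + d)"
    using assms unfolding right_slope_def by blast
  note e = e0(1) affine_aboutD[OF e0(2)] and d = d0(1) affine_aboutD[OF d0(2)]
  define s where "s = u + min e d"
  have "2 powi k * (s - u) = 2 powi l * (s - u)" "s - u \<noteq> 0"
    using e(1) d(1) e(2)[of s] d(2)[of s] by (auto simp: s_def)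
  then have "2 powi k = (2 powi l :: real)" by simp
  then show ?thesis
    using power_int_strict_increasing[of k l "2::real"] power_int_strict_increasing[of l k "2::real"]
    by (cases k l rule: linorder_cases) simp_all
qed

lemma right_slope_comp:
  assumes "right_slope y u k" "right_slope z u l" "y u = u" "z u = u"
    "\<And>s. u \<le> s \<Longrightarrow> s \<le> u + e0 \<Longrightarrow> x s = y (z s)" "e0 > 0"
  shows "right_slope x u (k + l)"
proof -
  obtain e d where e0: "e > 0" "affine_about y u k u (u + e)" and d0: "d > 0" "affine_about z u l u (u + d)"
    using assms(1,2) unfolding right_slope_def by blast
  note e = e0(1) affine_aboutD[OF e0(2)] and d = d0(1) affine_aboutD[OF d0(2)]
  define r where "r = min (min d e0) (e / 2 powi l)"
  have "x s = x u + 2 powi (k + l) * (s - u)" if s: "u \<le> s" "s \<le> u + r" for s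
  proof -
    have "s \<le> u + d" "s \<le> u + e0" "s - u \<le> e / 2 powi l" using s by (auto simp: r_def)
    then have z: "z s = u + 2 powi l * (s - u)" "2 powi l * (s - u) \<le> e"
      using d(2)[OF s(1)] assms(4) by (simp_all add: field_simps)
    then have "y (z s) = u + 2 powi k * (2 powi l * (s - u))"
      using e(2)[of "z s"] assms(3) s(1) by simp
    moreover have "x s = y (z s)" "x u = u"
      using assms(5)[OF s(1)] assms(5)[of u] assms(3,4,6) \<open>s \<le> u + e0\<close> by auto
    ultimately show ?thesis by (simp add: power_int_add)
  qed
  moreover have "r > 0" unfolding r_def using e d assms by simp
  ultimately show ?thesis unfolding right_slope_def affine_about_def by blast
qed

text \<open>
  The exponent of the slope on the right of \<open>u\<close>.
\<close>

definition slope_at :: "real \<Rightarrow> (real \<Rightarrow> real) \<Rightarrow> int" where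
  "slope_at u y = (THE k. right_slope y u k)"

lemma slope_at_eq: "right_slope y u k \<Longrightarrow> slope_at u y = k"
  unfolding slope_at_def using right_slope_unique by blast

lemma right_slope_slope_at: "y \<in> thompson_maps \<Longrightarrow> 0 \<le> u \<Longrightarrow> u < 1 \<Longrightarrow> right_slope y u (slope_at u y)"
  using right_slope_exists slope_at_eq by metis

lemma slope_at_mult:
  assumes "y \<in> thompson_maps" "z \<in> thompson_maps" "0 \<le> u" "u < 1" "y u = u" "z u = u"
  shows "slope_at u (y \<otimes>\<^bsub>thompson_F\<^esub> z) = slope_at u y + slope_at u z"
proof (rule slope_at_eq, rule right_slope_comp[of y u _ z _ "1 - u"])
  show "right_slope y u (slope_at u y)" "right_slope z u (slope_at u z)"
    using assms right_slope_slope_at by auto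
qed (use assms in auto)

section \<open>Elements without dyadic fixed points\<close>

text \<open>
  A nontrivial subgroup of the integers is generated by its least positive element.
\<close>

lemma (in group) iso_integer_group_if_embeds:
  assumes l: "l \<in> hom G integer_group" "inj_on l (carrier G)" and x: "x \<in> carrier G" "x \<noteq> \<one>"
  shows "G \<cong> integer_group"
proof -
  interpret l: group_hom G integer_group l
    by (simp add: group_hom_def group_hom_axioms_def l(1) group_axioms)
  have l_one: "l \<one> = 0" using l.hom_one by simp
  have l_inv: "l (inv y) = - l y" if "y \<in> carrier G" for y using l.hom_inv[OF that] by simp
  have l_mult: "l (y \<otimes> z) = l y + l z" if "y \<in> carrier G" "z \<in> carrier G" for y z using l.hom_mult[OF that] by simp
  have l_pow: "l (y [^] (n::int)) = n * l y" if "y \<in> carrier G" for y n using l.hom_int_pow[OF that] by simp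
  \<comment> \<open>the positive values of \<open>l\<close>; the least one belongs to a generator\<close>
  define M where "M = (\<lambda>n::nat. n > 0 \<and> (\<exists>y\<in>carrier G. l y = int n))"
  have "l x \<noteq> 0" using x l(2) l_one unfolding inj_on_def by (metis one_closed)
  then have "l x > 0 \<or> l (inv x) > 0" using l_inv[OF x(1)] by linarith
  then obtain y where "y \<in> carrier G" "l y > 0" using x by blast
  then have "M (nat (l y))" unfolding M_def by auto
  then have "M (LEAST n. M n)" by (rule LeastI)
  define m where "m = (LEAST n. M n)"
  obtain g where g: "g \<in> carrier G" "l g = int m" "m > 0"
    using \<open>M (LEAST n. M n)\<close> unfolding M_def m_def by blast
  have powers: "y = g [^] (l y div int m)" if y: "y \<in> carrier G" for y
  proof -
    let ?q = "l y div int m" and ?r = "l y mod int m"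
    let ?z = "y \<otimes> inv (g [^] ?q)"
    have "l ?z = l y - ?q * int m" using y g l_mult l_inv l_pow by simp
    then have lz: "l ?z = ?r" by (simp add: minus_div_mult_eq_mod)
    have "?r = 0"
    proof (rule ccontr)
      assume "?r \<noteq> 0"
      then have r: "0 < ?r" "?r < int m" using g(3) pos_mod_sign[of "int m" "l y"] pos_mod_bound[of "int m" "l y"] by linarith+
      have "?z \<in> carrier G" using y g by simp
      then have "M (nat ?r)" unfolding M_def using r lz by auto
      then have "m \<le> nat ?r" unfolding m_def by (rule Least_le)
      then show False using r by simp
    qed
    then have "?q * int m = l y" using div_mult_mod_eq[of "l y" "int m"] by simp
    then have "l y = l (g [^] ?q)" using g l_pow by simp
    then show ?thesis using l(2) y g unfolding inj_on_def by simp
  qed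
  have "(\<lambda>n::int. g [^] n) \<in> iso integer_group G"
  proof (rule isoI)
    show "(\<lambda>n::int. g [^] n) \<in> hom integer_group G" by (rule hom_integer_group_pow[OF g(1)])
    show "bij_betw (\<lambda>n::int. g [^] n) (carrier integer_group) (carrier G)"
    proof (rule bij_betwI')
      fix i j :: int
      show "(g [^] i = g [^] j) = (i = j)"
      proof
        assume "g [^] i = g [^] j"
        then have "i * l g = j * l g" using l_pow[OF g(1), of i] l_pow[OF g(1), of j] by metis
        then show "i = j" using g(2,3) by simp
      qed (rule arg_cong)
    next
      fix y assume "y \<in> carrier G"
      define q where "q = l y div int m"
      have "y = g [^] q" unfolding q_def by (rule powers[OF \<open>y \<in> carrier G\<close>])
      moreover have "q \<in> carrier integer_group" by simp
      ultimately show "\<exists>n::int\<in>carrier integer_group. y = g [^] n" by blast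
    qed (use g in auto)
  qed
  then have "integer_group \<cong> G" unfolding is_iso_def by blast
  then show ?thesis by (rule group.iso_sym[OF group_integer_group])
qed

lemma funpow_above:
  assumes "y \<in> thompson_maps" "0 \<le> t" "t \<le> 1" "t < y t"
  shows "t < (y ^^ Suc n) t"
proof (induction n)
  case (Suc n)
  have "0 \<le> (y ^^ Suc n) t" "(y ^^ Suc n) t \<le> 1" using thompson_pow_apply[OF assms(1-3)] by blast+
  then have "y t < y ((y ^^ Suc n) t)" using thompson_less[OF assms(1,2) Suc] by blast
  then show ?case using assms(4) by simp
qed (use assms in simp)

lemma funpow_below:
  assumes "y \<in> thompson_maps" "0 \<le> t" "t \<le> 1" "y t < t"
  shows "(y ^^ Suc n) t < t"
proof (induction n)
  case (Suc n)
  have "0 \<le> (y ^^ Suc n) t" "(y ^^ Suc n) t \<le> 1" using thompson_pow_apply[OF assms(1-3)] by blast+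
  then have "y ((y ^^ Suc n) t) < y t" using thompson_less[OF assms(1) _ Suc assms(3)] by blast
  then show ?case using assms(4) by simp
qed (use assms in simp)

lemma funpow_fixes: "y t = t \<Longrightarrow> (y ^^ n) t = t"
  by (induction n) auto

lemma funpow_fixes_iff:
  assumes "y \<in> thompson_maps" "0 \<le> t" "t \<le> 1" "0 < n"
  shows "(y ^^ n) t = t \<longleftrightarrow> y t = t"
proof -
  obtain m where "n = Suc m" using assms(4) not0_implies_Suc by auto
  then show ?thesis
    using funpow_above[OF assms(1-3), of m] funpow_below[OF assms(1-3), of m] funpow_fixes[of y t n]
    by (cases t "y t" rule: linorder_cases) (simp_all del: funpow.simps)
qed

lemma thompson_inv_fixes_iff:
  assumes "y \<in> thompson_maps" "0 \<le> t" "t \<le> 1"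
  shows "(inv\<^bsub>thompson_F\<^esub> y) t = t \<longleftrightarrow> y t = t"
  using thompson_inv_apply(1)[OF assms] thompson_inv_apply(2)[OF assms] by auto

lemma int_pow_fixes_iff:
  assumes "y \<in> thompson_maps" "0 \<le> t" "t \<le> 1" "n \<noteq> 0"
  shows "(y [^]\<^bsub>thompson_F\<^esub> (n::int)) t = t \<longleftrightarrow> y t = t"
proof (cases "n < 0")
  case True
  let ?p = "y [^]\<^bsub>thompson_F\<^esub> nat (- n)"
  have "y [^]\<^bsub>thompson_F\<^esub> n = inv\<^bsub>thompson_F\<^esub> ?p" using True int_pow_def2[of thompson_F y n] by presburger
  moreover have "(inv\<^bsub>thompson_F\<^esub> ?p) t = t \<longleftrightarrow> ?p t = t"
    by (rule thompson_inv_fixes_iff[OF thompson_pow_closed[OF assms(1)] assms(2,3)])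
  moreover have "?p t = (y ^^ nat (- n)) t" by (rule conjunct1[OF thompson_pow_apply[OF assms(1-3)]])
  ultimately show ?thesis using funpow_fixes_iff[OF assms(1-3), of "nat (- n)"] True by simp
next
  case False
  have "y [^]\<^bsub>thompson_F\<^esub> n = y [^]\<^bsub>thompson_F\<^esub> nat n" using False int_pow_def2[of thompson_F y n] by presburger
  moreover have "(y [^]\<^bsub>thompson_F\<^esub> nat n) t = (y ^^ nat n) t" by (rule conjunct1[OF thompson_pow_apply[OF assms(1-3)]])
  ultimately show ?thesis using funpow_fixes_iff[OF assms(1-3), of "nat n"] False assms by simp
qed

text \<open>
  No dyadic point strictly inside is fixed; other fixed points are permitted, and they do not
  let the centralizer split, because no element can break there.
\<close>

definition atomic :: "(real \<Rightarrow> real) \<Rightarrow> real \<Rightarrow> real \<Rightarrow> bool" where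
  "atomic h u v \<longleftrightarrow> h \<in> thompson_maps \<and> dyadic_interval u v \<and> h u = u \<and> h v = v \<and>
     (\<forall>t. dyadic t \<longrightarrow> u < t \<longrightarrow> t < v \<longrightarrow> h t \<noteq> t)"

definition commutes_on :: "(real \<Rightarrow> real) \<Rightarrow> (real \<Rightarrow> real) \<Rightarrow> real \<Rightarrow> real \<Rightarrow> bool" where
  "commutes_on x y u v \<longleftrightarrow> (\<forall>t. u \<le> t \<longrightarrow> t \<le> v \<longrightarrow> x (y t) = y (x t))"

text \<open>
  The centralizer of \<open>h\<close> over the piece \<open>[u, v]\<close>, realized by elements supported in the piece.
\<close>

definition F_comm :: "(real \<Rightarrow> real) \<Rightarrow> real \<Rightarrow> real \<Rightarrow> (real \<Rightarrow> real) set" where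
  "F_comm h u v = {y \<in> F_on u v. commutes_on y h u v}"

lemma commutes_onD: "commutes_on x y u v \<Longrightarrow> u \<le> t \<Longrightarrow> t \<le> v \<Longrightarrow> x (y t) = y (x t)"
  unfolding commutes_on_def by blast

lemma commutes_onI: "(\<And>t. u \<le> t \<Longrightarrow> t \<le> v \<Longrightarrow> x (y t) = y (x t)) \<Longrightarrow> commutes_on x y u v"
  unfolding commutes_on_def by blast

lemma atomic_facts:
  assumes "atomic h u v"
  shows "h \<in> thompson_maps" "dyadic_interval u v" "h u = u" "h v = v" "0 \<le> u" "u < v" "v \<le> 1" "u < 1" "0 < v"
    "\<And>t. dyadic t \<Longrightarrow> u < t \<Longrightarrow> t < v \<Longrightarrow> h t \<noteq> t"
  using assms unfolding atomic_def dyadic_interval_def by auto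

lemma dyadic_interval_facts:
  assumes "dyadic_interval u v"
  shows "dyadic u" "dyadic v" "0 \<le> u" "u < v" "v \<le> 1" "u < 1" "0 < v" "u \<le> 1" "0 \<le> v" "u \<le> v"
  using assms unfolding dyadic_interval_def by auto

lemma F_comm_F_on: "y \<in> F_comm h u v \<Longrightarrow> y \<in> F_on u v"
  and F_comm_thompson: "y \<in> F_comm h u v \<Longrightarrow> y \<in> thompson_maps"
  and F_comm_commutes: "y \<in> F_comm h u v \<Longrightarrow> commutes_on y h u v"
  by (auto simp: F_comm_def F_on_def)

lemma subgroup_F_comm:
  assumes uv: "dyadic_interval u v" and h: "h \<in> thompson_maps" "h u = u" "h v = v"
  shows "subgroup (F_comm h u v) thompson_F"
proof (rule F.subgroupI)
  note uv' = dyadic_interval_facts[OF uv]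
  note F_sub = subgroup_F_on[OF uv]
  have hr: "u \<le> h t" "h t \<le> v" if "u \<le> t" "t \<le> v" for t
    using thompson_preserves_interval[OF h uv'(3,5) that] by auto
  show "F_comm h u v \<subseteq> carrier thompson_F" using F_comm_thompson by auto
  have "commutes_on \<one>\<^bsub>thompson_F\<^esub> h u v"
  proof (rule commutes_onI)
    fix t assume t: "u \<le> t" "t \<le> v"
    then have "0 \<le> t" "t \<le> 1" "0 \<le> h t" "h t \<le> 1" using hr[OF t] uv' by auto
    then show "\<one>\<^bsub>thompson_F\<^esub> (h t) = h (\<one>\<^bsub>thompson_F\<^esub> t)" by simp
  qed
  then show "F_comm h u v \<noteq> {}" unfolding F_comm_def using subgroup.one_closed[OF F_sub] by blast
  fix y assume y: "y \<in> F_comm h u v"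
  note yF = F_comm_F_on[OF y] and yT = F_comm_thompson[OF y]
  have "commutes_on (inv\<^bsub>thompson_F\<^esub> y) h u v"
  proof (rule commutes_onI)
    fix t assume t: "u \<le> t" "t \<le> v"
    let ?s = "(inv\<^bsub>thompson_F\<^esub> y) t"
    have iF: "inv\<^bsub>thompson_F\<^esub> y \<in> F_on u v" by (rule subgroup.m_inv_closed[OF F_sub yF])
    have s: "u \<le> ?s" "?s \<le> v" using F_on_range[OF iF uv t] by auto
    have s1: "0 \<le> h ?s" "h ?s \<le> 1" "0 \<le> t" "t \<le> 1" using hr[OF s] t uv' by auto
    have "y (h ?s) = h (y ?s)" by (rule commutes_onD[OF F_comm_commutes[OF y] s])
    then have "y (h ?s) = h t" using yT s1 by simp
    then show "(inv\<^bsub>thompson_F\<^esub> y) (h t) = h ?s" using yT s1 by (metis thompson_inv_apply(2))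
  qed
  then show "inv\<^bsub>thompson_F\<^esub> y \<in> F_comm h u v"
    unfolding F_comm_def using subgroup.m_inv_closed[OF F_sub yF] by blast
  fix x assume x: "x \<in> F_comm h u v"
  note xF = F_comm_F_on[OF x] and xT = F_comm_thompson[OF x]
  have "commutes_on (x \<otimes>\<^bsub>thompson_F\<^esub> y) h u v"
  proof (rule commutes_onI)
    fix t assume t: "u \<le> t" "t \<le> v"
    have yt: "u \<le> y t" "y t \<le> v" using F_on_range[OF yF uv t] by auto
    have s1: "0 \<le> h t" "h t \<le> 1" "0 \<le> t" "t \<le> 1" using hr[OF t] t uv' by auto
    have "x (y (h t)) = h (x (y t))"
      using commutes_onD[OF F_comm_commutes[OF y] t] commutes_onD[OF F_comm_commutes[OF x] yt] by simp
    then show "(x \<otimes>\<^bsub>thompson_F\<^esub> y) (h t) = h ((x \<otimes>\<^bsub>thompson_F\<^esub> y) t)" using xT yT s1 by simp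
  qed
  then show "x \<otimes>\<^bsub>thompson_F\<^esub> y \<in> F_comm h u v"
    unfolding F_comm_def using subgroup.m_closed[OF F_sub xF yF] by blast
qed

text \<open>
  Let \<open>y\<close> be the identity on \<open>[u, w]\<close>. If \<open>h\<close> moves \<open>w\<close> to the right, conjugation by \<open>h\<close> carries
  the identity over to \<open>[u, h w]\<close>; if \<open>h\<close> moves \<open>w\<close> to the left, its inverse does the same. If \<open>h\<close>
  fixes \<open>w\<close>, then \<open>w\<close> is not dyadic, and \<open>y\<close> is affine around \<open>w\<close>.
\<close>

lemma atomic_germ_determines:
  assumes h: "atomic h u v" and y: "y \<in> thompson_maps" "commutes_on y h u v"
    and e: "0 < e" "u + e \<le> v" "identity_on y u (u + e)"
  shows "identity_on y u v"
proof (rule identity_propagates_right[OF y(1) _ _ _ e])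
  note h' = atomic_facts[OF h]
  show "0 \<le> u" "u < v" "v \<le> 1" using h' by auto
  fix w assume w: "u < w" "w < v" and idw: "identity_on y u w"
  have w1: "0 \<le> w" "w \<le> 1" using w h' by auto
  let ?i = "inv\<^bsub>thompson_F\<^esub> h"
  have iT: "?i \<in> thompson_maps" and iu: "?i u = u" "?i v = v"
    using h' thompson_inv_fixes[OF h'(1)] by auto
  have hr: "u \<le> h t" "h t \<le> v" if "u \<le> t" "t \<le> v" for t
    using thompson_preserves_interval[OF h'(1,3,4,5,7) that] by auto
  have ir: "u \<le> ?i t" "?i t \<le> v" if "u \<le> t" "t \<le> v" for t
    using thompson_preserves_interval[OF iT iu h'(5,7) that] by auto
  \<comment> \<open>push the identity past \<open>w\<close> by \<open>h\<close>, by its inverse, or by affineness at \<open>w\<close>\<close>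
  consider "w < h w" | "h w < w" | "h w = w" by linarith
  then show "\<exists>w'>w. w' \<le> v \<and> identity_on y w w'"
  proof cases
    case 1
    have "identity_on y w (h w)"
    proof (rule identity_onI)
      fix t assume t: "w \<le> t" "t \<le> h w"
      have t1: "u \<le> t" "t \<le> v" "0 \<le> t" "t \<le> 1" using t w hr[of w] h' by auto
      let ?s = "?i t"
      have s: "u \<le> ?s" "?s \<le> v" using ir t1 by auto
      have hs: "h ?s = t" using h'(1) t1 by simp
      have "?s \<le> w" using thompson_le[OF iT, of t "h w"] t t1 hr[of w] w w1 h' by auto
      then have "y ?s = ?s" using identity_onD[OF idw s(1)] by simp
      then show "y t = t" using commutes_onD[OF y(2) s] hs by simp
    qed
    then show ?thesis using 1 hr[of w] w by auto
  next
    case 2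
    have w': "w < ?i w" using thompson_less[OF iT, of "h w" w] 2 hr[of w] w w1 h' by auto
    have "identity_on y w (?i w)"
    proof (rule identity_onI)
      fix t assume t: "w \<le> t" "t \<le> ?i w"
      have t1: "u \<le> t" "t \<le> v" "0 \<le> t" "t \<le> 1" using t w ir[of w] h' by auto
      have "h t \<le> w" using thompson_le[OF h'(1), of t "?i w"] t t1 ir[of w] w w1 h' by auto
      then have "y (h t) = h t" using identity_onD[OF idw, of "h t"] hr[OF t1(1,2)] by simp
      then have "h (y t) = h t" using commutes_onD[OF y(2) t1(1,2)] by simp
      then show "y t = t" using thompson_inj[OF h'(1)] thompson_range[OF y(1)] t1 by blast
    qed
    then show ?thesis using w' ir[of w] w by auto
  next
    case 3
    then have "\<not> dyadic w" using h'(10) w by blast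
    then show ?thesis using identity_extends_right[OF y(1) _ h'(5) w h'(7) idw] by blast
  qed
qed

lemma F_on_identity:
  assumes "y \<in> F_on u v" "dyadic_interval u v" "identity_on y u v"
  shows "y = \<one>\<^bsub>thompson_F\<^esub>"
proof (rule F_on_eqI[OF assms(1)])
  show "\<one>\<^bsub>thompson_F\<^esub> \<in> F_on u v" by (rule subgroup.one_closed[OF subgroup_F_on[OF assms(2)]])
  fix t assume t: "u \<le> t" "t \<le> v"
  then have "0 \<le> t" "t \<le> 1" using dyadic_interval_facts[OF assms(2)] by auto
  then show "y t = \<one>\<^bsub>thompson_F\<^esub> t" using identity_onD[OF assms(3) t] by simp
qed

lemma slope_zero_identity:
  assumes "right_slope y u 0" "y u = u"
  obtains e where "e > 0" "identity_on y u (u + e)"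
proof -
  obtain e where e: "e > 0" "affine_about y u 0 u (u + e)" using assms unfolding right_slope_def by blast
  have "identity_on y u (u + e)"
  proof (rule identity_onI)
    fix t assume "u \<le> t" "t \<le> u + e"
    then show "y t = t" using affine_aboutD[OF e(2)] assms(2) by simp
  qed
  with e(1) show thesis by (rule that)
qed

lemma atomic_slope_zero:
  assumes h: "atomic h u v" and y: "y \<in> F_comm h u v" "slope_at u y = 0"
  shows "y = \<one>\<^bsub>thompson_F\<^esub>"
proof -
  note h' = atomic_facts[OF h]
  have "right_slope y u 0" using right_slope_slope_at[OF F_comm_thompson[OF y(1)] h'(5,8)] y(2) by simp
  then obtain e where e: "e > 0" "identity_on y u (u + e)"
    using slope_zero_identity F_on_fixes(1)[OF F_comm_F_on[OF y(1)]] by blast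
  define d where "d = min e (v - u)"
  have "0 < d" "u + d \<le> v" "identity_on y u (u + d)"
    using e h'(6) identity_on_subset[OF e(2), of u "u + d"] by (auto simp: d_def)
  then have "identity_on y u v"
    using atomic_germ_determines[OF h F_comm_thompson[OF y(1)] F_comm_commutes[OF y(1)]] by blast
  then show ?thesis using F_on_identity[OF F_comm_F_on[OF y(1)] h'(2)] by blast
qed

text \<open>
  This makes the group of elements commuting with an atomic element nontrivial.
\<close>

lemma atomic_self:
  assumes h: "atomic h u v"
  shows "support_extend u v h \<in> F_comm h u v" "support_extend u v h \<noteq> \<one>\<^bsub>thompson_F\<^esub>"
proof -
  note h' = atomic_facts[OF h]
  have "commutes_on (support_extend u v h) h u v"
  proof (rule commutes_onI)
    fix t assume t: "u \<le> t" "t \<le> v"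
    have "u \<le> h t" "h t \<le> v" using thompson_preserves_interval[OF h'(1,3,4,5,7) t] by auto
    then show "support_extend u v h (h t) = h (support_extend u v h t)" using t h' by simp
  qed
  then show "support_extend u v h \<in> F_comm h u v"
    unfolding F_comm_def using support_extend_self[OF h'(1,3,4,2)] by blast
  obtain d where d: "dyadic d" "u < d" "d < v" using dyadic_dense[OF h'(6)] by blast
  then have "support_extend u v h d \<noteq> d" using h'(10)[OF d] h' by simp
  moreover have "\<one>\<^bsub>thompson_F\<^esub> d = d" using d h' by simp
  ultimately show "support_extend u v h \<noteq> \<one>\<^bsub>thompson_F\<^esub>" by metis
qed

definition F_comm_group :: "(real \<Rightarrow> real) \<Rightarrow> real \<Rightarrow> real \<Rightarrow> (real \<Rightarrow> real) monoid" where
  "F_comm_group h u v = thompson_F\<lparr>carrier := F_comm h u v\<rparr>"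

lemma F_comm_group:
  assumes h: "atomic h u v"
  shows "group (F_comm_group h u v)" "slope_at u \<in> hom (F_comm_group h u v) integer_group"
    "inj_on (slope_at u) (F_comm h u v)"
proof -
  note h' = atomic_facts[OF h]
  note sub = subgroup_F_comm[OF h'(2,1,3,4)]
  show grp: "group (F_comm_group h u v)"
    unfolding F_comm_group_def by (rule subgroup.subgroup_is_group[OF sub]) (rule F.group_axioms)
  have mult: "slope_at u (y \<otimes>\<^bsub>thompson_F\<^esub> z) = slope_at u y + slope_at u z"
    if "y \<in> F_comm h u v" "z \<in> F_comm h u v" for y z
    using slope_at_mult[OF F_comm_thompson[OF that(1)] F_comm_thompson[OF that(2)] h'(5,8)]
      F_on_fixes(1)[OF F_comm_F_on] that by blast
  then show hom: "slope_at u \<in> hom (F_comm_group h u v) integer_group"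
    unfolding F_comm_group_def by (intro homI) auto
  interpret s: group_hom "F_comm_group h u v" integer_group "slope_at u"
    by (simp add: group_hom_def group_hom_axioms_def hom grp)
  show "inj_on (slope_at u) (F_comm h u v)"
  proof -
    have "y = \<one>\<^bsub>F_comm_group h u v\<^esub>" if "y \<in> carrier (F_comm_group h u v)" "slope_at u y = 0" for y
      using that atomic_slope_zero[OF h] unfolding F_comm_group_def by simp
    then have "inj_on (slope_at u) (carrier (F_comm_group h u v))"
      by (subst s.inj_on_one_iff) auto
    then show ?thesis unfolding F_comm_group_def by simp
  qed
qed

text \<open>
  The slope at the left endpoint is an embedding into the integers, by
  \<open>atomic_germ_determines\<close>, and the group is nontrivial.
\<close>

theorem F_comm_iso_integer_group:
  assumes h: "atomic h u v" shows "F_comm_group h u v \<cong> integer_group"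
  by (rule group.iso_integer_group_if_embeds[OF F_comm_group(1,2)[OF h], of "support_extend u v h"])
     (use F_comm_group(3)[OF h] atomic_self[OF h] in \<open>auto simp: F_comm_group_def\<close>)

lemma F_comm_abelian:
  assumes h: "atomic h u v" and yz: "y \<in> F_comm h u v" "z \<in> F_comm h u v"
  shows "y \<otimes>\<^bsub>thompson_F\<^esub> z = z \<otimes>\<^bsub>thompson_F\<^esub> y"
proof -
  note h' = atomic_facts[OF h]
  note sub = subgroup_F_comm[OF h'(2,1,3,4)]
  have "slope_at u (y \<otimes>\<^bsub>thompson_F\<^esub> z) = slope_at u (z \<otimes>\<^bsub>thompson_F\<^esub> y)"
    using slope_at_mult[OF F_comm_thompson F_comm_thompson h'(5,8)]
      F_on_fixes(1)[OF F_comm_F_on] yz by (metis add.commute)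
  then show ?thesis using F_comm_group(3)[OF h] subgroup.m_closed[OF sub] yz unfolding inj_on_def by blast
qed

lemma F_comm_commutes_on:
  assumes h: "atomic h u v" and yz: "y \<in> F_comm h u v" "z \<in> F_comm h u v"
  shows "commutes_on y z u v"
proof (rule commutes_onI)
  fix t assume "u \<le> t" "t \<le> v"
  then have "0 \<le> t" "t \<le> 1" using atomic_facts[OF h] by auto
  then show "y (z t) = z (y t)"
    using F_comm_abelian[OF assms] F_comm_thompson[OF yz(1)] F_comm_thompson[OF yz(2)] by (metis mult_thompson_apply)
qed

text \<open>
  In an infinite cyclic group a nontrivial element and \<open>h\<close> itself have a common nontrivial power,
  and a monotone map fixes exactly the points fixed by any of its nontrivial powers.
\<close>

theorem F_comm_nontrivial_atomic:
  assumes h: "atomic h u v" and y: "y \<in> F_comm h u v" "y \<noteq> \<one>\<^bsub>thompson_F\<^esub>"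
  shows "atomic y u v"
proof -
  note h' = atomic_facts[OF h]
  note sub = subgroup_F_comm[OF h'(2,1,3,4)]
  define x where "x = support_extend u v h"
  have x: "x \<in> F_comm h u v" "x \<noteq> \<one>\<^bsub>thompson_F\<^esub>" unfolding x_def using atomic_self[OF h] by auto
  define i where "i = slope_at u x"
  define j where "j = slope_at u y"
  have ij: "i \<noteq> 0" "j \<noteq> 0" unfolding i_def j_def using atomic_slope_zero[OF h] x y by blast+
  let ?G = "F_comm_group h u v"
  have pow: "slope_at u (z [^]\<^bsub>thompson_F\<^esub> n) = n * slope_at u z" "z [^]\<^bsub>thompson_F\<^esub> n \<in> F_comm h u v"
    if z: "z \<in> F_comm h u v" for z and n :: int
  proof -
    have eq: "z [^]\<^bsub>thompson_F\<^esub> n = z [^]\<^bsub>?G\<^esub> n"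
      unfolding F_comm_group_def by (rule F.int_pow_consistent[OF sub z])
    have z': "z \<in> carrier ?G" using z by (simp add: F_comm_group_def)
    show "slope_at u (z [^]\<^bsub>thompson_F\<^esub> n) = n * slope_at u z"
      using hom_int_pow[OF F_comm_group(2)[OF h] z' F_comm_group(1)[OF h] group_integer_group, of n] eq by simp
    show "z [^]\<^bsub>thompson_F\<^esub> n \<in> F_comm h u v"
      using group.int_pow_closed[OF F_comm_group(1)[OF h] z', of n] eq by (simp add: F_comm_group_def)
  qed
  \<comment> \<open>the powers with exponents exchanged have the same slope \<open>i * j\<close>\<close>
  have "slope_at u (y [^]\<^bsub>thompson_F\<^esub> i) = slope_at u (x [^]\<^bsub>thompson_F\<^esub> j)"
    using pow(1)[OF y(1), of i] pow(1)[OF x(1), of j] by (simp add: i_def j_def)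
  then have eq: "y [^]\<^bsub>thompson_F\<^esub> i = x [^]\<^bsub>thompson_F\<^esub> j"
    using F_comm_group(3)[OF h] pow(2)[OF y(1), of i] pow(2)[OF x(1), of j] unfolding inj_on_def by blast
  have "y t \<noteq> t" if t: "dyadic t" "u < t" "t < v" for t
  proof
    assume "y t = t"
    have t1: "0 \<le> t" "t \<le> 1" using t h' by auto
    have "x t = t"
      using \<open>y t = t\<close> int_pow_fixes_iff[OF F_comm_thompson[OF y(1)] t1 ij(1)]
        int_pow_fixes_iff[OF F_comm_thompson[OF x(1)] t1 ij(2)] eq by simp
    then show False using h'(10)[OF t] t t1 unfolding x_def by simp
  qed
  then show ?thesis
    unfolding atomic_def using h'(2) F_comm_thompson[OF y(1)] F_on_fixes[OF F_comm_F_on[OF y(1)]] by blast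
qed

text \<open>
  The common element \<open>z\<close> is again atomic, so everything commuting with \<open>z\<close> commutes with each other;
  in particular whatever commutes with \<open>h\<close> commutes with \<open>k\<close>.
\<close>

theorem F_comm_eq_if_meet:
  assumes h: "atomic h u v" and k: "atomic k u v"
    and z: "z \<in> F_comm h u v" "z \<in> F_comm k u v" "z \<noteq> \<one>\<^bsub>thompson_F\<^esub>"
  shows "F_comm h u v = F_comm k u v"
proof -
  have "F_comm h u v \<subseteq> F_comm k u v"
    if h: "atomic h u v" and k: "atomic k u v" and z: "z \<in> F_comm h u v" "z \<in> F_comm k u v" for h k
  proof
    fix y assume y: "y \<in> F_comm h u v"
    note k' = atomic_facts[OF k]
    have za: "atomic z u v" by (rule F_comm_nontrivial_atomic[OF k z(2) \<open>z \<noteq> \<one>\<^bsub>thompson_F\<^esub>\<close>])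
    have yz: "y \<in> F_comm z u v"
      using F_comm_commutes_on[OF h y z(1)] F_comm_F_on[OF y] unfolding F_comm_def by blast
    define x where "x = support_extend u v k"
    have x: "x \<in> F_comm k u v" unfolding x_def using atomic_self[OF k] by blast
    then have "x \<in> F_comm z u v"
      using F_comm_commutes_on[OF k x z(2)] F_comm_F_on[OF x] unfolding F_comm_def by blast
    then have c: "commutes_on y x u v" using F_comm_commutes_on[OF za yz] by blast
    have "commutes_on y k u v"
    proof (rule commutes_onI)
      fix t assume t: "u \<le> t" "t \<le> v"
      have "u \<le> y t" "y t \<le> v" using F_on_range[OF F_comm_F_on[OF y] k'(2) t] by auto
      then show "y (k t) = k (y t)" using commutes_onD[OF c t] t k' unfolding x_def by simp
    qed
    then show "y \<in> F_comm k u v" unfolding F_comm_def using F_comm_F_on[OF y] by blast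
  qed
  from this[OF h k z(1,2)] this[OF k h z(2,1)] show ?thesis by blast
qed

section \<open>The centralizer fixes the boundary fixed points\<close>

lemma subgroup_centralizer:
  assumes x: "x \<in> thompson_maps"
  shows "subgroup (centralizer thompson_F {x}) thompson_F"
  unfolding centralizer_singleton
proof (rule F.subgroupI)
  show "{y \<in> thompson_maps. commutes y x} \<subseteq> carrier thompson_F" by auto
  have "commutes \<one>\<^bsub>thompson_F\<^esub> x" unfolding commutes_def using x by simp
  then show "{y \<in> thompson_maps. commutes y x} \<noteq> {}" using thompson_one_closed by blast
  fix y assume "y \<in> {y \<in> thompson_maps. commutes y x}"
  then have y: "y \<in> thompson_maps" "commutes y x" by auto
  let ?i = "inv\<^bsub>thompson_F\<^esub> y"
  have i: "?i \<in> thompson_maps" using y by simp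
  have "?i (x t) = x (?i t)" if t: "0 \<le> t" "t \<le> 1" for t
  proof -
    have s: "0 \<le> ?i t" "?i t \<le> 1" using thompson_range[OF i t] by auto
    have xs: "0 \<le> x (?i t)" "x (?i t) \<le> 1" using thompson_range[OF x s] by auto
    have "y (x (?i t)) = x t" using commutes_apply[OF y(2,1) x s] thompson_inv_apply(1)[OF y(1) t] by simp
    then show ?thesis using thompson_inv_apply(2)[OF y(1) xs] by simp
  qed
  then have "commutes ?i x" using commutes_iff[OF i x] by blast
  then show "?i \<in> {y \<in> thompson_maps. commutes y x}" using i by blast
  fix z assume "z \<in> {y \<in> thompson_maps. commutes y x}"
  then have z: "z \<in> thompson_maps" "commutes z x" by auto
  have yz: "y \<otimes>\<^bsub>thompson_F\<^esub> z \<in> thompson_maps" "z \<otimes>\<^bsub>thompson_F\<^esub> y \<in> thompson_maps" using y z by auto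
  have "y (z (x t)) = x (y (z t)) \<and> z (y (x t)) = x (z (y t))" if t: "0 \<le> t" "t \<le> 1" for t
    using commutes_apply[OF y(2,1) x t] commutes_apply[OF z(2,1) x t]
      commutes_apply[OF y(2,1) x, of "z t"] commutes_apply[OF z(2,1) x, of "y t"]
      thompson_range[OF y(1) t] thompson_range[OF z(1) t] by simp
  then have "commutes (z \<otimes>\<^bsub>thompson_F\<^esub> y) x" "commutes (y \<otimes>\<^bsub>thompson_F\<^esub> z) x"
    using commutes_iff[OF yz(1) x] commutes_iff[OF yz(2) x] y z thompson_range[OF x] by simp_all
  then show "z \<otimes>\<^bsub>thompson_F\<^esub> y \<in> {y \<in> thompson_maps. commutes y x}" using yz by blast
qed

text \<open>
  If some points were moved up, the largest of them would be sent to a larger point that is also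
  moved up.
\<close>

lemma finite_monotone_fixes:
  fixes y :: "real \<Rightarrow> real"
  assumes S: "finite S" "\<And>q. q \<in> S \<Longrightarrow> y q \<in> S" and mono: "\<And>p q. p \<in> S \<Longrightarrow> q \<in> S \<Longrightarrow> p < q \<Longrightarrow> y p < y q"
    and p: "p \<in> S"
  shows "y p = p"
proof (rule ccontr)
  assume "y p \<noteq> p"
  then consider "p < y p" | "y p < p" by linarith
  then show False
  proof cases
    case 1
    define Q where "Q = {q \<in> S. q < y q}"
    have Q: "finite Q" "Q \<noteq> {}" unfolding Q_def using S(1) p 1 by auto
    have "Max Q \<in> Q" using Q by (rule Max_in)
    then have "y (Max Q) \<in> Q" unfolding Q_def using S(2) mono by blast
    then have "y (Max Q) \<le> Max Q" using Q(1) by simp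
    then show False using \<open>Max Q \<in> Q\<close> unfolding Q_def by auto
  next
    case 2
    define Q where "Q = {q \<in> S. y q < q}"
    have Q: "finite Q" "Q \<noteq> {}" unfolding Q_def using S(1) p 2 by auto
    have "Min Q \<in> Q" using Q by (rule Min_in)
    then have "y (Min Q) \<in> Q" unfolding Q_def using S(2) mono by blast
    then have "Min Q \<le> y (Min Q)" using Q(1) by simp
    then show False using \<open>Min Q \<in> Q\<close> unfolding Q_def by auto
  qed
qed

abbreviation bd :: "(real \<Rightarrow> real) \<Rightarrow> real set" where "bd x \<equiv> boundary_fixpoints x 0 1"

lemma bd_fix: "t \<in> bd x \<Longrightarrow> 0 \<le> t \<and> t \<le> 1 \<and> x t = t"
  unfolding boundary_fixpoints_def by auto

lemma bd_witness:
  assumes "t \<in> bd x" "0 < e" obtains s where "0 \<le> s" "s \<le> 1" "\<bar>s - t\<bar> < e" "x s \<noteq> s"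
proof -
  have "\<exists>s\<in>{0..1}. \<bar>s - t\<bar> < e \<and> x s \<noteq> s"
    using assms unfolding boundary_fixpoints_def by simp
  then show thesis using that by auto
qed

text \<open>
  The maxima and minima cut the neighbourhood off at the ends of the unit interval, so that the
  statement also covers the points 0 and 1.
\<close>

lemma not_bd_identity:
  assumes "t \<notin> bd x" "0 \<le> t" "t \<le> 1" "x t = t"
  shows "\<exists>e>0. identity_on x (max 0 (t - e)) (min 1 (t + e))"
proof -
  have "\<exists>e>0. \<forall>s\<in>{0..1}. \<bar>s - t\<bar> < e \<longrightarrow> x s = s"
    using assms unfolding boundary_fixpoints_def by auto
  then obtain e where e: "e > 0" "\<forall>s\<in>{0..1}. \<bar>s - t\<bar> < e \<longrightarrow> x s = s" by (elim exE conjE) (rule that)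
  have "identity_on x (max 0 (t - e / 2)) (min 1 (t + e / 2))"
  proof (rule identity_onI)
    fix s assume "max 0 (t - e / 2) \<le> s" "s \<le> min 1 (t + e / 2)"
    then have "s \<in> {0..1}" "\<bar>s - t\<bar> < e" using e(1) by (auto simp: abs_less_iff)
    then show "x s = s" using bspec[OF e(2), of s] by blast
  qed
  then show ?thesis using e(1) by (intro exI[of _ "e / 2"]) simp
qed

text \<open>
  An element commuting with \<open>x\<close> maps the fixed set of \<open>x\<close> and its boundary to themselves; the boundary
  is finite, and the element is increasing.
\<close>

lemma centralizer_fixes_boundary:
  assumes x: "x \<in> thompson_maps" and y: "y \<in> thompson_maps" "commutes y x" and p: "p \<in> bd x"
  shows "y p = p"
proof (rule finite_monotone_fixes[OF finite_boundary_fixpoints[OF thompson_pl2[OF x]] _ _ p])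
  fix q assume q: "q \<in> bd x"
  have q1: "0 \<le> q" "q \<le> 1" "x q = q" using bd_fix[OF q] by auto
  have "x (y q) = y q" using commutes_apply[OF y(2,1) x q1(1,2)] q1(3) by simp
  moreover have "\<exists>s\<in>{0..1}. \<bar>s - y q\<bar> < e \<and> x s \<noteq> s" if e: "e > 0" for e
  proof -
    obtain d where d: "d > 0" "\<forall>s\<in>{0..1}. dist s q < d \<longrightarrow> dist (y s) (y q) < e"
      using pl2_continuous[OF thompson_pl2[OF y(1)]] q1 e unfolding continuous_on_iff by force
    obtain s where s: "0 \<le> s" "s \<le> 1" "\<bar>s - q\<bar> < d" "x s \<noteq> s" by (rule bd_witness[OF q d(1)])
    have "x (y s) = y (x s)" using commutes_apply[OF y(2,1) x s(1,2)] by simp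
    then have "x (y s) \<noteq> y s" using thompson_inj[OF y(1)] thompson_range[OF x] s by metis
    then show ?thesis using thompson_range[OF y(1) s(1,2)] d(2) s by (intro bexI[of _ "y s"]) (auto simp: dist_real_def)
  qed
  ultimately show "y q \<in> bd x" using thompson_range[OF y(1) q1(1,2)] unfolding boundary_fixpoints_def by auto
next
  fix p q assume "p \<in> bd x" "q \<in> bd x" "p < q"
  then show "y p < y q" using thompson_less[OF y(1)] bd_fix by blast
qed

text \<open>
  Suppose \<open>x\<close> fixes a dyadic point inside. Then \<open>x\<close> is the identity near it, and the identity spreads
  in both directions: past a dyadic point because it is no boundary point of the fixed set, past any
  other point because \<open>x\<close> does not break there.
\<close>

lemma identity_or_atomic:
  assumes x: "x \<in> thompson_maps" and ab: "dyadic_interval a b" "x a = a" "x b = b"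
    and nobd: "\<And>t. t \<in> bd x \<Longrightarrow> dyadic t \<Longrightarrow> a < t \<Longrightarrow> t < b \<Longrightarrow> False"
  shows "identity_on x a b \<or> atomic x a b"
proof (cases "\<exists>t. dyadic t \<and> a < t \<and> t < b \<and> x t = t")
  case False
  then show ?thesis unfolding atomic_def using assms by blast
next
  case True
  then obtain t where t: "dyadic t" "a < t" "t < b" "x t = t" by blast
  note ab' = dyadic_interval_facts[OF ab(1)]
  have t1: "0 \<le> t" "t \<le> 1" using t ab' by auto
  have "t \<notin> bd x" using nobd t by blast
  then obtain e0 where e0: "0 < e0" "identity_on x (max 0 (t - e0)) (min 1 (t + e0))"
    using not_bd_identity[of t x, OF _ t1 t(4)] by blast
  define e where "e = min e0 (min (t - a) (b - t))"
  have e: "0 < e" "a \<le> t - e" "t + e \<le> b" "e \<le> e0" using e0(1) t by (auto simp: e_def)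
  have near: "identity_on x (t - e) (t + e)"
    by (rule identity_on_subset[OF e0(2)]) (use e ab' in auto)
  \<comment> \<open>the continuation step of the propagation: \<open>w\<close> is dyadic but no boundary point, or no breakpoint\<close>
  have "identity_on x t b"
  proof (rule identity_propagates_right[OF x])
    fix w assume w: "t < w" "w < b" and id: "identity_on x t w"
    have xw: "x w = w" using identity_onD[OF id] w by simp
    show "\<exists>w'>w. w' \<le> b \<and> identity_on x w w'"
    proof (cases "dyadic w")
      case True
      have "a < w" "w < b" using w t by linarith+
      then have "w \<notin> bd x" using nobd[of w] True by blast
      moreover have w1: "0 \<le> w" "w \<le> 1" using w t1 ab' by linarith+
      ultimately obtain d where d: "0 < d" "identity_on x (max 0 (w - d)) (min 1 (w + d))"
        using not_bd_identity[of w x, OF _ w1 xw] by blast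
      have "identity_on x w (min b (w + d / 2))"
        by (rule identity_on_subset[OF d(2)]) (use w w1 ab' d(1) in auto)
      then show ?thesis using d(1) w by (intro exI[of _ "min b (w + d / 2)"]) auto
    next
      case False
      show ?thesis by (rule identity_extends_right[OF x False t1(1) w ab'(5) id])
    qed
  qed (use t t1 ab' e identity_on_subset[OF near] in auto)
  moreover have "identity_on x a t"
  proof (rule identity_propagates_left[OF x])
    fix w assume w: "a < w" "w < t" and id: "identity_on x w t"
    have xw: "x w = w" using identity_onD[OF id] w by simp
    show "\<exists>w'<w. a \<le> w' \<and> identity_on x w' w"
    proof (cases "dyadic w")
      case True
      have "a < w" "w < b" using w t by linarith+
      then have "w \<notin> bd x" using nobd[of w] True by blast
      moreover have w1: "0 \<le> w" "w \<le> 1" using w t1 ab' by linarith+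
      ultimately obtain d where d: "0 < d" "identity_on x (max 0 (w - d)) (min 1 (w + d))"
        using not_bd_identity[of w x, OF _ w1 xw] by blast
      have "identity_on x (max a (w - d / 2)) w"
        by (rule identity_on_subset[OF d(2)]) (use w w1 ab' d(1) in auto)
      then show ?thesis using d(1) w by (intro exI[of _ "max a (w - d / 2)"]) auto
    next
      case False
      show ?thesis by (rule identity_extends_left[OF x False ab'(3) w t1(2) id])
    qed
  qed (use t t1 ab' e identity_on_subset[OF near] in auto)
  ultimately show ?thesis using identity_on_join by blast
qed

section \<open>Bumps\<close>

text \<open>
  A map with slopes 2, 1 and 1/2 that lies strictly above the diagonal.
\<close>

lemma bump_exists:
  assumes uv: "dyadic_interval u v"
  obtains g where "g \<in> F_on u v" "atomic g u v"
proof -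
  note uv' = dyadic_interval_facts[OF uv]
  define L where "L = (v - u) / 4"
  have L: "L > 0" "dyadic L" "v = u + 4 * L" unfolding L_def using uv' by (auto simp: field_simps)
  \<comment> \<open>slope 2 on the first quarter, a translation on the second, slope 1/2 on the right half\<close>
  define g where "g = (\<lambda>t. if t \<le> u + L then 2 * t - u else if t \<le> u + 2 * L then t + L else (t + v) / 2)"
  have "pl2 (\<lambda>t. 2 * t - u) u (u + L)"
    by (rule pl2.affine[where k = 1 and c = "- u"]) (use uv' L in auto)
  moreover have "pl2 (\<lambda>t. t + L) (u + L) (u + 2 * L)"
    by (rule pl2.affine[where k = 0 and c = L]) (use uv' L in auto)
  moreover have "pl2 (\<lambda>t. (t + v) / 2) (u + 2 * L) v"
    by (rule pl2.affine[where k = "-1" and c = "v / 2"]) (use uv' L in \<open>auto simp: power_int_minus field_simps\<close>)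
  ultimately have pl: "pl2 g u v"
    unfolding g_def using L by (intro pl2_glue) (auto simp: field_simps)
  have guv: "g u = u" "g v = v" unfolding g_def using L by auto
  have less: "t < g t" if "u < t" "t < v" for t unfolding g_def using that L by auto
  have F: "support_extend u v g \<in> F_on u v" by (rule support_extend_F_on[OF uv pl guv])
  have "support_extend u v g t \<noteq> t" if "u < t" "t < v" for t
    using less[OF that] that uv' by simp
  then have "atomic (support_extend u v g) u v"
    unfolding atomic_def using F_on_thompson[OF F] F_on_fixes[OF F] uv by blast
  with F show thesis by (rule that)
qed

lemma F_on_mono:
  assumes "a \<le> c" "d \<le> b" "dyadic_interval a b" "dyadic_interval c d"
  shows "F_on c d \<subseteq> F_on a b"
proof
  fix y assume y: "y \<in> F_on c d"
  note 1 = dyadic_interval_facts[OF assms(3)] and 2 = dyadic_interval_facts[OF assms(4)]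
  have out: "y t = t" if "0 \<le> t" "t \<le> 1" "t \<le> c \<or> d \<le> t" for t
    using that F_on_outside[OF y, of t] F_on_fixes[OF y] by (metis order_le_less)
  show "y \<in> F_on a b"
    by (rule F_onI[OF F_on_thompson[OF y]]) (rule out; use assms(1,2) 1 2 in linarith)+
qed

text \<open>
  Outside the piece \<open>y\<close> is the identity, and \<open>x\<close> preserves the outside.
\<close>

lemma F_on_commutes:
  assumes y: "y \<in> F_on a b" and ab: "dyadic_interval a b" and x: "x \<in> thompson_maps" "x a = a" "x b = b"
    and c: "commutes_on y x a b"
  shows "commutes y x"
proof (subst commutes_iff[OF F_on_thompson[OF y] x(1)], intro allI impI)
  fix t :: real assume t: "0 \<le> t" "t \<le> 1"
  note ab' = dyadic_interval_facts[OF ab]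
  consider "t < a" | "b < t" | "a \<le> t" "t \<le> b" by linarith
  then show "y (x t) = x (y t)"
  proof cases
    case 1
    then have "x t < a" using thompson_less[OF x(1) t(1), of a] x(2) ab' by simp
    then have "y (x t) = x t" "y t = t"
      using F_on_outside(1)[OF y] thompson_range[OF x(1) t] 1 t by blast+
    then show ?thesis by simp
  next
    case 2
    then have "b < x t" using thompson_less[OF x(1), of b t] x(3) ab' t by simp
    then have "y (x t) = x t" "y t = t"
      using F_on_outside(2)[OF y] thompson_range[OF x(1) t] 2 t by blast+
    then show ?thesis by simp
  next
    case 3
    then show ?thesis by (rule commutes_onD[OF c])
  qed
qed

text \<open>
  Otherwise a bump on the right half of \<open>[c, d]\<close> would commute with \<open>x\<close> and be nontrivial, hence
  atomic on \<open>[a, b]\<close>; but it fixes the dyadic midpoint of \<open>[c, d]\<close>.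
\<close>

lemma atomic_not_full:
  assumes x: "atomic x a b" and cd: "a \<le> c" "d \<le> b" "dyadic_interval c d"
    and full: "\<And>y. y \<in> F_on c d \<Longrightarrow> commutes_on y x a b"
  shows False
proof -
  note x' = atomic_facts[OF x] and cd' = dyadic_interval_facts[OF cd(3)]
  define m where "m = (c + d) / 2"
  have m: "dyadic m" "c < m" "m < d" unfolding m_def using cd' by auto
  have md: "dyadic_interval m d" unfolding dyadic_interval_def using m cd' by auto
  obtain g where g: "g \<in> F_on m d" "atomic g m d" by (rule bump_exists[OF md])
  have "g \<in> F_on c d" using F_on_mono[OF _ _ cd(3) md] m g by auto
  then have "commutes_on g x a b" by (rule full)
  moreover have "g \<in> F_on a b" using F_on_mono[OF _ _ x'(2) md] m cd g by auto
  ultimately have gF: "g \<in> F_comm x a b" unfolding F_comm_def by blast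
  obtain t where t: "dyadic t" "m < t" "t < d" using dyadic_dense[OF m(3)] by blast
  then have "g t \<noteq> t" using atomic_facts(10)[OF g(2) t] by blast
  then have "g \<noteq> \<one>\<^bsub>thompson_F\<^esub>" using t m cd' by auto
  then have "atomic g a b" by (rule F_comm_nontrivial_atomic[OF x gF])
  then have "g m \<noteq> m" using atomic_facts(10)[of g a b m] m cd by auto
  then show False using F_on_fixes[OF g(1)] by blast
qed

section \<open>Standard subgroups\<close>

text \<open>
  The three kinds of pieces: \<open>C\<close> contains everything supported in the piece, nothing but the
  identity, or exactly what commutes with some atomic element. In the last case the restrictions of the
  members of \<open>C\<close> to the piece are required to lie in that cyclic group.
\<close>

definition piece :: "(real \<Rightarrow> real) set \<Rightarrow> real \<Rightarrow> real \<Rightarrow> bool" where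
  "piece C a b \<longleftrightarrow> dyadic_interval a b \<and> (\<forall>y\<in>C. y a = a \<and> y b = b) \<and>
     (F_on a b \<subseteq> C \<or> (\<forall>y\<in>C. identity_on y a b) \<or>
      (\<exists>h. atomic h a b \<and> (\<forall>y\<in>C. support_extend a b y \<in> F_comm h a b) \<and> F_comm h a b \<subseteq> C))"

definition consecutive :: "real set \<Rightarrow> real \<Rightarrow> real \<Rightarrow> bool" where
  "consecutive P a b \<longleftrightarrow> a \<in> P \<and> b \<in> P \<and> a < b \<and> (\<forall>p\<in>P. p \<le> a \<or> b \<le> p)"

definition cut_set :: "real set \<Rightarrow> bool" where
  "cut_set P \<longleftrightarrow> finite P \<and> 0 \<in> P \<and> 1 \<in> P \<and> (\<forall>p\<in>P. dyadic p \<and> 0 \<le> p \<and> p \<le> 1)"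

text \<open>
  The last condition excludes cut points that have full pieces on both sides. Next to every
  interior cut point there is then a piece that is not full, so some element moves points arbitrarily
  near it, and the cut point can be recognized as a boundary fixed point. The condition becomes weaker
  when \<open>C\<close> shrinks and is therefore inherited by intersections.
\<close>

definition standard :: "(real \<Rightarrow> real) set \<Rightarrow> real set \<Rightarrow> bool" where
  "standard C P \<longleftrightarrow> subgroup C thompson_F \<and> cut_set P \<and>
     (\<forall>a b. consecutive P a b \<longrightarrow> piece C a b) \<and>
     (\<forall>p c e. p \<in> P \<longrightarrow> dyadic_interval c p \<longrightarrow> dyadic_interval p e \<longrightarrow> \<not> (F_on c p \<subseteq> C \<and> F_on p e \<subseteq> C))"

lemma cut_set_consecutive_interval: "cut_set P \<Longrightarrow> consecutive P a b \<Longrightarrow> dyadic_interval a b"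
  unfolding cut_set_def consecutive_def dyadic_interval_def by blast

lemma consecutive_below:
  assumes P: "cut_set P" and p: "p \<in> P" "0 < p" obtains a where "consecutive P a p"
proof -
  let ?A = "{q \<in> P. q < p}"
  have A: "finite ?A" "?A \<noteq> {}" using P p unfolding cut_set_def by auto
  have "Max ?A \<in> ?A" by (rule Max_in[OF A])
  moreover have "q \<le> Max ?A \<or> p \<le> q" if "q \<in> P" for q using that A(1) by (cases "q < p") auto
  ultimately have "consecutive P (Max ?A) p" unfolding consecutive_def using p by blast
  then show thesis by (rule that)
qed

lemma consecutive_above:
  assumes P: "cut_set P" and p: "p \<in> P" "p < 1" obtains b where "consecutive P p b"
proof -
  let ?A = "{q \<in> P. p < q}"
  have A: "finite ?A" "?A \<noteq> {}" using P p unfolding cut_set_def by auto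
  have "Min ?A \<in> ?A" by (rule Min_in[OF A])
  moreover have "q \<le> p \<or> Min ?A \<le> q" if "q \<in> P" for q using that A(1) by (cases "p < q") auto
  ultimately have "consecutive P p (Min ?A)" unfolding consecutive_def using p by blast
  then show thesis by (rule that)
qed

lemma consecutive_refine:
  assumes P: "cut_set P" and sub: "P \<subseteq> Q" and cd: "consecutive Q c d" "0 \<le> c" "d \<le> 1"
  obtains a b where "consecutive P a b" "a \<le> c" "d \<le> b"
proof -
  let ?A = "{q \<in> P. q \<le> c}" and ?B = "{q \<in> P. d \<le> q}"
  have A: "finite ?A" "?A \<noteq> {}" and B: "finite ?B" "?B \<noteq> {}" using P cd unfolding cut_set_def by auto
  have m: "Max ?A \<in> ?A" "Min ?B \<in> ?B" by (rule Max_in[OF A], rule Min_in[OF B])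
  have "q \<le> Max ?A \<or> Min ?B \<le> q" if "q \<in> P" for q
  proof -
    have "q \<le> c \<or> d \<le> q" using that sub cd(1) unfolding consecutive_def by blast
    then show ?thesis using that A(1) B(1) by auto
  qed
  moreover have "c < d" using cd(1) unfolding consecutive_def by blast
  ultimately have "consecutive P (Max ?A) (Min ?B)" unfolding consecutive_def using m by auto
  then show thesis using that m by blast
qed

lemma piece_D:
  assumes "piece C a b"
  shows "dyadic_interval a b" "y \<in> C \<Longrightarrow> y a = a" "y \<in> C \<Longrightarrow> y b = b"
    "F_on a b \<subseteq> C \<or> (\<forall>y\<in>C. identity_on y a b) \<or>
      (\<exists>h. atomic h a b \<and> (\<forall>y\<in>C. support_extend a b y \<in> F_comm h a b) \<and> F_comm h a b \<subseteq> C)"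
  using assms unfolding piece_def by blast+

lemma support_extend_identity:
  assumes "identity_on y a b" shows "support_extend a b y = \<one>\<^bsub>thompson_F\<^esub>"
  unfolding support_extend_def one_thompson using identity_onD[OF assms] by (auto simp: restrict_def)

lemma support_extend_F_on_self:
  assumes "y \<in> F_on a b" "dyadic_interval a b" shows "support_extend a b y = y"
proof (rule F_on_eqI[OF support_extend_self assms(1)])
  fix t assume "a \<le> t" "t \<le> b"
  then show "support_extend a b y t = y t" using dyadic_interval_facts[OF assms(2)] by simp
qed (use assms F_on_thompson F_on_fixes in blast)+

lemma support_extend_one_identity:
  assumes "support_extend a b y = \<one>\<^bsub>thompson_F\<^esub>" "dyadic_interval a b" shows "identity_on y a b"
proof (rule identity_onI)
  fix t assume t: "a \<le> t" "t \<le> b"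
  then have t1: "0 \<le> t" "t \<le> 1" using dyadic_interval_facts[OF assms(2)] by auto
  have "support_extend a b y t = y t" using t t1 by simp
  then show "y t = t" using assms(1) one_thompson_apply[OF t1] by metis
qed

lemma subgroup_sub: "subgroup C thompson_F \<Longrightarrow> y \<in> C \<Longrightarrow> y \<in> thompson_maps"
  using subgroup.subset by fastforce

lemma piece_support_extend:
  assumes C: "subgroup C thompson_F" and p: "piece C a b" and y: "y \<in> C"
  shows "support_extend a b y \<in> C \<inter> F_on a b"
proof -
  have F: "support_extend a b y \<in> F_on a b"
    by (rule support_extend_self[OF subgroup_sub[OF C y] piece_D(2,3)[OF p y] piece_D(1)[OF p]])
  have "support_extend a b y \<in> C" using piece_D(4)[OF p]
  proof (elim disjE exE conjE)
    assume "\<forall>y\<in>C. identity_on y a b"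
    then have "support_extend a b y = \<one>\<^bsub>thompson_F\<^esub>" using support_extend_identity y by blast
    then show ?thesis using subgroup.one_closed[OF C] by simp
  qed (use F y in blast)+
  then show ?thesis using F by blast
qed

text \<open>
  A full or trivial piece restricts to a piece of the same kind. If an atomic piece is properly
  refined, a cut point inside is a dyadic fixed point of all members of \<open>D\<close>, so that none of them
  can be nontrivial on the piece.
\<close>

lemma piece_refine:
  assumes C: "subgroup C thompson_F" and p: "piece C a b" and cd: "a \<le> c" "d \<le> b" "dyadic_interval c d"
    and D: "D \<subseteq> C" "\<And>y. y \<in> D \<Longrightarrow> y c = c" "\<And>y. y \<in> D \<Longrightarrow> y d = d"
  shows "F_on c d \<subseteq> C \<or> (\<forall>y\<in>D. identity_on y c d) \<or>
      (\<exists>h. atomic h c d \<and> (\<forall>y\<in>C. support_extend c d y \<in> F_comm h c d) \<and> F_comm h c d \<subseteq> C)"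
proof -
  note ab = piece_D(1)[OF p] and ab' = dyadic_interval_facts[OF piece_D(1)[OF p]] and cd' = dyadic_interval_facts[OF cd(3)]
  show ?thesis using piece_D(4)[OF p]
  proof (elim disjE exE conjE)
    assume "F_on a b \<subseteq> C"
    then show ?thesis using F_on_mono[OF cd(1,2) ab cd(3)] by blast
  next
    assume "\<forall>y\<in>C. identity_on y a b"
    then have "\<forall>y\<in>D. identity_on y c d" using D(1) identity_on_subset cd(1,2) by blast
    then show ?thesis by blast
  next
    fix h assume h: "atomic h a b" and hC: "\<forall>y\<in>C. support_extend a b y \<in> F_comm h a b" "F_comm h a b \<subseteq> C"
    show ?thesis
    proof (cases "a = c \<and> b = d")
      case True
      then show ?thesis using h hC by blast
    next
      case False
      have "identity_on y c d" if y: "y \<in> D" for y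
      proof -
        have "a < c \<or> d < b" using False cd by auto
        then obtain q where q: "dyadic q" "a < q" "q < b" "y q = q"
          using D(2,3)[OF y] cd cd' by (metis less_le_trans le_less_trans)
        have sq: "support_extend a b y q = q" using q ab' by simp
        have sF: "support_extend a b y \<in> F_comm h a b" using hC D y by blast
        have "\<not> atomic (support_extend a b y) a b" using sq atomic_facts(10)[of "support_extend a b y" a b q] q by blast
        then have "support_extend a b y = \<one>\<^bsub>thompson_F\<^esub>" using F_comm_nontrivial_atomic[OF h sF] by blast
        then have "identity_on y a b" by (rule support_extend_one_identity[OF _ ab])
        then show ?thesis by (rule identity_on_subset[OF _ cd(1,2)])
      qed
      then show ?thesis by blast
    qed
  qed
qed

lemma F_comm_sub_F_on: "F_comm h a b \<subseteq> F_on a b"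
  unfolding F_comm_def by blast

text \<open>
  On each interval of the common refinement both subgroups are of one of the three kinds. The only
  case that is not immediate is that of two atomic elements; there the two cyclic groups coincide or meet
  trivially.
\<close>

theorem standard_Int:
  assumes s1: "standard C1 P1" and s2: "standard C2 P2"
  shows "standard (C1 \<inter> C2) (P1 \<union> P2)"
proof -
  have C1: "subgroup C1 thompson_F" and C2: "subgroup C2 thompson_F" and P1: "cut_set P1" and P2: "cut_set P2"
    and pc1: "\<And>a b. consecutive P1 a b \<Longrightarrow> piece C1 a b" and pc2: "\<And>a b. consecutive P2 a b \<Longrightarrow> piece C2 a b"
    using s1 s2 unfolding standard_def by blast+
  let ?C = "C1 \<inter> C2" and ?P = "P1 \<union> P2"
  have C: "subgroup ?C thompson_F" using F.subgroups_Inter_pair[OF C1 C2] .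
  have P: "cut_set ?P" using P1 P2 unfolding cut_set_def by blast
  have fix1: "y p = p" if yp: "y \<in> C1" "p \<in> P1" for y p
  proof (cases "p = 0")
    case True then show ?thesis using thompson_0 subgroup_sub[OF C1 yp(1)] by simp
  next
    case False
    then have "0 < p" using P1 yp(2) unfolding cut_set_def by force
    then obtain a where "consecutive P1 a p" using consecutive_below[OF P1 yp(2)] by blast
    then show ?thesis using piece_D(3)[OF pc1 yp(1)] by blast
  qed
  have fix2: "y p = p" if yp: "y \<in> C2" "p \<in> P2" for y p
  proof (cases "p = 0")
    case True then show ?thesis using thompson_0 subgroup_sub[OF C2 yp(1)] by simp
  next
    case False
    then have "0 < p" using P2 yp(2) unfolding cut_set_def by force
    then obtain a where "consecutive P2 a p" using consecutive_below[OF P2 yp(2)] by blast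
    then show ?thesis using piece_D(3)[OF pc2 yp(1)] by blast
  qed
  have "piece ?C c d" if cd: "consecutive ?P c d" for c d
  proof -
    have cdi: "dyadic_interval c d" by (rule cut_set_consecutive_interval[OF P cd])
    note cd' = dyadic_interval_facts[OF cdi]
    have fixcd: "y c = c" "y d = d" if "y \<in> ?C" for y
      using fix1 fix2 that cd unfolding consecutive_def by blast+
    obtain a b where ab: "consecutive P1 a b" "a \<le> c" "d \<le> b"
      by (rule consecutive_refine[OF P1 _ cd cd'(3,5)]) blast+
    obtain a' b' where ab': "consecutive P2 a' b'" "a' \<le> c" "d \<le> b'"
      by (rule consecutive_refine[OF P2 _ cd cd'(3,5)]) blast+
    have t1: "F_on c d \<subseteq> C1 \<or> (\<forall>y\<in>?C. identity_on y c d) \<or>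
      (\<exists>h. atomic h c d \<and> (\<forall>y\<in>C1. support_extend c d y \<in> F_comm h c d) \<and> F_comm h c d \<subseteq> C1)"
      by (rule piece_refine[OF C1 pc1[OF ab(1)] ab(2,3) cdi]) (use fixcd in blast)+
    have t2: "F_on c d \<subseteq> C2 \<or> (\<forall>y\<in>?C. identity_on y c d) \<or>
      (\<exists>h. atomic h c d \<and> (\<forall>y\<in>C2. support_extend c d y \<in> F_comm h c d) \<and> F_comm h c d \<subseteq> C2)"
      by (rule piece_refine[OF C2 pc2[OF ab'(1)] ab'(2,3) cdi]) (use fixcd in blast)+
    have "F_on c d \<subseteq> ?C \<or> (\<forall>y\<in>?C. identity_on y c d) \<or>
      (\<exists>h. atomic h c d \<and> (\<forall>y\<in>?C. support_extend c d y \<in> F_comm h c d) \<and> F_comm h c d \<subseteq> ?C)"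
      using t1 t2
    proof (elim disjE exE conjE)
      fix h assume "F_on c d \<subseteq> C1" "atomic h c d" "\<forall>y\<in>C2. support_extend c d y \<in> F_comm h c d" "F_comm h c d \<subseteq> C2"
      then show ?thesis using F_comm_sub_F_on[of h c d] by blast
    next
      fix h assume "F_on c d \<subseteq> C2" "atomic h c d" "\<forall>y\<in>C1. support_extend c d y \<in> F_comm h c d" "F_comm h c d \<subseteq> C1"
      then show ?thesis using F_comm_sub_F_on[of h c d] by blast
    next
      \<comment> \<open>two cyclic pieces: the intersection is trivial or both\<close>
      fix h k assume h: "atomic h c d" "\<forall>y\<in>C1. support_extend c d y \<in> F_comm h c d" "F_comm h c d \<subseteq> C1"
        and k: "atomic k c d" "\<forall>y\<in>C2. support_extend c d y \<in> F_comm k c d" "F_comm k c d \<subseteq> C2"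
      show ?thesis
      proof (cases "\<exists>z. z \<in> F_comm h c d \<and> z \<in> F_comm k c d \<and> z \<noteq> \<one>\<^bsub>thompson_F\<^esub>")
        case True
        then have "F_comm h c d = F_comm k c d" using F_comm_eq_if_meet[OF h(1) k(1)] by blast
        then show ?thesis using h k by blast
      next
        case False
        then have "\<forall>y\<in>?C. support_extend c d y = \<one>\<^bsub>thompson_F\<^esub>" using h(2) k(2) by blast
        then show ?thesis using support_extend_one_identity[OF _ cdi] by blast
      qed
    qed blast+
    then show ?thesis unfolding piece_def using cdi fixcd by blast
  qed
  moreover have "\<not> (F_on c p \<subseteq> ?C \<and> F_on p e \<subseteq> ?C)"
    if "p \<in> ?P" "dyadic_interval c p" "dyadic_interval p e" for p c e
    using that s1 s2 unfolding standard_def by blast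
  ultimately show ?thesis unfolding standard_def using C P by blast
qed

section \<open>The centralizer of an element is standard\<close>

text \<open>
  The boundary fixed points that are not dyadic are left out: no element breaks there, so
  the centralizer does not split at them.
\<close>

definition cuts :: "(real \<Rightarrow> real) \<Rightarrow> real set" where
  "cuts x = {0, 1} \<union> {p \<in> bd x. dyadic p}"

lemma cut_set_cuts: "x \<in> thompson_maps \<Longrightarrow> cut_set (cuts x)"
  unfolding cut_set_def cuts_def
  using finite_boundary_fixpoints[OF thompson_pl2] bd_fix[of _ x] by auto

lemma cuts_fixed: "x \<in> thompson_maps \<Longrightarrow> y \<in> centralizer thompson_F {x} \<Longrightarrow> p \<in> cuts x \<Longrightarrow> y p = p"
  unfolding cuts_def centralizer_singleton
  using centralizer_fixes_boundary thompson_0 thompson_1 by blast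

lemma centralizer_self: "x \<in> thompson_maps \<Longrightarrow> x \<in> centralizer thompson_F {x}"
  unfolding centralizer_singleton commutes_def by simp

lemma cuts_identity_or_atomic:
  assumes x: "x \<in> thompson_maps" and ab: "consecutive (cuts x) a b"
  shows "identity_on x a b \<or> atomic x a b"
proof (rule identity_or_atomic[OF x cut_set_consecutive_interval[OF cut_set_cuts[OF x] ab]])
  show "x a = a" "x b = b" using cuts_fixed[OF x centralizer_self[OF x]] ab unfolding consecutive_def by blast+
  fix t assume t: "t \<in> bd x" "dyadic t" "a < t" "t < b"
  then have "t \<in> cuts x" unfolding cuts_def by blast
  then show False using t ab unfolding consecutive_def by force
qed

lemma F_on_sub_centralizer:
  assumes x: "x \<in> thompson_maps" and ab: "dyadic_interval a b" "identity_on x a b"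
  shows "F_on a b \<subseteq> centralizer thompson_F {x}"
proof
  note ab' = dyadic_interval_facts[OF ab(1)]
  fix y assume y: "y \<in> F_on a b"
  have xa: "x a = a" "x b = b" using identity_onD[OF ab(2)] ab' by simp_all
  have "commutes_on y x a b"
  proof (rule commutes_onI)
    fix t assume t: "a \<le> t" "t \<le> b"
    have "x (y t) = y t" using F_on_range[OF y ab(1) t] by (intro identity_onD[OF ab(2)]) auto
    moreover have "x t = t" by (rule identity_onD[OF ab(2) t])
    ultimately show "y (x t) = x (y t)" by simp
  qed
  then have "commutes y x" by (rule F_on_commutes[OF y ab(1) x xa])
  then show "y \<in> centralizer thompson_F {x}" unfolding centralizer_singleton using F_on_thompson[OF y] by blast
qed

lemma commutes_commutes_on:
  assumes "commutes y x" "y \<in> thompson_maps" "x \<in> thompson_maps" "0 \<le> a" "b \<le> 1"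
  shows "commutes_on y x a b"
proof (rule commutes_onI)
  fix t assume t: "a \<le> t" "t \<le> b"
  then have "0 \<le> t" "t \<le> 1" using assms(4,5) by auto
  then show "y (x t) = x (y t)" by (rule commutes_apply[OF assms(1-3)])
qed

lemma support_extend_commutes_on:
  assumes c: "commutes_on y x a b" and x: "x \<in> thompson_maps" "x a = a" "x b = b" and ab: "dyadic_interval a b"
  shows "commutes_on (support_extend a b y) x a b"
proof (rule commutes_onI)
  note ab' = dyadic_interval_facts[OF ab]
  fix t assume t: "a \<le> t" "t \<le> b"
  have "a \<le> x t" "x t \<le> b" using thompson_preserves_interval[OF x ab'(3,5) t] by auto
  then show "support_extend a b y (x t) = x (support_extend a b y t)" using t ab' commutes_onD[OF c t] by simp
qed

lemma atomic_centralizer_piece: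
  assumes x: "atomic x a b" and fixes_ab: "\<And>y. y \<in> centralizer thompson_F {x} \<Longrightarrow> y a = a \<and> y b = b"
  shows "\<forall>y\<in>centralizer thompson_F {x}. support_extend a b y \<in> F_comm x a b"
    and "F_comm x a b \<subseteq> centralizer thompson_F {x}"
proof -
  note x' = atomic_facts[OF x]
  show "\<forall>y\<in>centralizer thompson_F {x}. support_extend a b y \<in> F_comm x a b"
  proof
    fix y assume y: "y \<in> centralizer thompson_F {x}"
    then have y': "y \<in> thompson_maps" "commutes y x" unfolding centralizer_singleton by auto
    have "commutes_on (support_extend a b y) x a b"
      by (rule support_extend_commutes_on[OF commutes_commutes_on[OF y'(2,1) x'(1,5,7)] x'(1,3,4,2)])
    moreover have "support_extend a b y \<in> F_on a b"
      using support_extend_self[OF y'(1) _ _ x'(2)] fixes_ab[OF y] by blast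
    ultimately show "support_extend a b y \<in> F_comm x a b" unfolding F_comm_def by blast
  qed
  show "F_comm x a b \<subseteq> centralizer thompson_F {x}"
  proof
    fix y assume y: "y \<in> F_comm x a b"
    have "commutes y x" by (rule F_on_commutes[OF F_comm_F_on[OF y] x'(2,1,3,4) F_comm_commutes[OF y]])
    then show "y \<in> centralizer thompson_F {x}" unfolding centralizer_singleton using F_comm_thompson[OF y] by blast
  qed
qed

text \<open>
  The common endpoint is a boundary fixed point, hence has moved points on some side.
\<close>

lemma cuts_not_identity_both:
  assumes x: "x \<in> thompson_maps" and ab: "consecutive (cuts x) a p" "consecutive (cuts x) p b"
    and id: "identity_on x a p" "identity_on x p b"
  shows False
proof -
  have i: "dyadic_interval a p" "dyadic_interval p b"
    using cut_set_consecutive_interval[OF cut_set_cuts[OF x]] ab by blast+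
  have "p \<noteq> 0" "p \<noteq> 1" using dyadic_interval_facts[OF i(1)] dyadic_interval_facts[OF i(2)] by auto
  then have "p \<in> bd x" using ab(1) unfolding consecutive_def cuts_def by blast
  moreover have "0 < min (p - a) (b - p)" using ab unfolding consecutive_def by auto
  ultimately obtain s where s: "\<bar>s - p\<bar> < min (p - a) (b - p)" "x s \<noteq> s" by (rule bd_witness)
  have "a \<le> s" "s \<le> b" using s(1) by (auto simp: abs_less_iff)
  then show False using identity_onD[OF identity_on_join[OF id]] s(2) by blast
qed

text \<open>
  Identity pieces of \<open>x\<close> are full and atomic pieces are cyclic. If both sides of a cut point were full,
  even on short intervals, neither adjacent piece could be atomic by \<open>atomic_not_full\<close>, and both
  cannot be identity pieces.
\<close>

theorem standard_centralizer:
  assumes x: "x \<in> thompson_maps"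
  shows "standard (centralizer thompson_F {x}) (cuts x)"
proof -
  let ?C = "centralizer thompson_F {x}"
  note P = cut_set_cuts[OF x]
  have "piece ?C a b" if ab: "consecutive (cuts x) a b" for a b
  proof -
    have i: "dyadic_interval a b" by (rule cut_set_consecutive_interval[OF P ab])
    have fixes_ab: "y a = a \<and> y b = b" if "y \<in> ?C" for y
      using cuts_fixed[OF x that] ab unfolding consecutive_def by blast
    have "F_on a b \<subseteq> ?C \<or>
      (\<exists>h. atomic h a b \<and> (\<forall>y\<in>?C. support_extend a b y \<in> F_comm h a b) \<and> F_comm h a b \<subseteq> ?C)"
      using cuts_identity_or_atomic[OF x ab]
    proof
      assume "identity_on x a b" then show ?thesis using F_on_sub_centralizer[OF x i] by blast
    next
      assume a: "atomic x a b" then show ?thesis using atomic_centralizer_piece[OF a fixes_ab] by blast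
    qed
    then show ?thesis unfolding piece_def using i fixes_ab by blast
  qed
  \<comment> \<open>the adjacent pieces are not atomic by \<open>atomic_not_full\<close>, and not both identity pieces\<close>
  moreover have False if p: "p \<in> cuts x" and i: "dyadic_interval c p" "dyadic_interval p e"
      and full: "F_on c p \<subseteq> ?C" "F_on p e \<subseteq> ?C" for p c e
  proof -
    note i1 = dyadic_interval_facts[OF i(1)] and i2 = dyadic_interval_facts[OF i(2)]
    obtain a where a: "consecutive (cuts x) a p" by (rule consecutive_below[OF P p i1(7)])
    obtain b where b: "consecutive (cuts x) p b" by (rule consecutive_above[OF P p i2(6)])
    have ia: "dyadic_interval a p" and ib: "dyadic_interval p b"
      using cut_set_consecutive_interval[OF P] a b by blast+
    note ia' = dyadic_interval_facts[OF ia] and ib' = dyadic_interval_facts[OF ib]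
    have na: "\<not> atomic x a p"
    proof
      assume at: "atomic x a p"
      \<comment> \<open>the full interval may overlap the piece only partially\<close>
      have j: "dyadic_interval (max a c) p" using ia' i1 unfolding dyadic_interval_def by (auto simp: max_def)
      show False
      proof (rule atomic_not_full[OF at _ _ j])
        fix y assume "y \<in> F_on (max a c) p"
        then have "y \<in> ?C" using F_on_mono[OF _ _ i(1) j] full by auto
        then show "commutes_on y x a p"
          unfolding centralizer_singleton using commutes_commutes_on[OF _ _ x ia'(3,5)] by blast
      qed auto
    qed
    have nb: "\<not> atomic x p b"
    proof
      assume at: "atomic x p b"
      have j: "dyadic_interval p (min b e)" using ib' i2 unfolding dyadic_interval_def by (auto simp: min_def)
      show False
      proof (rule atomic_not_full[OF at _ _ j])
        fix y assume "y \<in> F_on p (min b e)"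
        then have "y \<in> ?C" using F_on_mono[OF _ _ i(2) j] full by auto
        then show "commutes_on y x p b"
          unfolding centralizer_singleton using commutes_commutes_on[OF _ _ x ib'(3,5)] by blast
      qed auto
    qed
    show False
      using cuts_not_identity_both[OF x a b] cuts_identity_or_atomic[OF x a] cuts_identity_or_atomic[OF x b] na nb by blast
  qed
  ultimately show ?thesis unfolding standard_def using subgroup_centralizer[OF x] P by blast
qed

section \<open>Decomposing a standard subgroup\<close>

lemma cut_set_subdivision:
  assumes P: "cut_set P"
  obtains p r where "subdivision p r" "\<And>i. i < r \<Longrightarrow> consecutive P (p i) (p (Suc i))"
proof -
  define xs where "xs = sorted_list_of_set P"
  have fin: "finite P" and P0: "0 \<in> P" "1 \<in> P" and Pd: "\<And>p. p \<in> P \<Longrightarrow> dyadic p \<and> 0 \<le> p \<and> p \<le> 1"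
    using P unfolding cut_set_def by auto
  have xs: "set xs = P" "sorted xs" "distinct xs" unfolding xs_def using fin by simp_all
  have less: "xs ! i < xs ! j" if "i < j" "j < length xs" for i j
    using that sorted_nth_mono[OF xs(2), of i j] xs(3) by (simp add: nth_eq_iff_index_eq order_less_le)
  have mem: "xs ! i \<in> P" if "i < length xs" for i using that xs(1) nth_mem by blast
  obtain i0 where i0: "i0 < length xs" "xs ! i0 = 0" using P0 xs(1) by (metis in_set_conv_nth)
  obtain i1 where i1: "i1 < length xs" "xs ! i1 = 1" using P0 xs(1) by (metis in_set_conv_nth)
  have "i0 = 0"
  proof (rule ccontr)
    assume "i0 \<noteq> 0"
    then have "xs ! 0 < 0" using less[of 0 i0] i0 by simp
    moreover have "0 < length xs" using i0(1) by linarith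
    then have "0 \<le> xs ! 0" using Pd[OF mem[of 0]] by blast
    ultimately show False by simp
  qed
  have i1': "i1 = length xs - 1"
  proof (rule ccontr)
    assume "i1 \<noteq> length xs - 1"
    then have "1 < xs ! (length xs - 1)" using less[of i1 "length xs - 1"] i1 by simp
    moreover have "length xs - 1 < length xs" using i0(1) by linarith
    then have "xs ! (length xs - 1) \<le> 1" using Pd[OF mem[of "length xs - 1"]] by blast
    ultimately show False by simp
  qed
  define r where "r = length xs - 1"
  show thesis
  proof (rule that[of "\<lambda>i. xs ! i" r])
    show "subdivision (\<lambda>i. xs ! i) r"
      unfolding subdivision_def
    proof (intro conjI allI impI)
      fix i assume "i \<le> r"
      then show "dyadic (xs ! i)" using Pd[OF mem[of i]] i0 r_def by auto
    qed (use i0 i1 i1' \<open>i0 = 0\<close> less r_def in auto)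
    fix i assume i: "i < r"
    have "q \<le> xs ! i \<or> xs ! Suc i \<le> q" if q: "q \<in> P" for q
    proof -
      obtain j where j: "j < length xs" "q = xs ! j" using q xs(1) by (metis in_set_conv_nth)
      have "j \<le> i \<or> Suc i \<le> j" by auto
      then show ?thesis using sorted_nth_mono[OF xs(2)] i j r_def by auto
    qed
    then show "consecutive P (xs ! i) (xs ! Suc i)"
      unfolding consecutive_def using mem[of i] mem[of "Suc i"] less[of i "Suc i"] i r_def by auto
  qed
qed

lemma support_extend_mult:
  assumes y: "y \<in> thompson_maps" "y a = a" "y b = b" and z: "z \<in> thompson_maps" "z a = a" "z b = b"
    and ab: "dyadic_interval a b"
  shows "support_extend a b (y \<otimes>\<^bsub>thompson_F\<^esub> z) = support_extend a b y \<otimes>\<^bsub>thompson_F\<^esub> support_extend a b z"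
proof -
  note ab' = dyadic_interval_facts[OF ab]
  have Fy: "support_extend a b y \<in> F_on a b" and Fz: "support_extend a b z \<in> F_on a b"
    using support_extend_self y z ab by blast+
  show ?thesis
  proof (rule F_on_eqI)
    show "support_extend a b (y \<otimes>\<^bsub>thompson_F\<^esub> z) \<in> F_on a b"
      by (rule support_extend_self[OF _ _ _ ab]) (use y z ab' in simp_all)
    show "support_extend a b y \<otimes>\<^bsub>thompson_F\<^esub> support_extend a b z \<in> F_on a b"
      by (rule subgroup.m_closed[OF subgroup_F_on[OF ab] Fy Fz])
    fix t assume t: "a \<le> t" "t \<le> b"
    then have t1: "0 \<le> t" "t \<le> 1" using ab' by auto
    have zt: "a \<le> z t" "z t \<le> b" using thompson_preserves_interval[OF z ab'(3,5) t] by auto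
    then have zt1: "0 \<le> z t" "z t \<le> 1" using ab' by auto
    show "support_extend a b (y \<otimes>\<^bsub>thompson_F\<^esub> z) t = (support_extend a b y \<otimes>\<^bsub>thompson_F\<^esub> support_extend a b z) t"
      using t t1 zt zt1 y z F_on_thompson[OF Fy] F_on_thompson[OF Fz] by simp
  qed
qed

text \<open>
  Sufficient conditions for a subgroup to be the direct product of its parts supported in the pieces:
  its elements respect the pieces, and it contains the restriction of each element to each piece.
\<close>

locale split_subgroup =
  fixes C p r
  assumes C: "subgroup C thompson_F" and subdiv: "subdivision p r"
    and fixes_p: "\<And>y i. y \<in> C \<Longrightarrow> i \<le> r \<Longrightarrow> y (p i) = p i"
    and split: "\<And>y i. y \<in> C \<Longrightarrow> i < r \<Longrightarrow> support_extend (p i) (p (Suc i)) y \<in> C"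
begin

abbreviation factor :: "nat \<Rightarrow> (real \<Rightarrow> real) monoid" where
  "factor i \<equiv> thompson_F\<lparr>carrier := C \<inter> F_on (p i) (p (Suc i))\<rparr>"

lemma C_thompson: "y \<in> C \<Longrightarrow> y \<in> thompson_maps"
  by (rule subgroup_sub[OF C])

lemma interval: "i < r \<Longrightarrow> dyadic_interval (p i) (p (Suc i))"
  by (rule subdivision_interval[OF subdiv])

lemma split_mem: "y \<in> C \<Longrightarrow> i < r \<Longrightarrow> support_extend (p i) (p (Suc i)) y \<in> C \<inter> F_on (p i) (p (Suc i))"
  using split support_extend_self[OF C_thompson _ _ interval] fixes_p by simp

lemma subgroup_factor: "i < r \<Longrightarrow> subgroup (C \<inter> F_on (p i) (p (Suc i))) thompson_F"
  by (rule F.subgroups_Inter_pair[OF C subgroup_F_on[OF interval]])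

lemma group_factor: "i < r \<Longrightarrow> group (factor i)"
  by (rule subgroup.subgroup_is_group[OF subgroup_factor F.group_axioms])

lemma eq_if_eq_on_pieces:
  assumes "y \<in> C" "z \<in> C" "\<And>i t. i < r \<Longrightarrow> p i \<le> t \<Longrightarrow> t \<le> p (Suc i) \<Longrightarrow> y t = z t"
  shows "y = z"
proof (rule thompson_eqI[OF C_thompson C_thompson])
  fix t :: real assume "0 \<le> t" "t \<le> 1"
  then obtain i where "i < r" "p i \<le> t" "t \<le> p (Suc i)" by (rule subdivision_locate[OF subdiv])
  then show "y t = z t" by (rule assms(3))
qed (use assms in auto)

lemma glue_factors:
  assumes f: "\<And>i. i < r \<Longrightarrow> f i \<in> C \<inter> F_on (p i) (p (Suc i))"
  obtains g where "g \<in> C" "\<And>i t. i < r \<Longrightarrow> p i \<le> t \<Longrightarrow> t \<le> p (Suc i) \<Longrightarrow> g t = f i t"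
proof -
  have "\<exists>g\<in>C. (\<forall>i<n. \<forall>t. p i \<le> t \<longrightarrow> t \<le> p (Suc i) \<longrightarrow> g t = f i t) \<and> identity_on g (p n) 1"
    if "n \<le> r" for n
    using that
  proof (induction n)
    case 0
    have "p 0 = 0" using subdiv by (simp add: subdivision_def)
    then have "identity_on \<one>\<^bsub>thompson_F\<^esub> (p 0) 1" by (intro identity_onI) simp
    then show ?case using subgroup.one_closed[OF C] by (intro bexI[of _ "\<one>\<^bsub>thompson_F\<^esub>"]) simp_all
  next
    case (Suc n)
    then obtain g where g: "g \<in> C" "\<forall>i<n. \<forall>t. p i \<le> t \<longrightarrow> t \<le> p (Suc i) \<longrightarrow> g t = f i t"
      and gid: "identity_on g (p n) 1" by auto
    have n: "n < r" using Suc by simp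
    have fn: "f n \<in> C" "f n \<in> F_on (p n) (p (Suc n))" using f[OF n] by auto
    note i' = dyadic_interval_facts[OF interval[OF n]]
    \<comment> \<open>the new factor acts first: it preserves its own piece, on which \<open>g\<close> is the identity\<close>
    let ?h = "g \<otimes>\<^bsub>thompson_F\<^esub> f n"
    have happ: "?h t = g (f n t)" if "0 \<le> t" "t \<le> 1" for t
      using mult_thompson_apply[OF C_thompson[OF g(1)] C_thompson[OF fn(1)] that] .
    have "?h t = f i t" if i: "i < Suc n" and t: "p i \<le> t" "t \<le> p (Suc i)" for i t
    proof -
      have ir: "i < r" using i n by simp
      note i'' = dyadic_interval_facts[OF interval[OF ir]]
      have t1: "0 \<le> t" "t \<le> 1" using t i'' by auto
      show ?thesis
      proof (cases "i = n")
        case True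
        have "p n \<le> f n t" "f n t \<le> p (Suc n)" using F_on_range[OF fn(2) interval[OF n]] t True by auto
        then have "g (f n t) = f n t" using i' by (intro identity_onD[OF gid]) auto
        then show ?thesis using happ[OF t1] True by simp
      next
        case False
        then have "i < n" using i by simp
        have "t \<le> p n" using t subdivision_le[OF subdiv, of "Suc i" n] \<open>i < n\<close> n by simp
        then have "f n t = t" using F_on_outside(1)[OF fn(2) t1(1)] F_on_fixes(1)[OF fn(2)] by (cases "t = p n") auto
        then have "?h t = g t" using happ[OF t1] by simp
        then show ?thesis using g(2) \<open>i < n\<close> t by simp
      qed
    qed
    moreover have "identity_on ?h (p (Suc n)) 1"
    proof (rule identity_onI)
      fix t assume t: "p (Suc n) \<le> t" "t \<le> 1"
      then have t1: "0 \<le> t" using i' by auto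
      have "f n t = t" using F_on_outside(2)[OF fn(2) t(2)] F_on_fixes(2)[OF fn(2)] t by (cases "t = p (Suc n)") auto
      moreover have "g t = t" by (rule identity_onD[OF gid]) (use t i' in auto)
      ultimately show "?h t = t" using happ[OF t1 t(2)] by simp
    qed
    moreover have "?h \<in> C" by (rule subgroup.m_closed[OF C g(1) fn(1)])
    ultimately show ?case by (intro bexI[of _ ?h]) blast+
  qed
  from this[OF order_refl] obtain g where g: "g \<in> C" "\<forall>i<r. \<forall>t. p i \<le> t \<longrightarrow> t \<le> p (Suc i) \<longrightarrow> g t = f i t"
    by blast
  show thesis
  proof (rule that[OF g(1)])
    fix i t assume "i < r" "p i \<le> t" "t \<le> p (Suc i)"
    then show "g t = f i t" using g(2) by simp
  qed
qed

theorem iso_product: "thompson_F\<lparr>carrier := C\<rparr> \<cong> product_group {..<r} factor"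
proof -
  define \<Phi> where "\<Phi> = (\<lambda>y. \<lambda>i\<in>{..<r}. support_extend (p i) (p (Suc i)) y)"
  have mem: "\<Phi> y \<in> carrier (product_group {..<r} factor)" if "y \<in> C" for y
    unfolding \<Phi>_def using split_mem[OF that] by auto
  have restr: "support_extend (p i) (p (Suc i)) y t = y t" if "i < r" "p i \<le> t" "t \<le> p (Suc i)" for y i t
    using that dyadic_interval_facts[OF interval[OF that(1)]] by simp
  have inj: "y = z" if yz: "y \<in> C" "z \<in> C" "\<Phi> y = \<Phi> z" for y z
  proof (rule eq_if_eq_on_pieces[OF yz(1,2)])
    fix i t assume it: "i < r" "p i \<le> t" "t \<le> p (Suc i)"
    have "\<Phi> y i = \<Phi> z i" using yz(3) by simp
    then have "support_extend (p i) (p (Suc i)) y = support_extend (p i) (p (Suc i)) z" unfolding \<Phi>_def using it by simp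
    then show "y t = z t" using restr[OF it] by metis
  qed
  have surj: "\<exists>y\<in>C. f = \<Phi> y" if "f \<in> carrier (product_group {..<r} factor)" for f
  proof -
    have f: "f i \<in> C \<inter> F_on (p i) (p (Suc i))" if "i < r" for i
      using \<open>f \<in> carrier (product_group {..<r} factor)\<close> that by (auto simp: PiE_iff)
    obtain g where g: "g \<in> C" "\<And>i t. i < r \<Longrightarrow> p i \<le> t \<Longrightarrow> t \<le> p (Suc i) \<Longrightarrow> g t = f i t"
      using glue_factors[of f, OF f] by metis
    have "f i = support_extend (p i) (p (Suc i)) g" if i: "i < r" for i
    proof (rule F_on_eqI)
      show "f i \<in> F_on (p i) (p (Suc i))" using f[OF i] by blast
      show "support_extend (p i) (p (Suc i)) g \<in> F_on (p i) (p (Suc i))" using split_mem[OF g(1) i] by blast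
      fix t assume t: "p i \<le> t" "t \<le> p (Suc i)"
      show "f i t = support_extend (p i) (p (Suc i)) g t" unfolding restr[OF i t] by (rule g(2)[OF i t, symmetric])
    qed
    then have "f = \<Phi> g" unfolding \<Phi>_def using that by (intro ext) (auto simp: PiE_iff extensional_def)
    then show ?thesis using g(1) by blast
  qed
  have hom: "\<Phi> (y \<otimes>\<^bsub>thompson_F\<^esub> z) = (\<lambda>i\<in>{..<r}. \<Phi> y i \<otimes>\<^bsub>thompson_F\<^esub> \<Phi> z i)" if yz: "y \<in> C" "z \<in> C" for y z
    unfolding \<Phi>_def
  proof (rule restrict_ext)
    fix i assume "i \<in> {..<r}"
    then have i: "i < r" by simp
    show "support_extend (p i) (p (Suc i)) (y \<otimes>\<^bsub>thompson_F\<^esub> z) =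
      (\<lambda>i\<in>{..<r}. support_extend (p i) (p (Suc i)) y) i \<otimes>\<^bsub>thompson_F\<^esub> (\<lambda>i\<in>{..<r}. support_extend (p i) (p (Suc i)) z) i"
      using support_extend_mult[OF C_thompson[OF yz(1)] _ _ C_thompson[OF yz(2)] _ _ interval[OF i]]
        fixes_p[OF yz(1)] fixes_p[OF yz(2)] i by simp
  qed
  have "\<Phi> \<in> iso (thompson_F\<lparr>carrier := C\<rparr>) (product_group {..<r} factor)"
  proof (rule isoI)
    show "\<Phi> \<in> hom (thompson_F\<lparr>carrier := C\<rparr>) (product_group {..<r} factor)"
      by (rule homI) (use mem hom in simp_all)
    show "bij_betw \<Phi> (carrier (thompson_F\<lparr>carrier := C\<rparr>)) (carrier (product_group {..<r} factor))"
      by (rule bij_betwI') (use inj mem surj in auto)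
  qed
  then show ?thesis unfolding is_iso_def by blast
qed

end

lemma standard_fixes:
  assumes s: "standard C P" and y: "y \<in> C" and p: "p \<in> P" shows "y p = p"
proof (cases "p = 0")
  case True
  then show ?thesis using thompson_0 subgroup_sub[OF _ y] s unfolding standard_def by blast
next
  case False
  have P: "cut_set P" using s unfolding standard_def by blast
  then have "0 < p" using False p unfolding cut_set_def by force
  then obtain a where "consecutive P a p" using consecutive_below[OF P p] by blast
  then show ?thesis using piece_D(3)[OF _ y] s unfolding standard_def by blast
qed

lemma standard_split:
  assumes s: "standard C P" and p: "subdivision p r" "\<And>i. i < r \<Longrightarrow> consecutive P (p i) (p (Suc i))"
  shows "split_subgroup C p r"
proof (rule split_subgroup.intro)
  show C: "subgroup C thompson_F" using s unfolding standard_def by blast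
  have pc: "piece C (p i) (p (Suc i))" if "i < r" for i using s p(2)[OF that] unfolding standard_def by blast
  show "subdivision p r" by fact
  have r: "0 < r" using p(1) by (auto simp: subdivision_def intro: gr0I)
  show "support_extend (p i) (p (Suc i)) y \<in> C" if y: "y \<in> C" and i: "i < r" for y i
    using piece_support_extend[OF C pc[OF i] y] by blast
  show "y (p i) = p i" if y: "y \<in> C" and i: "i \<le> r" for y i
  proof -
    have "p i \<in> P"
      using p(2)[of i] p(2)[of "i - 1"] r i unfolding consecutive_def by (cases "i = r") auto
    then show ?thesis using standard_fixes[OF s y] by blast
  qed
qed

lemma F_comm_infinite_cyclic:
  assumes h: "atomic h a b"
  shows "cyclic_group (F_comm_group h a b)" "infinite (carrier (F_comm_group h a b))"
proof -
  note iso = F_comm_iso_integer_group[OF h] and grp = F_comm_group(1)[OF h]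
  show "cyclic_group (F_comm_group h a b)"
    using isomorphic_group_cyclicity[OF iso grp group_integer_group] cyclic_integer_group by blast
  obtain f where "bij_betw f (carrier (F_comm_group h a b)) (UNIV :: int set)"
    using iso unfolding is_iso_def iso_def by auto
  then show "infinite (carrier (F_comm_group h a b))" using bij_betw_finite infinite_UNIV_int by metis
qed

text \<open>
  The factor of a piece is the whole group of the piece, trivial, or the infinite cyclic centralizer of
  an atomic element, according to the kind of the piece.
\<close>

theorem standard_decomposes:
  assumes s: "standard C P"
  shows "\<exists>(k::nat) (D :: nat \<Rightarrow> (real \<Rightarrow> real) monoid).
           (\<forall>i<k. group (D i) \<and>
              (trivial_group (D i) \<or> (cyclic_group (D i) \<and> infinite (carrier (D i))) \<or> D i \<cong> thompson_F)) \<and>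
           thompson_F\<lparr>carrier := C\<rparr> \<cong> product_group {..<k} D"
proof -
  have P: "cut_set P" using s unfolding standard_def by blast
  obtain p r where p: "subdivision p r" "\<And>i. i < r \<Longrightarrow> consecutive P (p i) (p (Suc i))"
    using cut_set_subdivision[OF P] by metis
  interpret split_subgroup C p r by (rule standard_split[OF s p])
  have "trivial_group (factor i) \<or> (cyclic_group (factor i) \<and> infinite (carrier (factor i))) \<or> factor i \<cong> thompson_F"
    if i: "i < r" for i
  proof -
    let ?a = "p i" and ?b = "p (Suc i)"
    have pc: "piece C ?a ?b" using s p(2)[OF i] unfolding standard_def by blast
    note ab = piece_D(1)[OF pc]
    show ?thesis using piece_D(4)[OF pc]
    proof (elim disjE exE conjE)
      assume "F_on ?a ?b \<subseteq> C"
      then have "C \<inter> F_on ?a ?b = F_on ?a ?b" by blast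
      then show ?thesis using F_on_iso_thompson[OF ab] by simp
    next
      assume "\<forall>y\<in>C. identity_on y ?a ?b"
      then have "C \<inter> F_on ?a ?b \<subseteq> {\<one>\<^bsub>thompson_F\<^esub>}" using F_on_identity[OF _ ab] by blast
      then have "trivial_group (factor i)" using group.trivial_group_subset[OF group_factor[OF i]] by simp
      then show ?thesis by blast
    next
      fix h assume h: "atomic h ?a ?b" "\<forall>y\<in>C. support_extend ?a ?b y \<in> F_comm h ?a ?b" "F_comm h ?a ?b \<subseteq> C"
      have "C \<inter> F_on ?a ?b \<subseteq> F_comm h ?a ?b"
      proof
        fix y assume "y \<in> C \<inter> F_on ?a ?b"
        then show "y \<in> F_comm h ?a ?b" using h(2) support_extend_F_on_self[OF _ ab, of y] by force
      qed
      then have "C \<inter> F_on ?a ?b = F_comm h ?a ?b" using h(3) F_comm_sub_F_on[of h ?a ?b] by blast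
      then show ?thesis using F_comm_infinite_cyclic[OF h(1)] unfolding F_comm_group_def by simp
    qed
  qed
  then have "\<forall>i<r. group (factor i) \<and> (trivial_group (factor i) \<or>
      (cyclic_group (factor i) \<and> infinite (carrier (factor i))) \<or> factor i \<cong> thompson_F)"
    using group_factor by simp
  then show ?thesis using iso_product by (intro exI[of _ r] exI[of _ factor]) (rule conjI)
qed

section \<open>Standard subgroups as intersections of centralizers\<close>

lemma standard_finite_intersection:
  assumes "finite S" "S \<noteq> {}" "S \<subseteq> thompson_maps"
  shows "\<exists>P. standard (\<Inter>x\<in>S. centralizer thompson_F {x}) P"
  using assms
proof (induction S rule: finite_ne_induct)
  case (singleton x)
  then show ?case using standard_centralizer[of x] by auto
next
  case (insert x S)
  then obtain P where "standard (\<Inter>x\<in>S. centralizer thompson_F {x}) P" by auto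
  then have "standard (centralizer thompson_F {x} \<inter> (\<Inter>x\<in>S. centralizer thompson_F {x})) (cuts x \<union> P)"
    using standard_Int[OF standard_centralizer] insert by blast
  then show ?case by auto
qed

text \<open>
  Adding the identity leaves the intersection unchanged and keeps the family nonempty, so that
  the formula also covers an empty set of generators.
\<close>

lemma centralizer_generate:
  assumes S: "S \<subseteq> thompson_maps"
  shows "centralizer thompson_F (generate thompson_F S) = (\<Inter>x\<in>insert \<one>\<^bsub>thompson_F\<^esub> S. centralizer thompson_F {x})"
proof
  show "centralizer thompson_F (generate thompson_F S) \<subseteq> (\<Inter>x\<in>insert \<one>\<^bsub>thompson_F\<^esub> S. centralizer thompson_F {x})"
    unfolding centralizer_def using generate.incl[of _ S thompson_F] generate.one[of thompson_F S] by auto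
  show "(\<Inter>x\<in>insert \<one>\<^bsub>thompson_F\<^esub> S. centralizer thompson_F {x}) \<subseteq> centralizer thompson_F (generate thompson_F S)"
  proof
    fix y assume y: "y \<in> (\<Inter>x\<in>insert \<one>\<^bsub>thompson_F\<^esub> S. centralizer thompson_F {x})"
    then have yT: "y \<in> thompson_maps" and c: "\<And>x. x \<in> S \<Longrightarrow> commutes x y"
      unfolding centralizer_singleton by (auto intro: commutes_sym)
    have sub: "subgroup (centralizer thompson_F {y}) thompson_F" by (rule subgroup_centralizer[OF yT])
    have "S \<subseteq> centralizer thompson_F {y}" unfolding centralizer_singleton using c S by auto
    then have "generate thompson_F S \<subseteq> centralizer thompson_F {y}" by (rule F.generate_subgroup_incl[OF _ sub])
    then show "y \<in> centralizer thompson_F (generate thompson_F S)"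
      using yT unfolding centralizer_def by fastforce
  qed
qed

text \<open>
  Two elements \<open>a\<close> and \<open>b\<close> are glued from local choices. On a full piece both are the
  identity. On an atomic piece both are the atomic element. On a trivial piece \<open>a\<close> is a bump on the
  whole piece and \<open>b\<close> a bump on its left half: what commutes with the second fixes the midpoint, and
  what commutes with the first and fixes a dyadic point inside is trivial. Elements commuting with \<open>a\<close>
  fix every cut point, because next to it there is a piece that is not full, on which \<open>a\<close> moves points
  arbitrarily near the cut point.
\<close>

theorem standard_two_centralizers:
  assumes s: "standard C P"
  shows "\<exists>a\<in>thompson_maps. \<exists>b\<in>thompson_maps. C = centralizer thompson_F {a} \<inter> centralizer thompson_F {b}"
proof -
  have P: "cut_set P" using s unfolding standard_def by blast
  obtain p r where p: "subdivision p r" "\<And>i. i < r \<Longrightarrow> consecutive P (p i) (p (Suc i))"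
    using cut_set_subdivision[OF P] by metis
  interpret split_subgroup C p r by (rule standard_split[OF s p])
  \<comment> \<open>\<open>f\<close> and \<open>g\<close> are the local choices on the \<open>i\<close>-th piece for the two elements\<close>
  define good where "good = (\<lambda>i f g. f \<in> thompson_maps \<and> g \<in> thompson_maps \<and>
      f (p i) = p i \<and> f (p (Suc i)) = p (Suc i) \<and> g (p i) = p i \<and> g (p (Suc i)) = p (Suc i) \<and>
      (\<forall>y\<in>C. commutes_on y f (p i) (p (Suc i)) \<and> commutes_on y g (p i) (p (Suc i))) \<and>
      (F_on (p i) (p (Suc i)) \<subseteq> C \<or> atomic f (p i) (p (Suc i))) \<and>
      (\<forall>y\<in>F_on (p i) (p (Suc i)). commutes_on y f (p i) (p (Suc i)) \<longrightarrow> commutes_on y g (p i) (p (Suc i)) \<longrightarrow> y \<in> C))"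
  have "\<exists>f g. good i f g" if i: "i < r" for i
  proof -
    let ?a = "p i" and ?b = "p (Suc i)"
    have pc: "piece C ?a ?b" using s p(2)[OF i] unfolding standard_def by blast
    note ab = piece_D(1)[OF pc] and ab' = dyadic_interval_facts[OF piece_D(1)[OF pc]]
    have one: "commutes_on y \<one>\<^bsub>thompson_F\<^esub> ?a ?b" if y: "y \<in> C" for y
      by (rule commutes_commutes_on[OF _ C_thompson[OF y] thompson_one_closed ab'(3,5)])
         (use C_thompson[OF y] in \<open>simp add: commutes_def\<close>)
    show ?thesis using piece_D(4)[OF pc]
    proof (elim disjE exE conjE)
      assume full: "F_on ?a ?b \<subseteq> C"
      have "good i \<one>\<^bsub>thompson_F\<^esub> \<one>\<^bsub>thompson_F\<^esub>"
        unfolding good_def using full one ab' by auto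
      then show ?thesis by blast
    next
      assume triv: "\<forall>y\<in>C. identity_on y ?a ?b"
      obtain f where f: "f \<in> F_on ?a ?b" "atomic f ?a ?b" by (rule bump_exists[OF ab])
      define m where "m = (?a + ?b) / 2"
      have m: "dyadic m" "?a < m" "m < ?b" "0 < m" "m < 1" unfolding m_def using ab' by auto
      have am: "dyadic_interval ?a m" using m ab' unfolding dyadic_interval_def by auto
      obtain g where g: "g \<in> F_on ?a m" "atomic g ?a m" by (rule bump_exists[OF am])
      have gF: "g \<in> F_on ?a ?b" using F_on_mono[OF _ _ ab am] g m by auto
      have triv_comm: "commutes_on y z ?a ?b" if y: "y \<in> C" and z: "z \<in> F_on ?a ?b" for y z
      proof (rule commutes_onI)
        fix t assume t: "?a \<le> t" "t \<le> ?b"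
        have "y t = t" "y (z t) = z t"
          using identity_onD[OF bspec[OF triv y]] F_on_range[OF z ab t] t by auto
        then show "y (z t) = z (y t)" by simp
      qed
      have gT: "g \<in> thompson_maps" by (rule F_on_thompson[OF g(1)])
      \<comment> \<open>points to the left of \<open>m\<close> are moved by the bump\<close>
      have "m \<in> bd g"
      proof -
        have "\<exists>s\<in>{0..1}. \<bar>s - m\<bar> < e \<and> g s \<noteq> s" if e: "e > 0" for e
        proof -
          obtain d where d: "dyadic d" "max ?a (m - e) < d" "d < m"
            using dyadic_dense[of "max ?a (m - e)" m] m e by auto
          then have "g d \<noteq> d" using atomic_facts(10)[OF g(2)] by simp
          then show ?thesis using d m ab' by (intro bexI[of _ d]) auto
        qed
        then show ?thesis unfolding boundary_fixpoints_def using F_on_fixes(2)[OF g(1)] m by auto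
      qed
      have "y \<in> C" if y: "y \<in> F_on ?a ?b" "commutes_on y f ?a ?b" "commutes_on y g ?a ?b" for y
      proof -
        have "commutes y g" by (rule F_on_commutes[OF y(1) ab gT F_on_fixes[OF gF] y(3)])
        then have "y m = m" using centralizer_fixes_boundary[OF gT F_on_thompson[OF y(1)] _ \<open>m \<in> bd g\<close>] by blast
        then have "\<not> atomic y ?a ?b" using atomic_facts(10)[of y ?a ?b m] m by blast
        moreover have "y \<in> F_comm f ?a ?b" unfolding F_comm_def using y by blast
        ultimately have "y = \<one>\<^bsub>thompson_F\<^esub>" using F_comm_nontrivial_atomic[OF f(2)] by blast
        then show ?thesis using subgroup.one_closed[OF C] by simp
      qed
      then have "good i f g"
        unfolding good_def using f gF gT triv_comm F_on_thompson F_on_fixes by blast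
      then show ?thesis by blast
    next
      fix h assume h: "atomic h ?a ?b" "\<forall>y\<in>C. support_extend ?a ?b y \<in> F_comm h ?a ?b" "F_comm h ?a ?b \<subseteq> C"
      note h' = atomic_facts[OF h(1)]
      have "commutes_on y h ?a ?b" if y: "y \<in> C" for y
      proof (rule commutes_onI)
        fix t assume t: "?a \<le> t" "t \<le> ?b"
        have c: "commutes_on (support_extend ?a ?b y) h ?a ?b" using F_comm_commutes h(2) y by blast
        have "?a \<le> h t" "h t \<le> ?b" using thompson_preserves_interval[OF h'(1,3,4) ab'(3,5) t] by auto
        then show "y (h t) = h (y t)" using commutes_onD[OF c t] t ab' by simp
      qed
      then have "good i h h" unfolding good_def using h h' F_comm_def by blast
      then show ?thesis by blast
    qed
  qed
  then obtain f g where fg: "\<And>i. i < r \<Longrightarrow> good i (f i) (g i)" by metis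
  have f: "f i \<in> thompson_maps \<and> f i (p i) = p i \<and> f i (p (Suc i)) = p (Suc i)"
    and g: "g i \<in> thompson_maps \<and> g i (p i) = p i \<and> g i (p (Suc i)) = p (Suc i)" if "i < r" for i
    using fg[OF that] unfolding good_def by blast+
  obtain a where a: "a \<in> thompson_maps" "\<And>i t. i < r \<Longrightarrow> p i \<le> t \<Longrightarrow> t \<le> p (Suc i) \<Longrightarrow> a t = f i t"
    using glue_pieces[OF p(1) f] by metis
  obtain b where b: "b \<in> thompson_maps" "\<And>i t. i < r \<Longrightarrow> p i \<le> t \<Longrightarrow> t \<le> p (Suc i) \<Longrightarrow> b t = g i t"
    using glue_pieces[OF p(1) g] by metis
  have le: "p i \<le> p (Suc i)" if "i < r" for i using dyadic_interval_facts[OF interval[OF that]] by simp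
  \<comment> \<open>commutation over a piece depends only on the values on that piece\<close>
  have transfer: "commutes_on y z (p i) (p (Suc i)) \<longleftrightarrow> commutes_on y z' (p i) (p (Suc i))"
    if i: "i < r" and y: "y \<in> thompson_maps" "y (p i) = p i" "y (p (Suc i)) = p (Suc i)"
      and zz: "\<forall>t. p i \<le> t \<longrightarrow> t \<le> p (Suc i) \<longrightarrow> z t = z' t" for y z z' i
  proof -
    note i' = dyadic_interval_facts[OF interval[OF i]]
    have "y (z t) = z (y t) \<longleftrightarrow> y (z' t) = z' (y t)" if t: "p i \<le> t" "t \<le> p (Suc i)" for t
      using zz t thompson_preserves_interval[OF y i'(3,5) t] by simp
    then show ?thesis unfolding commutes_on_def by blast
  qed
  have fa: "\<forall>t. p i \<le> t \<longrightarrow> t \<le> p (Suc i) \<longrightarrow> a t = f i t"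
    and gb: "\<forall>t. p i \<le> t \<longrightarrow> t \<le> p (Suc i) \<longrightarrow> b t = g i t" if "i < r" for i
    using a(2)[OF that] b(2)[OF that] by simp_all
  have commutes_local: "commutes y z"
    if y: "y \<in> thompson_maps" and z: "z \<in> thompson_maps" and c: "\<And>i. i < r \<Longrightarrow> commutes_on y z (p i) (p (Suc i))" for y z
  proof (subst commutes_iff[OF y z], intro allI impI)
    fix t :: real assume "0 \<le> t" "t \<le> 1"
    then obtain i where i: "i < r" "p i \<le> t" "t \<le> p (Suc i)" by (rule subdivision_locate[OF p(1)])
    show "y (z t) = z (y t)" by (rule commutes_onD[OF c[OF i(1)] i(2,3)])
  qed
  have "C \<subseteq> centralizer thompson_F {a} \<inter> centralizer thompson_F {b}"
  proof
    fix y assume y: "y \<in> C"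
    note yT = C_thompson[OF y]
    have "commutes_on y a (p i) (p (Suc i)) \<and> commutes_on y b (p i) (p (Suc i))" if i: "i < r" for i
    proof -
      have yp: "y (p i) = p i" "y (p (Suc i)) = p (Suc i)" using fixes_p[OF y] i by auto
      have "commutes_on y (f i) (p i) (p (Suc i)) \<and> commutes_on y (g i) (p i) (p (Suc i))"
        using fg[OF i] y unfolding good_def by blast
      then show ?thesis using transfer[OF i yT yp fa[OF i]] transfer[OF i yT yp gb[OF i]] by blast
    qed
    then show "y \<in> centralizer thompson_F {a} \<inter> centralizer thompson_F {b}"
      unfolding centralizer_singleton using yT commutes_local a(1) b(1) by blast
  qed
  moreover have "centralizer thompson_F {a} \<inter> centralizer thompson_F {b} \<subseteq> C"
  proof
    fix y assume "y \<in> centralizer thompson_F {a} \<inter> centralizer thompson_F {b}"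
    then have yT: "y \<in> thompson_maps" and ya: "commutes y a" and yb: "commutes y b"
      unfolding centralizer_singleton by auto
    have a_moves: "a t \<noteq> t" if i: "i < r" "\<not> F_on (p i) (p (Suc i)) \<subseteq> C" and t: "dyadic t" "p i < t" "t < p (Suc i)" for i t
    proof -
      have "atomic (f i) (p i) (p (Suc i))" using fg[OF i(1)] i(2) unfolding good_def by blast
      then have "f i t \<noteq> t" using atomic_facts(10) t by blast
      then show ?thesis using a(2)[OF i(1)] t by simp
    qed
    have a_fix: "a (p i) = p i \<and> a (p (Suc i)) = p (Suc i)" if i: "i < r" for i
      using a(2)[OF i, of "p i"] a(2)[OF i, of "p (Suc i)"] f[OF i] le[OF i] by simp
    \<comment> \<open>interior cut points are boundary fixed points of \<open>a\<close>\<close>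
    have yp: "y (p (Suc i)) = p (Suc i)" if i: "Suc i < r" for i
    proof (rule centralizer_fixes_boundary[OF a(1) yT ya])
      let ?p = "p (Suc i)"
      have ir: "i < r" using i by simp
      note i1 = dyadic_interval_facts[OF interval[OF ir]] and i2 = dyadic_interval_facts[OF interval[OF i]]
      have "?p \<in> P" using p(2)[OF i] unfolding consecutive_def by blast
      then have "\<not> (F_on (p i) ?p \<subseteq> C \<and> F_on ?p (p (Suc (Suc i))) \<subseteq> C)"
        using s interval[OF ir] interval[OF i] unfolding standard_def by blast
      moreover have "\<exists>s\<in>{0..1}. \<bar>s - ?p\<bar> < e \<and> a s \<noteq> s" if e: "e > 0" and nf: "\<not> F_on (p i) ?p \<subseteq> C" for e
      proof -
        have "max (p i) (?p - e) < ?p" using e i1 by simp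
        then obtain d where d: "dyadic d" "max (p i) (?p - e) < d" "d < ?p" by (rule dyadic_dense)
        have "a d \<noteq> d" by (rule a_moves[OF ir nf d(1)]) (use d in auto)
        then show ?thesis using d i1 by (intro bexI[of _ d]) auto
      qed
      moreover have "\<exists>s\<in>{0..1}. \<bar>s - ?p\<bar> < e \<and> a s \<noteq> s" if e: "e > 0" and nf: "\<not> F_on ?p (p (Suc (Suc i))) \<subseteq> C" for e
      proof -
        have "?p < min (p (Suc (Suc i))) (?p + e)" using e i2 by simp
        then obtain d where d: "dyadic d" "?p < d" "d < min (p (Suc (Suc i))) (?p + e)" by (rule dyadic_dense)
        have "a d \<noteq> d" by (rule a_moves[OF i nf d(1)]) (use d in auto)
        then show ?thesis using d i2 by (intro bexI[of _ d]) auto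
      qed
      moreover have "a ?p = ?p" using a_fix[OF ir] by blast
      ultimately show "?p \<in> bd a" unfolding boundary_fixpoints_def using i1 i2 by auto
    qed
    have yp': "y (p i) = p i" if ir: "i \<le> r" for i
    proof -
      consider "i = 0" | "i = r" | j where "i = Suc j" "Suc j < r" using ir by (cases i) force+
      then show ?thesis
      proof cases
        case 1 then show ?thesis using p(1) thompson_0[OF yT] by (simp add: subdivision_def)
      next
        case 2 then show ?thesis using p(1) thompson_1[OF yT] by (simp add: subdivision_def)
      next
        case 3 then show ?thesis using yp by blast
      qed
    qed
    have fy: "support_extend (p i) (p (Suc i)) y \<in> C \<inter> F_on (p i) (p (Suc i))" if i: "i < r" for i
    proof -
      note i' = dyadic_interval_facts[OF interval[OF i]]
      have yi: "y (p i) = p i" "y (p (Suc i)) = p (Suc i)" using yp' i by auto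
      have F: "support_extend (p i) (p (Suc i)) y \<in> F_on (p i) (p (Suc i))"
        by (rule support_extend_self[OF yT yi interval[OF i]])
      have "commutes_on y a (p i) (p (Suc i))" "commutes_on y b (p i) (p (Suc i))"
        using commutes_commutes_on[OF ya yT a(1) i'(3,5)] commutes_commutes_on[OF yb yT b(1) i'(3,5)] by blast+
      then have "commutes_on y (f i) (p i) (p (Suc i))" "commutes_on y (g i) (p i) (p (Suc i))"
        using transfer[OF i yT yi fa[OF i]] transfer[OF i yT yi gb[OF i]] by blast+
      then have "commutes_on (support_extend (p i) (p (Suc i)) y) (f i) (p i) (p (Suc i))"
        "commutes_on (support_extend (p i) (p (Suc i)) y) (g i) (p i) (p (Suc i))"
        using support_extend_commutes_on[OF _ _ _ _ interval[OF i]] f[OF i] g[OF i] by blast+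
      then show ?thesis using fg[OF i] F unfolding good_def by blast
    qed
    \<comment> \<open>\<open>y\<close> is glued from its restrictions, which lie in \<open>C\<close>\<close>
    obtain z where z: "z \<in> C" "\<And>i t. i < r \<Longrightarrow> p i \<le> t \<Longrightarrow> t \<le> p (Suc i) \<Longrightarrow> z t = support_extend (p i) (p (Suc i)) y t"
      using glue_factors[of "\<lambda>i. support_extend (p i) (p (Suc i)) y", OF fy] by metis
    have "y = z"
    proof (rule thompson_eqI[OF yT C_thompson[OF z(1)]])
      fix t :: real assume t: "0 \<le> t" "t \<le> 1"
      then obtain i where i: "i < r" "p i \<le> t" "t \<le> p (Suc i)" by (rule subdivision_locate[OF p(1)])
      show "y t = z t" using z(2)[OF i] i t by simp
    qed
    then show "y \<in> C" using z(1) by simp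
  qed
  ultimately show ?thesis using a(1) b(1) by blast
qed

section \<open>The structure of the centralizer of one element\<close>

lemma product_group_union_iso:
  fixes G :: "'i \<Rightarrow> ('a, 'b) monoid_scheme"
  assumes AB: "A \<inter> B = {}"
  shows "product_group (A \<union> B) G \<cong> product_group A G \<times>\<times> product_group B G"
proof -
  define \<Phi> :: "('i \<Rightarrow> 'a) \<Rightarrow> ('i \<Rightarrow> 'a) \<times> ('i \<Rightarrow> 'a)" where "\<Phi> = (\<lambda>f. (restrict f A, restrict f B))"
  have "\<Phi> \<in> iso (product_group (A \<union> B) G) (product_group A G \<times>\<times> product_group B G)"
  proof (rule isoI)
    show "\<Phi> \<in> hom (product_group (A \<union> B) G) (product_group A G \<times>\<times> product_group B G)"
      by (rule homI) (auto simp: \<Phi>_def DirProd_def PiE_iff)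
    show "bij_betw \<Phi> (carrier (product_group (A \<union> B) G)) (carrier (product_group A G \<times>\<times> product_group B G))"
    proof (rule bij_betwI')
      fix f g assume fg: "f \<in> carrier (product_group (A \<union> B) G)" "g \<in> carrier (product_group (A \<union> B) G)"
      show "(\<Phi> f = \<Phi> g) = (f = g)"
      proof
        assume eq: "\<Phi> f = \<Phi> g"
        have "f i = g i" if "i \<in> A \<union> B" for i
          using eq that unfolding \<Phi>_def by (metis Pair_inject Un_iff restrict_apply')
        with fg show "f = g" unfolding carrier_product_group by (rule PiE_ext)
      qed simp
    next
      fix f assume "f \<in> carrier (product_group (A \<union> B) G)"
      then show "\<Phi> f \<in> carrier (product_group A G \<times>\<times> product_group B G)"
        unfolding \<Phi>_def by (auto simp: DirProd_def)
    next
      fix fg assume "fg \<in> carrier (product_group A G \<times>\<times> product_group B G)"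
      then obtain f g where fg: "fg = (f, g)" "f \<in> (\<Pi>\<^sub>E i\<in>A. carrier (G i))" "g \<in> (\<Pi>\<^sub>E i\<in>B. carrier (G i))"
        unfolding DirProd_def by auto
      let ?h = "\<lambda>i. if i \<in> A then f i else if i \<in> B then g i else undefined"
      have "restrict ?h A = f" "restrict ?h B = g"
        using fg(2,3) AB by (auto simp: PiE_def extensional_def restrict_def fun_eq_iff)
      moreover have "?h \<in> carrier (product_group (A \<union> B) G)" using fg(2,3) by (auto simp: PiE_iff extensional_def)
      ultimately show "\<exists>h\<in>carrier (product_group (A \<union> B) G). fg = \<Phi> h"
        unfolding \<Phi>_def fg(1) by (intro bexI[of _ ?h]) simp_all
    qed
  qed
  then show ?thesis unfolding is_iso_def by blast
qed

lemma product_group_reindex_iso: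
  fixes G :: "('a, 'b) monoid_scheme" and s :: "'j \<Rightarrow> 'i"
  assumes s: "bij_betw s J I"
  shows "product_group I (\<lambda>_. G) \<cong> product_group J (\<lambda>_. G)"
proof -
  define \<Phi> :: "('i \<Rightarrow> 'a) \<Rightarrow> 'j \<Rightarrow> 'a" where "\<Phi> = (\<lambda>f. \<lambda>j\<in>J. f (s j))"
  have sJ: "s j \<in> I" if "j \<in> J" for j using s that bij_betwE by blast
  have "\<Phi> \<in> iso (product_group I (\<lambda>_. G)) (product_group J (\<lambda>_. G))"
  proof (rule isoI)
    show "\<Phi> \<in> hom (product_group I (\<lambda>_. G)) (product_group J (\<lambda>_. G))"
      by (rule homI) (use sJ in \<open>auto simp: \<Phi>_def PiE_iff intro!: restrict_ext\<close>)
    show "bij_betw \<Phi> (carrier (product_group I (\<lambda>_. G))) (carrier (product_group J (\<lambda>_. G)))"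
    proof (rule bij_betwI')
      fix f g assume fg: "f \<in> carrier (product_group I (\<lambda>_. G))" "g \<in> carrier (product_group I (\<lambda>_. G))"
      show "(\<Phi> f = \<Phi> g) = (f = g)"
      proof
        assume eq: "\<Phi> f = \<Phi> g"
        have "f i = g i" if i: "i \<in> I" for i
        proof -
          obtain j where "j \<in> J" "i = s j" using s i by (auto simp: bij_betw_def)
          then show ?thesis using fun_cong[OF eq, of j] unfolding \<Phi>_def by simp
        qed
        with fg show "f = g" unfolding carrier_product_group by (rule PiE_ext)
      qed simp
    next
      fix f assume "f \<in> carrier (product_group I (\<lambda>_. G))"
      then show "\<Phi> f \<in> carrier (product_group J (\<lambda>_. G))" unfolding \<Phi>_def using sJ by auto
    next
      fix f assume f: "f \<in> carrier (product_group J (\<lambda>_. G))"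
      let ?h = "\<lambda>i\<in>I. f (inv_into J s i)"
      have inv: "inv_into J s (s j) = j" if "j \<in> J" for j using s that by (auto simp: bij_betw_def)
      have "inv_into J s i \<in> J" if "i \<in> I" for i using s that by (metis bij_betw_def inv_into_into)
      then have "?h \<in> carrier (product_group I (\<lambda>_. G))" using f by (auto simp: PiE_iff)
      moreover have "f = \<Phi> ?h" unfolding \<Phi>_def using f inv sJ by (auto simp: PiE_iff extensional_def restrict_def fun_eq_iff)
      ultimately show "\<exists>h\<in>carrier (product_group I (\<lambda>_. G)). f = \<Phi> h" by blast
    qed
  qed
  then show ?thesis unfolding is_iso_def by blast
qed

lemma product_group_card_iso:
  fixes G :: "('a, 'b) monoid_scheme" and D :: "'i \<Rightarrow> ('c, 'd) monoid_scheme"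
  assumes "finite I" "card I = n" "\<And>i. i \<in> I \<Longrightarrow> D i \<cong> G" "\<And>i. i \<in> I \<Longrightarrow> group (D i)" "group G"
  shows "product_group I D \<cong> product_group {..<n} (\<lambda>_. G)"
proof -
  have "product_group I D \<cong> product_group I (\<lambda>_. G)" by (rule iso_product_groupI) (use assms in auto)
  moreover obtain s where "bij_betw s {..<n} I"
    using ex_bij_betw_nat_finite[OF assms(1)] assms(2) by (auto simp: atLeast0LessThan)
  then have "product_group I (\<lambda>_. G) \<cong> product_group {..<n} (\<lambda>_. G)" by (rule product_group_reindex_iso)
  ultimately show ?thesis by (rule iso_trans)
qed

text \<open>
  Every index with the property, except possibly the last, is followed by one without it.
\<close>

lemma card_no_two_consecutive:
  assumes "\<And>i. Suc i < r \<Longrightarrow> \<not> (Q i \<and> Q (Suc i))"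
  shows "card {i. i < r \<and> Q i} \<le> card {i. i < r \<and> \<not> Q i} + 1"
proof -
  have sub: "Suc ` ({i. i < r \<and> Q i} - {r - 1}) \<subseteq> {i. i < r \<and> \<not> Q i}"
  proof
    fix j assume "j \<in> Suc ` ({i. i < r \<and> Q i} - {r - 1})"
    then obtain i where "j = Suc i" "i < r" "Q i" "i \<noteq> r - 1" by auto
    then show "j \<in> {i. i < r \<and> \<not> Q i}" using assms[of i] by auto
  qed
  have "card ({i. i < r \<and> Q i} - {r - 1}) = card (Suc ` ({i. i < r \<and> Q i} - {r - 1}))" by (simp add: card_image)
  also have "\<dots> \<le> card {i. i < r \<and> \<not> Q i}" by (rule card_mono[OF _ sub]) simp
  finally show ?thesis using card_Diff1_le[of "{i. i < r \<and> Q i}" "r - 1"] card_Diff_singleton_if[of "{i. i < r \<and> Q i}" "r - 1"]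
    by (auto split: if_splits)
qed

text \<open>
  The cyclic factors come from the atomic pieces and the copies of the whole group from the identity
  pieces; no two identity pieces are adjacent, so there is at most one more of them.
\<close>

theorem centralizer_element_structure:
  assumes x: "x \<in> thompson_maps"
  shows "\<exists>m n :: nat. m \<le> n + 1 \<and> thompson_F\<lparr>carrier := centralizer thompson_F {x}\<rparr> \<cong>
          product_group {..<m} (\<lambda>_. thompson_F) \<times>\<times> product_group {..<n} (\<lambda>_. integer_group)"
proof -
  let ?C = "centralizer thompson_F {x}"
  have s: "standard ?C (cuts x)" by (rule standard_centralizer[OF x])
  obtain p r where p: "subdivision p r" "\<And>i. i < r \<Longrightarrow> consecutive (cuts x) (p i) (p (Suc i))"
    using cut_set_subdivision[OF cut_set_cuts[OF x]] by metis
  interpret split_subgroup ?C p r by (rule standard_split[OF s p])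
  define Q where "Q = (\<lambda>i. identity_on x (p i) (p (Suc i)))"
  define A where "A = {i. i < r \<and> Q i}"
  define B where "B = {i. i < r \<and> \<not> Q i}"
  have AB: "A \<inter> B = {}" "{..<r} = A \<union> B" "finite A" "finite B" unfolding A_def B_def by auto
  have le: "card A \<le> card B + 1"
    unfolding A_def B_def
    by (rule card_no_two_consecutive) (use cuts_not_identity_both[OF x p(2) p(2)] Q_def Suc_lessD in blast)
  have fA: "factor i \<cong> thompson_F" if "i \<in> A" for i
  proof -
    have i: "i < r" "identity_on x (p i) (p (Suc i))" using that unfolding A_def Q_def by auto
    have "?C \<inter> F_on (p i) (p (Suc i)) = F_on (p i) (p (Suc i))"
      using F_on_sub_centralizer[OF x interval[OF i(1)] i(2)] by blast
    then show ?thesis using F_on_iso_thompson[OF interval[OF i(1)]] by simp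
  qed
  have fB: "factor i \<cong> integer_group" if "i \<in> B" for i
  proof -
    let ?a = "p i" and ?b = "p (Suc i)"
    have i: "i < r" "\<not> identity_on x ?a ?b" using that unfolding B_def Q_def by auto
    have at: "atomic x ?a ?b" using cuts_identity_or_atomic[OF x p(2)[OF i(1)]] i(2) by blast
    have fixes_ab: "y ?a = ?a \<and> y ?b = ?b" if "y \<in> ?C" for y using fixes_p[OF that] i(1) by simp
    note cp = atomic_centralizer_piece[OF at fixes_ab]
    have "?C \<inter> F_on ?a ?b \<subseteq> F_comm x ?a ?b"
    proof
      fix y assume "y \<in> ?C \<inter> F_on ?a ?b"
      then show "y \<in> F_comm x ?a ?b" using cp(1) support_extend_F_on_self[OF _ interval[OF i(1)], of y] by force
    qed
    then have "?C \<inter> F_on ?a ?b = F_comm x ?a ?b" using cp(2) F_comm_sub_F_on[of x ?a ?b] by blast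
    then show ?thesis using F_comm_iso_integer_group[OF at] unfolding F_comm_group_def by simp
  qed
  have grp: "group (factor i)" if "i \<in> A \<union> B" for i using that group_factor AB(2) by auto
  have iso1: "product_group {..<r} factor \<cong> product_group A factor \<times>\<times> product_group B factor"
    unfolding AB(2) by (rule product_group_union_iso[OF AB(1)])
  have iso2: "product_group A factor \<times>\<times> product_group B factor \<cong>
      product_group {..<card A} (\<lambda>_. thompson_F) \<times>\<times> product_group {..<card B} (\<lambda>_. integer_group)"
  proof -
    have "product_group A factor \<cong> product_group {..<card A} (\<lambda>_. thompson_F)"
      by (rule product_group_card_iso) (use AB fA grp F.group_axioms in auto)
    moreover have "product_group B factor \<cong> product_group {..<card B} (\<lambda>_. integer_group)"
      by (rule product_group_card_iso) (use AB fB grp group_integer_group in auto)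
    moreover have "group (product_group A factor)" using grp by (intro product_group) blast
    ultimately show ?thesis using group.DirProd_iso_trans by blast
  qed
  show ?thesis using le iso_trans[OF iso_trans[OF iso_product iso1] iso2] by blast
qed

section \<open>Centralizers of several elements\<close>

text \<open>
  Such a centralizer is a finite intersection of standard subgroups.
\<close>

theorem centralizer_finitely_generated:
  assumes "finitely_generated_subgroup thompson_F A"
  shows "\<exists>(k::nat) (D :: nat \<Rightarrow> (real \<Rightarrow> real) monoid).
           (\<forall>i<k. group (D i) \<and>
              (trivial_group (D i) \<or> (cyclic_group (D i) \<and> infinite (carrier (D i))) \<or> D i \<cong> thompson_F)) \<and>
           thompson_F\<lparr>carrier := centralizer thompson_F A\<rparr> \<cong> product_group {..<k} D"
proof -
  obtain S where S: "finite S" "S \<subseteq> thompson_maps" "A = generate thompson_F S"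
    using assms unfolding finitely_generated_subgroup_def by auto
  have "\<exists>P. standard (\<Inter>x\<in>insert \<one>\<^bsub>thompson_F\<^esub> S. centralizer thompson_F {x}) P"
    by (rule standard_finite_intersection) (use S in auto)
  then obtain P where "standard (centralizer thompson_F A) P"
    unfolding S(3) centralizer_generate[OF S(2)] by blast
  then show ?thesis by (rule standard_decomposes)
qed

theorem centralizer_intersection_two:
  fixes x :: "nat \<Rightarrow> real \<Rightarrow> real"
  assumes "k \<ge> 2" "\<forall>i<k. x i \<in> thompson_maps"
  shows "\<exists>a \<in> thompson_maps. \<exists>b \<in> thompson_maps.
           (\<Inter>i<k. centralizer thompson_F {x i}) = centralizer thompson_F {a} \<inter> centralizer thompson_F {b}"
proof -
  have "\<exists>P. standard (\<Inter>y\<in>x ` {..<k}. centralizer thompson_F {y}) P"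
    by (rule standard_finite_intersection) (use assms in \<open>auto simp: lessThan_empty_iff\<close>)
  then obtain P where "standard (\<Inter>i<k. centralizer thompson_F {x i}) P" by auto
  then show ?thesis by (rule standard_two_centralizers)
qed

section \<open>Dyadic cells\<close>

text \<open>
  The map sends the \<open>i\<close>-th dyadic cell of length \<open>2\<^sup>-\<^sup>E\<close> affinely and increasingly onto the \<open>j\<close>-th cell
  of length \<open>2\<^sup>-\<^sup>E\<^sup>'\<close>; the parameter \<open>s\<close> is the relative position in the cell.
\<close>

definition cell_map :: "(real \<Rightarrow> real) \<Rightarrow> nat \<Rightarrow> nat \<Rightarrow> nat \<Rightarrow> nat \<Rightarrow> bool" where
  "cell_map f E i E' j \<longleftrightarrow> (\<forall>s. 0 \<le> s \<longrightarrow> s \<le> 1 \<longrightarrow> f ((real i + s) / 2 ^ E) = (real j + s) / 2 ^ E')"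

definition cell_fine :: "nat \<Rightarrow> (real \<Rightarrow> real) \<Rightarrow> bool" where
  "cell_fine e f \<longleftrightarrow> (\<forall>E\<ge>e. \<forall>i<2 ^ E. \<exists>E' j. E \<le> E' + e \<and> E' \<le> E + e \<and> j < 2 ^ E' \<and> cell_map f E i E' j)"

definition in_cell :: "nat \<Rightarrow> nat \<Rightarrow> real \<Rightarrow> bool" where
  "in_cell E i t \<longleftrightarrow> real i / 2 ^ E \<le> t \<and> t \<le> (real i + 1) / 2 ^ E"

lemma cell_mapD: "cell_map f E i E' j \<Longrightarrow> 0 \<le> s \<Longrightarrow> s \<le> 1 \<Longrightarrow> f ((real i + s) / 2 ^ E) = (real j + s) / 2 ^ E'"
  unfolding cell_map_def by blast

lemma cell_mapI: "(\<And>s. 0 \<le> s \<Longrightarrow> s \<le> 1 \<Longrightarrow> f ((real i + s) / 2 ^ E) = (real j + s) / 2 ^ E') \<Longrightarrow> cell_map f E i E' j"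
  unfolding cell_map_def by blast

lemma cell_fineD: "cell_fine e f \<Longrightarrow> e \<le> E \<Longrightarrow> i < 2 ^ E \<Longrightarrow> \<exists>E' j. E \<le> E' + e \<and> E' \<le> E + e \<and> j < 2 ^ E' \<and> cell_map f E i E' j"
  unfolding cell_fine_def by blast

lemma cell_fineI: "(\<And>E i. e \<le> E \<Longrightarrow> i < 2 ^ E \<Longrightarrow> \<exists>E' j. E \<le> E' + e \<and> E' \<le> E + e \<and> j < 2 ^ E' \<and> cell_map f E i E' j) \<Longrightarrow> cell_fine e f"
  unfolding cell_fine_def by blast

lemma cell_fine_mono:
  assumes "cell_fine e f" "e \<le> e'" shows "cell_fine e' f"
proof (rule cell_fineI)
  fix E i assume E: "e' \<le> E" "i < (2::nat) ^ E"
  then obtain E' j where "E \<le> E' + e" "E' \<le> E + e" "j < 2 ^ E'" "cell_map f E i E' j"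
    using cell_fineD[OF assms(1), of E i] assms(2) by auto
  then show "\<exists>E' j. E \<le> E' + e' \<and> E' \<le> E + e' \<and> j < 2 ^ E' \<and> cell_map f E i E' j"
    using assms(2) by (intro exI[of _ E'] exI[of _ j]) auto
qed

lemma in_cell_param:
  assumes "in_cell E i t" obtains s where "0 \<le> s" "s \<le> 1" "t = (real i + s) / 2 ^ E"
proof (rule that[of "t * 2 ^ E - real i"])
  show "0 \<le> t * 2 ^ E - real i" "t * 2 ^ E - real i \<le> 1"
    using assms unfolding in_cell_def by (simp_all add: field_simps)
qed simp

lemma in_cellI: "0 \<le> s \<Longrightarrow> s \<le> 1 \<Longrightarrow> in_cell E i ((real i + s) / 2 ^ E)"
  unfolding in_cell_def by (simp add: divide_right_mono)

lemma cell_range: "i < 2 ^ E \<Longrightarrow> 0 \<le> s \<Longrightarrow> s \<le> 1 \<Longrightarrow> 0 \<le> (real i + s) / 2 ^ E \<and> (real i + s) / 2 ^ E \<le> 1"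
proof -
  assume a: "i < 2 ^ E" "0 \<le> s" "s \<le> 1"
  have "real (Suc i) \<le> real (2 ^ E)" using a(1) by (simp only: of_nat_le_iff Suc_le_eq)
  then have "real i + s \<le> 2 ^ E" using a(3) by simp
  then show ?thesis using a(2) by simp
qed

lemma cell_exists:
  assumes "0 \<le> t" "t \<le> 1" obtains i where "i < 2 ^ E" "in_cell E i t"
proof (cases "t = 1")
  case True
  have "in_cell E (2 ^ E - 1) t" unfolding in_cell_def True by (simp add: of_nat_diff divide_simps)
  then show thesis by (intro that[of "2 ^ E - 1"]) simp_all
next
  case False
  define i where "i = nat \<lfloor>t * 2 ^ E\<rfloor>"
  have ri: "real i = of_int \<lfloor>t * 2 ^ E\<rfloor>" unfolding i_def using assms by simp
  have "t * 2 ^ E < 2 ^ E" using False assms by simp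
  then have "real i < 2 ^ E" unfolding ri by linarith
  then have "i < 2 ^ E" by (metis of_nat_less_numeral_power_cancel_iff)
  moreover have "in_cell E i t" unfolding in_cell_def ri by (simp add: field_simps) linarith
  ultimately show thesis by (rule that)
qed

lemma cell_index_bound:
  assumes "(real j + 1) / 2 ^ E \<le> 1" shows "j < 2 ^ E"
proof -
  have "real j + 1 \<le> 2 ^ E" using assms by simp
  then have "real j < 2 ^ E" by linarith
  then show ?thesis by (metis of_nat_less_numeral_power_cancel_iff)
qed

lemma cell_map_index_bound:
  assumes "cell_map f E i E' j" "i < 2 ^ E" "f \<in> thompson_maps" shows "j < 2 ^ E'"
proof (rule cell_index_bound)
  have "f ((real i + 1) / 2 ^ E) \<le> 1" using thompson_range[OF assms(3)] cell_range[OF assms(2), of 1] by simp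
  then show "(real j + 1) / 2 ^ E' \<le> 1" using cell_mapD[OF assms(1), of 1] by simp
qed

text \<open>
  The midpoint of a small cell lies in only one cell of any coarser level, whereas an endpoint may
  belong to two.
\<close>

lemma subcell_of_midpoint:
  assumes "e \<le> E" "in_cell e i0 ((real i + 1 / 2) / 2 ^ E)"
  obtains q where "q < 2 ^ (E - e)" "i = i0 * 2 ^ (E - e) + q"
proof -
  let ?D = "2 ^ (E - e) :: nat"
  have E: "(2::real) ^ E = 2 ^ e * real ?D" using assms(1) by (simp add: power_add[symmetric])
  have "real i0 * real ?D \<le> real i + 1 / 2" "real i + 1 / 2 \<le> (real i0 + 1) * real ?D"
  proof -
    have "real i0 / 2 ^ e * 2 ^ E \<le> real i + 1 / 2" "real i + 1 / 2 \<le> (real i0 + 1) / 2 ^ e * 2 ^ E"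
      using assms(2) unfolding in_cell_def by (simp_all add: pos_le_divide_eq pos_divide_le_eq)
    then show "real i0 * real ?D \<le> real i + 1 / 2" "real i + 1 / 2 \<le> (real i0 + 1) * real ?D"
      unfolding E by simp_all
  qed
  then have "real (i0 * ?D) < real i + 1" "real i < real ((i0 + 1) * ?D)" by (simp_all add: algebra_simps)
  then have "i0 * ?D < i + 1" "i < (i0 + 1) * ?D" by linarith+
  then show thesis by (intro that[of "i - i0 * ?D"]) (simp_all add: algebra_simps)
qed

lemma cell_map_subcell:
  assumes "cell_map f e i e' j" "q < 2 ^ d"
  shows "cell_map f (e + d) (i * 2 ^ d + q) (e' + d) (j * 2 ^ d + q)"
proof (rule cell_mapI)
  fix s :: real assume s: "0 \<le> s" "s \<le> 1"
  define s' where "s' = (real q + s) / 2 ^ d"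
  have "0 \<le> s'" "s' \<le> 1" using cell_range[OF assms(2) s] unfolding s'_def by auto
  then have "f ((real i + s') / 2 ^ e) = (real j + s') / 2 ^ e'" by (rule cell_mapD[OF assms(1)])
  moreover have "(real (k * 2 ^ d + q) + s) / 2 ^ (l + d) = (real k + s') / 2 ^ l" for k l
    unfolding s'_def by (simp add: power_add field_simps)
  ultimately show "f ((real (i * 2 ^ d + q) + s) / 2 ^ (e + d)) = (real (j * 2 ^ d + q) + s) / 2 ^ (e' + d)" by simp
qed

lemma cell_map_comp:
  assumes "cell_map g E i E1 j" "cell_map f E1 j E2 k" shows "cell_map (\<lambda>t. f (g t)) E i E2 k"
  by (rule cell_mapI) (simp only: cell_mapD[OF assms(1)] cell_mapD[OF assms(2)])

lemma cell_fine_comp: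
  assumes f: "cell_fine e1 f" and g: "cell_fine e2 g" shows "cell_fine (e1 + e2) (\<lambda>t. f (g t))"
proof (rule cell_fineI)
  fix E i assume E: "e1 + e2 \<le> E" "i < (2::nat) ^ E"
  then obtain E1 j where 1: "E \<le> E1 + e2" "E1 \<le> E + e2" "j < 2 ^ E1" "cell_map g E i E1 j"
    using cell_fineD[OF g, of E i] by auto
  then obtain E2 k where 2: "E1 \<le> E2 + e1" "E2 \<le> E1 + e1" "k < 2 ^ E2" "cell_map f E1 j E2 k"
    using cell_fineD[OF f, of E1 j] E by auto
  have "cell_map (\<lambda>t. f (g t)) E i E2 k" by (rule cell_map_comp[OF 1(4) 2(4)])
  then show "\<exists>E' j. E \<le> E' + (e1 + e2) \<and> E' \<le> E + (e1 + e2) \<and> j < 2 ^ E' \<and> cell_map (\<lambda>t. f (g t)) E i E' j"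
    using 1 2 by (intro exI[of _ E2] exI[of _ k]) auto
qed

lemma cell_fine_funpow: "cell_fine e f \<Longrightarrow> cell_fine (n * e) (f ^^ n)"
proof (induction n)
  case 0
  have "cell_fine 0 (\<lambda>t. t)" by (rule cell_fineI) (auto simp: cell_map_def)
  then show ?case by (simp add: id_def)
next
  case (Suc n)
  have "cell_fine (e + n * e) (\<lambda>t. f ((f ^^ n) t))" by (rule cell_fine_comp) (use Suc in auto)
  then show ?case by (simp add: comp_def)
qed

text \<open>
  The image of a cell of length \<open>2\<^sup>-\<^sup>e\<close> is a cell of length at least \<open>2\<^sup>-\<^sup>2\<^sup>e\<close>, so
  every cell of length at most \<open>2\<^sup>-\<^sup>2\<^sup>e\<close> lies inside such an image; hence the factor 2.
\<close>

lemma cell_fine_inverse: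
  assumes x: "x \<in> thompson_maps" "cell_fine e x" shows "cell_fine (2 * e) (inv\<^bsub>thompson_F\<^esub> x)"
proof (rule cell_fineI)
  fix E i assume E: "2 * e \<le> E" "i < (2::nat) ^ E"
  let ?y = "inv\<^bsub>thompson_F\<^esub> x"
  let ?t = "(real i + 1 / 2) / 2 ^ E"
  have t: "0 \<le> ?t" "?t \<le> 1" using cell_range[OF E(2), of "1/2"] by auto
  have yt: "0 \<le> ?y ?t" "?y ?t \<le> 1" using thompson_range[OF _ t, of ?y] x by auto
  obtain i0 where i0: "i0 < 2 ^ e" "in_cell e i0 (?y ?t)" by (rule cell_exists[OF yt])
  obtain e' j0 where c: "e \<le> e' + e" "e' \<le> e + e" "cell_map x e i0 e' j0"
    using cell_fineD[OF x(2) order_refl i0(1)] by auto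
  obtain s where s: "0 \<le> s" "s \<le> 1" "?y ?t = (real i0 + s) / 2 ^ e" by (rule in_cell_param[OF i0(2)])
  have "?t = x (?y ?t)" using thompson_inv_apply(1)[OF x(1) t] by simp
  also have "\<dots> = (real j0 + s) / 2 ^ e'" unfolding s(3) by (rule cell_mapD[OF c(3) s(1,2)])
  finally have "in_cell e' j0 ?t" using in_cellI[OF s(1,2)] by simp
  moreover have e'E: "e' \<le> E" using c(2) E(1) by simp
  ultimately obtain q where q: "q < 2 ^ (E - e')" "i = j0 * 2 ^ (E - e') + q" using subcell_of_midpoint by metis
  define E'' where "E'' = e + (E - e')"
  define k where "k = i0 * 2 ^ (E - e') + q"
  have cm: "cell_map x E'' k E i"
    using cell_map_subcell[OF c(3) q(1)] e'E unfolding E''_def k_def q(2) by simp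
  have "k < 2 ^ E''"
  proof -
    have "k < (i0 + 1) * 2 ^ (E - e')" unfolding k_def using q(1) by simp
    also have "\<dots> \<le> 2 ^ e * 2 ^ (E - e')" using i0(1) by (intro mult_le_mono1) simp
    finally show ?thesis unfolding E''_def by (simp add: power_add)
  qed
  moreover have "cell_map ?y E i E'' k"
  proof (rule cell_mapI)
    fix s :: real assume s: "0 \<le> s" "s \<le> 1"
    have "0 \<le> (real k + s) / 2 ^ E''" "(real k + s) / 2 ^ E'' \<le> 1" using cell_range[OF \<open>k < 2 ^ E''\<close> s] by auto
    then have "?y (x ((real k + s) / 2 ^ E'')) = (real k + s) / 2 ^ E''" by (rule thompson_inv_apply(2)[OF x(1)])
    then show "?y ((real i + s) / 2 ^ E) = (real k + s) / 2 ^ E''" using cell_mapD[OF cm s] by simp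
  qed
  ultimately show "\<exists>E' j. E \<le> E' + 2 * e \<and> E' \<le> E + 2 * e \<and> j < 2 ^ E' \<and> cell_map ?y E i E' j"
    using c E e'E unfolding E''_def by (intro exI[of _ "e + (E - e')"] exI[of _ k]) auto
qed

text \<open>
  An affine map with slope \<open>2\<^sup>q\<close> whose additive constant has denominator \<open>2\<^sup>n\<close> respects the
  grid as soon as the cell is so small that its image has length at most \<open>2\<^sup>-\<^sup>n\<close>.
\<close>

lemma affine_cell:
  assumes aff: "\<And>t. in_cell E i t \<Longrightarrow> f t = 2 powi q * t + real_of_int z / 2 ^ n"
    and E: "int n + \<bar>q\<bar> \<le> int E" and f: "f \<in> thompson_maps" and i: "i < 2 ^ E"
  obtains E' j where "int E' = int E - q" "j < 2 ^ E'" "cell_map f E i E' j"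
proof -
  define E' where "E' = nat (int E - q)"
  have E': "int E' = int E - q" "n \<le> E'" unfolding E'_def using E by auto
  have pq: "2 powi q / 2 ^ E = (1::real) / 2 ^ E'"
  proof -
    have "(2::real) powi q / 2 ^ E = 2 powi (q - int E)" by (simp add: power_int_diff)
    also have "\<dots> = 2 powi (- int E')" using E' by simp
    finally show ?thesis by (simp add: power_int_minus field_simps)
  qed
  define J where "J = int i + z * 2 ^ (E' - n)"
  have val: "f ((real i + s) / 2 ^ E) = (real_of_int J + s) / 2 ^ E'" if s: "0 \<le> s" "s \<le> 1" for s
  proof -
    have "f ((real i + s) / 2 ^ E) = (2 powi q / 2 ^ E) * (real i + s) + real_of_int z / 2 ^ n"
      using aff[OF in_cellI[OF s]] by simp
    also have "real_of_int z / 2 ^ n = real_of_int z * 2 ^ (E' - n) / 2 ^ E'"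
    proof -
      have "(2::real) ^ E' = 2 ^ (E' - n) * 2 ^ n" using E'(2) by (simp flip: power_add)
      then show ?thesis by simp
    qed
    finally show ?thesis unfolding pq J_def by (simp add: add_divide_distrib)
  qed
  have "0 \<le> f ((real i + 0) / 2 ^ E)" using thompson_range[OF f] cell_range[OF i, of 0] by simp
  then have "0 \<le> real_of_int J / 2 ^ E'" using val[of 0] by simp
  moreover have "(0::real) < 2 ^ E'" by simp
  ultimately have "0 \<le> J" by (metis divide_neg_pos not_le of_int_less_0_iff)
  then have cm: "cell_map f E i E' (nat J)" using val by (intro cell_mapI) simp
  show thesis using that[OF E'(1) cell_map_index_bound[OF cm i f] cm] .
qed

lemma pl2_fine_on:
  "pl2 f a b \<Longrightarrow> 0 \<le> a \<Longrightarrow> b \<le> 1 \<Longrightarrow> f \<in> thompson_maps \<Longrightarrow> \<exists>e. \<forall>E\<ge>e. \<forall>i. a \<le> real i / 2 ^ E \<longrightarrow> (real i + 1) / 2 ^ E \<le> b \<longrightarrow>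
     (\<exists>E' j. E \<le> E' + e \<and> E' \<le> E + e \<and> j < 2 ^ E' \<and> cell_map f E i E' j)"
proof (induction rule: pl2.induct)
  case (affine a b c k)
  obtain z n where c: "c = real_of_int z / 2 ^ n" using affine(4) unfolding dyadic_def by blast
  show ?case
  proof (rule exI[of _ "n + nat \<bar>k\<bar>"], intro allI impI)
    fix E i assume E: "n + nat \<bar>k\<bar> \<le> E" and ia: "a \<le> real i / 2 ^ E" "(real i + 1) / 2 ^ E \<le> b"
    have aff: "f t = 2 powi k * t + real_of_int z / 2 ^ n" if "in_cell E i t" for t
      using affine(5)[of t] that ia unfolding in_cell_def c by linarith
    have i: "i < 2 ^ E" by (rule cell_index_bound) (use ia affine.prems in linarith)
    obtain E' j where "int E' = int E - k" "j < 2 ^ E'" "cell_map f E i E' j"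
      by (rule affine_cell[OF aff _ affine.prems(3) i]) (use E in auto)
    then show "\<exists>E' j. E \<le> E' + (n + nat \<bar>k\<bar>) \<and> E' \<le> E + (n + nat \<bar>k\<bar>) \<and> j < 2 ^ E' \<and> cell_map f E i E' j"
      by (intro exI[of _ E'] exI[of _ j]) auto
  qed
next
  case (join a b c)
  have ab: "a < b" "b < c" "dyadic b" using pl2_dom[OF join.hyps(1)] pl2_dom[OF join.hyps(2)] by simp_all
  obtain e1 where e1: "\<forall>E\<ge>e1. \<forall>i. a \<le> real i / 2 ^ E \<longrightarrow> (real i + 1) / 2 ^ E \<le> b \<longrightarrow>
     (\<exists>E' j. E \<le> E' + e1 \<and> E' \<le> E + e1 \<and> j < 2 ^ E' \<and> cell_map f E i E' j)"
    using join.IH(1) join.prems ab by auto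
  obtain e2 where e2: "\<forall>E\<ge>e2. \<forall>i. b \<le> real i / 2 ^ E \<longrightarrow> (real i + 1) / 2 ^ E \<le> c \<longrightarrow>
     (\<exists>E' j. E \<le> E' + e2 \<and> E' \<le> E + e2 \<and> j < 2 ^ E' \<and> cell_map f E i E' j)"
    using join.IH(2) join.prems ab by auto
  obtain z n where b: "b = real_of_int z / 2 ^ n" using ab(3) unfolding dyadic_def by blast
  show ?case
  proof (rule exI[of _ "e1 + e2 + n"], intro allI impI)
    fix E i assume E: "e1 + e2 + n \<le> E" and ia: "a \<le> real i / 2 ^ E" "(real i + 1) / 2 ^ E \<le> c"
    \<comment> \<open>the grid contains \<open>b\<close>, so no cell contains \<open>b\<close> in its interior\<close>
    define w where "w = z * 2 ^ (E - n)"
    have "(2::real) ^ E = 2 ^ (E - n) * 2 ^ n" using E by (simp flip: power_add)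
    then have bw: "b = real_of_int w / 2 ^ E" unfolding b w_def by simp
    consider "int i + 1 \<le> w" | "w \<le> int i" by linarith
    then have "(real i + 1) / 2 ^ E \<le> b \<or> b \<le> real i / 2 ^ E"
    proof cases
      case 1
      then have "real_of_int (int i + 1) \<le> real_of_int w" by (simp only: of_int_le_iff)
      then show ?thesis unfolding bw by (simp add: divide_right_mono)
    next
      case 2
      then have "real_of_int w \<le> real_of_int (int i)" by (simp only: of_int_le_iff)
      then show ?thesis unfolding bw by (simp add: divide_right_mono)
    qed
    then show "\<exists>E' j. E \<le> E' + (e1 + e2 + n) \<and> E' \<le> E + (e1 + e2 + n) \<and> j < 2 ^ E' \<and> cell_map f E i E' j"
    proof
      assume "(real i + 1) / 2 ^ E \<le> b"
      then obtain E' j where "E \<le> E' + e1 \<and> E' \<le> E + e1 \<and> j < 2 ^ E' \<and> cell_map f E i E' j"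
        using e1 E ia by (metis add_leD1)
      then show ?thesis by (intro exI[of _ E'] exI[of _ j]) auto
    next
      assume "b \<le> real i / 2 ^ E"
      then obtain E' j where "E \<le> E' + e2 \<and> E' \<le> E + e2 \<and> j < 2 ^ E' \<and> cell_map f E i E' j"
        using e2 E ia by (metis add_leD1 add_leD2)
      then show ?thesis by (intro exI[of _ E'] exI[of _ j]) auto
    qed
  qed
qed

lemma thompson_cell_fine: "f \<in> thompson_maps \<Longrightarrow> \<exists>e. cell_fine e f"
proof -
  assume f: "f \<in> thompson_maps"
  obtain e where e: "\<forall>E\<ge>e. \<forall>i. 0 \<le> real i / 2 ^ E \<longrightarrow> (real i + 1) / 2 ^ E \<le> 1 \<longrightarrow>
     (\<exists>E' j. E \<le> E' + e \<and> E' \<le> E + e \<and> j < 2 ^ E' \<and> cell_map f E i E' j)"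
    using pl2_fine_on[OF thompson_pl2[OF f] _ _ f] by auto
  have "cell_fine e f"
  proof (rule cell_fineI)
    fix E i assume "e \<le> E" "i < (2::nat) ^ E"
    then show "\<exists>E' j. E \<le> E' + e \<and> E' \<le> E + e \<and> j < 2 ^ E' \<and> cell_map f E i E' j"
      using e cell_range[of i E 1] cell_range[of i E 0] by simp
  qed
  then show ?thesis by blast
qed

section \<open>Roots near a fixed point\<close>

lemma linear_iterate:
  fixes H :: "real \<Rightarrow> real"
  assumes lin: "\<And>r. 0 \<le> r \<Longrightarrow> r \<le> b \<Longrightarrow> H r = 2 powi l * r" and r: "0 \<le> r"
  shows "(\<And>i. i < m \<Longrightarrow> 2 powi (l * int i) * r \<le> b) \<Longrightarrow> (H ^^ m) r = 2 powi (l * int m) * r"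
proof (induction m)
  case (Suc m)
  have "(H ^^ m) r = 2 powi (l * int m) * r" by (rule Suc.IH) (use Suc.prems in simp)
  moreover have "H (2 powi (l * int m) * r) = 2 powi l * (2 powi (l * int m) * r)"
    by (rule lin) (use Suc.prems[of m] r in simp_all)
  ultimately show ?case by (simp add: power_int_add distrib_left)
qed simp

lemma powi2_le_iff: "(2::real) powi k \<le> 2 powi l \<longleftrightarrow> k \<le> l"
  by (metis linorder_not_le one_less_numeral_iff power_int_increasing power_int_strict_increasing semiring_norm(76) less_imp_le)

lemma powi2_eq_iff: "(2::real) powi k = 2 powi l \<longleftrightarrow> k = l"
  by (metis powi2_le_iff order_antisym order_refl)

lemma powi2_small:
  fixes k :: int and r b :: real assumes "k < 0" "0 < b"
  obtains m :: nat where "2 powi (k * int m) * r \<le> b"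
proof (cases "r \<le> 0")
  case True
  then have "2 powi (k * int 0) * r \<le> b" using assms by simp
  then show thesis by (rule that)
next
  case False
  obtain m where m: "(1/2) ^ m < b / r" using real_arch_pow_inv[of "b / r" "1/2"] assms False by auto
  have "(2::real) powi (k * int m) \<le> 2 powi (- int m)"
    unfolding powi2_le_iff using assms(1) mult_right_mono[of k "-1" "int m"] by simp
  also have "\<dots> = (1/2) ^ m" by (simp add: power_int_minus power_divide inverse_eq_divide)
  finally have "2 powi (k * int m) \<le> b / r" using m by linarith
  then show thesis using that False by (simp add: field_simps)
qed

text \<open>
  \<open>H\<close> is linear near 0 and its \<open>n\<close>-th iterate \<open>Y\<close> is linear on all of \<open>[0, R]\<close>; then \<open>H\<close> is
  linear on \<open>[0, R]\<close> too, since it commutes with \<open>Y\<close>. If \<open>Y\<close> contracts, a power of \<open>Y\<close> carries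
  a given point into the germ of \<open>H\<close> at 0; if \<open>Y\<close> expands, the point is the image of such a point under a
  power of \<open>Y\<close>; and if \<open>Y\<close> is the identity, so is the increasing map \<open>H\<close>.
\<close>

lemma radial_root:
  fixes H :: "real \<Rightarrow> real" and k l :: int
  assumes n: "0 < n" and e: "0 < e" "e \<le> R" "R \<le> M"
    and mono: "\<And>r s. 0 \<le> r \<Longrightarrow> r < s \<Longrightarrow> s \<le> M \<Longrightarrow> H r < H s"
    and range: "\<And>r. 0 \<le> r \<Longrightarrow> r \<le> M \<Longrightarrow> 0 \<le> H r \<and> H r \<le> M"
    and lin: "\<And>r. 0 \<le> r \<Longrightarrow> r \<le> e \<Longrightarrow> H r = 2 powi l * r"
    and iterate: "\<And>r. 0 \<le> r \<Longrightarrow> r \<le> R \<Longrightarrow> (H ^^ n) r = 2 powi k * r"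
  shows "l * int n = k \<and> (\<forall>r. 0 \<le> r \<longrightarrow> r \<le> R \<longrightarrow> H r = 2 powi l * r)"
proof -
  define Y where "Y = H ^^ n"
  have Ylin: "Y r = 2 powi k * r" if "0 \<le> r" "r \<le> R" for r using iterate[OF that] unfolding Y_def .
  have comm: "H ((Y ^^ m) r) = (Y ^^ m) (H r)" for m r
  proof (induction m arbitrary: r)
    case (Suc m)
    have "H (Y r) = Y (H r)" for r unfolding Y_def by (simp add: funpow_swap1)
    then show ?case using Suc by simp
  qed simp
  have rangen: "0 \<le> (H ^^ m) r \<and> (H ^^ m) r \<le> M" if "0 \<le> r" "r \<le> M" for m r
    using that range by (induction m) auto
  have above: "r < (H ^^ Suc m) r" if "0 \<le> r" "r \<le> M" "r < H r" for m r
  proof (induction m)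
    case (Suc m)
    have "H r < H ((H ^^ Suc m) r)" by (rule mono) (use that Suc rangen[OF that(1,2), of "Suc m"] in auto)
    then show ?case using that(3) by simp
  qed (use that in simp)
  have below: "(H ^^ Suc m) r < r" if "0 \<le> r" "r \<le> M" "H r < r" for m r
  proof (induction m)
    case (Suc m)
    have "H ((H ^^ Suc m) r) < H r" by (rule mono) (use that Suc rangen[OF that(1,2), of "Suc m"] in auto)
    then show ?case using that(3) by simp
  qed (use that in simp)
  obtain n' where n': "n = Suc n'" using n not0_implies_Suc by auto
  \<comment> \<open>so small that the first \<open>n\<close> iterates stay in the germ, whatever the sign of \<open>l\<close>\<close>
  define r0 where "r0 = 2 powi (- (\<bar>l\<bar> * int n)) * e"
  have r0: "0 < r0" "r0 \<le> R"
  proof -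
    show "0 < r0" unfolding r0_def using e(1) by simp
    have "2 powi (- (\<bar>l\<bar> * int n)) \<le> (2::real) powi 0" unfolding powi2_le_iff by simp
    then have "r0 \<le> 1 * e" unfolding r0_def using e(1) by (intro mult_right_mono) simp_all
    then show "r0 \<le> R" using e(2) by simp
  qed
  have "2 powi (l * int i) * r0 \<le> e" if "i < n" for i
  proof -
    have "l * int i \<le> \<bar>l\<bar> * int n"
    proof -
      have "l * int i \<le> \<bar>l\<bar> * int i" by (intro mult_right_mono) simp_all
      moreover have "\<bar>l\<bar> * int i \<le> \<bar>l\<bar> * int n" using that by (intro mult_left_mono) simp_all
      ultimately show ?thesis by linarith
    qed
    then have "2 powi (l * int i) * r0 \<le> 2 powi (\<bar>l\<bar> * int n) * r0"
      using r0(1) powi2_le_iff by (intro mult_right_mono) simp_all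
    also have "\<dots> = e" unfolding r0_def by (simp add: power_int_minus flip: mult.assoc)
    finally show ?thesis .
  qed
  then have "(H ^^ n) r0 = 2 powi (l * int n) * r0" by (intro linear_iterate[OF lin]) (use r0 in auto)
  then have "2 powi (l * int n) * r0 = 2 powi k * r0" using iterate[of r0] r0 by simp
  then have lk: "l * int n = k" using r0(1) powi2_eq_iff by simp
  have "H r = 2 powi l * r" if r: "0 \<le> r" "r \<le> R" for r
  proof -
    have rM: "r \<le> M" using r e by simp
    consider "l = 0" | "l < 0" | "0 < l" by linarith
    then show ?thesis
    proof cases
      case 1
      then have "Y r = r" using Ylin[OF r] lk by simp
      then have "H r = r" using above[OF r(1) rM, of n'] below[OF r(1) rM, of n'] unfolding Y_def n'
        by (cases r "H r" rule: linorder_cases) auto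
      then show ?thesis using 1 by simp
    next
      case 2
      then have k0: "k < 0" using lk n by (simp add: mult_neg_pos flip: lk)
      obtain m :: nat where m: "2 powi (k * int m) * r \<le> e" by (rule powi2_small[OF k0 e(1)])
      \<comment> \<open>\<open>Y\<close> contracts, hence so does \<open>H\<close>\<close>
      have Hr: "0 \<le> H r" "H r \<le> R"
      proof -
        show "0 \<le> H r" using range[OF r(1) rM] by simp
        have "2 powi k \<le> (2::real) powi 0" unfolding powi2_le_iff using k0 by simp
        then have "Y r \<le> r" using Ylin[OF r] r(1) by (simp add: mult_left_le_one_le)
        then have "H r \<le> r" using above[OF r(1) rM, of n'] unfolding Y_def n' by fastforce
        then show "H r \<le> R" using r by simp
      qed
      have small: "2 powi (k * int i) * s \<le> R" if "0 \<le> s" "s \<le> R" for i s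
      proof -
        have "2 powi (k * int i) \<le> (2::real) powi 0"
          unfolding powi2_le_iff using k0 by (simp add: mult_nonpos_nonneg)
        then have "2 powi (k * int i) * s \<le> s" using that(1) by (simp add: mult_left_le_one_le)
        then show ?thesis using that(2) by simp
      qed
      have 3: "(Y ^^ m) r = 2 powi (k * int m) * r" by (rule linear_iterate[OF Ylin r(1)]) (use small r in auto)
      have 4: "(Y ^^ m) (H r) = 2 powi (k * int m) * H r" by (rule linear_iterate[OF Ylin Hr(1)]) (use small Hr in auto)
      have "H (2 powi (k * int m) * r) = 2 powi l * (2 powi (k * int m) * r)" by (rule lin) (use r m in auto)
      then have "2 powi (k * int m) * H r = 2 powi (k * int m) * (2 powi l * r)"
        using comm[of m r] 3 4 by (simp add: mult.left_commute)
      then show ?thesis by simp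
    next
      case 3
      then have k0: "- k < 0" and lk': "l \<le> k" using n by (simp_all flip: lk)
      obtain m :: nat where m: "2 powi (- k * int m) * r \<le> e" by (rule powi2_small[OF k0 e(1)])
      \<comment> \<open>the point of the germ that the \<open>m\<close>-th power of \<open>Y\<close> carries to \<open>r\<close>\<close>
      define w where "w = 2 powi (- k * int m) * r"
      have w: "0 \<le> w" "w \<le> e" unfolding w_def using m r by auto
      have pw: "2 powi (k * int i) * w = 2 powi (k * int i - k * int m) * r" for i
        unfolding w_def by (simp add: power_int_diff power_int_minus divide_inverse)
      show ?thesis
      proof (cases "m = 0")
        case True
        then have "w = r" unfolding w_def by simp
        then show ?thesis using lin w by simp
      next
        case False
        have small: "2 powi (k * int i - k * int m + d) * r \<le> R" if "i < m" "d \<le> k" for i d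
        proof -
          have "k * int i + k \<le> k * int m" using that(1) k0 by (simp add: mult_left_mono flip: distrib_left_numeral) (metis add.commute distrib_left int_ops(4) mult.right_neutral mult_left_mono of_nat_Suc of_nat_le_iff Suc_leI less_imp_le)
          then have "k * int i - k * int m + d \<le> 0" using that(2) by simp
          then have "2 powi (k * int i - k * int m + d) \<le> (2::real) powi 0" unfolding powi2_le_iff .
          then have "2 powi (k * int i - k * int m + d) * r \<le> r" using r(1) by (simp add: mult_left_le_one_le)
          then show ?thesis using r by simp
        qed
        have 4: "(Y ^^ m) w = 2 powi (k * int m) * w"
          by (rule linear_iterate[OF Ylin w(1)]) (use pw small[of _ 0] k0 in auto)
        have 5: "(Y ^^ m) (2 powi l * w) = 2 powi (k * int m) * (2 powi l * w)"
        proof (rule linear_iterate[OF Ylin])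
          fix i assume i: "i < m"
          have "2 powi (k * int i) * (2 powi l * w) = 2 powi (k * int i - k * int m + l) * r"
            using pw[of i] by (simp add: power_int_add mult.left_commute mult.assoc mult.commute)
          then show "2 powi (k * int i) * (2 powi l * w) \<le> R" using small[OF i lk'] by simp
        qed (use w in auto)
        have "2 powi (k * int m) * w = r" using pw[of m] by simp
        then have "H r = H ((Y ^^ m) w)" using 4 by simp
        also have "\<dots> = (Y ^^ m) (2 powi l * w)" using comm[of m w] lin[OF w] by simp
        also have "\<dots> = 2 powi l * (2 powi (k * int m) * w)" unfolding 5 by simp
        finally show ?thesis using \<open>2 powi (k * int m) * w = r\<close> by simp
      qed
    qed
  qed
  then show ?thesis using lk by blast
qed

definition root_of :: "nat \<Rightarrow> (real \<Rightarrow> real) \<Rightarrow> (real \<Rightarrow> real) \<Rightarrow> bool" where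
  "root_of n x h \<longleftrightarrow> h \<in> thompson_maps \<and> 0 < n \<and> h [^]\<^bsub>thompson_F\<^esub> n = x"

lemma roots_iff: "h \<in> roots thompson_F x \<longleftrightarrow> (\<exists>n. root_of n x h)"
  unfolding roots_def root_of_def by auto

lemma root_of_facts:
  assumes "root_of n x h"
  shows "h \<in> thompson_maps" "0 < n" "x \<in> thompson_maps" "\<And>t. 0 \<le> t \<Longrightarrow> t \<le> 1 \<Longrightarrow> x t = (h ^^ n) t"
  using assms thompson_pow_apply unfolding root_of_def by auto

lemma root_commutes:
  assumes h: "root_of n x h" and t: "0 \<le> t" "t \<le> 1" shows "h (x t) = x (h t)"
  using root_of_facts(4)[OF h t] root_of_facts(4)[OF h] thompson_range[OF root_of_facts(1)[OF h] t]
  by (simp add: funpow_swap1)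

text \<open>
  \<open>radial_root\<close> in the coordinate \<open>r\<close> that measures the distance from \<open>a\<close>, to the right for
  \<open>\<sigma> = 1\<close> and to the left for \<open>\<sigma> = -1\<close>.
\<close>

lemma root_radial:
  assumes h: "root_of n x h" and a: "0 \<le> a" "a \<le> 1" "h a = a" and s: "\<sigma> = 1 \<or> \<sigma> = -1"
    and M: "0 \<le> a + \<sigma> * M" "a + \<sigma> * M \<le> 1" "h (a + \<sigma> * M) = a + \<sigma> * M"
    and e: "0 < e" "e \<le> R" "R \<le> M"
    and germ: "\<And>r. 0 \<le> r \<Longrightarrow> r \<le> e \<Longrightarrow> h (a + \<sigma> * r) = a + \<sigma> * (2 powi l * r)"
    and lin: "\<And>r. 0 \<le> r \<Longrightarrow> r \<le> R \<Longrightarrow> x (a + \<sigma> * r) = a + \<sigma> * (2 powi k * r)"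
  shows "l * int n = k \<and> (\<forall>r. 0 \<le> r \<longrightarrow> r \<le> R \<longrightarrow> h (a + \<sigma> * r) = a + \<sigma> * (2 powi l * r))"
proof -
  note h' = root_of_facts[OF h]
  have ss: "\<sigma> * \<sigma> = 1" "\<sigma> * (\<sigma> * r) = r" for r using s by auto
  define H where "H = (\<lambda>r. \<sigma> * (h (a + \<sigma> * r) - a))"
  have dom: "0 \<le> a + \<sigma> * r \<and> a + \<sigma> * r \<le> 1" if "0 \<le> r" "r \<le> M" for r
    using s a(1,2) M(1,2) that by auto
  have mono: "H r < H r'" if r: "0 \<le> r" "r < r'" "r' \<le> M" for r r'
  proof -
    have d: "0 \<le> a + \<sigma> * r" "a + \<sigma> * r \<le> 1" "0 \<le> a + \<sigma> * r'" "a + \<sigma> * r' \<le> 1" using dom[of r] dom[of r'] r by auto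
    show ?thesis using s
    proof
      assume "\<sigma> = 1" then show ?thesis
        unfolding H_def using thompson_less[OF h'(1) d(1) _ d(4)] r by simp
    next
      assume "\<sigma> = -1" then show ?thesis
        unfolding H_def using thompson_less[OF h'(1) d(3) _ d(2)] r by simp
    qed
  qed
  have H0: "H 0 = 0" "H M = M" unfolding H_def using a(3) M(3) ss by simp_all
  have range: "0 \<le> H r \<and> H r \<le> M" if "0 \<le> r" "r \<le> M" for r
    using mono[of 0 r] mono[of r M] H0 that by (cases "r = 0"; cases "r = M") auto
  have hH: "h (a + \<sigma> * r) = a + \<sigma> * H r" for r unfolding H_def ss(2) by simp
  have iter: "(h ^^ m) (a + \<sigma> * r) = a + \<sigma> * (H ^^ m) r" for m r
    by (induction m) (simp_all add: hH)
  have "l * int n = k \<and> (\<forall>r. 0 \<le> r \<longrightarrow> r \<le> R \<longrightarrow> H r = 2 powi l * r)"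
  proof (rule radial_root[OF h'(2) e mono range])
    fix r assume r: "0 \<le> r" "r \<le> e"
    show "H r = 2 powi l * r" unfolding H_def germ[OF r] using ss by simp
  next
    fix r assume r: "0 \<le> r" "r \<le> R"
    have "x (a + \<sigma> * r) = a + \<sigma> * (H ^^ n) r" using h'(4)[of "a + \<sigma> * r"] dom[of r] r e iter by simp
    then have "\<sigma> * (H ^^ n) r = \<sigma> * (2 powi k * r)" using lin[OF r] by linarith
    then have "\<sigma> * (\<sigma> * (H ^^ n) r) = \<sigma> * (\<sigma> * (2 powi k * r))" by (rule arg_cong)
    then show "(H ^^ n) r = 2 powi k * r" unfolding ss .
  qed
  then show ?thesis using hH by simp
qed

text \<open>
  The slopes of the root on the two sides of \<open>a\<close> agree, as both have the \<open>n\<close>-th power \<open>2\<^sup>k\<close>.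
\<close>

lemma root_affine_near_fixpoint:
  assumes h: "root_of n x h" and uv: "0 \<le> u" "u \<le> a" "a \<le> v" "v \<le> 1" "u < v"
    and lin: "\<And>t. u \<le> t \<Longrightarrow> t \<le> v \<Longrightarrow> x t = a + 2 powi k * (t - a)"
  shows "\<exists>l. l * int n = k \<and> (\<forall>t. u \<le> t \<longrightarrow> t \<le> v \<longrightarrow> h t = a + 2 powi l * (t - a))"
proof -
  note h' = root_of_facts[OF h]
  have a01: "0 \<le> a" "a \<le> 1" using uv by auto
  have "(h ^^ n) a = a" using h'(4)[OF a01] lin[of a] uv by simp
  then have ha: "h a = a" using funpow_fixes_iff[OF h'(1) a01 h'(2)] by blast
  have right: "\<exists>l. l * int n = k \<and> (\<forall>t. a \<le> t \<longrightarrow> t \<le> v \<longrightarrow> h t = a + 2 powi l * (t - a))" if av: "a < v"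
  proof -
    obtain e l where e: "e > 0" "a + e \<le> 1" "affine_about h a l a (a + e)"
      using thompson_germ_right[OF h'(1) a01(1)] av uv by auto
    have "l * int n = k \<and> (\<forall>r. 0 \<le> r \<longrightarrow> r \<le> v - a \<longrightarrow> h (a + 1 * r) = a + 1 * (2 powi l * r))"
    proof (rule root_radial[OF h a01 ha, where M = "1 - a" and e = "min e (v - a)"])
      fix r assume "0 \<le> r" "r \<le> min e (v - a)"
      then show "h (a + 1 * r) = a + 1 * (2 powi l * r)" using affine_aboutD[OF e(3), of "a + r"] ha by simp
    next
      fix r assume "0 \<le> r" "r \<le> v - a"
      then show "x (a + 1 * r) = a + 1 * (2 powi k * r)" using lin[of "a + r"] uv by simp
    qed (use uv av e thompson_1[OF h'(1)] in auto)
    then have l: "l * int n = k" and H: "\<And>r. 0 \<le> r \<Longrightarrow> r \<le> v - a \<Longrightarrow> h (a + 1 * r) = a + 1 * (2 powi l * r)"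
      by blast+
    have "h t = a + 2 powi l * (t - a)" if "a \<le> t" "t \<le> v" for t using H[of "t - a"] that by simp
    then show ?thesis using l by blast
  qed
  have left: "\<exists>l. l * int n = k \<and> (\<forall>t. u \<le> t \<longrightarrow> t \<le> a \<longrightarrow> h t = a + 2 powi l * (t - a))" if ua: "u < a"
  proof -
    have "0 < a" using ua uv by simp
    then obtain e l where e: "e > 0" "0 \<le> a - e" "affine_about h a l (a - e) a"
      using thompson_germ_left[OF h'(1) _ a01(2)] by auto
    have "l * int n = k \<and> (\<forall>r. 0 \<le> r \<longrightarrow> r \<le> a - u \<longrightarrow> h (a + (-1) * r) = a + (-1) * (2 powi l * r))"
    proof (rule root_radial[OF h a01 ha, where M = a and e = "min e (a - u)"])
      fix r assume "0 \<le> r" "r \<le> min e (a - u)"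
      then show "h (a + (-1) * r) = a + (-1) * (2 powi l * r)" using affine_aboutD[OF e(3), of "a - r"] ha by simp
    next
      fix r assume "0 \<le> r" "r \<le> a - u"
      then show "x (a + (-1) * r) = a + (-1) * (2 powi k * r)" using lin[of "a - r"] uv by simp
    qed (use uv ua e thompson_0[OF h'(1)] in auto)
    then have l: "l * int n = k" and H: "\<And>r. 0 \<le> r \<Longrightarrow> r \<le> a - u \<Longrightarrow> h (a + (-1) * r) = a + (-1) * (2 powi l * r)"
      by blast+
    have "h t = a + 2 powi l * (t - a)" if "u \<le> t" "t \<le> a" for t using H[of "a - t"] that by (simp add: algebra_simps)
    then show ?thesis using l by blast
  qed
  consider "a = u" | "a = v" | "u < a" "a < v" using uv by linarith
  then show ?thesis
  proof cases
    case 1 then show ?thesis using right uv by auto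
  next
    case 2 then show ?thesis using left uv by auto
  next
    case 3
    obtain l where l: "l * int n = k" "\<forall>t. a \<le> t \<longrightarrow> t \<le> v \<longrightarrow> h t = a + 2 powi l * (t - a)" using right[OF 3(2)] by (elim exE conjE) (rule that)
    obtain l' where l': "l' * int n = k" "\<forall>t. u \<le> t \<longrightarrow> t \<le> a \<longrightarrow> h t = a + 2 powi l' * (t - a)" using left[OF 3(1)] by (elim exE conjE) (rule that)
    have "l' = l" using l(1) l'(1) h'(2) by (metis mult_right_cancel of_nat_0_less_iff less_irrefl)
    then have "\<forall>t. u \<le> t \<longrightarrow> t \<le> v \<longrightarrow> h t = a + 2 powi l * (t - a)" using l(2) l'(2) by (meson linear)
    then show ?thesis using l(1) by (intro exI[of _ l] conjI)
  qed
qed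

text \<open>
  Multiplication by an odd number does not change the denominator of a dyadic number.
\<close>

lemma dyadic_odd_multiple:
  fixes q w :: int
  assumes d: "dyadic d" and q: "odd q" "d * of_int q = of_int w / 2 ^ N"
  shows "\<exists>z::int. d = of_int z / 2 ^ N"
proof -
  obtain u v where u: "d = of_int u / 2 ^ v" using d unfolding dyadic_def by blast
  show ?thesis
  proof (cases "v \<le> N")
    case True
    then have "(2::real) ^ N = 2 ^ (N - v) * 2 ^ v" by (simp flip: power_add)
    then have "d = of_int (u * 2 ^ (N - v)) / 2 ^ N" unfolding u by simp
    then show ?thesis by blast
  next
    case False
    then have p: "(2::real) ^ v = 2 ^ (v - N) * 2 ^ N" by (simp flip: power_add)
    have "real_of_int u * of_int q / 2 ^ (v - N) = of_int w" using q(2) unfolding u p by (simp add: field_simps)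
    then have "real_of_int (u * q) = real_of_int (w * 2 ^ (v - N))" by (simp add: field_simps)
    then have "u * q = w * 2 ^ (v - N)" by (simp only: of_int_eq_iff)
    then have "2 ^ (v - N) dvd u * q" by simp
    moreover have "coprime (2 ^ (v - N)) q" using q(1) by (simp add: coprime_left_2_iff_odd)
    ultimately have "2 ^ (v - N) dvd u" by (simp add: coprime_dvd_mult_left_iff)
    then obtain z where "u = 2 ^ (v - N) * z" by blast
    then have "d = of_int z / 2 ^ N" unfolding u p by simp
    then show ?thesis by blast
  qed
qed

text \<open>
  The additive constants \<open>d\<close> of a root and \<open>w / 2\<^sup>N\<close> of its \<open>n\<close>-th power, both affine about \<open>a\<close>, differ by the
  factor \<open>(1 - 2\<^sup>l\<^sup>n) / (1 - 2\<^sup>l)\<close>. Up to a power of two this is an odd integer, so \<open>d\<close> needs no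
  larger denominator. It matters that the bound is independent of \<open>n\<close>.
\<close>

lemma root_constant_dyadic:
  fixes l :: int
  assumes d: "dyadic d" "d = (1 - 2 powi l) * a" and n: "0 < n"
    and D: "(1 - 2 powi (l * int n)) * a = of_int w / 2 ^ N"
  shows "\<exists>z::int. d = of_int z / 2 ^ N"
proof (cases "l = 0")
  case True
  then have "d = of_int 0 / 2 ^ N" using d(2) by simp
  then show ?thesis by blast
next
  case False
  define p where "p = nat \<bar>l\<bar>"
  have p: "0 < p" unfolding p_def using False by simp
  \<comment> \<open>the quotient of the two factors, a divisor of an odd number\<close>
  have "(2::int) ^ p - 1 dvd (2 ^ p) ^ n - 1" unfolding power_diff_1_eq by simp
  then obtain q where q: "(2::int) ^ (p * n) - 1 = (2 ^ p - 1) * q" unfolding power_mult by blast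
  have "odd ((2::int) ^ (p * n) - 1)" using p n by simp
  then have oq: "odd q" unfolding q by simp
  have rq: "(2::real) ^ (p * n) - 1 = (2 ^ p - 1) * of_int q"
    using arg_cong[OF q, of real_of_int] by simp
  show ?thesis
  proof (cases "l > 0")
    case True
    then have "2 powi l = (2::real) ^ p" "2 powi (l * int n) = (2::real) ^ (p * n)"
      unfolding p_def by (simp_all add: power_int_def nat_mult_distrib)
    then have dp: "d = (1 - 2 ^ p) * a" and "(1 - 2 ^ (p * n)) * a = of_int w / 2 ^ N"
      using d(2) D by simp_all
    moreover have "d * of_int q = - ((2 ^ p - 1) * of_int q) * a" unfolding dp by (simp add: algebra_simps)
    ultimately have "d * of_int q = - (2 ^ (p * n) - 1) * a" "(1 - 2 ^ (p * n)) * a = of_int w / 2 ^ N"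
      unfolding rq[symmetric] by simp_all
    then have "d * of_int q = of_int w / 2 ^ N" by (simp add: algebra_simps)
    then show ?thesis by (rule dyadic_odd_multiple[OF d(1) oq])
  next
    case False
    then have l: "l = - int p" unfolding p_def by simp
    then have 1: "2 powi l = 1 / (2::real) ^ p" "2 powi (l * int n) = 1 / (2::real) ^ (p * n)"
      by (simp_all add: power_int_minus inverse_eq_divide flip: of_nat_mult)
    have dp: "d = (1 - 1 / 2 ^ p) * a" using d(2) unfolding 1 .
    have "2 ^ p * d = (2 ^ p - 1) * a" unfolding dp by (simp add: field_simps)
    then have "2 ^ p * (d * of_int q) = ((2 ^ p - 1) * of_int q) * a"
      by (simp add: mult.assoc[symmetric])
    then have "2 ^ p * (d * of_int q) = (2 ^ (p * n) - 1) * a" unfolding rq .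
    also have "\<dots> = 2 ^ (p * n) * (of_int w / 2 ^ N)" unfolding D[symmetric] 1 by (simp add: field_simps)
    also have "(2::real) ^ (p * n) = 2 ^ p * 2 ^ (p * (n - 1))" using n by (cases n) (simp_all add: power_add)
    finally have "2 ^ p * (d * of_int q) = 2 ^ p * (of_int (2 ^ (p * (n - 1)) * w) / 2 ^ N)" by simp
    then have "d * of_int q = of_int (2 ^ (p * (n - 1)) * w) / 2 ^ N" unfolding mult_cancel_left by simp
    then show ?thesis by (rule dyadic_odd_multiple[OF d(1) oq])
  qed
qed

lemma root_on_fixed_cell:
  assumes h: "root_of n x h" and c: "cell_map x e i e' j" "i < 2 ^ e" and a: "in_cell e i a" "x a = a"
  shows "\<exists>(l::int) (z::int). l * int n = int e - int e' \<and> (\<forall>t. in_cell e i t \<longrightarrow> h t = 2 powi l * t + of_int z / 2 ^ e')"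
proof -
  note h' = root_of_facts[OF h]
  define k where "k = int e - int e'"
  define D where "D = real_of_int (int j - int i) / 2 ^ e'"
  have pk: "2 powi k / 2 ^ e = (1::real) / 2 ^ e'" unfolding k_def by (simp add: power_int_diff)
  have xt: "x t = 2 powi k * t + D" if t: "in_cell e i t" for t
  proof -
    obtain s where s: "0 \<le> s" "s \<le> 1" "t = (real i + s) / 2 ^ e" by (rule in_cell_param[OF t])
    have "2 powi k * t = (2 powi k / 2 ^ e) * (real i + s)" unfolding s(3) by simp
    then have "2 powi k * t + D = (real j + s) / 2 ^ e'" unfolding pk D_def by (simp add: add_divide_distrib diff_divide_distrib)
    then show ?thesis using cell_mapD[OF c(1) s(1,2)] s(3) by simp
  qed
  have Da: "(1 - 2 powi k) * a = D" using xt[OF a(1)] a(2) by (simp add: algebra_simps)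
  let ?u = "real i / 2 ^ e" and ?v = "(real i + 1) / 2 ^ e"
  have uv: "0 \<le> ?u" "?v \<le> 1" "?u < ?v" using cell_range[OF c(2), of 1] by (auto simp: divide_strict_right_mono)
  have ua: "?u \<le> a" "a \<le> ?v" using a(1) unfolding in_cell_def by auto
  have "\<exists>l. l * int n = k \<and> (\<forall>t. ?u \<le> t \<longrightarrow> t \<le> ?v \<longrightarrow> h t = a + 2 powi l * (t - a))"
  proof (rule root_affine_near_fixpoint[OF h uv(1) ua uv(2,3)])
    fix t assume "?u \<le> t" "t \<le> ?v"
    then have "x t = 2 powi k * t + D" using xt unfolding in_cell_def by blast
    then show "x t = a + 2 powi k * (t - a)" using Da by (simp add: algebra_simps)
  qed
  then obtain l where l: "l * int n = k" and ht: "\<forall>t. ?u \<le> t \<longrightarrow> t \<le> ?v \<longrightarrow> h t = a + 2 powi l * (t - a)"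
    by (elim exE conjE) (rule that)
  \<comment> \<open>dyadic because \<open>h\<close> maps the left end of the cell to a dyadic number\<close>
  define d where "d = (1 - 2 powi l) * a"
  have hd: "h t = 2 powi l * t + d" if "in_cell e i t" for t
    using ht that unfolding in_cell_def d_def by (simp add: algebra_simps)
  have "in_cell e i ?u" unfolding in_cell_def by (simp add: divide_right_mono)
  then have "h ?u = 2 powi l * ?u + d" by (rule hd)
  moreover have "dyadic ?u" by simp
  moreover have "?u \<le> 1" using uv by linarith
  then have "dyadic (h ?u)" using thompson_dyadic_iff[OF h'(1) uv(1)] \<open>dyadic ?u\<close> by blast
  moreover have "d = h ?u - 2 powi l * ?u" using calculation(1) by simp
  ultimately have "dyadic d" using dyadic_diff dyadic_mult dyadic_powi by metis
  moreover have "(1 - 2 powi (l * int n)) * a = of_int (int j - int i) / 2 ^ e'" using Da unfolding D_def l .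
  ultimately have "\<exists>z::int. d = of_int z / 2 ^ e'" using root_constant_dyadic[OF _ d_def h'(2)] by blast
  then obtain z :: int where "d = of_int z / 2 ^ e'" by blast
  then have "\<forall>t. in_cell e i t \<longrightarrow> h t = 2 powi l * t + of_int z / 2 ^ e'" using hd by blast
  then show ?thesis using l unfolding k_def by blast
qed

section \<open>Orbits reach a cell with a fixed point\<close>

definition fixed_cell :: "(real \<Rightarrow> real) \<Rightarrow> nat \<Rightarrow> nat \<Rightarrow> bool" where
  "fixed_cell x e i \<longleftrightarrow> (\<exists>a. in_cell e i a \<and> x a = a)"

text \<open>
  The displacements of the two endpoints of the cell are multiples of \<open>4\<^sup>-\<^sup>e\<close>, and on the cell the
  displacement is affine. As it never vanishes, both have the same sign and are at least \<open>4\<^sup>-\<^sup>e\<close> in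
  absolute value.
\<close>

lemma displacement_off_fixed_cell:
  assumes c: "cell_map x e i e' j" "e' \<le> 2 * e" and nf: "\<not> fixed_cell x e i" and u: "in_cell e i u"
  shows "u + 1 / 4 ^ e \<le> x u \<or> x u \<le> u - 1 / 4 ^ e"
proof -
  \<comment> \<open>the displacements of the two ends of the cell, in units of \<open>4\<^sup>-\<^sup>e\<close>\<close>
  define P0 where "P0 = int j * 2 ^ (2 * e - e') - int i * 2 ^ e"
  define P1 where "P1 = (int j + 1) * 2 ^ (2 * e - e') - (int i + 1) * 2 ^ e"
  have p4: "(4::real) ^ e = 2 ^ e * 2 ^ e" "(4::real) ^ e = 2 ^ e' * 2 ^ (2 * e - e')"
  proof -
    show "(4::real) ^ e = 2 ^ e * 2 ^ e" by (simp flip: power_mult_distrib)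
    have "(4::real) ^ e = (2 ^ 2) ^ e" by simp
    also have "\<dots> = 2 ^ (2 * e)" by (simp only: power_mult)
    also have "\<dots> = 2 ^ e' * 2 ^ (2 * e - e')" using c(2) by (simp flip: power_add)
    finally show "(4::real) ^ e = 2 ^ e' * 2 ^ (2 * e - e')" .
  qed
  have val: "(x ((real i + s) / 2 ^ e) - (real i + s) / 2 ^ e) * 4 ^ e = (1 - s) * P0 + s * P1"
    if s: "0 \<le> s" "s \<le> 1" for s
  proof -
    have "x ((real i + s) / 2 ^ e) * 4 ^ e = (real j + s) * 2 ^ (2 * e - e')"
      unfolding cell_mapD[OF c(1) s] p4(2) by simp
    moreover have "(real i + s) / 2 ^ e * 4 ^ e = (real i + s) * 2 ^ e" unfolding p4(1) by simp
    ultimately show ?thesis unfolding P0_def P1_def by (simp add: left_diff_distrib) (simp add: algebra_simps)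
  qed
  have nz: "(1 - s) * P0 + s * P1 \<noteq> 0" if s: "0 \<le> s" "s \<le> 1" for s :: real
  proof
    assume "(1 - s) * P0 + s * P1 = 0"
    then have "x ((real i + s) / 2 ^ e) = (real i + s) / 2 ^ e" using val[OF s] by simp
    then show False using nf in_cellI[OF s] unfolding fixed_cell_def by blast
  qed
  have nz01: "P0 \<noteq> 0" "P1 \<noteq> 0" using nz[of 0] nz[of 1] by auto
  have same: "(0 < P0 \<and> 0 < P1) \<or> (P0 < 0 \<and> P1 < 0)"
  proof (rule ccontr)
    assume "\<not> ?thesis"
    then have opp: "(0 < P0 \<and> P1 < 0) \<or> (P0 < 0 \<and> 0 < P1)" using nz01 by linarith
    define S where "S = \<bar>real_of_int P0\<bar> + \<bar>real_of_int P1\<bar>"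
    \<comment> \<open>the zero of the displacement if the signs differ\<close>
    define s where "s = \<bar>real_of_int P0\<bar> / S"
    have S: "0 < S" unfolding S_def using nz01 by linarith
    have "0 \<le> s" unfolding s_def using S by simp
    moreover have "s \<le> 1" unfolding s_def using S by (simp add: pos_divide_le_eq) (simp add: S_def)
    moreover have "1 - s = \<bar>real_of_int P1\<bar> / S" unfolding s_def using S by (simp add: field_simps) (simp add: S_def)
    then have "(1 - s) * P0 + s * P1 = (\<bar>real_of_int P1\<bar> * P0 + \<bar>real_of_int P0\<bar> * P1) / S"
      unfolding s_def by (simp add: add_divide_distrib)
    moreover have "\<bar>real_of_int P1\<bar> * P0 + \<bar>real_of_int P0\<bar> * P1 = 0" using opp by auto
    ultimately show False using nz[of s] by simp
  qed
  obtain s where s: "0 \<le> s" "s \<le> 1" "u = (real i + s) / 2 ^ e" by (rule in_cell_param[OF u])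
  have v: "(x u - u) * 4 ^ e = (1 - s) * P0 + s * P1" using val[OF s(1,2)] s(3) by simp
  from same show ?thesis
  proof
    assume "0 < P0 \<and> 0 < P1"
    then have "1 \<le> real_of_int P0" "1 \<le> real_of_int P1" by auto
    then have "(1 - s) * 1 + s * 1 \<le> (1 - s) * P0 + s * P1" using s by (intro add_mono mult_left_mono) auto
    then have "1 \<le> (x u - u) * 4 ^ e" using v by simp
    then have "1 / 4 ^ e \<le> x u - u" by (simp add: divide_le_eq)
    then show ?thesis by linarith
  next
    assume "P0 < 0 \<and> P1 < 0"
    then have "real_of_int P0 \<le> -1" "real_of_int P1 \<le> -1" by auto
    then have "(1 - s) * P0 + s * P1 \<le> (1 - s) * (-1) + s * (-1)" using s by (intro add_mono mult_left_mono) auto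
    then have "1 \<le> (u - x u) * 4 ^ e" using v by (simp add: algebra_simps)
    then have "1 / 4 ^ e \<le> u - x u" by (simp add: divide_le_eq)
    then show ?thesis by linarith
  qed
qed

text \<open>
  An orbit is monotone. As long as it avoids the cells with fixed points, every step has length
  at least \<open>4\<^sup>-\<^sup>e\<close>, and more than \<open>4\<^sup>e\<close> such steps would leave the unit interval.
\<close>

lemma orbit_meets_fixed_cell:
  assumes x: "x \<in> thompson_maps" "cell_fine e x" and t: "0 \<le> t" "t \<le> 1"
  shows "\<exists>m\<le>4 ^ e. \<exists>i<2 ^ e. in_cell e i ((x ^^ m) t) \<and> fixed_cell x e i"
proof (rule ccontr)
  assume no: "\<not> ?thesis"
  have orb: "0 \<le> (x ^^ m) t" "(x ^^ m) t \<le> 1" for m using thompson_pow_apply[OF x(1) t] by blast+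
  have moves: "(x ^^ m) t + 1 / 4 ^ e \<le> x ((x ^^ m) t) \<or> x ((x ^^ m) t) \<le> (x ^^ m) t - 1 / 4 ^ e" if m: "m \<le> 4 ^ e" for m
  proof -
    obtain i where i: "i < 2 ^ e" "in_cell e i ((x ^^ m) t)" by (rule cell_exists[OF orb])
    obtain e' j where c: "e' \<le> e + e" "cell_map x e i e' j" using cell_fineD[OF x(2) order_refl i(1)] by auto
    have "\<not> fixed_cell x e i" using no i m by blast
    then show ?thesis using displacement_off_fixed_cell[OF c(2) _ _ i(2)] c(1) by simp
  qed
  have pos: "(0::real) < 1 / 4 ^ e" by simp
  have total: "real (4 ^ e + 1) / 4 ^ e > 1" by (simp add: field_simps)
  have "t + 1 / 4 ^ e \<le> x t \<or> x t \<le> t - 1 / 4 ^ e" using moves[OF le0] by (simp only: funpow.simps id_apply)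
  then have "t \<noteq> x t" using pos by (elim disjE) linarith+
  then consider "t < x t" | "x t < t" by linarith
  then show False
  proof cases
    case 1
    have up: "(x ^^ m) t < x ((x ^^ m) t)" for m
    proof (induction m)
      case (Suc m)
      show ?case using thompson_less[OF x(1) orb(1)[of m] Suc] orb(2)[of "Suc m"] by simp
    qed (use 1 in simp)
    have "m \<le> 4 ^ e + 1 \<Longrightarrow> t + real m / 4 ^ e \<le> (x ^^ m) t" for m
    proof (induction m)
      case (Suc m)
      then have "(x ^^ m) t + 1 / 4 ^ e \<le> x ((x ^^ m) t)" using moves[of m] up[of m] pos by force
      then show ?case using Suc by (simp add: add_divide_distrib)
    qed simp
    from this[of "4 ^ e + 1"] show False using total orb(2)[of "4 ^ e + 1"] t by linarith
  next
    case 2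
    have down: "x ((x ^^ m) t) < (x ^^ m) t" for m
    proof (induction m)
      case (Suc m)
      show ?case using thompson_less[OF x(1) _ Suc orb(2)[of m]] orb(1)[of "Suc m"] by simp
    qed (use 2 in simp)
    have "m \<le> 4 ^ e + 1 \<Longrightarrow> (x ^^ m) t \<le> t - real m / 4 ^ e" for m
    proof (induction m)
      case (Suc m)
      then have "x ((x ^^ m) t) \<le> (x ^^ m) t - 1 / 4 ^ e" using moves[of m] down[of m] pos by force
      then show ?case using Suc by (simp add: add_divide_distrib)
    qed simp
    from this[of "4 ^ e + 1"] show False using total orb(1)[of "4 ^ e + 1"] t by linarith
  qed
qed

section \<open>Bounds for the fineness and the exponent of roots\<close>

lemma in_cell_subcell:
  assumes "q < 2 ^ d" "in_cell (e + d) (i * 2 ^ d + q) t" shows "in_cell e i t"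
proof -
  obtain s where s: "0 \<le> s" "s \<le> 1" "t = (real (i * 2 ^ d + q) + s) / 2 ^ (e + d)" by (rule in_cell_param[OF assms(2)])
  have "t = (real i + (real q + s) / 2 ^ d) / 2 ^ e" unfolding s(3) by (simp add: power_add field_simps)
  then show ?thesis using in_cellI cell_range[OF assms(1) s(1,2)] by simp
qed

text \<open>
  Let \<open>x\<^sup>m\<close> carry the midpoint of a small cell into a cell with a fixed point. A root \<open>h\<close> equals the
  composition of \<open>x\<^sup>m\<close>, \<open>h\<close> and \<open>x\<^sup>-\<^sup>m\<close>, where the middle factor acts on a cell on which it is
  affine with the controlled data of \<open>root_on_fixed_cell\<close>. The outer factors change the level
  of a cell by at most \<open>m * e\<close> each, the middle one by at most \<open>e\<close>; the remaining slack ensures that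
  the cells involved are small enough.
\<close>

theorem root_cell_fine:
  assumes h: "root_of n x h" and fx: "cell_fine e x" and fy: "cell_fine e (inv\<^bsub>thompson_F\<^esub> x)"
  shows "cell_fine ((2 * 4 ^ e + 4) * e) h"
proof (rule cell_fineI)
  note h' = root_of_facts[OF h]
  let ?M = "4 ^ e :: nat" and ?y = "inv\<^bsub>thompson_F\<^esub> x"
  fix E i assume E: "(2 * 4 ^ e + 4) * e \<le> E" "i < (2::nat) ^ E"
  let ?t = "(real i + 1 / 2) / 2 ^ E"
  have t: "0 \<le> ?t" "?t \<le> 1" using cell_range[OF E(2), of "1/2"] by auto
  obtain m i0 where m: "m \<le> ?M" and i0: "i0 < 2 ^ e" "in_cell e i0 ((x ^^ m) ?t)" "fixed_cell x e i0"
    using orbit_meets_fixed_cell[OF h'(3) fx t] by blast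
  have me: "m * e \<le> ?M * e" using m by simp
  have E2: "2 * (?M * e) + 4 * e \<le> E" using E(1) by (simp add: algebra_simps)
  \<comment> \<open>the image of the cell under \<open>x\<^sup>m\<close> is a cell, and by its midpoint it lies in the \<open>i0\<close>-th cell of level \<open>e\<close>\<close>
  obtain E1 j where 1: "E \<le> E1 + m * e" "E1 \<le> E + m * e" "j < 2 ^ E1" "cell_map (x ^^ m) E i E1 j"
    using cell_fineD[OF cell_fine_funpow[OF fx], of m E i] E2 me E(2) by auto
  have E1: "4 * e + ?M * e \<le> E1" using 1(1) E2 me by linarith
  have "in_cell e i0 ((real j + 1 / 2) / 2 ^ E1)" using i0(2) cell_mapD[OF 1(4), of "1/2"] by simp
  then obtain q where q: "q < 2 ^ (E1 - e)" "j = i0 * 2 ^ (E1 - e) + q"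
    using subcell_of_midpoint[of e E1 i0 j] E1 by auto
  obtain e' j0 where c: "e \<le> e' + e" "e' \<le> e + e" "cell_map x e i0 e' j0"
    using cell_fineD[OF fx order_refl i0(1)] by auto
  obtain a where a: "in_cell e i0 a" "x a = a" using i0(3) unfolding fixed_cell_def by blast
  obtain l z :: int where l: "l * int n = int e - int e'"
    and hl: "\<And>t. in_cell e i0 t \<Longrightarrow> h t = 2 powi l * t + of_int z / 2 ^ e'"
    using root_on_fixed_cell[OF h c(3) i0(1) a] by metis
  have "\<bar>l\<bar> \<le> \<bar>l * int n\<bar>" using h'(2) by (simp add: abs_mult mult_le_cancel_left1)
  then have le: "\<bar>l\<bar> \<le> int e" using l c by linarith
  have hj: "h t = 2 powi l * t + of_int z / 2 ^ e'" if "in_cell E1 j t" for t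
    using hl in_cell_subcell[OF q(1), of e i0 t] that q(2) E1 by simp
  have "4 * e \<le> E1" using E1 by (rule add_leD1)
  then have eE: "int e' + \<bar>l\<bar> \<le> int E1" using le c by linarith
  \<comment> \<open>\<open>h\<close> is affine on the cell with fixed point, so it maps the smaller cell to a cell\<close>
  obtain E2' j2 where 2: "int E2' = int E1 - l" "j2 < 2 ^ E2'" "cell_map h E1 j E2' j2"
    by (rule affine_cell[OF hj eE h'(1) 1(3)])
  have E2': "m * e \<le> E2'" "E1 \<le> E2' + e" "E2' \<le> E1 + e" using 2(1) le E1 me by linarith+
  obtain E3 j3 where 3: "E2' \<le> E3 + m * e" "E3 \<le> E2' + m * e" "j3 < 2 ^ E3" "cell_map (?y ^^ m) E2' j2 E3 j3"
    using cell_fineD[OF cell_fine_funpow[OF fy] E2'(1) 2(2)] by auto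
  have undo: "(?y ^^ m) ((x ^^ m) u) = u" if "0 \<le> u" "u \<le> 1" for u m
  proof (induction m)
    case (Suc m)
    have r: "0 \<le> (x ^^ m) u" "(x ^^ m) u \<le> 1" using thompson_pow_apply[OF h'(3) that] by blast+
    have "(?y ^^ Suc m) ((x ^^ Suc m) u) = (?y ^^ m) (?y (x ((x ^^ m) u)))" by (simp add: funpow_swap1)
    then show ?case using thompson_inv_apply(2)[OF h'(3) r] Suc by simp
  qed simp
  have comm: "h ((x ^^ m) u) = (x ^^ m) (h u)" if "0 \<le> u" "u \<le> 1" for u m
  proof (induction m)
    case (Suc m)
    have r: "0 \<le> (x ^^ m) u" "(x ^^ m) u \<le> 1" using thompson_pow_apply[OF h'(3) that] by blast+
    show ?case using root_commutes[OF h r] Suc by simp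
  qed simp
  have cm: "cell_map h E i E3 j3"
  proof (rule cell_mapI)
    fix s :: real assume s: "0 \<le> s" "s \<le> 1"
    let ?u = "(real i + s) / 2 ^ E"
    have u: "0 \<le> ?u" "?u \<le> 1" using cell_range[OF E(2) s] by auto
    have hu: "0 \<le> h ?u" "h ?u \<le> 1" using thompson_range[OF h'(1) u] by auto
    have "h ?u = (?y ^^ m) ((x ^^ m) (h ?u))" using undo[OF hu] by simp
    also have "\<dots> = (?y ^^ m) (h ((x ^^ m) ?u))" using comm[OF u] by simp
    also have "\<dots> = (real j3 + s) / 2 ^ E3"
      unfolding cell_mapD[OF 1(4) s] cell_mapD[OF 2(3) s] by (rule cell_mapD[OF 3(4) s])
    finally show "h ?u = (real j3 + s) / 2 ^ E3" .
  qed
  have "(2 * 4 ^ e + 4) * e = 2 * (?M * e) + 4 * e" by (simp add: algebra_simps)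
  then have "E \<le> E3 + (2 * 4 ^ e + 4) * e" "E3 \<le> E + (2 * 4 ^ e + 4) * e"
    using 1(1,2) 3(1,2) E2'(2,3) me by linarith+
  then show "\<exists>E' j. E \<le> E' + (2 * 4 ^ e + 4) * e \<and> E' \<le> E + (2 * 4 ^ e + 4) * e \<and> j < 2 ^ E' \<and> cell_map h E i E' j"
    using 3(3) cm by blast
qed

text \<open>
  Let \<open>n > e\<close>. On a cell with a fixed point the slope exponent of \<open>x\<close> is a multiple of \<open>n\<close> and at most \<open>e\<close>
  in absolute value, so it is 0 and \<open>x\<close> is the identity on the cell. Starting at the fixed point 0,
  this spreads from cell to cell.
\<close>

theorem root_order_bound:
  assumes h: "root_of n x h" and fx: "cell_fine e x" and nt: "x \<noteq> \<one>\<^bsub>thompson_F\<^esub>"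
  shows "n \<le> e"
proof (rule ccontr)
  assume ne: "\<not> n \<le> e"
  note h' = root_of_facts[OF h]
  have step: "x t = t" if i: "i < 2 ^ e" and a: "in_cell e i a" "x a = a" and t: "in_cell e i t" for i a t
  proof -
    obtain e' j where c: "e \<le> e' + e" "e' \<le> e + e" "cell_map x e i e' j" using cell_fineD[OF fx order_refl i] by auto
    obtain l :: int where l: "l * int n = int e - int e'" using root_on_fixed_cell[OF h c(3) i a] by blast
    have "l = 0"
    proof (rule ccontr)
      assume "l \<noteq> 0"
      then have "1 * int n \<le> \<bar>l\<bar> * int n" by (intro mult_right_mono) simp_all
      then have "int n \<le> \<bar>l * int n\<bar>" by (simp add: abs_mult)
      then show False using l c ne by linarith
    qed
    then have e': "e' = e" using l by simp
    obtain s where s: "0 \<le> s" "s \<le> 1" "a = (real i + s) / 2 ^ e" by (rule in_cell_param[OF a(1)])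
    have "(real j + s) / 2 ^ e = (real i + s) / 2 ^ e" using cell_mapD[OF c(3) s(1,2)] a(2) s(3) e' by simp
    then have "j = i" by simp
    obtain s' where s': "0 \<le> s'" "s' \<le> 1" "t = (real i + s') / 2 ^ e" by (rule in_cell_param[OF t])
    then show ?thesis using cell_mapD[OF c(3) s'(1,2)] \<open>j = i\<close> e' by simp
  qed
  have left: "i < 2 ^ e \<Longrightarrow> x (real i / 2 ^ e) = real i / 2 ^ e" for i
  proof (induction i)
    case 0 then show ?case using thompson_0[OF h'(3)] by simp
  next
    case (Suc i)
    have "in_cell e i (real i / 2 ^ e)" "in_cell e i (real (Suc i) / 2 ^ e)"
      unfolding in_cell_def by (simp_all add: divide_right_mono)
    then show ?case using step[of i "real i / 2 ^ e" "real (Suc i) / 2 ^ e"] Suc by simp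
  qed
  have "x = \<one>\<^bsub>thompson_F\<^esub>"
  proof (rule thompson_eqI[OF h'(3) thompson_one_closed])
    fix t :: real assume t: "0 \<le> t" "t \<le> 1"
    obtain i where i: "i < 2 ^ e" "in_cell e i t" by (rule cell_exists[OF t])
    have "in_cell e i (real i / 2 ^ e)" unfolding in_cell_def by (simp add: divide_right_mono)
    then show "x t = \<one>\<^bsub>thompson_F\<^esub> t" using step[OF i(1) _ left[OF i(1)] i(2)] t by simp
  qed
  then show False using nt by blast
qed

section \<open>A calculus of recursive functions\<close>

text \<open>
  Only the values on lists of length \<open>n\<close> count for \<^const>\<open>general_recursive\<close>, which is itself
  not closed under changing the others. Passing to this closure allows functions to be described by
  natural terms in the list of arguments.
\<close>

definition gr :: "nat \<Rightarrow> (nat list \<Rightarrow> nat) \<Rightarrow> bool" where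
  "gr n f \<longleftrightarrow> (\<exists>g. general_recursive n g \<and> (\<forall>xs. length xs = n \<longrightarrow> f xs = g xs))"

definition grp :: "nat \<Rightarrow> (nat list \<Rightarrow> bool) \<Rightarrow> bool" where
  "grp n P \<longleftrightarrow> gr n (\<lambda>xs. of_bool (P xs))"

lemma gr_cong: "gr n g \<Longrightarrow> (\<And>xs. length xs = n \<Longrightarrow> f xs = g xs) \<Longrightarrow> gr n f"
  unfolding gr_def by fastforce

lemma gr_general_recursive: "general_recursive n f \<Longrightarrow> gr n f"
  unfolding gr_def by blast

lemma gr_nth: "i < n \<Longrightarrow> gr n (\<lambda>xs. xs ! i)"
  by (rule gr_general_recursive) (rule general_recursive.proj)

lemma gr_comp:
  assumes g: "gr m g" and f: "\<And>i. i < m \<Longrightarrow> gr n (f i)"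
  shows "gr n (\<lambda>xs. g (map (\<lambda>i. f i xs) [0..<m]))"
proof -
  obtain G where G: "general_recursive m G" "\<And>xs. length xs = m \<Longrightarrow> g xs = G xs" using g unfolding gr_def by blast
  have "\<forall>i. \<exists>h. i < m \<longrightarrow> general_recursive n h \<and> (\<forall>xs. length xs = n \<longrightarrow> f i xs = h xs)"
    using f unfolding gr_def by blast
  then obtain h where h: "\<And>i. i < m \<Longrightarrow> general_recursive n (h i)" "\<And>i xs. i < m \<Longrightarrow> length xs = n \<Longrightarrow> f i xs = h i xs"
    by metis
  have "gr n (\<lambda>xs. G (map (\<lambda>i. h i xs) [0..<m]))"
    by (rule gr_general_recursive) (rule general_recursive.comp[OF G(1) h(1)])
  then show ?thesis
  proof (rule gr_cong)
    fix xs :: "nat list" assume "length xs = n"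
    then have m: "map (\<lambda>i. f i xs) [0..<m] = map (\<lambda>i. h i xs) [0..<m]" using h(2) by simp
    show "g (map (\<lambda>i. f i xs) [0..<m]) = G (map (\<lambda>i. h i xs) [0..<m])" unfolding m by (rule G(2)) simp
  qed
qed

lemma gr_comp1: "gr 1 (\<lambda>xs. f (xs ! 0)) \<Longrightarrow> gr n a \<Longrightarrow> gr n (\<lambda>xs. f (a xs))"
  using gr_comp[of 1 "\<lambda>xs. f (xs ! 0)" n "\<lambda>_. a"] by simp

lemma gr_comp2:
  assumes "gr 2 (\<lambda>xs. f (xs ! 0) (xs ! 1))" "gr n a" "gr n b" shows "gr n (\<lambda>xs. f (a xs) (b xs))"
  using gr_comp[of 2 "\<lambda>xs. f (xs ! 0) (xs ! 1)" n "\<lambda>i. if i = 0 then a else b"] assms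
  by (simp add: upt_rec numeral_2_eq_2)

lemma gr_comp3:
  assumes "gr 3 (\<lambda>xs. f (xs ! 0) (xs ! 1) (xs ! 2))" "gr n a" "gr n b" "gr n c" shows "gr n (\<lambda>xs. f (a xs) (b xs) (c xs))"
  using gr_comp[of 3 "\<lambda>xs. f (xs ! 0) (xs ! 1) (xs ! 2)" n "\<lambda>i. if i = 0 then a else if i = 1 then b else c"] assms
  by (simp add: upt_rec numeral_2_eq_2 numeral_3_eq_3)

lemma gr_comp4:
  assumes "gr 4 (\<lambda>xs. f (xs ! 0) (xs ! 1) (xs ! 2) (xs ! 3))" "gr n a" "gr n b" "gr n c" "gr n d"
  shows "gr n (\<lambda>xs. f (a xs) (b xs) (c xs) (d xs))"
  using gr_comp[of 4 "\<lambda>xs. f (xs ! 0) (xs ! 1) (xs ! 2) (xs ! 3)" n "\<lambda>i. if i = 0 then a else if i = 1 then b else if i = 2 then c else d"] assms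
  by (simp add: upt_rec numeral_2_eq_2 numeral_3_eq_3 eval_nat_numeral)

lemma map_nth_drop: "length xs = m + n \<Longrightarrow> map (\<lambda>i. xs ! (m + i)) [0..<n] = drop m xs"
  by (rule nth_equalityI) auto

lemma tl_eq_drop: "tl xs = drop 1 xs" "tl (tl xs) = drop 2 xs"
  by (simp_all add: drop_Suc numeral_2_eq_2)

lemma gr_drop: "gr n f \<Longrightarrow> gr (m + n) (\<lambda>xs. f (drop m xs))"
proof -
  assume f: "gr n f"
  have "gr (m + n) (\<lambda>xs. f (map (\<lambda>i. xs ! (m + i)) [0..<n]))"
    by (rule gr_comp[OF f]) (simp add: gr_nth)
  then show ?thesis by (rule gr_cong) (simp add: map_nth_drop)
qed

lemma gr_tl: "gr n f \<Longrightarrow> gr (Suc n) (\<lambda>xs. f (tl xs))"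
  using gr_drop[of n f 1] by (simp add: tl_eq_drop)

lemma gr_skip: "gr (Suc n) f \<Longrightarrow> gr (Suc (Suc n)) (\<lambda>xs. f (xs ! 0 # tl (tl xs)))"
proof -
  assume f: "gr (Suc n) f"
  have "gr (Suc (Suc n)) (\<lambda>xs. f (map (\<lambda>i. xs ! (if i = 0 then 0 else Suc i)) [0..<Suc n]))"
    by (rule gr_comp[OF f]) (simp add: gr_nth)
  then show ?thesis
  proof (rule gr_cong)
    fix xs :: "nat list" assume len: "length xs = Suc (Suc n)"
    have "map (\<lambda>i. xs ! (if i = 0 then 0 else Suc i)) [0..<Suc n] = xs ! 0 # tl (tl xs)"
      by (rule nth_equalityI) (use len in \<open>auto simp: nth_Cons' nth_tl simp del: upt_Suc\<close>)
    then show "f (xs ! 0 # tl (tl xs)) = f (map (\<lambda>i. xs ! (if i = 0 then 0 else Suc i)) [0..<Suc n])" by simp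
  qed
qed

text \<open>
  Primitive recursion whose bound and parameters are arbitrary functions of the arguments. In the step
  function the counter and the recursive value occupy the first two positions, so the old arguments
  are reached by \<open>tl (tl ys)\<close>.
\<close>

lemma gr_rec:
  assumes b: "gr n b" and f: "gr n f" and g: "gr (Suc (Suc n)) (\<lambda>ys. g (ys ! 0) (ys ! 1) (tl (tl ys)))"
  shows "gr n (\<lambda>xs. rec_nat (f xs) (\<lambda>y r. g y r xs) (b xs))"
proof -
  obtain f' where f': "general_recursive n f'" "\<And>xs. length xs = n \<Longrightarrow> f xs = f' xs" using f unfolding gr_def by blast
  obtain g' where g': "general_recursive (Suc (Suc n)) g'" "\<And>ys. length ys = Suc (Suc n) \<Longrightarrow> g (ys ! 0) (ys ! 1) (tl (tl ys)) = g' ys"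
    using g unfolding gr_def by blast
  let ?R = "\<lambda>xs. rec_nat (f' (tl xs)) (\<lambda>y r. g' (y # r # tl xs)) (hd xs)"
  have "gr (Suc n) ?R" by (rule gr_general_recursive) (rule general_recursive.prim[OF f'(1) g'(1)])
  then have "gr n (\<lambda>xs. ?R (map (\<lambda>i. if i = 0 then b xs else xs ! (i - 1)) [0..<Suc n]))"
  proof (rule gr_comp)
    fix i assume "i < Suc n"
    then show "gr n (\<lambda>xs. if i = 0 then b xs else xs ! (i - 1))" using b gr_nth[of "i - 1" n] by (cases i) auto
  qed
  then show ?thesis
  proof (rule gr_cong)
    fix xs :: "nat list" assume len: "length xs = n"
    have m: "map (\<lambda>i. if i = 0 then b xs else xs ! (i - 1)) [0..<Suc n] = b xs # xs"
      by (rule nth_equalityI) (use len in \<open>auto simp: nth_Cons' simp del: upt_Suc\<close>)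
    have "rec_nat (f xs) (\<lambda>y r. g y r xs) k = rec_nat (f' xs) (\<lambda>y r. g' (y # r # xs)) k" for k
    proof (induction k)
      case (Suc k)
      have "g k r xs = g' (k # r # xs)" for r using g'(2)[of "k # r # xs"] len by simp
      then show ?case using Suc by simp
    qed (use f'(2) len in simp)
    then show "rec_nat (f xs) (\<lambda>y r. g y r xs) (b xs) = ?R (map (\<lambda>i. if i = 0 then b xs else xs ! (i - 1)) [0..<Suc n])"
      unfolding m by simp
  qed
qed

named_theorems gr_intros

text \<open>
  The forms with \<open>tl\<close> arise under bounded sums, quantifiers and recursions, each of which puts one
  or two bound variables in front of the arguments.
\<close>

lemma gr_vars [gr_intros]:
  "i < n \<Longrightarrow> gr n (\<lambda>xs. xs ! i)" "Suc i < n \<Longrightarrow> gr n (\<lambda>xs. tl xs ! i)" "Suc (Suc i) < n \<Longrightarrow> gr n (\<lambda>xs. tl (tl xs) ! i)"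
  "Suc (Suc (Suc i)) < n \<Longrightarrow> gr n (\<lambda>xs. tl (tl (tl xs)) ! i)"
proof -
  show "i < n \<Longrightarrow> gr n (\<lambda>xs. xs ! i)" by (rule gr_nth)
  show "Suc i < n \<Longrightarrow> gr n (\<lambda>xs. tl xs ! i)"
    by (rule gr_cong[OF gr_nth[of "Suc i"]]) (auto simp: nth_tl)
  show "Suc (Suc i) < n \<Longrightarrow> gr n (\<lambda>xs. tl (tl xs) ! i)"
    by (rule gr_cong[OF gr_nth[of "Suc (Suc i)"]]) (auto simp: nth_tl)
  show "Suc (Suc (Suc i)) < n \<Longrightarrow> gr n (\<lambda>xs. tl (tl (tl xs)) ! i)"
    by (rule gr_cong[OF gr_nth[of "Suc (Suc (Suc i))"]]) (auto simp: nth_tl)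
qed

lemma gr_Suc [gr_intros]: "gr n a \<Longrightarrow> gr n (\<lambda>xs. Suc (a xs))"
  by (rule gr_comp1[OF gr_general_recursive[OF general_recursive.succ]])

lemma gr_const [gr_intros]: "gr n (\<lambda>xs. c)"
proof (induction c)
  case 0 show ?case by (rule gr_general_recursive) (rule general_recursive.zero)
qed (rule gr_Suc)

lemma gr_add [gr_intros]: assumes "gr n a" "gr n b" shows "gr n (\<lambda>xs. a xs + b xs)"
proof -
  have "gr n (\<lambda>xs. rec_nat (a xs) (\<lambda>y r. Suc r) (b xs))"
    by (rule gr_rec[OF assms(2,1)]) (intro gr_intros, simp)
  moreover have "rec_nat u (\<lambda>y r. Suc r) v = u + v" for u v :: nat by (induction v) auto
  ultimately show ?thesis by (simp add: gr_cong)
qed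

lemma gr_tl_tl: "gr n a \<Longrightarrow> gr (Suc (Suc n)) (\<lambda>xs. a (tl (tl xs)))"
  using gr_tl[OF gr_tl] .

lemma gr_mult [gr_intros]: assumes "gr n a" "gr n b" shows "gr n (\<lambda>xs. a xs * b xs)"
proof -
  have "gr n (\<lambda>xs. rec_nat 0 (\<lambda>y r. r + a xs) (b xs))"
    by (rule gr_rec[OF assms(2) gr_const]) (intro gr_add gr_vars(1) gr_tl_tl assms, simp)
  moreover have "rec_nat 0 (\<lambda>y r. r + u) v = u * v" for u v :: nat by (induction v) auto
  ultimately show ?thesis by simp
qed

text \<open>
  Truncated subtraction iterates the predecessor, itself a recursion that discards the recursive
  value.
\<close>

lemma gr_diff [gr_intros]: assumes "gr n a" "gr n b" shows "gr n (\<lambda>xs. a xs - b xs)"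
proof -
  have "gr 1 (\<lambda>xs. rec_nat 0 (\<lambda>y r. y) (xs ! 0))"
    by (rule gr_rec[OF gr_nth gr_const]) (simp, intro gr_vars(1), simp)
  moreover have "rec_nat 0 (\<lambda>y r. y) v = v - 1" for v :: nat by (cases v) auto
  ultimately have pred: "gr 1 (\<lambda>xs. xs ! 0 - 1)" by simp
  have "gr n (\<lambda>xs. rec_nat (a xs) (\<lambda>y r. r - 1) (b xs))"
    by (rule gr_rec[OF assms(2,1)], rule gr_comp1[OF pred, of "Suc (Suc n)" "\<lambda>ys. ys ! 1"]) (intro gr_vars(1), simp)
  moreover have "rec_nat u (\<lambda>y r. r - 1) v = u - v" for u v :: nat by (induction v) auto
  ultimately show ?thesis by simp
qed

lemma gr_power [gr_intros]: assumes "gr n a" "gr n b" shows "gr n (\<lambda>xs. a xs ^ b xs)"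
proof -
  have "gr n (\<lambda>xs. rec_nat 1 (\<lambda>y r. r * a xs) (b xs))"
    by (rule gr_rec[OF assms(2) gr_const]) (intro gr_mult gr_vars(1) gr_tl_tl assms, simp)
  moreover have "rec_nat 1 (\<lambda>y r. r * u) v = u ^ v" for u v :: nat by (induction v) auto
  ultimately show ?thesis by simp
qed

lemma gr_sum [gr_intros]:
  assumes "gr n b" "gr (Suc n) (\<lambda>ys. f (ys ! 0) (tl ys))"
  shows "gr n (\<lambda>xs. \<Sum>y<b xs. f y xs)"
proof -
  have "gr (Suc (Suc n)) (\<lambda>ys. f (ys ! 0) (tl (tl ys)))" using gr_skip[OF assms(2)] by simp
  then have "gr n (\<lambda>xs. rec_nat 0 (\<lambda>y r. r + f y xs) (b xs))"
    by (intro gr_rec[OF assms(1) gr_const] gr_add gr_vars(1)) simp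
  moreover have "rec_nat 0 (\<lambda>y r. r + f y xs) v = (\<Sum>y<v. f y xs)" for v xs by (induction v) auto
  ultimately show ?thesis by simp
qed

lemma grp_eq [gr_intros]: "gr n a \<Longrightarrow> gr n b \<Longrightarrow> grp n (\<lambda>xs. a xs = b xs)"
  unfolding grp_def by (rule gr_cong[of _ "\<lambda>xs. 1 - ((a xs - b xs) + (b xs - a xs))"]) (intro gr_intros, auto)

lemma grp_le [gr_intros]: "gr n a \<Longrightarrow> gr n b \<Longrightarrow> grp n (\<lambda>xs. a xs \<le> b xs)"
  unfolding grp_def by (rule gr_cong[of _ "\<lambda>xs. 1 - (a xs - b xs)"]) (intro gr_intros, auto)

lemma grp_less [gr_intros]: "gr n a \<Longrightarrow> gr n b \<Longrightarrow> grp n (\<lambda>xs. a xs < b xs)"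
  using grp_le[of n "\<lambda>xs. Suc (a xs)" b] by (simp add: gr_Suc Suc_le_eq)

lemma grp_not [gr_intros]: "grp n P \<Longrightarrow> grp n (\<lambda>xs. \<not> P xs)"
  unfolding grp_def by (rule gr_cong[of _ "\<lambda>xs. 1 - of_bool (P xs)"]) (intro gr_intros, auto)

lemma grp_conj [gr_intros]: "grp n P \<Longrightarrow> grp n Q \<Longrightarrow> grp n (\<lambda>xs. P xs \<and> Q xs)"
  unfolding grp_def by (rule gr_cong[of _ "\<lambda>xs. of_bool (P xs) * of_bool (Q xs)"]) (intro gr_intros, auto)

lemma grp_disj [gr_intros]: "grp n P \<Longrightarrow> grp n Q \<Longrightarrow> grp n (\<lambda>xs. P xs \<or> Q xs)"
  using grp_not[OF grp_conj[OF grp_not grp_not]] by simp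

lemma grp_imp [gr_intros]: "grp n P \<Longrightarrow> grp n Q \<Longrightarrow> grp n (\<lambda>xs. P xs \<longrightarrow> Q xs)"
  unfolding imp_conv_disj by (rule grp_disj[OF grp_not])

lemma gr_if [gr_intros]: "grp n P \<Longrightarrow> gr n a \<Longrightarrow> gr n b \<Longrightarrow> gr n (\<lambda>xs. if P xs then a xs else b xs)"
  unfolding grp_def
  by (rule gr_cong[of _ "\<lambda>xs. of_bool (P xs) * a xs + (1 - of_bool (P xs)) * b xs"]) (intro gr_intros, auto)

lemma grp_ex [gr_intros]:
  assumes "gr n b" "grp (Suc n) (\<lambda>ys. P (ys ! 0) (tl ys))" shows "grp n (\<lambda>xs. \<exists>y<b xs. P y xs)"
proof -
  have "gr (Suc n) (\<lambda>ys. of_bool (P (ys ! 0) (tl ys)))" using assms(2) unfolding grp_def .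
  then have "gr n (\<lambda>xs. \<Sum>y<b xs. of_bool (P y xs))" by (rule gr_sum[OF assms(1)])
  then have "grp n (\<lambda>xs. 0 < (\<Sum>y<b xs. of_bool (P y xs) :: nat))" by (rule grp_less[OF gr_const])
  moreover have "0 < (\<Sum>y<v. of_bool (P y xs) :: nat) \<longleftrightarrow> (\<exists>y<v. P y xs)" for v xs by (auto simp: card_gt_0_iff)
  ultimately show ?thesis by simp
qed

lemma grp_all [gr_intros]:
  assumes "gr n b" "grp (Suc n) (\<lambda>ys. P (ys ! 0) (tl ys))" shows "grp n (\<lambda>xs. \<forall>y<b xs. P y xs)"
  using grp_not[OF grp_ex[OF assms(1) grp_not[OF assms(2)]]] by simp

section \<open>Arithmetic on codes\<close>

text \<open>
  Lists are coded by \<^const>\<open>list_encode\<close>: the empty list as 0 and a nonempty one as the successor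
  of the code of the pair of its head and the code of its tail.
\<close>

definition pfst :: "nat \<Rightarrow> nat" where "pfst p = fst (prod_decode p)"
definition psnd :: "nat \<Rightarrow> nat" where "psnd p = snd (prod_decode p)"
definition ltl :: "nat \<Rightarrow> nat" where "ltl l = psnd (l - 1)"
definition lnth :: "nat \<Rightarrow> nat \<Rightarrow> nat" where "lnth c i = pfst ((ltl ^^ i) c - 1)"
text \<open>
  The list has an entry with index \<open>i\<close>.
\<close>

definition has :: "nat \<Rightarrow> nat \<Rightarrow> bool" where "has c i \<longleftrightarrow> 0 < (ltl ^^ i) c"

text \<open>
  The numerator of a coded dyadic number over the denominator \<open>2\<^sup>L\<close>, provided that \<open>L\<close> is at least the
  coded exponent.
\<close>

definition coord :: "nat \<Rightarrow> nat \<Rightarrow> nat" where "coord L p = pfst p * 2 ^ (L - psnd p)"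
text \<open>
  The coordinates of the \<open>i\<close>-th vertex over the common denominator \<open>2\<^sup>L\<close>.
\<close>

definition vx :: "nat \<Rightarrow> nat \<Rightarrow> nat \<Rightarrow> nat" where "vx L c i = coord L (pfst (lnth c i))"
definition vy :: "nat \<Rightarrow> nat \<Rightarrow> nat \<Rightarrow> nat" where "vy L c i = coord L (psnd (lnth c i))"

text \<open>
  The vanishing of a determinant, with the negative terms moved to the other side so that it makes
  sense for natural numbers.
\<close>

definition collinear_nat :: "nat \<Rightarrow> nat \<Rightarrow> nat \<Rightarrow> nat \<Rightarrow> nat \<Rightarrow> nat \<Rightarrow> bool" where
  "collinear_nat a b k1 s1 k2 s2 \<longleftrightarrow> b * k2 + a * s1 + k1 * s2 = b * k1 + s1 * k2 + a * s2"

text \<open>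
  The point with coordinates \<open>a\<close> and \<open>b\<close> over \<open>2\<^sup>L\<close> lies on the polygon coded by \<open>c\<close>.
\<close>

definition on_graph :: "nat \<Rightarrow> nat \<Rightarrow> nat \<Rightarrow> nat \<Rightarrow> bool" where
  "on_graph L c a b \<longleftrightarrow> (\<exists>i<c. has c (Suc i) \<and> vx L c i \<le> a \<and> a \<le> vx L c (Suc i) \<and>
     collinear_nat a b (vx L c i) (vy L c i) (vx L c (Suc i)) (vy L c (Suc i)))"

text \<open>
  The value at \<open>a\<close>, on the grid of width \<open>2\<^sup>-\<^sup>L\<close>. If the value is a grid point, the sum has it as
  its only possible nonzero term.
\<close>

definition app :: "nat \<Rightarrow> nat \<Rightarrow> nat \<Rightarrow> nat" where
  "app L c a = (\<Sum>b<Suc (2 ^ L). if on_graph L c a b then b else 0)"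

text \<open>
  The slope of the segment is \<open>2\<^sup>m\<close> or \<open>2\<^sup>-\<^sup>m\<close> for some \<open>m \<le> c\<close>. The bound on the exponent loses nothing
  because vertices coded by \<open>c\<close> have coordinates that are multiples of \<open>2\<^sup>-\<^sup>c\<close> in the unit interval.
\<close>

definition pow2_slope :: "nat \<Rightarrow> nat \<Rightarrow> nat \<Rightarrow> nat \<Rightarrow> nat \<Rightarrow> bool" where
  "pow2_slope c k1 s1 k2 s2 \<longleftrightarrow>
     (\<exists>m<Suc c. s2 * 2 ^ m + k1 = k2 + s1 * 2 ^ m \<or> k2 * 2 ^ m + s1 = s2 + k1 * 2 ^ m)"

text \<open>
  The number \<open>c\<close> is at least the length of the list it codes and all exponents of its entries, so it
  serves as a bound for indices and as exponent of a common denominator.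
\<close>

definition valid :: "nat \<Rightarrow> bool" where
  "valid c \<longleftrightarrow> has c 1 \<and> vx c c 0 = 0 \<and> vy c c 0 = 0 \<and>
     (\<forall>i<c. has c i \<longrightarrow>
        (has c (Suc i) \<longrightarrow> vx c c i < vx c c (Suc i) \<and>
           pow2_slope c (vx c c i) (vy c c i) (vx c c (Suc i)) (vy c c (Suc i))) \<and>
        (\<not> has c (Suc i) \<longrightarrow> vx c c i = 2 ^ c \<and> vy c c i = 2 ^ c))"

text \<open>
  A level \<open>M\<close> at which the element coded by \<open>c\<close> and the \<open>n\<close>-th power of the one coded by \<open>e\<close> are
  both affine on cells, while their values at the grid points have denominator at most \<open>2\<^sup>2\<^sup>M\<close>.
\<close>

definition check_level :: "nat \<Rightarrow> nat \<Rightarrow> nat \<Rightarrow> nat" where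
  "check_level c e n = 3 * (e + 1) * (n + 1) + 3 * c"

definition iterate_app :: "nat \<Rightarrow> nat \<Rightarrow> nat \<Rightarrow> nat \<Rightarrow> nat" where
  "iterate_app L e n a = rec_nat a (\<lambda>_ r. app L e r) n"

text \<open>
  Equality of the \<open>n\<close>-th power with the given element is tested at all grid points of width \<open>2\<^sup>-\<^sup>M\<close>,
  with \<open>M\<close> the check level; the values are computed on the grid of width \<open>2\<^sup>-\<^sup>2\<^sup>M\<close>. The bound on \<open>n\<close> is that of
  \<open>root_order_bound\<close>, as the given element is \<open>3 * c\<close>-fine; it always admits \<open>n = 1\<close>, which
  covers the identity element.
\<close>

definition is_root_code :: "nat \<Rightarrow> nat \<Rightarrow> bool" where
  "is_root_code c e \<longleftrightarrow> valid e \<and> (\<exists>n<3 * c + 2. 0 < n \<and>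
     (\<forall>a<Suc (2 ^ check_level c e n).
        iterate_app (2 * check_level c e n) e n (a * 2 ^ check_level c e n) =
        app (2 * check_level c e n) c (a * 2 ^ check_level c e n)))"

text \<open>
  The bound of \<open>root_cell_fine\<close> with \<open>6 * c\<close> for the fineness of the coded element and of its inverse.
\<close>

definition fineness_bound :: "nat \<Rightarrow> nat" where
  "fineness_bound c = (2 * 4 ^ (6 * c) + 4) * (6 * c)"

text \<open>
  A bound for the code of a list of \<open>2\<^sup>E + 1\<close> vertices with abscissas \<open>i / 2\<^sup>E\<close> and ordinates
  \<open>j / 4\<^sup>E\<close>: the code of the list in which every entry is replaced by an upper bound for all of them.
\<close>

definition code_bound :: "nat \<Rightarrow> nat" where
  "code_bound E = rec_nat 0 (\<lambda>_ r. Suc (prod_encode (prod_encode (prod_encode (2 ^ E, E), prod_encode (4 ^ E, 2 * E)), r))) (Suc (2 ^ E))"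

text \<open>
  The code of the list of all root codes up to the bound.
\<close>

definition root_list :: "nat \<Rightarrow> nat" where
  "root_list c = rec_nat 0 (\<lambda>e r. if is_root_code c e then Suc (prod_encode (e, r)) else r) (Suc (code_bound (fineness_bound c)))"

lemma gr_prod_encode [gr_intros]: assumes "gr n a" "gr n b" shows "gr n (\<lambda>xs. prod_encode (a xs, b xs))"
proof -
  have "triangle v = (\<Sum>i<Suc v. i)" for v by (induction v) auto
  then have "gr 1 (\<lambda>xs. triangle (xs ! 0))" by (simp only:) (intro gr_intros; simp)
  then have "gr n (\<lambda>xs. triangle (a xs + b xs) + a xs)"
    using gr_add[OF gr_comp1[OF _ gr_add[OF assms]] assms(1)] by blast
  then show ?thesis unfolding prod_encode_def by simp
qed

text \<open>
  The pairing function is increasing in both arguments, so decoding is a bounded search, expressed as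
  a sum with a single relevant term.
\<close>

lemma prod_decode_sums:
  "pfst p = (\<Sum>a<Suc p. \<Sum>b<Suc p. if prod_encode (a, b) = p then a else 0)"
  "psnd p = (\<Sum>a<Suc p. \<Sum>b<Suc p. if prod_encode (a, b) = p then b else 0)"
proof -
  obtain u v where p: "prod_decode p = (u, v)" by (cases "prod_decode p")
  then have pe: "p = prod_encode (u, v)" by (metis prod_decode_inverse)
  have le: "u < Suc p" "v < Suc p" unfolding pe using le_prod_encode_1 le_prod_encode_2 by (auto simp: less_Suc_eq_le)
  have if_eq: "(if prod_encode (a, b) = p then f a b else 0) = (if a = u then if b = v then f u v else 0 else 0)"
    for a b and f :: "nat \<Rightarrow> nat \<Rightarrow> nat" unfolding pe by auto
  have "(\<Sum>a<Suc p. \<Sum>b<Suc p. if prod_encode (a, b) = p then f a b else 0) = f u v" for f :: "nat \<Rightarrow> nat \<Rightarrow> nat"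
  proof -
    have "(\<Sum>b<Suc p. if a = u then if b = v then f u v else 0 else 0) = (if a = u then f u v else 0)" for a
      using le by (simp add: sum.delta del: sum.lessThan_Suc)
    then show ?thesis unfolding if_eq using le by (simp add: sum.delta del: sum.lessThan_Suc)
  qed
  from this[of "\<lambda>a b. a"] this[of "\<lambda>a b. b"]
  show "pfst p = (\<Sum>a<Suc p. \<Sum>b<Suc p. if prod_encode (a, b) = p then a else 0)"
    "psnd p = (\<Sum>a<Suc p. \<Sum>b<Suc p. if prod_encode (a, b) = p then b else 0)"
    by (simp_all add: pfst_def psnd_def p del: sum.lessThan_Suc)
qed

lemma gr_pfst [gr_intros]: "gr n a \<Longrightarrow> gr n (\<lambda>xs. pfst (a xs))"
  by (rule gr_comp1[of pfst]) (unfold prod_decode_sums, intro gr_intros; simp)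

lemma gr_psnd [gr_intros]: "gr n a \<Longrightarrow> gr n (\<lambda>xs. psnd (a xs))"
  by (rule gr_comp1[of psnd]) (unfold prod_decode_sums, intro gr_intros; simp)

lemma gr_ltl_iter [gr_intros]: assumes "gr n a" "gr n b" shows "gr n (\<lambda>xs. (ltl ^^ b xs) (a xs))"
proof -
  have "gr n (\<lambda>xs. rec_nat (a xs) (\<lambda>y r. ltl r) (b xs))"
    by (rule gr_rec[OF assms(2,1)]) (unfold ltl_def, intro gr_intros, simp)
  moreover have "rec_nat u (\<lambda>y r. ltl r) v = (ltl ^^ v) u" for u v by (induction v) auto
  ultimately show ?thesis by simp
qed

lemma gr_lnth [gr_intros]: "gr n a \<Longrightarrow> gr n b \<Longrightarrow> gr n (\<lambda>xs. lnth (a xs) (b xs))"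
  unfolding lnth_def by (intro gr_intros)

lemma grp_has [gr_intros]: "gr n a \<Longrightarrow> gr n b \<Longrightarrow> grp n (\<lambda>xs. has (a xs) (b xs))"
  unfolding has_def by (intro gr_intros)

lemma gr_vx [gr_intros]: "gr n a \<Longrightarrow> gr n b \<Longrightarrow> gr n c \<Longrightarrow> gr n (\<lambda>xs. vx (a xs) (b xs) (c xs))"
  unfolding vx_def coord_def by (intro gr_intros)

lemma gr_vy [gr_intros]: "gr n a \<Longrightarrow> gr n b \<Longrightarrow> gr n c \<Longrightarrow> gr n (\<lambda>xs. vy (a xs) (b xs) (c xs))"
  unfolding vy_def coord_def by (intro gr_intros)

lemma grp_on_graph: "grp 4 (\<lambda>xs. on_graph (xs ! 0) (xs ! 1) (xs ! 2) (xs ! 3))"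
  unfolding on_graph_def collinear_nat_def by (intro gr_intros; simp)

lemma gr_app [gr_intros]:
  assumes "gr n a" "gr n b" "gr n c" shows "gr n (\<lambda>xs. app (a xs) (b xs) (c xs))"
proof (rule gr_comp3[OF _ assms])
  have "gr 4 (\<lambda>xs. of_bool (on_graph (tl xs ! 0) (tl xs ! 1) (tl xs ! 2) (xs ! 0)))"
    by (rule gr_comp4[OF grp_on_graph[unfolded grp_def]]) (intro gr_vars; simp)+
  then have "grp (Suc 3) (\<lambda>xs. on_graph (tl xs ! 0) (tl xs ! 1) (tl xs ! 2) (xs ! 0))" unfolding grp_def by simp
  then show "gr 3 (\<lambda>xs. app (xs ! 0) (xs ! 1) (xs ! 2))"
    unfolding app_def by (intro gr_sum gr_if gr_intros; simp)
qed

lemma grp_valid: "grp 1 (\<lambda>xs. valid (xs ! 0))"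
  unfolding valid_def pow2_slope_def by (intro gr_intros; simp)

lemma gr_check_level [gr_intros]: "gr n a \<Longrightarrow> gr n b \<Longrightarrow> gr n c \<Longrightarrow> gr n (\<lambda>xs. check_level (a xs) (b xs) (c xs))"
  unfolding check_level_def by (intro gr_intros)

lemma gr_iterate_app [gr_intros]:
  assumes "gr n a" "gr n b" "gr n c" "gr n d" shows "gr n (\<lambda>xs. iterate_app (a xs) (b xs) (c xs) (d xs))"
  unfolding iterate_app_def
  by (rule gr_rec[OF assms(3,4)]) (intro gr_app gr_tl_tl assms gr_vars(1), simp)

lemma grp_is_root_code: "grp 2 (\<lambda>xs. is_root_code (xs ! 0) (xs ! 1))"
proof -
  have "grp 2 (\<lambda>xs. valid (xs ! 1))"
    using gr_comp1[OF grp_valid[unfolded grp_def], of 2 "\<lambda>xs. xs ! 1"] gr_nth[of 1 2] unfolding grp_def by simp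
  then show ?thesis unfolding is_root_code_def by (intro grp_conj) (assumption, (intro gr_intros; simp))
qed

theorem computable_root_list: "computable root_list"
proof -
  have b: "gr n (\<lambda>xs. code_bound (a xs))" if a: "gr n a" for n a
    unfolding code_bound_def
    by (rule gr_rec) (intro gr_intros a, intro gr_intros, intro gr_intros gr_tl_tl a, simp)
  have "gr 3 (\<lambda>ys. of_bool (is_root_code (tl (tl ys) ! 0) (ys ! 0)))"
    by (rule gr_comp2[OF grp_is_root_code[unfolded grp_def]]) (intro gr_vars; simp)+
  then have "grp (Suc (Suc 1)) (\<lambda>ys. is_root_code (tl (tl ys) ! 0) (ys ! 0))" unfolding grp_def by (simp add: numeral_3_eq_3)
  then have "gr 1 (\<lambda>xs. root_list (xs ! 0))"
    unfolding root_list_def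
    by (intro gr_rec gr_Suc b gr_const gr_if gr_prod_encode gr_vars(1)) (unfold fineness_bound_def, ((intro gr_intros)?; simp)+)
  then obtain g where "general_recursive 1 g" "\<And>xs. length xs = 1 \<Longrightarrow> root_list (xs ! 0) = g xs" unfolding gr_def by blast
  then show ?thesis unfolding computable_def by (intro exI[of _ g] conjI allI) (simp, metis One_nat_def length_Cons list.size(3) nth_Cons_0)
qed

section \<open>Reading codes\<close>

lemma list_decode_pos: "0 < l \<Longrightarrow> list_decode l = pfst (l - 1) # list_decode (psnd (l - 1))"
  by (cases l) (simp_all add: pfst_def psnd_def split: prod.split)

lemma psnd_0: "psnd 0 = 0"
proof -
  have "prod_encode (0, 0) = 0" by (simp add: prod_encode_def)
  then have "prod_decode 0 = (0, 0)" by (metis prod_encode_inverse)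
  then show ?thesis by (simp add: psnd_def)
qed

lemma list_decode_ltl: "list_decode (ltl l) = tl (list_decode l)"
  by (cases "l = 0") (simp_all add: ltl_def psnd_0 list_decode_pos)

lemma list_decode_ltl_iter: "list_decode ((ltl ^^ i) c) = drop i (list_decode c)"
  by (induction i) (simp_all add: list_decode_ltl drop_Suc tl_drop)

lemma list_decode_eq_Nil: "list_decode l = [] \<longleftrightarrow> l = 0"
  by (cases "l = 0") (simp_all add: list_decode_pos)

lemma has_iff: "has c i \<longleftrightarrow> i < length (list_decode c)"
  unfolding has_def using list_decode_ltl_iter[of i c] list_decode_eq_Nil[of "(ltl ^^ i) c"] by auto

lemma lnth_eq: "i < length (list_decode c) \<Longrightarrow> lnth c i = list_decode c ! i"
proof -
  assume i: "i < length (list_decode c)"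
  then have "0 < (ltl ^^ i) c" using has_iff has_def by simp
  then have "drop i (list_decode c) = lnth c i # list_decode (psnd ((ltl ^^ i) c - 1))"
    using list_decode_pos list_decode_ltl_iter unfolding lnth_def by metis
  then show ?thesis by (metis hd_drop_conv_nth i list.sel(1))
qed

lemma length_le_list_encode: "length xs \<le> list_encode xs"
proof (induction xs)
  case (Cons x xs)
  then show ?case using le_prod_encode_2[of "list_encode xs" x] by simp
qed simp

lemma length_list_decode: "length (list_decode c) \<le> c"
  using length_le_list_encode[of "list_decode c"] by simp

lemma mem_le_list_encode: "x \<in> set xs \<Longrightarrow> x < list_encode xs"
proof (induction xs)
  case (Cons y xs)
  then show ?case using le_prod_encode_1[of y "list_encode xs"] le_prod_encode_2[of "list_encode xs" y] by auto
qed simp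

lemma nth_list_decode_less: "i < length (list_decode c) \<Longrightarrow> list_decode c ! i < c"
  using mem_le_list_encode[of "list_decode c ! i" "list_decode c"] by simp

lemma pfst_le: "pfst p \<le> p" and psnd_le: "psnd p \<le> p"
  using le_prod_encode_1[of "pfst p" "psnd p"] le_prod_encode_2[of "psnd p" "pfst p"]
  by (simp_all add: pfst_def psnd_def)

lemma decode_dyadic_coord: "psnd p \<le> L \<Longrightarrow> decode_dyadic p = real (coord L p) / 2 ^ L"
proof -
  assume "psnd p \<le> L"
  then have "(2::real) ^ L = 2 ^ (L - psnd p) * 2 ^ psnd p" by (simp flip: power_add)
  then show ?thesis unfolding decode_dyadic_def coord_def pfst_def psnd_def by (simp add: case_prod_beta)
qed

definition vert :: "nat \<Rightarrow> nat \<Rightarrow> real \<times> real" where "vert c i = decode_vertices c ! i"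

lemma vert_coords:
  assumes i: "i < length (list_decode c)" and L: "c \<le> L"
  shows "vert c i = (real (vx L c i) / 2 ^ L, real (vy L c i) / 2 ^ L)"
proof -
  let ?p = "list_decode c ! i"
  have p: "?p < c" by (rule nth_list_decode_less[OF i])
  have le: "psnd (pfst ?p) \<le> L" "psnd (psnd ?p) \<le> L"
    using psnd_le[of "pfst ?p"] pfst_le[of ?p] psnd_le[of "psnd ?p"] psnd_le[of ?p] p L by linarith+
  have "vert c i = (decode_dyadic (pfst ?p), decode_dyadic (psnd ?p))"
    unfolding vert_def decode_vertices_def using i by (simp add: map_prod_def case_prod_beta pfst_def psnd_def)
  then show ?thesis unfolding decode_dyadic_coord[OF le(1)] decode_dyadic_coord[OF le(2)] vx_def vy_def lnth_eq[OF i] .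
qed

text \<open>
  The same determinant as in \<^const>\<open>collinear_nat\<close>, for real points.
\<close>

definition collinear :: "real \<Rightarrow> real \<Rightarrow> real \<times> real \<Rightarrow> real \<times> real \<Rightarrow> bool" where
  "collinear t s p q \<longleftrightarrow> s * fst q + t * snd p + fst p * snd q = s * fst p + snd p * fst q + t * snd q"

lemma closed_segment_iff:
  fixes p q :: "real \<times> real" assumes pq: "fst p < fst q"
  shows "(t, s) \<in> closed_segment p q \<longleftrightarrow> fst p \<le> t \<and> t \<le> fst q \<and> collinear t s p q"
proof
  assume "(t, s) \<in> closed_segment p q"
  then obtain u where u: "0 \<le> u" "u \<le> 1" "(t, s) = (1 - u) *\<^sub>R p + u *\<^sub>R q" unfolding closed_segment_def by blast
  then have ts: "t = (1 - u) * fst p + u * fst q" "s = (1 - u) * snd p + u * snd q"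
    by (metis fst_add fst_conv fst_scaleR real_scaleR_def, metis snd_add snd_conv snd_scaleR real_scaleR_def)
  have e: "t - fst p = u * (fst q - fst p)" "fst q - t = (1 - u) * (fst q - fst p)" unfolding ts by (simp_all add: algebra_simps)
  have "0 \<le> t - fst p" unfolding e(1) using u pq by simp
  moreover have "0 \<le> fst q - t" unfolding e(2) using u pq by simp
  ultimately have "fst p \<le> t" "t \<le> fst q" by simp_all
  moreover have "collinear t s p q" unfolding collinear_def ts by (simp add: algebra_simps)
  ultimately show "fst p \<le> t \<and> t \<le> fst q \<and> collinear t s p q" by blast
next
  assume a: "fst p \<le> t \<and> t \<le> fst q \<and> collinear t s p q"
  define w where "w = fst q - fst p"
  have w: "0 < w" "w \<noteq> 0" unfolding w_def using pq by auto
  define u where "u = (t - fst p) / w"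
  have u: "0 \<le> u" "u \<le> 1" unfolding u_def using a w by (simp_all add: w_def)
  have uw: "u * w = t - fst p" unfolding u_def using w by simp
  have "t = fst p + u * w" using uw by simp
  then have t: "t = (1 - u) * fst p + u * fst q" unfolding w_def by (simp add: algebra_simps)
  have "(s - snd p) * w = (t - fst p) * (snd q - snd p)" using a unfolding collinear_def w_def by (simp add: algebra_simps)
  then have "(s - snd p) * w = (u * (snd q - snd p)) * w" unfolding uw[symmetric] by (simp add: mult.commute mult.left_commute)
  then have "s - snd p = u * (snd q - snd p)" unfolding mult_cancel_right using w(2) by blast
  then have "s = (1 - u) * snd p + u * snd q" by (simp add: algebra_simps)
  with t have "(t, s) = (1 - u) *\<^sub>R p + u *\<^sub>R q" by (simp add: prod_eq_iff)
  then show "(t, s) \<in> closed_segment p q" unfolding closed_segment_def using u by blast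
qed

lemma collinear_scaled:
  "collinear (real a / 2 ^ L) (real b / 2 ^ L) (real k1 / 2 ^ L, real s1 / 2 ^ L) (real k2 / 2 ^ L, real s2 / 2 ^ L)
    \<longleftrightarrow> collinear_nat a b k1 s1 k2 s2"
proof -
  let ?D = "(2::real) ^ L * 2 ^ L"
  have "collinear (real a / 2 ^ L) (real b / 2 ^ L) (real k1 / 2 ^ L, real s1 / 2 ^ L) (real k2 / 2 ^ L, real s2 / 2 ^ L)
    \<longleftrightarrow> real (b * k2 + a * s1 + k1 * s2) / ?D = real (b * k1 + s1 * k2 + a * s2) / ?D"
    unfolding collinear_def by (simp add: add_divide_distrib)
  also have "\<dots> \<longleftrightarrow> real (b * k2 + a * s1 + k1 * s2) = real (b * k1 + s1 * k2 + a * s2)" by simp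
  also have "\<dots> \<longleftrightarrow> collinear_nat a b k1 s1 k2 s2" unfolding collinear_nat_def by (simp only: of_nat_eq_iff)
  finally show ?thesis .
qed

section \<open>Codes and their elements\<close>

lemma codes_element_iff:
  "codes_element c x \<longleftrightarrow> x \<in> thompson_maps \<and>
     sorted_wrt (\<lambda>p q. fst p < fst q) (decode_vertices c) \<and>
     (\<lambda>t. (t, x t)) ` {0..1} = (\<Union>i<length (list_decode c) - 1. closed_segment (vert c i) (vert c (Suc i)))"
  unfolding codes_element_def Let_def vert_def by (simp add: decode_vertices_def)

lemma codes_sorted:
  "codes_element c x \<Longrightarrow> i < j \<Longrightarrow> j < length (list_decode c) \<Longrightarrow> fst (vert c i) < fst (vert c j)"
  unfolding codes_element_iff vert_def
  by (auto simp: sorted_wrt_iff_nth_less decode_vertices_def)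

lemma codes_graph:
  assumes c: "codes_element c x" and i: "Suc i < length (list_decode c)" and t: "fst (vert c i) \<le> t" "t \<le> fst (vert c (Suc i))"
    and col: "collinear t s (vert c i) (vert c (Suc i))"
  shows "0 \<le> t" "t \<le> 1" "s = x t"
proof -
  have "(t, s) \<in> closed_segment (vert c i) (vert c (Suc i))"
    using closed_segment_iff[OF codes_sorted[OF c _ i, of i]] t col by simp
  then have "(t, s) \<in> (\<lambda>t. (t, x t)) ` {0..1}" using c i unfolding codes_element_iff by force
  then show "0 \<le> t" "t \<le> 1" "s = x t" by auto
qed

lemma codes_locate:
  assumes c: "codes_element c x" and t: "0 \<le> t" "t \<le> 1"
  obtains i where "Suc i < length (list_decode c)" "fst (vert c i) \<le> t" "t \<le> fst (vert c (Suc i))"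
    "collinear t (x t) (vert c i) (vert c (Suc i))"
proof -
  have "(t, x t) \<in> (\<lambda>t. (t, x t)) ` {0..1}" using t by auto
  then obtain i where i: "i < length (list_decode c) - 1" "(t, x t) \<in> closed_segment (vert c i) (vert c (Suc i))"
    using c unfolding codes_element_iff by blast
  then have "Suc i < length (list_decode c)" by simp
  then show thesis using that i(2) closed_segment_iff[OF codes_sorted[OF c]] by blast
qed

lemma codes_length: "codes_element c x \<Longrightarrow> 1 < length (list_decode c)"
  using codes_locate[of c x 0] by (metis One_nat_def Suc_lessD Suc_lessI le_numeral_extra(3) less_Suc_eq_0_disj not_less_eq zero_less_one less_imp_le)

lemma codes_vertex:
  assumes c: "codes_element c x" and i: "i < length (list_decode c)"
  shows "0 \<le> fst (vert c i)" "fst (vert c i) \<le> 1" "snd (vert c i) = x (fst (vert c i))"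
proof -
  have "0 \<le> fst (vert c i) \<and> fst (vert c i) \<le> 1 \<and> snd (vert c i) = x (fst (vert c i))"
  proof (cases "Suc i < length (list_decode c)")
    case True
    have "fst (vert c i) \<le> fst (vert c (Suc i))" using codes_sorted[OF c _ True, of i] by simp
    then show ?thesis using codes_graph[OF c True order_refl, of "snd (vert c i)"] unfolding collinear_def by simp
  next
    case False
    then obtain j where j: "i = Suc j" "Suc j < length (list_decode c)" using i codes_length[OF c] by (cases i) auto
    have "fst (vert c j) \<le> fst (vert c (Suc j))" using codes_sorted[OF c _ j(2), of j] by simp
    then show ?thesis using codes_graph[OF c j(2) _ order_refl, of "snd (vert c i)"] unfolding collinear_def j(1) by simp
  qed
  then show "0 \<le> fst (vert c i)" "fst (vert c i) \<le> 1" "snd (vert c i) = x (fst (vert c i))" by blast+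
qed

lemma codes_ends:
  assumes c: "codes_element c x"
  shows "vert c 0 = (0, 0)" "vert c (length (list_decode c) - 1) = (1, 1)"
proof -
  let ?n = "length (list_decode c)"
  have x: "x \<in> thompson_maps" using c unfolding codes_element_iff by blast
  have n: "1 < ?n" by (rule codes_length[OF c])
  then have n0: "0 < ?n" "?n - 1 < ?n" by linarith+
  obtain i where i: "Suc i < ?n" "fst (vert c i) \<le> 0" by (rule codes_locate[OF c, of 0]) auto
  have "fst (vert c 0) \<le> fst (vert c i)" using codes_sorted[OF c, of 0 i] i by (cases "i = 0") auto
  then have "fst (vert c 0) = 0" using codes_vertex(1)[OF c n0(1)] i by simp
  then show "vert c 0 = (0, 0)" using codes_vertex(3)[OF c n0(1)] thompson_0[OF x] by (simp add: prod_eq_iff)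
  obtain j where j: "Suc j < ?n" "1 \<le> fst (vert c (Suc j))" by (rule codes_locate[OF c, of 1]) auto
  have "fst (vert c (Suc j)) \<le> fst (vert c (?n - 1))"
  proof (cases "Suc j = ?n - 1")
    case False
    then have "Suc j < ?n - 1" using j by linarith
    then show ?thesis using codes_sorted[OF c _ n0(2)] by (simp add: less_imp_le)
  qed simp
  then have "fst (vert c (?n - 1)) = 1" using codes_vertex(2)[OF c n0(2)] j by simp
  then show "vert c (?n - 1) = (1, 1)" using codes_vertex(3)[OF c n0(2)] thompson_1[OF x] by (simp add: prod_eq_iff)
qed

text \<open>
  The segment is part of the graph of an element of the group, so near its left end its slope is a
  power of two. Two distinct coordinates differ by at least \<open>2\<^sup>-\<^sup>c\<close> and at most 1, which bounds the
  exponent.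
\<close>

lemma codes_slope:
  assumes c: "codes_element c x" and i: "Suc i < length (list_decode c)"
  obtains q :: int where "\<bar>q\<bar> \<le> int c" "snd (vert c (Suc i)) - snd (vert c i) = 2 powi q * (fst (vert c (Suc i)) - fst (vert c i))"
    "\<And>t. fst (vert c i) \<le> t \<Longrightarrow> t \<le> fst (vert c (Suc i)) \<Longrightarrow> x t = snd (vert c i) + 2 powi q * (t - fst (vert c i))"
proof -
  have x: "x \<in> thompson_maps" using c unfolding codes_element_iff by blast
  obtain X0 Y0 where p: "vert c i = (X0, Y0)" by (cases "vert c i")
  obtain X1 Y1 where p': "vert c (Suc i) = (X1, Y1)" by (cases "vert c (Suc i)")
  have i': "i < length (list_decode c)" using i by simp
  have lt: "X0 < X1" using codes_sorted[OF c _ i, of i] p p' by simp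
  define w where "w = (Y1 - Y0) / (X1 - X0)"
  have wX: "w * (X1 - X0) = Y1 - Y0" unfolding w_def using lt by simp
  have lin: "x t = Y0 + w * (t - X0)" if t: "X0 \<le> t" "t \<le> X1" for t
  proof -
    have "(Y0 + w * (t - X0)) * X1 + t * Y0 + X0 * Y1 - ((Y0 + w * (t - X0)) * X0 + Y0 * X1 + t * Y1) =
        (t - X0) * (w * (X1 - X0) - (Y1 - Y0))" by (simp add: algebra_simps)
    then have "collinear t (Y0 + w * (t - X0)) (vert c i) (vert c (Suc i))" unfolding collinear_def p p' wX by simp
    then show ?thesis using codes_graph(3)[OF c i, of t] t p p' by simp
  qed
  have X: "0 \<le> X0" "X1 \<le> 1" "Y0 = x X0" "Y1 = x X1" using codes_vertex[OF c i'] codes_vertex[OF c i] p p' by auto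
  obtain e q where e: "e > 0" "affine_about x X0 q X0 (X0 + e)" using thompson_germ_right[OF x X(1)] lt X by auto
  define r where "r = min e (X1 - X0)"
  have r: "0 < r" "r \<le> e" "X0 + r \<le> X1" using e lt unfolding r_def by auto
  have "2 powi q * r = w * r" using affine_aboutD[OF e(2), of "X0 + r"] lin[of "X0 + r"] r X(3) by simp
  then have wq: "w = 2 powi q" using r by simp
  have diff: "Y1 - Y0 = 2 powi q * (X1 - X0)" using wX wq by simp
  have vc: "(X0, Y0) = (real (vx c c i) / 2 ^ c, real (vy c c i) / 2 ^ c)"
    "(X1, Y1) = (real (vx c c (Suc i)) / 2 ^ c, real (vy c c (Suc i)) / 2 ^ c)"
    using vert_coords[OF i' order_refl] vert_coords[OF i order_refl] p p' by auto
  have big: "1 / 2 ^ c \<le> v - u" if "u < v" "u = real a / 2 ^ c" "v = real b / 2 ^ c" for u v :: real and a b :: nat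
  proof -
    have "a < b" using that by (simp add: divide_less_cancel)
    then have "real a + 1 \<le> real b" by simp
    then have "(real a + 1) / 2 ^ c \<le> real b / 2 ^ c" by (simp add: divide_right_mono)
    then show ?thesis using that by (simp add: add_divide_distrib)
  qed
  have Y: "Y0 < Y1" "0 \<le> Y0" "Y1 \<le> 1" using thompson_less[OF x X(1) lt X(2)] thompson_range[OF x, of X0] thompson_range[OF x, of X1] X lt by auto
  have vc': "X0 = real (vx c c i) / 2 ^ c" "Y0 = real (vy c c i) / 2 ^ c"
    "X1 = real (vx c c (Suc i)) / 2 ^ c" "Y1 = real (vy c c (Suc i)) / 2 ^ c" using vc by simp_all
  have dx: "1 / 2 ^ c \<le> X1 - X0" "X1 - X0 \<le> 1" and dy: "1 / 2 ^ c \<le> Y1 - Y0" "Y1 - Y0 \<le> 1"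
    using big[OF lt vc'(1,3)] big[OF Y(1) vc'(2,4)] X(1,2) Y(2,3) by linarith+
  have m: "(2::real) powi (- int c) = 1 / 2 ^ c" by (simp add: power_int_minus inverse_eq_divide)
  have "2 powi (- int c) \<le> (2::real) powi q"
  proof -
    have "2 powi q * (X1 - X0) \<le> 2 powi q * (1::real)" using dx(2) by (intro mult_left_mono) simp_all
    then have "1 / 2 ^ c \<le> 2 powi q * (1::real)" using dy(1) diff by linarith
    then show ?thesis unfolding m by simp
  qed
  moreover have "2 powi q \<le> (2::real) powi int c"
  proof -
    have "2 powi q * (1 / 2 ^ c) \<le> 2 powi q * (X1 - X0)" using dx(1) by (intro mult_left_mono) simp_all
    then have "2 powi q * (1 / 2 ^ c) \<le> (1::real)" using dy(2) diff by linarith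
    then have "2 powi q \<le> (2::real) ^ c" by (simp add: field_simps)
    then show ?thesis by simp
  qed
  ultimately have "\<bar>q\<bar> \<le> int c" unfolding powi2_le_iff by linarith
  then show thesis using that[of q] diff lin wq p p' by simp
qed

text \<open>
  Vertices have denominator \<open>2\<^sup>c\<close>, slopes have exponent at most \<open>c\<close>, hence the additive
  constants have denominator \<open>2\<^sup>2\<^sup>c\<close>; no vertex lies inside a cell of length \<open>2\<^sup>-\<^sup>E\<close> with \<open>E \<ge> c\<close>.
\<close>

lemma codes_cell_fine:
  assumes c: "codes_element c x" shows "cell_fine (3 * c) x"
proof (rule cell_fineI)
  have x: "x \<in> thompson_maps" using c unfolding codes_element_iff by blast
  fix E i assume E: "3 * c \<le> E" "i < (2::nat) ^ E"
  let ?t = "(real i + 1 / 2) / 2 ^ E"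
  have t: "0 \<le> ?t" "?t \<le> 1" using cell_range[OF E(2), of "1/2"] by auto
  obtain k where k: "Suc k < length (list_decode c)" "fst (vert c k) \<le> ?t" "?t \<le> fst (vert c (Suc k))"
    by (rule codes_locate[OF c t])
  have k': "k < length (list_decode c)" using k by simp
  have cE: "c \<le> E" using E(1) by simp
  have v: "vert c k = (real (vx E c k) / 2 ^ E, real (vy E c k) / 2 ^ E)"
    "vert c (Suc k) = (real (vx E c (Suc k)) / 2 ^ E, real (vy E c (Suc k)) / 2 ^ E)"
    using vert_coords[OF k' cE] vert_coords[OF k(1) cE] by auto
  have "real (vx E c k) \<le> real i + 1 / 2" "real i + 1 / 2 \<le> real (vx E c (Suc k))"
    using k(2,3) unfolding v by (simp_all add: divide_le_cancel)
  then have "vx E c k \<le> i" "i + 1 \<le> vx E c (Suc k)" by linarith+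
  then have r: "real (vx E c k) \<le> real i" "real i + 1 \<le> real (vx E c (Suc k))" by linarith+
  obtain q where q: "\<bar>q\<bar> \<le> int c" and lin: "\<And>t. fst (vert c k) \<le> t \<Longrightarrow> t \<le> fst (vert c (Suc k)) \<Longrightarrow>
      x t = snd (vert c k) + 2 powi q * (t - fst (vert c k))"
    by (rule codes_slope[OF c k(1)]) blast
  define d where "d = snd (vert c k) - 2 powi q * fst (vert c k)"
  have "d = real_of_int (int (vy c c k)) / 2 ^ c - 2 powi q * (real (vx c c k) / 2 ^ c)"
    unfolding d_def vert_coords[OF k' order_refl] by simp
  also have "2 powi q = real_of_int (2 ^ nat (q + int c)) / 2 ^ c"
  proof -
    have "(2::real) powi q = 2 powi (q + int c) / 2 powi (int c)" by (simp add: power_int_add)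
    moreover have "(2::real) powi (q + int c) = 2 ^ nat (q + int c)" using q by (simp add: power_int_def)
    ultimately show ?thesis by simp
  qed
  finally have d: "d = real_of_int (int (vy c c k) * 2 ^ c - 2 ^ nat (q + int c) * int (vx c c k)) / 2 ^ (2 * c)"
    by (simp add: mult_2 power_add diff_divide_distrib)
  have aff: "x t = 2 powi q * t + real_of_int (int (vy c c k) * 2 ^ c - 2 ^ nat (q + int c) * int (vx c c k)) / 2 ^ (2 * c)"
    if t: "in_cell E i t" for t
  proof -
    have "real (vx E c k) / 2 ^ E \<le> real i / 2 ^ E" "(real i + 1) / 2 ^ E \<le> real (vx E c (Suc k)) / 2 ^ E"
      using r by (auto intro: divide_right_mono)
    then have "fst (vert c k) \<le> t" "t \<le> fst (vert c (Suc k))" using t unfolding in_cell_def v by auto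
    then have "x t = 2 powi q * t + d" using lin unfolding d_def by (simp add: algebra_simps)
    then show ?thesis unfolding d .
  qed
  have qE: "int (2 * c) + \<bar>q\<bar> \<le> int E" using q E(1) by linarith
  obtain E' j where 1: "int E' = int E - q" "j < 2 ^ E'" "cell_map x E i E' j"
    by (rule affine_cell[OF aff qE x E(2)])
  then have "E \<le> E' + 3 * c \<and> E' \<le> E + 3 * c \<and> j < 2 ^ E' \<and> cell_map x E i E' j" using q by auto
  then show "\<exists>E' j. E \<le> E' + 3 * c \<and> E' \<le> E + 3 * c \<and> j < 2 ^ E' \<and> cell_map x E i E' j" by blast
qed

lemma pow2_slope_iff:
  assumes "k1 < k2"
  shows "pow2_slope c k1 s1 k2 s2 \<longleftrightarrow> (\<exists>q::int. \<bar>q\<bar> \<le> int c \<and> (real s2 - real s1) = 2 powi q * (real k2 - real k1))"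
proof
  assume "pow2_slope c k1 s1 k2 s2"
  then obtain m where m: "m \<le> c" "s2 * 2 ^ m + k1 = k2 + s1 * 2 ^ m \<or> k2 * 2 ^ m + s1 = s2 + k1 * 2 ^ m"
    unfolding pow2_slope_def by (auto simp: less_Suc_eq_le)
  from m(2) show "\<exists>q::int. \<bar>q\<bar> \<le> int c \<and> (real s2 - real s1) = 2 powi q * (real k2 - real k1)"
  proof
    assume "s2 * 2 ^ m + k1 = k2 + s1 * 2 ^ m"
    then have "real (s2 * 2 ^ m + k1) = real (k2 + s1 * 2 ^ m)" by (simp only:)
    then have "(real s2 - real s1) * 2 ^ m = real k2 - real k1" by (simp add: algebra_simps)
    then show ?thesis using m(1) by (intro exI[of _ "- int m"]) (simp add: power_int_minus field_simps)
  next
    assume "k2 * 2 ^ m + s1 = s2 + k1 * 2 ^ m"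
    then have "real (k2 * 2 ^ m + s1) = real (s2 + k1 * 2 ^ m)" by (simp only:)
    then have "(real s2 - real s1) = 2 ^ m * (real k2 - real k1)" by (simp add: algebra_simps)
    then show ?thesis using m(1) by (intro exI[of _ "int m"]) simp
  qed
next
  assume "\<exists>q::int. \<bar>q\<bar> \<le> int c \<and> (real s2 - real s1) = 2 powi q * (real k2 - real k1)"
  then obtain q :: int where q: "\<bar>q\<bar> \<le> int c" "real s2 - real s1 = 2 powi q * (real k2 - real k1)" by blast
  define m where "m = nat \<bar>q\<bar>"
  have m: "m < Suc c" unfolding m_def using q(1) by simp
  show "pow2_slope c k1 s1 k2 s2"
  proof (cases "q \<ge> 0")
    case True
    then have "(2::real) powi q = 2 ^ m" unfolding m_def by (simp add: power_int_def)
    then have "real (k2 * 2 ^ m + s1) = real (s2 + k1 * 2 ^ m)" using q(2) by (simp add: algebra_simps)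
    then have "k2 * 2 ^ m + s1 = s2 + k1 * 2 ^ m" by (simp only: of_nat_eq_iff)
    then show ?thesis unfolding pow2_slope_def using m by blast
  next
    case False
    then have "(2::real) powi q = 1 / 2 ^ m" unfolding m_def by (simp add: power_int_def inverse_eq_divide power_one_over)
    then have "(real s2 - real s1) * 2 ^ m = real k2 - real k1" using q(2) by simp
    then have "real (s2 * 2 ^ m + k1) = real (k2 + s1 * 2 ^ m)" by (simp add: algebra_simps)
    then have "s2 * 2 ^ m + k1 = k2 + s1 * 2 ^ m" by (simp only: of_nat_eq_iff)
    then show ?thesis unfolding pow2_slope_def using m by blast
  qed
qed

lemma codes_valid:
  assumes c: "codes_element c x" shows "valid c"
proof -
  let ?n = "length (list_decode c)"
  have n: "1 < ?n" by (rule codes_length[OF c])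
  have v: "vert c i = (real (vx c c i) / 2 ^ c, real (vy c c i) / 2 ^ c)" if "i < ?n" for i
    using vert_coords[OF that order_refl] .
  have "0 < ?n" using n by linarith
  then have 0: "vx c c 0 = 0" "vy c c 0 = 0" using v[OF \<open>0 < ?n\<close>] codes_ends(1)[OF c] by auto
  have step: "vx c c i < vx c c (Suc i)" "pow2_slope c (vx c c i) (vy c c i) (vx c c (Suc i)) (vy c c (Suc i))"
    if i: "Suc i < ?n" for i
  proof -
    have v': "vert c i = (real (vx c c i) / 2 ^ c, real (vy c c i) / 2 ^ c)"
      "vert c (Suc i) = (real (vx c c (Suc i)) / 2 ^ c, real (vy c c (Suc i)) / 2 ^ c)" using v i by auto
    show lt: "vx c c i < vx c c (Suc i)"
      using codes_sorted[OF c _ i, of i] unfolding v' by (simp add: divide_less_cancel)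
    obtain q where q: "\<bar>q\<bar> \<le> int c" "snd (vert c (Suc i)) - snd (vert c i) = 2 powi q * (fst (vert c (Suc i)) - fst (vert c i))"
      by (rule codes_slope[OF c i]) blast
    have "(real (vy c c (Suc i)) - real (vy c c i)) / 2 ^ c = 2 powi q * (real (vx c c (Suc i)) - real (vx c c i)) / 2 ^ c"
      using q(2) unfolding v' by (simp add: diff_divide_distrib right_diff_distrib)
    then have "real (vy c c (Suc i)) - real (vy c c i) = 2 powi q * (real (vx c c (Suc i)) - real (vx c c i))" by simp
    then show "pow2_slope c (vx c c i) (vy c c i) (vx c c (Suc i)) (vy c c (Suc i))"
      using pow2_slope_iff[OF lt] q(1) by blast
  qed
  have last: "vx c c i = 2 ^ c" "vy c c i = 2 ^ c" if i: "i < ?n" "\<not> Suc i < ?n" for i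
  proof -
    have "i = ?n - 1" using i by simp
    then have "real (vx c c i) / 2 ^ c = 1" "real (vy c c i) / 2 ^ c = 1" using v[OF i(1)] codes_ends(2)[OF c] by auto
    then have "real (vx c c i) = real (2 ^ c)" "real (vy c c i) = real (2 ^ c)" by (simp_all add: field_simps)
    then show "vx c c i = 2 ^ c" "vy c c i = 2 ^ c" by (simp_all only: of_nat_eq_iff)
  qed
  show ?thesis unfolding valid_def has_iff using n 0 step last by blast
qed

text \<open>
  A code determines the graph.
\<close>

lemma codes_unique: "codes_element c x \<Longrightarrow> codes_element c y \<Longrightarrow> x = y"
proof (rule thompson_eqI)
  assume x: "codes_element c x" and y: "codes_element c y"
  show "x \<in> thompson_maps" "y \<in> thompson_maps" using x y unfolding codes_element_iff by auto
  fix t :: real assume t: "0 \<le> t" "t \<le> 1"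
  obtain i where "Suc i < length (list_decode c)" "fst (vert c i) \<le> t" "t \<le> fst (vert c (Suc i))"
    "collinear t (x t) (vert c i) (vert c (Suc i))" by (rule codes_locate[OF x t])
  then show "x t = y t" by (rule codes_graph(3)[OF y])
qed

lemma collinear_unique:
  assumes "fst p < fst q" "collinear t s p q" "collinear t s' p q" shows "s = s'"
proof -
  have "(s - s') * (fst q - fst p) = 0" using assms(2,3) unfolding collinear_def by (simp add: algebra_simps)
  then show ?thesis using assms(1) by simp
qed

lemma graph_of_segments:
  assumes p: "subdivision U n"
    and h: "\<And>i t. i < n \<Longrightarrow> U i \<le> t \<Longrightarrow> t \<le> U (Suc i) \<Longrightarrow> collinear t (h t) (U i, W i) (U (Suc i), W (Suc i))"
  shows "(\<lambda>t. (t, h t)) ` {0..1} = (\<Union>i<n. closed_segment (U i, W i) (U (Suc i), W (Suc i)))"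
proof -
  have lt: "fst (U i, W i) < fst (U (Suc i), W (Suc i))" if "i < n" for i
    using subdivision_less[OF p, of i "Suc i"] that by simp
  show ?thesis
  proof (intro equalityI subsetI)
    fix z assume "z \<in> (\<lambda>t. (t, h t)) ` {0..1}"
    then obtain t where t: "0 \<le> t" "t \<le> 1" "z = (t, h t)" by auto
    obtain i where i: "i < n" "U i \<le> t" "t \<le> U (Suc i)" by (rule subdivision_locate[OF p t(1,2)])
    then have "z \<in> closed_segment (U i, W i) (U (Suc i), W (Suc i))"
      unfolding t(3) closed_segment_iff[OF lt[OF i(1)]] using h[OF i] by simp
    then show "z \<in> (\<Union>i<n. closed_segment (U i, W i) (U (Suc i), W (Suc i)))" using i(1) by blast
  next
    fix z assume "z \<in> (\<Union>i<n. closed_segment (U i, W i) (U (Suc i), W (Suc i)))"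
    then obtain i where i: "i < n" "z \<in> closed_segment (U i, W i) (U (Suc i), W (Suc i))" by blast
    obtain t s where z: "z = (t, s)" by (cases z)
    have ts: "U i \<le> t" "t \<le> U (Suc i)" "collinear t s (U i, W i) (U (Suc i), W (Suc i))"
      using i(2) unfolding z closed_segment_iff[OF lt[OF i(1)]] by simp_all
    have "s = h t" by (rule collinear_unique[OF lt[OF i(1)] ts(3) h[OF i(1) ts(1,2)]])
    moreover have "0 \<le> t" "t \<le> 1" using ts dyadic_interval_facts[OF subdivision_interval[OF p i(1)]] by auto
    ultimately show "z \<in> (\<lambda>t. (t, h t)) ` {0..1}" unfolding z by auto
  qed
qed

lemma vert_less_imp_sorted:
  assumes "\<And>i. Suc i < length (list_decode c) \<Longrightarrow> fst (vert c i) < fst (vert c (Suc i))"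
  shows "sorted_wrt (\<lambda>p q. fst p < fst q) (decode_vertices c)"
proof -
  have len: "length (decode_vertices c) = length (list_decode c)" by (simp add: decode_vertices_def)
  have "fst (vert c i) < fst (vert c j)" if "i < j" "j < length (list_decode c)" for i j
    using that
  proof (induction j)
    case (Suc j)
    have "fst (vert c j) < fst (vert c (Suc j))" using assms Suc.prems by simp
    then show ?case using Suc by (cases "i = j") auto
  qed simp
  then show ?thesis unfolding sorted_wrt_iff_nth_less len vert_def[symmetric] by blast
qed

text \<open>
  Together with \<open>codes_valid\<close> this shows that \<^const>\<open>valid\<close> decides which numbers are codes.
\<close>

theorem valid_codes_element:
  assumes v: "valid c" shows "\<exists>h. codes_element c h"
proof -
  define n where "n = length (list_decode c) - 1"
  define U where "U = (\<lambda>i. fst (vert c i))"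
  define W where "W = (\<lambda>i. snd (vert c i))"
  have len: "1 < length (list_decode c)" using v unfolding valid_def has_iff by blast
  then have n: "0 < n" "length (list_decode c) = Suc n" "n < c" using length_list_decode[of c] unfolding n_def by linarith+
  have vc: "U i = real (vx c c i) / 2 ^ c" "W i = real (vy c c i) / 2 ^ c" if "i \<le> n" for i
    using vert_coords[of i c c] that n unfolding U_def W_def by auto
  have 0: "U 0 = 0" "W 0 = 0" using vc[of 0] v unfolding valid_def by auto
  have last: "U n = 1" "W n = 1" using vc[of n] v n unfolding valid_def has_iff by auto
  have step: "U i < U (Suc i)" "\<exists>q::int. W (Suc i) - W i = 2 powi q * (U (Suc i) - U i)" if i: "i < n" for i
  proof -
    have ic: "i < c" "has c i" "has c (Suc i)" using i n unfolding has_iff by auto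
    then have s: "vx c c i < vx c c (Suc i)" "pow2_slope c (vx c c i) (vy c c i) (vx c c (Suc i)) (vy c c (Suc i))"
      using v unfolding valid_def by blast+
    show "U i < U (Suc i)" using s(1) vc[of i] vc[of "Suc i"] i by (simp add: divide_strict_right_mono)
    obtain q :: int where "real (vy c c (Suc i)) - real (vy c c i) = 2 powi q * (real (vx c c (Suc i)) - real (vx c c i))"
      using pow2_slope_iff[OF s(1)] s(2) by blast
    then have "(real (vy c c (Suc i)) - real (vy c c i)) / 2 ^ c = 2 powi q * ((real (vx c c (Suc i)) - real (vx c c i)) / 2 ^ c)" by simp
    then have "W (Suc i) - W i = 2 powi q * (U (Suc i) - U i)" using vc[of i] vc[of "Suc i"] i by (simp add: diff_divide_distrib)
    then show "\<exists>q::int. W (Suc i) - W i = 2 powi q * (U (Suc i) - U i)" by blast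
  qed
  obtain q :: "nat \<Rightarrow> int" where q: "\<And>i. i < n \<Longrightarrow> W (Suc i) - W i = 2 powi q i * (U (Suc i) - U i)" using step(2) by metis
  have dy: "dyadic (U i)" "dyadic (W i)" if "i \<le> n" for i using vc[OF that] by auto
  have sub: "subdivision U n" unfolding subdivision_def using 0 last step(1) dy by blast
  define f where "f = (\<lambda>i t. W i + 2 powi q i * (t - U i))"
  have "\<exists>g. pl2 g 0 1 \<and> (\<forall>i<n. \<forall>t. U i \<le> t \<and> t \<le> U (Suc i) \<longrightarrow> g t = f i t)"
  proof (rule glue_pl2[OF sub])
    fix i assume i: "i < n"
    show "pl2 (f i) (U i) (U (Suc i))"
    proof (rule pl2.affine[where k = "q i" and c = "W i - 2 powi q i * U i"])
      show "dyadic (W i - 2 powi q i * U i)" using dy[of i] i by (intro dyadic_diff dyadic_mult dyadic_powi) simp_all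
    qed (use i dy step(1) in \<open>simp_all add: f_def right_diff_distrib\<close>)
  next
    fix i assume "Suc i < n"
    then show "f i (U (Suc i)) = f (Suc i) (U (Suc i))" unfolding f_def using q[of i] by simp
  qed
  then obtain g where g: "pl2 g 0 1" "\<forall>i<n. \<forall>t. U i \<le> t \<and> t \<le> U (Suc i) \<longrightarrow> g t = f i t" by blast
  have "g (U 0) = f 0 (U 0)" using g(2) n step(1)[of 0] by simp
  then have g0: "g 0 = 0" unfolding f_def using 0 by simp
  obtain m where m: "n = Suc m" using n(1) not0_implies_Suc by auto
  have "g (U n) = f m (U n)" using g(2) m step(1)[of m] by simp
  then have g1: "g 1 = 1" unfolding f_def using q[of m] m last by simp
  define h where "h = restrict g {0..1}"
  have hT: "h \<in> thompson_maps" unfolding h_def by (rule thompson_mapsI[OF g(1) g0 g1])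
  have "(\<lambda>t. (t, h t)) ` {0..1} = (\<Union>i<n. closed_segment (U i, W i) (U (Suc i), W (Suc i)))"
  proof (rule graph_of_segments[OF sub])
    fix i t assume i: "i < n" and t: "U i \<le> t" "t \<le> U (Suc i)"
    have t1: "0 \<le> t" "t \<le> 1" using t dyadic_interval_facts[OF subdivision_interval[OF sub i]] by auto
    then have ht: "h t = W i + 2 powi q i * (t - U i)" using g(2) i t unfolding h_def f_def by simp
    have Y1: "W (Suc i) = W i + 2 powi q i * (U (Suc i) - U i)" using q[OF i] by simp
    show "collinear t (h t) (U i, W i) (U (Suc i), W (Suc i))"
      unfolding collinear_def ht fst_conv snd_conv Y1 by (simp add: algebra_simps)
  qed
  moreover have "(U i, W i) = vert c i" for i unfolding U_def W_def by simp
  moreover have "sorted_wrt (\<lambda>p q. fst p < fst q) (decode_vertices c)"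
    by (rule vert_less_imp_sorted) (use step(1) n in \<open>simp add: U_def\<close>)
  ultimately have "codes_element c h" unfolding codes_element_iff n_def[symmetric] using hT by simp
  then show ?thesis by blast
qed

section \<open>Every fine map has a small code\<close>

lemma triangle_mono: "a \<le> b \<Longrightarrow> triangle a \<le> triangle b"
  by (induction b) (auto simp: le_Suc_eq)

lemma prod_encode_mono: "a \<le> a' \<Longrightarrow> b \<le> b' \<Longrightarrow> prod_encode (a, b) \<le> prod_encode (a', b')"
  unfolding prod_encode_def using triangle_mono[of "a + b" "a' + b'"] by simp

lemma list_encode_bound:
  "(\<And>x. x \<in> set xs \<Longrightarrow> x \<le> w) \<Longrightarrow> list_encode xs \<le> rec_nat 0 (\<lambda>_ r. Suc (prod_encode (w, r))) (length xs)"
  by (induction xs) (simp_all add: prod_encode_mono)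

text \<open>
  All grid points of width \<open>2\<^sup>-\<^sup>E\<close> are taken as vertices. Fineness bounds the denominators of the values
  by \<open>4\<^sup>E\<close>.
\<close>

theorem small_code_exists:
  assumes h: "h \<in> thompson_maps" and f: "cell_fine E h"
  shows "\<exists>e\<le>code_bound E. codes_element e h"
proof -
  let ?N = "2 ^ E :: nat"
  have p4: "(4::real) ^ E = 2 ^ (2 * E)" by (simp add: power_mult)
  have cell: "\<exists>E' k. E' \<le> 2 * E \<and> k < 2 ^ E' \<and> cell_map h E i E' k" if "i < ?N" for i
    using cell_fineD[OF f order_refl that] by (metis mult_2)
  have "\<exists>j. j \<le> 4 ^ E \<and> h (real i / 2 ^ E) = real j / 2 ^ (2 * E)" if i: "i \<le> ?N" for i
  proof (cases "i = ?N")
    case True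
    then show ?thesis using thompson_1[OF h] p4 by (intro exI[of _ "4 ^ E"]) simp
  next
    case False
    then have "i < ?N" using i by simp
    then obtain E' k where c: "E' \<le> 2 * E" "k < 2 ^ E'" "cell_map h E i E' k" using cell by blast
    have p: "(2::real) ^ (2 * E) = 2 ^ (2 * E - E') * 2 ^ E'" using c(1) by (simp flip: power_add)
    have pn: "(4::nat) ^ E = 2 ^ (2 * E - E') * 2 ^ E'"
    proof -
      have "(4::nat) ^ E = (2 ^ 2) ^ E" by simp
      also have "\<dots> = 2 ^ (2 * E)" by (simp only: power_mult)
      finally show ?thesis using c(1) by (simp flip: power_add)
    qed
    have "h (real i / 2 ^ E) = real k / 2 ^ E'" using cell_mapD[OF c(3), of 0] by simp
    also have "\<dots> = real (2 ^ (2 * E - E') * k) / 2 ^ (2 * E)" unfolding p by simp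
    finally show ?thesis using c(2) pn by (intro exI[of _ "2 ^ (2 * E - E') * k"]) simp
  qed
  then obtain j where j: "\<And>i. i \<le> ?N \<Longrightarrow> j i \<le> 4 ^ E" "\<And>i. i \<le> ?N \<Longrightarrow> h (real i / 2 ^ E) = real (j i) / 2 ^ (2 * E)" by metis
  \<comment> \<open>the code of the \<open>i\<close>-th vertex\<close>
  define P where "P = (\<lambda>i. prod_encode (prod_encode (i, E), prod_encode (j i, 2 * E)))"
  define ps where "ps = map P [0..<Suc ?N]"
  define e where "e = list_encode ps"
  have dec: "list_decode e = ps" "length ps = Suc ?N" unfolding e_def ps_def by simp_all
  have "list_encode ps \<le> rec_nat 0 (\<lambda>_ r. Suc (prod_encode (prod_encode (prod_encode (2 ^ E, E), prod_encode (4 ^ E, 2 * E)), r))) (length ps)"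
  proof (rule list_encode_bound)
    fix x assume "x \<in> set ps"
    then obtain i where "i \<le> ?N" "x = P i" unfolding ps_def by (auto simp: less_Suc_eq_le simp del: upt_Suc)
    then show "x \<le> prod_encode (prod_encode (2 ^ E, E), prod_encode (4 ^ E, 2 * E))"
      unfolding P_def by (simp add: prod_encode_mono j(1))
  qed
  then have bound: "e \<le> code_bound E" unfolding e_def code_bound_def dec(2) .
  define U where "U = (\<lambda>i. real i / 2 ^ E)"
  define W where "W = (\<lambda>i. h (U i))"
  have vert: "vert e i = (U i, W i)" if "i \<le> ?N" for i
  proof -
    have "decode_vertices e ! i = map_prod decode_dyadic decode_dyadic (prod_decode (P i))"
      unfolding decode_vertices_def dec(1) ps_def using that by (simp del: upt_Suc add: less_Suc_eq_le)
    then show ?thesis unfolding vert_def P_def U_def W_def decode_dyadic_def using j(2)[OF that] by simp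
  qed
  have sub: "subdivision U ?N"
    unfolding subdivision_def U_def by (auto simp: divide_strict_right_mono)
  have "(\<lambda>t. (t, h t)) ` {0..1} = (\<Union>i<?N. closed_segment (U i, W i) (U (Suc i), W (Suc i)))"
  proof (rule graph_of_segments[OF sub])
    fix i t assume i: "i < ?N" and t: "U i \<le> t" "t \<le> U (Suc i)"
    obtain E' k where c: "cell_map h E i E' k" using cell[OF i] by blast
    have "in_cell E i t" using t unfolding in_cell_def U_def by (simp add: add.commute)
    then obtain s where s: "0 \<le> s" "s \<le> 1" "t = (real i + s) / 2 ^ E" by (rule in_cell_param)
    have "h t = (real k + s) / 2 ^ E'" "W i = real k / 2 ^ E'" "W (Suc i) = (real k + 1) / 2 ^ E'"
      using cell_mapD[OF c s(1,2)] cell_mapD[OF c, of 0] cell_mapD[OF c, of 1] unfolding s(3) W_def U_def by (simp_all add: add.commute)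
    then have W: "h t = W i + s * (W (Suc i) - W i)" by (simp add: add_divide_distrib)
    have U: "t = U i + s * (U (Suc i) - U i)" unfolding s(3) U_def by (simp add: add_divide_distrib)
    show "collinear t (h t) (U i, W i) (U (Suc i), W (Suc i))"
      unfolding collinear_def W fst_conv snd_conv by (subst (1 2) U) (simp add: algebra_simps)
  qed
  moreover have "(\<Union>i<?N. closed_segment (U i, W i) (U (Suc i), W (Suc i))) = (\<Union>i<?N. closed_segment (vert e i) (vert e (Suc i)))"
    by (rule SUP_cong) (simp_all add: vert)
  moreover have "sorted_wrt (\<lambda>p q. fst p < fst q) (decode_vertices e)"
    by (rule vert_less_imp_sorted) (use vert dec in \<open>simp add: U_def divide_strict_right_mono\<close>)
  ultimately have "codes_element e h" unfolding codes_element_iff dec using h by simp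
  then show ?thesis using bound by blast
qed

lemma finite_cell_fine: "finite {h \<in> thompson_maps. cell_fine E h}"
proof (rule finite_subset)
  show "{h \<in> thompson_maps. cell_fine E h} \<subseteq> (\<lambda>e. THE h. codes_element e h) ` {..code_bound E}"
  proof
    fix h assume "h \<in> {h \<in> thompson_maps. cell_fine E h}"
    then obtain e where e: "e \<le> code_bound E" "codes_element e h" using small_code_exists by blast
    then have "(THE h. codes_element e h) = h" using codes_unique by blast
    then show "h \<in> (\<lambda>e. THE h. codes_element e h) ` {..code_bound E}" using e(1) by force
  qed
qed simp

text \<open>
  The roots have bounded fineness, and only finitely many codes are needed for elements of
  bounded fineness.
\<close>

theorem finite_roots:
  assumes x: "x \<in> thompson_maps" shows "finite (roots thompson_F x)"
proof -
  obtain e where e: "cell_fine e x" using thompson_cell_fine[OF x] by blast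
  have e2: "cell_fine (2 * e) x" "cell_fine (2 * e) (inv\<^bsub>thompson_F\<^esub> x)"
    using cell_fine_mono[OF e, of "2 * e"] cell_fine_inverse[OF x e] by auto
  have "roots thompson_F x \<subseteq> {h \<in> thompson_maps. cell_fine ((2 * 4 ^ (2 * e) + 4) * (2 * e)) h}"
  proof
    fix h assume "h \<in> roots thompson_F x"
    then obtain n where n: "root_of n x h" unfolding roots_iff by blast
    then show "h \<in> {h \<in> thompson_maps. cell_fine ((2 * 4 ^ (2 * e) + 4) * (2 * e)) h}"
      using root_cell_fine[OF n e2] root_of_facts(1)[OF n] by simp
  qed
  then show ?thesis using finite_cell_fine finite_subset by blast
qed

section \<open>Evaluating codes on a grid\<close>

lemma on_graph_iff:
  assumes c: "codes_element c x" and L: "c \<le> L" and a: "a \<le> 2 ^ L"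
  shows "on_graph L c a b \<longleftrightarrow> x (real a / 2 ^ L) = real b / 2 ^ L"
proof
  assume "on_graph L c a b"
  then obtain i where i: "Suc i < length (list_decode c)" "vx L c i \<le> a" "a \<le> vx L c (Suc i)"
    "collinear_nat a b (vx L c i) (vy L c i) (vx L c (Suc i)) (vy L c (Suc i))" unfolding on_graph_def has_iff by blast
  have v: "vert c i = (real (vx L c i) / 2 ^ L, real (vy L c i) / 2 ^ L)"
    "vert c (Suc i) = (real (vx L c (Suc i)) / 2 ^ L, real (vy L c (Suc i)) / 2 ^ L)"
    using vert_coords[OF _ L] i(1) by auto
  have "real b / 2 ^ L = x (real a / 2 ^ L)"
    by (rule codes_graph(3)[OF c i(1)]) (use i collinear_scaled in \<open>simp_all add: v divide_right_mono\<close>)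
  then show "x (real a / 2 ^ L) = real b / 2 ^ L" by simp
next
  assume x: "x (real a / 2 ^ L) = real b / 2 ^ L"
  have "real a \<le> real (2 ^ L)" using a by (simp only: of_nat_le_iff)
  then have t: "0 \<le> real a / 2 ^ L" "real a / 2 ^ L \<le> 1" by simp_all
  obtain i where i: "Suc i < length (list_decode c)" "fst (vert c i) \<le> real a / 2 ^ L" "real a / 2 ^ L \<le> fst (vert c (Suc i))"
    "collinear (real a / 2 ^ L) (real b / 2 ^ L) (vert c i) (vert c (Suc i))"
    using codes_locate[OF c t] unfolding x by blast
  have v: "vert c i = (real (vx L c i) / 2 ^ L, real (vy L c i) / 2 ^ L)"
    "vert c (Suc i) = (real (vx L c (Suc i)) / 2 ^ L, real (vy L c (Suc i)) / 2 ^ L)"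
    using vert_coords[OF _ L] i(1) by auto
  have "collinear_nat a b (vx L c i) (vy L c i) (vx L c (Suc i)) (vy L c (Suc i))"
    using i(4) unfolding v collinear_scaled .
  moreover have "vx L c i \<le> a" "a \<le> vx L c (Suc i)" using i(2,3) unfolding v by (simp_all add: divide_le_cancel)
  moreover have "i < c" using i(1) length_list_decode[of c] by linarith
  ultimately show "on_graph L c a b" unfolding on_graph_def has_iff using i(1) by blast
qed

lemma app_eq:
  assumes c: "codes_element c x" and L: "c \<le> L" and a: "a \<le> 2 ^ L" and b: "x (real a / 2 ^ L) = real b / 2 ^ L"
  shows "app L c a = b" "b \<le> 2 ^ L"
proof -
  have x: "x \<in> thompson_maps" using c unfolding codes_element_iff by blast
  have "real a \<le> real (2 ^ L)" using a by (simp only: of_nat_le_iff)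
  then have "x (real a / 2 ^ L) \<le> 1" using thompson_range[OF x, of "real a / 2 ^ L"] by simp
  then have "real b \<le> real (2 ^ L)" unfolding b by simp
  then show bL: "b \<le> 2 ^ L" by (simp only: of_nat_le_iff)
  have "on_graph L c a b' \<longleftrightarrow> b' = b" for b' unfolding on_graph_iff[OF c L a] b by auto
  then show "app L c a = b" unfolding app_def using bL by (simp add: sum.delta del: sum.lessThan_Suc)
qed

lemma cell_fine_grid_value:
  assumes f: "cell_fine e f" "f \<in> thompson_maps" and E: "e \<le> E" "i \<le> 2 ^ E"
  obtains j where "f (real i / 2 ^ E) = real j / 2 ^ (E + e)"
proof (cases "i = 2 ^ E")
  case True
  have "f (real i / 2 ^ E) = real (2 ^ (E + e)) / 2 ^ (E + e)" using True thompson_1[OF f(2)] by simp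
  then show thesis by (rule that)
next
  case False
  then have "i < 2 ^ E" using E by simp
  then obtain E' k where c: "E' \<le> E + e" "cell_map f E i E' k" using cell_fineD[OF f(1) E(1)] by blast
  have "(2::real) ^ (E + e) = 2 ^ (E + e - E') * 2 ^ E'" using c(1) by (simp flip: power_add)
  then have "f (real i / 2 ^ E) = real (2 ^ (E + e - E') * k) / 2 ^ (E + e)" using cell_mapD[OF c(2), of 0] by simp
  then show thesis by (rule that)
qed

lemma grid_rescale:
  assumes "real i / 2 ^ E = t" "E \<le> L" shows "t = real (i * 2 ^ (L - E)) / 2 ^ L"
proof -
  have "(2::real) ^ L = 2 ^ (L - E) * 2 ^ E" using assms(2) by (simp flip: power_add)
  then show ?thesis using assms(1) by simp
qed

text \<open>
  Each application of a \<open>d\<close>-fine map refines the grid of values by \<open>d\<close>; as long as level \<open>L\<close> is not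
  exceeded, the computation on the grid of width \<open>2\<^sup>-\<^sup>L\<close> is exact.
\<close>

lemma iterate_app_eq:
  assumes c: "codes_element e h" and f: "cell_fine d h" and M: "d \<le> M" "a \<le> 2 ^ M" and L: "e \<le> L" "M \<le> L"
  shows "M + n * d \<le> L \<Longrightarrow> real (iterate_app L e n (a * 2 ^ (L - M))) / 2 ^ L = (h ^^ n) (real a / 2 ^ M) \<and>
    iterate_app L e n (a * 2 ^ (L - M)) \<le> 2 ^ L \<and> (\<exists>i\<le>2 ^ (M + n * d). (h ^^ n) (real a / 2 ^ M) = real i / 2 ^ (M + n * d))"
proof (induction n)
  case 0
  have "(2::nat) ^ L = 2 ^ M * 2 ^ (L - M)" using L(2) by (simp flip: power_add)
  then have "a * 2 ^ (L - M) \<le> 2 ^ L" using M(2) by simp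
  moreover have "real a / 2 ^ M = real (a * 2 ^ (L - M)) / 2 ^ L" by (rule grid_rescale[OF refl L(2)])
  ultimately show ?case using M(2) unfolding iterate_app_def by auto
next
  case (Suc n)
  have h: "h \<in> thompson_maps" using c unfolding codes_element_iff by blast
  let ?A = "iterate_app L e n (a * 2 ^ (L - M))"
  have IH: "real ?A / 2 ^ L = (h ^^ n) (real a / 2 ^ M)" "?A \<le> 2 ^ L"
    "\<exists>i\<le>2 ^ (M + n * d). (h ^^ n) (real a / 2 ^ M) = real i / 2 ^ (M + n * d)" using Suc by auto
  then obtain i where i: "i \<le> 2 ^ (M + n * d)" "(h ^^ n) (real a / 2 ^ M) = real i / 2 ^ (M + n * d)" by blast
  obtain j where j: "h (real i / 2 ^ (M + n * d)) = real j / 2 ^ (M + n * d + d)"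
    by (rule cell_fine_grid_value[OF f h _ i(1)]) (use M in simp)
  have hn: "(h ^^ Suc n) (real a / 2 ^ M) = real j / 2 ^ (M + Suc n * d)" using i(2) j by (simp add: ac_simps)
  have "real a \<le> real (2 ^ M)" using M(2) by (simp only: of_nat_le_iff)
  then have t: "0 \<le> real a / 2 ^ M" "real a / 2 ^ M \<le> 1" by simp_all
  have "(h ^^ Suc n) (real a / 2 ^ M) \<le> 1" using thompson_pow_apply[OF h t] by blast
  then have "real j \<le> real (2 ^ (M + Suc n * d))" unfolding hn by simp
  then have jb: "j \<le> 2 ^ (M + Suc n * d)" by (simp only: of_nat_le_iff)
  define B where "B = j * 2 ^ (L - (M + Suc n * d))"
  have B: "(h ^^ Suc n) (real a / 2 ^ M) = real B / 2 ^ L" unfolding B_def by (rule grid_rescale[OF hn[symmetric] Suc.prems])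
  have "h (real ?A / 2 ^ L) = real B / 2 ^ L" using B unfolding IH(1) by simp
  then have "app L e ?A = B" "B \<le> 2 ^ L" using app_eq[OF c L(1) IH(2)] by blast+
  moreover have "iterate_app L e (Suc n) (a * 2 ^ (L - M)) = app L e ?A" unfolding iterate_app_def by simp
  ultimately show ?case using B hn jb by auto
qed

text \<open>
  Both maps are affine on every cell of level \<open>M\<close>, so they are determined by their values at the grid
  points.
\<close>

lemma cell_fine_eqI:
  assumes f: "cell_fine M f" and g: "cell_fine M g"
    and eq: "\<And>a. a \<le> 2 ^ M \<Longrightarrow> f (real a / 2 ^ M) = g (real a / 2 ^ M)" and t: "0 \<le> t" "t \<le> 1"
  shows "f t = g t"
proof -
  obtain i where i: "i < 2 ^ M" "in_cell M i t" by (rule cell_exists[OF t])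
  obtain s where s: "0 \<le> s" "s \<le> 1" "t = (real i + s) / 2 ^ M" by (rule in_cell_param[OF i(2)])
  have aff: "u t = u (real i / 2 ^ M) + s * (u (real (Suc i) / 2 ^ M) - u (real i / 2 ^ M))" if u: "cell_fine M u" for u
  proof -
    obtain E k where c: "cell_map u M i E k" using cell_fineD[OF u order_refl i(1)] by blast
    show ?thesis
      using cell_mapD[OF c s(1,2)] cell_mapD[OF c, of 0] cell_mapD[OF c, of 1] unfolding s(3)
      by (simp add: add_divide_distrib add.commute)
  qed
  show ?thesis unfolding aff[OF f] aff[OF g] using eq[of i] eq[of "Suc i"] i(1) by simp
qed

lemma is_root_code_iff:
  assumes c: "codes_element c x" and e: "codes_element e h"
  shows "is_root_code c e \<longleftrightarrow> (\<exists>n<3 * c + 2. root_of n x h)"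
proof -
  have x: "x \<in> thompson_maps" and h: "h \<in> thompson_maps" using c e unfolding codes_element_iff by auto
  have key: "(\<forall>a<Suc (2 ^ check_level c e n).
        iterate_app (2 * check_level c e n) e n (a * 2 ^ check_level c e n) =
        app (2 * check_level c e n) c (a * 2 ^ check_level c e n)) \<longleftrightarrow> (\<forall>t. 0 \<le> t \<longrightarrow> t \<le> 1 \<longrightarrow> (h ^^ n) t = x t)" for n
  proof -
    define M where "M = check_level c e n"
    define L where "L = 2 * M"
    have M: "3 * e \<le> M" "3 * c \<le> M" "n * (3 * e) \<le> M" unfolding M_def check_level_def by (simp_all add: algebra_simps)
    have L: "e \<le> L" "c \<le> L" "M \<le> L" "L - M = M" "M + n * (3 * e) \<le> L" "M + 3 * c \<le> L" unfolding L_def using M by simp_all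
    have fx: "cell_fine (3 * c) x" and fh: "cell_fine (3 * e) h" using codes_cell_fine c e by auto
    have ev: "real (iterate_app L e n (a * 2 ^ M)) / 2 ^ L = (h ^^ n) (real a / 2 ^ M)"
      "real (app L c (a * 2 ^ M)) / 2 ^ L = x (real a / 2 ^ M)" if a: "a \<le> 2 ^ M" for a
    proof -
      show "real (iterate_app L e n (a * 2 ^ M)) / 2 ^ L = (h ^^ n) (real a / 2 ^ M)"
        using iterate_app_eq[OF e fh M(1) a L(1,3,5)] unfolding L(4) by blast
      obtain j where j: "x (real a / 2 ^ M) = real j / 2 ^ (M + 3 * c)" by (rule cell_fine_grid_value[OF fx x M(2) a])
      define B where "B = j * 2 ^ (L - (M + 3 * c))"
      have B: "x (real a / 2 ^ M) = real B / 2 ^ L" unfolding B_def by (rule grid_rescale[OF j[symmetric] L(6)])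
      have "(2::nat) ^ L = 2 ^ M * 2 ^ M" using L(4) L(3) by (simp flip: power_add)
      then have aL: "a * 2 ^ M \<le> 2 ^ L" using a by simp
      have "real a / 2 ^ M = real (a * 2 ^ M) / 2 ^ L" using grid_rescale[OF refl L(3), of a] unfolding L(4) .
      then show "real (app L c (a * 2 ^ M)) / 2 ^ L = x (real a / 2 ^ M)"
        using app_eq(1)[OF c L(2) aL] B by simp
    qed
    have "(\<forall>a<Suc (2 ^ M). iterate_app L e n (a * 2 ^ M) = app L c (a * 2 ^ M)) \<longleftrightarrow>
        (\<forall>a\<le>2 ^ M. (h ^^ n) (real a / 2 ^ M) = x (real a / 2 ^ M))"
    proof -
      have "iterate_app L e n (a * 2 ^ M) = app L c (a * 2 ^ M) \<longleftrightarrow> (h ^^ n) (real a / 2 ^ M) = x (real a / 2 ^ M)"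
        if "a \<le> 2 ^ M" for a unfolding ev[OF that, symmetric] by simp
      then show ?thesis by (simp add: less_Suc_eq_le)
    qed
    also have "\<dots> \<longleftrightarrow> (\<forall>t. 0 \<le> t \<longrightarrow> t \<le> 1 \<longrightarrow> (h ^^ n) t = x t)"
    proof
      assume eq: "\<forall>a\<le>2 ^ M. (h ^^ n) (real a / 2 ^ M) = x (real a / 2 ^ M)"
      have "cell_fine M (h ^^ n)" "cell_fine M x"
        using cell_fine_mono[OF cell_fine_funpow[OF fh] M(3)] cell_fine_mono[OF fx M(2)] by auto
      then show "\<forall>t. 0 \<le> t \<longrightarrow> t \<le> 1 \<longrightarrow> (h ^^ n) t = x t" using cell_fine_eqI eq by blast
    next
      assume eq: "\<forall>t. 0 \<le> t \<longrightarrow> t \<le> 1 \<longrightarrow> (h ^^ n) t = x t"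
      show "\<forall>a\<le>2 ^ M. (h ^^ n) (real a / 2 ^ M) = x (real a / 2 ^ M)"
      proof (intro allI impI)
        fix a :: nat assume "a \<le> 2 ^ M"
        then have "real a \<le> real (2 ^ M)" by (simp only: of_nat_le_iff)
        then show "(h ^^ n) (real a / 2 ^ M) = x (real a / 2 ^ M)" using eq by simp
      qed
    qed
    finally show ?thesis unfolding L_def M_def .
  qed
  have root: "root_of n x h \<longleftrightarrow> 0 < n \<and> (\<forall>t. 0 \<le> t \<longrightarrow> t \<le> 1 \<longrightarrow> (h ^^ n) t = x t)" for n
  proof
    assume "root_of n x h"
    then show "0 < n \<and> (\<forall>t. 0 \<le> t \<longrightarrow> t \<le> 1 \<longrightarrow> (h ^^ n) t = x t)" using root_of_facts by metis
  next
    assume a: "0 < n \<and> (\<forall>t. 0 \<le> t \<longrightarrow> t \<le> 1 \<longrightarrow> (h ^^ n) t = x t)"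
    have "h [^]\<^bsub>thompson_F\<^esub> n = x"
    proof (rule thompson_eqI[OF thompson_pow_closed[OF h] x])
      fix t :: real assume t: "0 \<le> t" "t \<le> 1"
      then show "(h [^]\<^bsub>thompson_F\<^esub> n) t = x t" using thompson_pow_apply[OF h t] a by metis
    qed
    then show "root_of n x h" unfolding root_of_def using h a by blast
  qed
  show ?thesis unfolding is_root_code_def key root using codes_valid[OF e] by blast
qed

lemma list_decode_filter:
  "set (list_decode (rec_nat 0 (\<lambda>e r. if P e then Suc (prod_encode (e, r)) else r) k)) = {e. e < k \<and> P e}"
  by (induction k) (auto simp: less_Suc_eq)

text \<open>
  Every root has a code below the bound, and its exponent can be chosen below the bound of the search.
  The identity element, for which exponents are unbounded, has itself as only root, with exponent 1.
\<close>

theorem root_list_correct: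
  assumes c: "codes_element c x"
  shows "\<exists>hs. codes_element_list (root_list c) hs \<and> set hs = roots thompson_F x"
proof -
  let ?es = "list_decode (root_list c)"
  have x: "x \<in> thompson_maps" using c unfolding codes_element_iff by blast
  have es: "set ?es = {e. e \<le> code_bound (fineness_bound c) \<and> is_root_code c e}"
    unfolding root_list_def list_decode_filter by (simp add: less_Suc_eq_le)
  \<comment> \<open>the element with a given code\<close>
  define D where "D = (\<lambda>e. THE h. codes_element e h)"
  have D: "codes_element e (D e)" if e: "e \<in> set ?es" for e
  proof -
    have "valid e" using e unfolding es is_root_code_def by blast
    then obtain h where h: "codes_element e h" using valid_codes_element by blast
    then have "D e = h" unfolding D_def using codes_unique by blast
    then show ?thesis using h by simp
  qed
  have fx: "cell_fine (3 * c) x" by (rule codes_cell_fine[OF c])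
  have f6: "cell_fine (6 * c) x" "cell_fine (6 * c) (inv\<^bsub>thompson_F\<^esub> x)"
    using cell_fine_mono[OF fx, of "6 * c"] cell_fine_inverse[OF x fx] by simp_all
  have "codes_element_list (root_list c) (map D ?es)"
    unfolding codes_element_list_def list_all2_map2 by (rule list.rel_refl_strong) (rule D)
  moreover have "set (map D ?es) = roots thompson_F x"
  proof (intro equalityI subsetI)
    fix h assume "h \<in> set (map D ?es)"
    then obtain e where e: "e \<in> set ?es" "h = D e" by auto
    then have "is_root_code c e" unfolding es by blast
    then show "h \<in> roots thompson_F x" using is_root_code_iff[OF c D[OF e(1)]] e(2) unfolding roots_iff by blast
  next
    fix h assume "h \<in> roots thompson_F x"
    then obtain n where n: "root_of n x h" unfolding roots_iff by blast
    note h = root_of_facts[OF n]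
    have "cell_fine (fineness_bound c) h" unfolding fineness_bound_def by (rule root_cell_fine[OF n f6])
    then obtain e where e: "e \<le> code_bound (fineness_bound c)" "codes_element e h" using small_code_exists[OF h(1)] by blast
    have "\<exists>n<3 * c + 2. root_of n x h"
    proof (cases "x = \<one>\<^bsub>thompson_F\<^esub>")
      case False
      then have "n \<le> 3 * c" by (rule root_order_bound[OF n fx])
      then show ?thesis using n by (intro exI[of _ n]) simp
    next
      case True
      have "h = \<one>\<^bsub>thompson_F\<^esub>"
      proof (rule thompson_eqI[OF h(1) thompson_one_closed])
        fix t :: real assume t: "0 \<le> t" "t \<le> 1"
        have "(h ^^ n) t = t" using h(4)[OF t] True t by simp
        then show "h t = \<one>\<^bsub>thompson_F\<^esub> t" using funpow_fixes_iff[OF h(1) t h(2)] t by simp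
      qed
      then have "root_of 1 x h" unfolding root_of_def True by simp
      then show ?thesis by (intro exI[of _ 1]) simp
    qed
    then have "is_root_code c e" using is_root_code_iff[OF c e(2)] by blast
    then have "e \<in> set ?es" unfolding es using e(1) by blast
    moreover have "D e = h" using codes_unique[OF D[OF calculation] e(2)] .
    ultimately show "h \<in> set (map D ?es)" by auto
  qed
  ultimately show ?thesis by blast
qed

section \<open>Centralizers and roots in Thompson's group\<close>

theorem theorem1p2:
  shows
    "(\<forall>x \<in> carrier thompson_F. \<exists>m n :: nat. m \<le> n + 1 \<and>
        thompson_F\<lparr>carrier := centralizer thompson_F {x}\<rparr> \<cong>
          product_group {..<m} (\<lambda>_. thompson_F) \<times>\<times> product_group {..<n} (\<lambda>_. integer_group)) \<and>
     ((\<forall>x \<in> carrier thompson_F. finite (roots thompson_F x)) \<and>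
      (\<exists>r. computable r \<and>
         (\<forall>c x. codes_element c x \<longrightarrow>
            (\<exists>hs. codes_element_list (r c) hs \<and> set hs = roots thompson_F x)))) \<and>
     (\<forall>A. finitely_generated_subgroup thompson_F A \<longrightarrow>
        (\<exists>(k::nat) (C :: nat \<Rightarrow> (real \<Rightarrow> real) monoid).
           (\<forall>i<k. group (C i) \<and>
              (trivial_group (C i) \<or> (cyclic_group (C i) \<and> infinite (carrier (C i))) \<or>
               C i \<cong> thompson_F)) \<and>
           thompson_F\<lparr>carrier := centralizer thompson_F A\<rparr> \<cong> product_group {..<k} C)) \<and>
     (\<forall>(k::nat) (x :: nat \<Rightarrow> real \<Rightarrow> real).
        k \<ge> 2 \<and> (\<forall>i<k. x i \<in> carrier thompson_F) \<longrightarrow>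
        (\<exists>a \<in> carrier thompson_F. \<exists>b \<in> carrier thompson_F.
           (\<Inter>i<k. centralizer thompson_F {x i}) =
             centralizer thompson_F {a} \<inter> centralizer thompson_F {b}))"
proof (intro conjI ballI allI impI)
  fix x assume "x \<in> carrier thompson_F"
  then show "\<exists>m n :: nat. m \<le> n + 1 \<and> thompson_F\<lparr>carrier := centralizer thompson_F {x}\<rparr> \<cong>
      product_group {..<m} (\<lambda>_. thompson_F) \<times>\<times> product_group {..<n} (\<lambda>_. integer_group)"
    by (intro centralizer_element_structure) simp
next
  fix x assume "x \<in> carrier thompson_F"
  then show "finite (roots thompson_F x)" by (intro finite_roots) simp
next
  show "\<exists>r. computable r \<and> (\<forall>c x. codes_element c x \<longrightarrow> (\<exists>hs. codes_element_list (r c) hs \<and> set hs = roots thompson_F x))"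
    using computable_root_list root_list_correct by blast
next
  fix A assume "finitely_generated_subgroup thompson_F A"
  then show "\<exists>(k::nat) (C :: nat \<Rightarrow> (real \<Rightarrow> real) monoid).
      (\<forall>i<k. group (C i) \<and> (trivial_group (C i) \<or> (cyclic_group (C i) \<and> infinite (carrier (C i))) \<or> C i \<cong> thompson_F)) \<and>
      thompson_F\<lparr>carrier := centralizer thompson_F A\<rparr> \<cong> product_group {..<k} C"
    by (rule centralizer_finitely_generated)
next
  fix k :: nat and x :: "nat \<Rightarrow> real \<Rightarrow> real"
  assume "k \<ge> 2 \<and> (\<forall>i<k. x i \<in> carrier thompson_F)"
  then show "\<exists>a \<in> carrier thompson_F. \<exists>b \<in> carrier thompson_F.
      (\<Inter>i<k. centralizer thompson_F {x i}) = centralizer thompson_F {a} \<inter> centralizer thompson_F {b}"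
    using centralizer_intersection_two[of k x] by simp
qed

end
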